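(* Let $(X,Z)$ satisfy, for $t\ge0$, $$X_t=X_0+\int_0^taX_s\,ds+W_t,\qquad Z_t=\int_0^thX_s\,ds+N_t,$$ where $a\in\mathbb{R}^{m\times m}$ and $h\in\mathbb{R}^{n\times m}$ are constant matrices, in the setting described in the context. Assume that $(a,h)$ is detectable and $(a,I)$ is stabilizable, and that there exists $T_0>0$ such that $\rho'(t)=0$ for all $t>T_0$, where $\rho(t)=\mathbb{E}(N_tX_0^T)$. Let $\gamma_\infty$ and $\lambda_0$ be as defined in the context. Then: (a) Let $P^{11}_t$ be the conditional variance of $X_t$ given $\mathcal{F}^Z_t$. For all $\lambda<\lambda_0$, $$\lim_{t\to\infty}e^{\lambda t}\big(P^{11}_t-\gamma_\infty\big)=0 .$$ (b) Let $\hat X_t=\mathbb{E}(X_t|\mathcal{F}^Z_t)$ and let $\hat X^0_t$ be the optimal conditional expectation of $X_t$ given the observation obtained when $X_0$ and $N$ are treated as independent (that is, $\rho=0$), as made precise in the context. Then for all $\lambda<\lambda_0$, $\lim_{t\to\infty}e^{\lambda t}(\hat X_t-\hat X^0_t)=0$ almost surely. (c) Let $\pi_t$ be the conditional Gaussian probability measure with mean $\hat X_t$ and covariance matrix $P^{11}_t$, and let $\pi^0_t=\mathcal{N}(\hat X^0_t,P^0_t)$, where $P^0_t$ is the conditional covariance of the usual Kalman filter (see context). Then $\lim_{t\to\infty}d_W(\pi_t,\pi^0_t)=0$ almost surely, where $d_W$ denotes the Wasserstein metric on the space of probability measures.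
   Context: $W$ and $N$ are standard Brownian motions in $\mathbb{R}^m$ and $\mathbb{R}^n$; the family $(X_0,W_t,N_t;\,t\ge0)$ is Gaussian, $W$ is independent of $(X_0,N)$, and $\rho(t)=\mathbb{E}(N_tX_0^T)$ is a $C^2$ function on $[0,\infty)$ with values in $\mathbb{R}^{n\times m}$ ($X_0$ and $N$ may be correlated). $\mathcal{F}^Z_t=\sigma(Z_s,\,s\in[0,t])$. Definitions. For a real $m\times m$ matrix $A$, the stable subspace of $A$ is the direct sum of the (right) kernels of $(\lambda_iI-A)^{m_i}$, where $\lambda_i$ runs over the eigenvalues of $A$ with negative real part and $m_i$ is the multiplicity of $\lambda_i$; the unstable subspace of $A$ is the orthogonal of the stable subspace. For $D\in\mathbb{R}^{n\times m}$, $(A,D)$ is detectable if the (right) kernel of the stacked matrix with block rows $D,DA,\dots,DA^{m-1}$ is contained in the stable subspace of $A$. For $B\in\mathbb{R}^{m\times l}$, $(A,B)$ is stabilizable if the unstable subspace of $A$ is contained in the linear span of the columns of $(B,AB,\dots,A^{m-1}B)$. $\gamma_\infty\in\mathbb{R}^{m\times m}$ is the unique symmetric nonnegative definite solution of the algebraic Riccati equation $\gamma_\infty a^T+a\gamma_\infty+I-\gamma_\infty h^Th\gamma_\infty=0$ (it exists under the detectability and stabilizability assumptions), and $$\lambda_0=\inf\{-\mathrm{Re}\,\lambda:\ \lambda\text{ is an eigenvalue of }a-\gamma_\infty h^Th\}>0 .$$ The usual (non-anticipative) Kalman–Bucy filter associated with the same observation $Z$ is $(\hat X^0_t,P^0_t)$,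 the solution of $$d\hat X^0_t=a\hat X^0_t\,dt+P^0_th^T(dZ_t-h\hat X^0_t\,dt),\quad \hat X^0_0=\mathbb{E}[X_0],\qquad \dot P^0_t=P^0_ta^T+aP^0_t+I-P^0_th^ThP^0_t,\quad P^0_0=\mathrm{Cov}(X_0).$$ The Wasserstein metric is taken of order 1. *)

theory Defs
  imports "HOL-Probability.Probability" "HOL-Computational_Algebra.Polynomial"
begin

subsection \<open>Linear algebra: detectability and stabilizability\<close>

primrec matpow :: "'a::semiring_1^'m^'m \<Rightarrow> nat \<Rightarrow> 'a^'m^'m" where
  "matpow A 0 = mat 1"
| "matpow A (Suc k) = A ** matpow A k"

abbreviation cmat :: "real^'m^'n \<Rightarrow> complex^'m^'n" where
  "cmat A \<equiv> map_matrix complex_of_real A"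

text \<open>Spectra and the subspaces attached to a real matrix are taken over the complex numbers.\<close>

definition eigenvalue :: "real^'m^'m \<Rightarrow> complex \<Rightarrow> bool" where
  "eigenvalue A l \<longleftrightarrow> (\<exists>v. v \<noteq> 0 \<and> cmat A *v v = l *s v)"

definition charpoly :: "real^'m^'m \<Rightarrow> complex poly" where
  "charpoly A = det (mat [:0, 1:] - map_matrix (\<lambda>x. [:x:]) (cmat A))"

text \<open>The sum of the generalized eigenspaces below is automatically direct, so it is
  the complex span of their union; the multiplicity is the algebraic one.\<close>

definition stable_subspace :: "real^'m^'m \<Rightarrow> (complex^'m) set" where
  "stable_subspace A = vec.span (\<Union>l\<in>{l. eigenvalue A l \<and> Re l < 0}.
     {v. matpow (mat l - cmat A) (order l (charpoly A)) *v v = 0})"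

definition unstable_subspace :: "real^'m^'m \<Rightarrow> (complex^'m) set" where
  "unstable_subspace A = {v. \<forall>u\<in>stable_subspace A. (\<Sum>i\<in>UNIV. v $ i * cnj (u $ i)) = 0}"

definition detectable :: "real^'m^'m \<Rightarrow> real^'m^'n \<Rightarrow> bool" where
  "detectable A D \<longleftrightarrow>
     {v. \<forall>k<CARD('m). cmat (D ** matpow A k) *v v = 0} \<subseteq> stable_subspace A"

definition stabilizable :: "real^'m^'m \<Rightarrow> real^'l^'m \<Rightarrow> bool" where
  "stabilizable A B \<longleftrightarrow>
     unstable_subspace A \<subseteq> vec.span (\<Union>k<CARD('m). columns (cmat (matpow A k ** B)))"

definition sym_nonneg :: "real^'m^'m \<Rightarrow> bool" where
  "sym_nonneg G \<longleftrightarrow> transpose G = G \<and> (\<forall>x. 0 \<le> x \<bullet> (G *v x))"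

text \<open>The right-hand side of the Riccati equations, with unit signal and observation noise.\<close>

definition riccati :: "real^'m^'m \<Rightarrow> real^'m^'n \<Rightarrow> real^'m^'m \<Rightarrow> real^'m^'m" where
  "riccati a h G = G ** transpose a + a ** G + mat 1 - G ** transpose h ** h ** G"

definition decay_rate :: "real^'m^'m \<Rightarrow> real^'m^'n \<Rightarrow> real^'m^'m \<Rightarrow> real" where
  "decay_rate a h G = Inf {- Re l | l. eigenvalue (a - G ** transpose h ** h) l}"


subsection \<open>Gaussian laws and Brownian motion\<close>

text \<open>Degenerate Gaussian laws are included throughout: Gaussian laws are affine images
  of standard ones.\<close>

definition gaussian_rv :: "'w measure \<Rightarrow> ('w \<Rightarrow> real) \<Rightarrow> bool" where
  "gaussian_rv M Y \<longleftrightarrow> Y \<in> borel_measurable M \<and>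
     (\<exists>\<mu> \<sigma>. distr M borel Y =
        distr (density lborel (\<lambda>x. ennreal (std_normal_density x))) borel (\<lambda>x. \<mu> + \<sigma> * x))"

definition gaussian_family :: "'w measure \<Rightarrow> ('w \<Rightarrow> real) set \<Rightarrow> bool" where
  "gaussian_family M S \<longleftrightarrow>
     (\<forall>F c. finite F \<and> F \<subseteq> S \<longrightarrow> gaussian_rv M (\<lambda>\<omega>. \<Sum>f\<in>F. c f * f \<omega>))"

definition std_gaussian :: "(real^'m) measure" where
  "std_gaussian = density lborel (\<lambda>x. ennreal (\<Prod>i\<in>UNIV. std_normal_density (x $ i)))"

text \<open>The law with mean \<open>\<mu>\<close> and covariance matrix \<open>G\<close>, for symmetric nonnegative definite \<open>G\<close>;
  it does not depend on the choice of the square root.\<close>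

definition gaussian_measure :: "real^'m \<Rightarrow> real^'m^'m \<Rightarrow> (real^'m) measure" where
  "gaussian_measure \<mu> G =
     distr std_gaussian borel (\<lambda>x. \<mu> + (SOME S :: real^'m^'m. S ** transpose S = G) *v x)"

definition continuous_process ::
  "'w measure \<Rightarrow> (real \<Rightarrow> 'w \<Rightarrow> 'b::topological_space) \<Rightarrow> bool" where
  "continuous_process M Y \<longleftrightarrow>
     (\<forall>t\<ge>0. Y t \<in> borel_measurable M) \<and>
     (\<forall>\<omega>\<in>space M. continuous_on {0..} (\<lambda>t. Y t \<omega>))"

definition brownian_motion :: "'w measure \<Rightarrow> (real \<Rightarrow> 'w \<Rightarrow> real^'m) \<Rightarrow> bool" where
  "brownian_motion M B \<longleftrightarrow>
     continuous_process M B \<and>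
     (AE \<omega> in M. B 0 \<omega> = 0) \<and>
     (\<forall>s t. 0 \<le> s \<and> s \<le> t \<longrightarrow>
        distr M borel (\<lambda>\<omega>. B t \<omega> - B s \<omega>) = gaussian_measure 0 ((t - s) *\<^sub>R mat 1)) \<and>
     (\<forall>\<tau> n. 0 \<le> \<tau> 0 \<and> (\<forall>k<n. \<tau> k \<le> \<tau> (Suc k)) \<longrightarrow>
        prob_space.indep_vars M (\<lambda>_. borel)
          (\<lambda>(k::nat) \<omega>. B (\<tau> (Suc k)) \<omega> - B (\<tau> k) \<omega>) {..<n})"


subsection \<open>Generated sigma-algebras and conditional moments\<close>

definition generated_sigma ::
  "'w measure \<Rightarrow> real set \<Rightarrow> (real \<Rightarrow> 'w \<Rightarrow> 'b::topological_space) \<Rightarrow> 'w measure" where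
  "generated_sigma M I Y =
     sigma (space M) (\<Union>s\<in>I. {Y s -` A \<inter> space M | A. A \<in> sets borel})"

definition mean_vec :: "'w measure \<Rightarrow> ('w \<Rightarrow> real^'m) \<Rightarrow> real^'m" where
  "mean_vec M Y = (\<chi> i. \<integral>\<omega>. Y \<omega> $ i \<partial>M)"

definition cov_mat :: "'w measure \<Rightarrow> ('w \<Rightarrow> real^'m) \<Rightarrow> real^'m^'m" where
  "cov_mat M Y =
     (\<chi> i j. \<integral>\<omega>. (Y \<omega> - mean_vec M Y) $ i * (Y \<omega> - mean_vec M Y) $ j \<partial>M)"

definition cond_mean :: "'w measure \<Rightarrow> 'w measure \<Rightarrow> ('w \<Rightarrow> real^'m) \<Rightarrow> 'w \<Rightarrow> real^'m" where
  "cond_mean M F Y \<omega> = (\<chi> i. real_cond_exp M F (\<lambda>\<omega>'. Y \<omega>' $ i) \<omega>)"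

definition cond_cov :: "'w measure \<Rightarrow> 'w measure \<Rightarrow> ('w \<Rightarrow> real^'m) \<Rightarrow> 'w \<Rightarrow> real^'m^'m" where
  "cond_cov M F Y \<omega> =
     (\<chi> i j. real_cond_exp M F
        (\<lambda>\<omega>'. (Y \<omega>' - cond_mean M F Y \<omega>') $ i * (Y \<omega>' - cond_mean M F Y \<omega>') $ j) \<omega>)"


subsection \<open>Stochastic integral and the Kalman--Bucy filter\<close>

text \<open>\<open>J\<close> is the Wiener--Ito integral over \<open>[0, t]\<close> of the deterministic (continuous) matrix
  function \<open>\<Phi>\<close> against the process \<open>V\<close>: the limit in probability of the left-point
  sums as the mesh tends to 0.  Measurability is demanded explicitly because
  \<open>measure M A = 0\<close> for nonmeasurable \<open>A\<close>.\<close>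

definition has_ito_integral ::
  "'w measure \<Rightarrow> (real \<Rightarrow> real^'n^'m) \<Rightarrow> (real \<Rightarrow> 'w \<Rightarrow> real^'n) \<Rightarrow> real \<Rightarrow> ('w \<Rightarrow> real^'m) \<Rightarrow> bool"
  where
  "has_ito_integral M \<Phi> V t J \<longleftrightarrow>
     (\<forall>s\<in>{0..t}. V s \<in> borel_measurable M) \<and> J \<in> borel_measurable M \<and>
     (\<forall>\<epsilon>>0. \<forall>\<delta>>0. \<exists>\<eta>>0. \<forall>(\<tau> :: nat \<Rightarrow> real) n.
        \<tau> 0 = 0 \<and> \<tau> n = t \<and> (\<forall>k<n. \<tau> k \<le> \<tau> (Suc k) \<and> \<tau> (Suc k) - \<tau> k < \<eta>) \<longrightarrow>
        measure M {\<omega>\<in>space M.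
          norm ((\<Sum>k<n. \<Phi> (\<tau> k) *v (V (\<tau> (Suc k)) \<omega> - V (\<tau> k) \<omega>)) - J \<omega>) > \<epsilon>} < \<delta>)"

text \<open>The Kalman--Bucy equations
  \<open>dY = a Y dt + P h\<^sup>T (dZ - h Y dt)\<close>, \<open>Y\<^sub>0 = \<mu>\<close>, and \<open>P' = riccati a h P\<close>, \<open>P\<^sub>0 = G\<close>;
  the first is written in integral form.\<close>

definition kalman_filter ::
  "'w measure \<Rightarrow> real^'m^'m \<Rightarrow> real^'m^'n \<Rightarrow> real^'m \<Rightarrow> real^'m^'m \<Rightarrow>
   (real \<Rightarrow> 'w \<Rightarrow> real^'n) \<Rightarrow> (real \<Rightarrow> 'w \<Rightarrow> real^'m) \<Rightarrow> (real \<Rightarrow> real^'m^'m) \<Rightarrow> bool" where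
  "kalman_filter M a h \<mu> G Z Y P \<longleftrightarrow>
     P 0 = G \<and>
     (\<forall>t\<ge>0. (P has_vector_derivative riccati a h (P t)) (at t within {0..})) \<and>
     continuous_process M Y \<and>
     (AE \<omega> in M. Y 0 \<omega> = \<mu>) \<and>
     (\<forall>t\<ge>0. has_ito_integral M (\<lambda>s. P s ** transpose h)
        (\<lambda>s \<omega>. Z s \<omega> - integral {0..s} (\<lambda>r. h *v Y r \<omega>)) t
        (\<lambda>\<omega>. Y t \<omega> - \<mu> - integral {0..t} (\<lambda>s. a *v Y s \<omega>)))"


subsection \<open>Wasserstein metric of order 1\<close>

definition couplings ::
  "'b::{second_countable_topology,metric_space} measure \<Rightarrow> 'b measure \<Rightarrow> ('b \<times> 'b) measure set" where
  "couplings \<mu> \<nu> =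
     {\<kappa>. sets \<kappa> = sets borel \<and> distr \<kappa> borel fst = \<mu> \<and> distr \<kappa> borel snd = \<nu>}"

definition wasserstein ::
  "'b::{second_countable_topology,metric_space} measure \<Rightarrow> 'b measure \<Rightarrow> ennreal" where
  "wasserstein \<mu> \<nu> = (INF \<kappa>\<in>couplings \<mu> \<nu>. \<integral>\<^sup>+ z. ennreal (dist (fst z) (snd z)) \<partial>\<kappa>)"

end

theory Submission
  imports Defs "HOL-Computational_Algebra.Fundamental_Theorem_Algebra"
begin

text \<open>Since \<open>\<rho>\<close> is constant after some time \<open>T\<close>, the increments of \<open>N\<close> after \<open>T\<close> are orthogonal to \<open>X\<^sub>0\<close>,
  to \<open>W\<close> and to the observations up to \<open>T\<close>.  All variables live in one Gaussian space, where
  orthogonality is independence and conditional means are orthogonal projections.  From \<open>T\<close> on the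
  filter is therefore the usual Kalman--Bucy filter, restarted from the (unusual) projection error at \<open>T\<close>:
  integrating against the fundamental matrix \<open>F\<close> of the closed loop, \<open>F (X - Xhat)\<close> is the projection
  error at \<open>T\<close> plus Wiener integrals against \<open>W\<close> and \<open>N\<close>, which is orthogonal to the observations up to
  \<open>t\<close>, and its covariance is \<open>F P F\<^sup>T\<close> with \<open>P\<close> a solution of the Riccati equation.

  Every solution of the Riccati equation from a symmetric nonnegative initial value is explicit and tends
  to \<open>\<gamma>\<close> at twice the rate of \<open>exp (t A)\<close>, \<open>A = a - \<gamma> h\<^sup>T h\<close>.  The errors \<open>X - Xhat\<close> and \<open>X - Xhat0\<close>
  solve the same equation, pathwise after integration by parts, with coefficients that differ by an
  exponentially small term; as Brownian paths grow subexponentially, their difference decays at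
  every rate below that of \<open>exp (t A)\<close>.  Since \<open>\<gamma>\<close> is positive definite, square roots of covariance
  matrices near \<open>\<gamma>\<close> can be chosen close to one another, and the linear images of one standard Gaussian
  vector couple the two conditional laws.\<close>

section \<open>Matrix calculus\<close>

text \<open>Before \<open>T\<close> the correlation of the initial state with the observation noise
  spoils the filtering equation, so no equation is used there: the past enters only through the
  covariance of the projection error at \<open>T\<close>, of which only symmetry and nonnegativity
  are known. Hence the deterministic obstacle: the denominator 1 + Ob \<Delta> of the explicit
  Riccati solution must be bounded below uniformly in time for every such initial value. It is,
  because the observability Gramian is at most \<theta> < 1 times the inverse of \<gamma>. This
  bound and the stability of \<open>A\<close> both stem from the unit signal noise: the Lyapunov
  equation with right-hand side -(1 + \<gamma> h^T h \<gamma>) makes \<gamma> definite and its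
  inverse a Lyapunov function. On the stochastic side all integrands are deterministic and
  differentiable, so integration by parts makes every integral a pathwise expression and only
  covariances need L2 theory. No innovation process is introduced: the error is guessed in
  integrated form and its covariance with each observation is computed to be zero. Rates strictly
  below the spectral one leave room for Jordan blocks and for the growth of the noise.\<close>

lemma bounded_bilinear_matrix_vector_mult:
  "bounded_bilinear ((*v) :: real^'n^'m \<Rightarrow> real^'n \<Rightarrow> real^'m)"
  unfolding bilinear_conv_bounded_bilinear[symmetric] bilinear_def
  by (auto intro!: linearI simp: algebra_simps
      vec_eq_iff matrix_vector_mult_def sum_distrib_left sum.distrib)

lemma bounded_bilinear_matrix_mult:
  "bounded_bilinear ((**) :: real^'n^'m \<Rightarrow> real^'k^'n \<Rightarrow> real^'k^'m)"
  unfolding bilinear_conv_bounded_bilinear[symmetric] bilinear_def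
  by (auto intro!: linearI simp: algebra_simps
      vec_eq_iff matrix_matrix_mult_def sum_distrib_left sum.distrib)

lemma bounded_linear_transpose:
  "bounded_linear (transpose :: real^'n^'m \<Rightarrow> real^'m^'n)"
  unfolding linear_conv_bounded_linear[symmetric]
  by (auto intro!: linearI simp: transpose_def vec_eq_iff)

lemmas has_vector_derivative_mult_mv = bounded_bilinear.has_vector_derivative[OF bounded_bilinear_matrix_vector_mult]
lemmas has_vector_derivative_mult_mm = bounded_bilinear.has_vector_derivative[OF bounded_bilinear_matrix_mult]
lemmas has_vector_derivative_transpose = bounded_linear.has_vector_derivative[OF bounded_linear_transpose]
lemmas continuous_on_mult_mv [continuous_intros] = bounded_bilinear.continuous_on[OF bounded_bilinear_matrix_vector_mult]
lemmas continuous_on_mult_mm [continuous_intros] = bounded_bilinear.continuous_on[OF bounded_bilinear_matrix_mult]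
lemmas continuous_on_transpose [continuous_intros] = bounded_linear.continuous_on[OF bounded_linear_transpose]

text \<open>The norm of a vector of rows is the Frobenius norm, so the bound is Cauchy-Schwarz in
  each row. All matrix estimates below use this norm.\<close>

lemma norm_matrix_vector_mult_le:
  fixes A :: "real^'n^'m" shows "norm (A *v x) \<le> norm A * norm x"
proof -
  have "norm (A *v x) = L2_set (\<lambda>i. (A *v x) $ i) UNIV"
    by (simp add: norm_vec_def L2_set_def)
  also have "\<dots> \<le> L2_set (\<lambda>i. norm (A $ i) * norm x) UNIV"
    unfolding L2_set_def
  proof (intro real_sqrt_le_mono sum_mono)
    fix i
    have "\<bar>(A *v x) $ i\<bar> \<le> norm (A $ i) * norm x"
      by (simp add: matrix_vector_mul_component Cauchy_Schwarz_ineq2)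
    then show "((A *v x) $ i)\<^sup>2 \<le> (norm (A $ i) * norm x)\<^sup>2"
      by (rule abs_le_square_iff[THEN iffD1, OF order_trans]) simp
  qed
  also have "\<dots> = norm A * norm x"
    by (simp add: L2_set_left_distrib norm_vec_def[of A])
  finally show ?thesis .
qed

lemma norm_transpose [simp]: "norm (transpose A) = norm (A :: real^'n^'m)"
proof -
  have "(\<Sum>i\<in>UNIV. \<Sum>j\<in>UNIV. (A $ j $ i)\<^sup>2) = (\<Sum>i\<in>UNIV. \<Sum>j\<in>UNIV. (A $ i $ j)\<^sup>2)"
    by (rule sum.swap)
  then show ?thesis
    by (simp add: norm_vec_def L2_set_def transpose_def sum_nonneg)
qed

lemma norm_matrix_mult_le:
  fixes A :: "real^'n^'m" and B :: "real^'k^'n" shows "norm (A ** B) \<le> norm A * norm B"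
proof -
  have r: "transpose (A ** B) $ i = A *v (transpose B $ i)" for i
    by (simp add: vec_eq_iff transpose_def matrix_matrix_mult_def matrix_vector_mult_def)
  have "norm (transpose (A ** B)) = L2_set (\<lambda>i. norm (A *v (transpose B $ i))) UNIV"
    by (simp only: norm_vec_def[of "transpose (A ** B)"] r)
  also have "\<dots> \<le> L2_set (\<lambda>i. norm A * norm (transpose B $ i)) UNIV"
    by (intro L2_set_mono norm_matrix_vector_mult_le) auto
  also have "\<dots> = norm A * norm (transpose B)"
    by (simp only: L2_set_right_distrib[OF norm_ge_zero] norm_vec_def[of "transpose B"])
  finally show ?thesis by simp
qed

lemma has_vector_derivative_vec_lambda:
  fixes f :: "'i::finite \<Rightarrow> real \<Rightarrow> 'a::real_normed_vector"
  assumes "\<And>i. (f i has_vector_derivative f' i) F"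
  shows "((\<lambda>t. \<chi> i. f i t) has_vector_derivative (\<chi> i. f' i)) F"
  using assms unfolding has_vector_derivative_def has_derivative_def
  by (auto intro!: vec_tendstoI bounded_linear_scaleR_left)

lemma has_vector_derivative_matrixI:
  fixes f :: "real \<Rightarrow> real^'n^'m"
  assumes "\<And>i j. ((\<lambda>t. f t $ i $ j) has_vector_derivative f' $ i $ j) F"
  shows "(f has_vector_derivative f') F"
proof -
  have "((\<lambda>t. \<chi> i. \<chi> j. f t $ i $ j) has_vector_derivative (\<chi> i. \<chi> j. f' $ i $ j)) F"
    by (intro has_vector_derivative_vec_lambda assms)
  then show ?thesis by simp
qed

subsection \<open>The matrix exponential\<close>

text \<open>The matrix exponential exp (t A), entry by entry as a real power series in t, so that
  termwise differentiation of scalar series applies.\<close>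

definition mexp :: "real^'m^'m \<Rightarrow> real \<Rightarrow> real^'m^'m" where
  "mexp A t = (\<chi> i j. \<Sum>k. (matpow A k $ i $ j / fact k) * t ^ k)"

lemma norm_matpow_le: "norm (matpow (A :: real^'m^'m) k) \<le> norm (mat 1 :: real^'m^'m) * norm A ^ k"
proof (induction k)
  case (Suc k)
  have "norm (matpow A (Suc k)) \<le> norm A * norm (matpow A k)"
    by (simp add: norm_matrix_mult_le)
  also have "\<dots> \<le> norm A * (norm (mat 1 :: real^'m^'m) * norm A ^ k)"
    by (intro mult_left_mono Suc) auto
  finally show ?case by (simp add: mult_ac)
qed simp

lemma matpow_Suc_right: "matpow A (Suc k) = matpow A k ** (A :: 'a::comm_ring_1^'m^'m)"
  by (induction k) (auto simp: matrix_mul_assoc)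

lemma abs_matrix_entry_le: "\<bar>(A :: real^'n^'m) $ i $ j\<bar> \<le> norm A"
  by (metis Finite_Cartesian_Product.norm_nth_le order_trans real_norm_def)

lemma summable_mexp: "summable (\<lambda>k. (matpow (A :: real^'m^'m) k $ i $ j / fact k) * t ^ k)"
proof (rule summable_comparison_test')
  show "summable (\<lambda>k. norm (mat 1 :: real^'m^'m) * (inverse (fact k) * (norm A * \<bar>t\<bar>) ^ k))"
    by (intro summable_mult summable_exp)
  fix k :: nat assume "k \<ge> 0"
  have "norm (matpow A k $ i $ j / fact k * t ^ k) = \<bar>matpow A k $ i $ j\<bar> * (\<bar>t\<bar> ^ k / fact k)"
    by (simp add: abs_mult power_abs)
  also have "\<dots> \<le> (norm (mat 1 :: real^'m^'m) * norm A ^ k) * (\<bar>t\<bar> ^ k / fact k)"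
    by (intro mult_right_mono order_trans[OF abs_matrix_entry_le norm_matpow_le]) auto
  finally show "norm (matpow A k $ i $ j / fact k * t ^ k)
      \<le> norm (mat 1 :: real^'m^'m) * (inverse (fact k) * (norm A * \<bar>t\<bar>) ^ k)"
    by (simp add: field_simps)
qed

lemma mexp_has_vector_derivative_left:
  "(mexp A has_vector_derivative A ** mexp A t) (at t within S)"
proof (rule has_vector_derivative_matrixI)
  fix i j
  define c where "c = (\<lambda>k. matpow A k $ i $ j / fact k)"
  have "((\<lambda>t. \<Sum>k. c k * t ^ k) has_field_derivative (\<Sum>k. diffs c k * t ^ k)) (at t)"
    unfolding c_def by (rule termdiffs_strong_converges_everywhere[OF summable_mexp])
  also have "(\<lambda>k. diffs c k * t ^ k) = (\<lambda>k. \<Sum>l\<in>UNIV. A $ i $ l * ((matpow A k $ l $ j / fact k) * t ^ k))"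
    by (auto simp: fun_eq_iff diffs_def c_def matrix_matrix_mult_def sum_divide_distrib sum_distrib_left
        sum_distrib_right field_simps intro!: sum.cong simp del: of_nat_Suc)
  also have "(\<Sum>k. \<Sum>l\<in>UNIV. A $ i $ l * ((matpow A k $ l $ j / fact k) * t ^ k)) = (A ** mexp A t) $ i $ j"
    by (simp only: suminf_sum[OF summable_mult[OF summable_mexp]] suminf_mult[OF summable_mexp])
      (simp add: matrix_matrix_mult_def mexp_def)
  finally show "((\<lambda>t. mexp A t $ i $ j) has_vector_derivative (A ** mexp A t) $ i $ j) (at t within S)"
    by (auto simp: mexp_def c_def has_real_derivative_iff_has_vector_derivative[symmetric]
        intro: has_field_derivative_at_within)
qed

text \<open>\<open>A\<close> commutes with its powers, so the differentiated series can also be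
  factored with \<open>A\<close> on the right. Uniqueness of derivatives then shows that
  \<open>A\<close> commutes with its exponential.\<close>

lemma mexp_has_vector_derivative_right:
  "(mexp A has_vector_derivative mexp A t ** A) (at t within S)"
proof (rule has_vector_derivative_matrixI)
  fix i j
  define c where "c = (\<lambda>k. matpow A k $ i $ j / fact k)"
  have "((\<lambda>t. \<Sum>k. c k * t ^ k) has_field_derivative (\<Sum>k. diffs c k * t ^ k)) (at t)"
    unfolding c_def by (rule termdiffs_strong_converges_everywhere[OF summable_mexp])
  also have "(\<lambda>k. diffs c k * t ^ k) = (\<lambda>k. \<Sum>l\<in>UNIV. A $ l $ j * ((matpow A k $ i $ l / fact k) * t ^ k))"
    by (auto simp: fun_eq_iff diffs_def c_def matpow_Suc_right matrix_matrix_mult_def sum_divide_distrib sum_distrib_left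
        sum_distrib_right field_simps intro!: sum.cong simp del: of_nat_Suc matpow.simps)
  also have "(\<Sum>k. \<Sum>l\<in>UNIV. A $ l $ j * ((matpow A k $ i $ l / fact k) * t ^ k)) = (mexp A t ** A) $ i $ j"
    by (simp only: suminf_sum[OF summable_mult[OF summable_mexp]] suminf_mult[OF summable_mexp])
      (simp add: matrix_matrix_mult_def mexp_def mult.commute)
  finally show "((\<lambda>t. mexp A t $ i $ j) has_vector_derivative (mexp A t ** A) $ i $ j) (at t within S)"
    by (auto simp: mexp_def c_def has_real_derivative_iff_has_vector_derivative[symmetric]
        intro: has_field_derivative_at_within)
qed

lemma mexp_0 [simp]: "mexp A 0 = mat 1"
proof -
  have "(\<Sum>k. (matpow A k $ i $ j / fact k) * 0 ^ k) = mat 1 $ i $ j" for i j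
    by (subst powser_zero) simp
  then show ?thesis by (simp add: mexp_def vec_eq_iff)
qed

lemma continuous_on_mexp [continuous_intros]:
  "continuous_on S f \<Longrightarrow> continuous_on S (\<lambda>x. mexp A (f x))"
  by (rule continuous_on_compose2[of UNIV "mexp A"])
    (auto intro!: continuous_on_vector_derivative mexp_has_vector_derivative_left)

lemma mexp_has_vector_derivative_right_compose:
  assumes "(f has_real_derivative d) (at t within S)"
  shows "((\<lambda>t. mexp A (f t)) has_vector_derivative d *\<^sub>R (mexp A (f t) ** A)) (at t within S)"
  using vector_diff_chain_within[OF assms[unfolded has_real_derivative_iff_has_vector_derivative]
      mexp_has_vector_derivative_right[of A "f t"]]
  by (simp add: o_def)

lemma scaleR_matrix_mult: "(c *\<^sub>R A) ** B = c *\<^sub>R (A ** (B :: real^'k^'n))"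
  "A ** (c *\<^sub>R B) = c *\<^sub>R (A ** B)"
  by (simp_all add: bounded_bilinear.scaleR_left[OF bounded_bilinear_matrix_mult]
      bounded_bilinear.scaleR_right[OF bounded_bilinear_matrix_mult])

lemmas matrix_bilinear =
  bounded_bilinear.add_left[OF bounded_bilinear_matrix_mult]
  bounded_bilinear.add_right[OF bounded_bilinear_matrix_mult]
  bounded_bilinear.diff_left[OF bounded_bilinear_matrix_mult]
  bounded_bilinear.diff_right[OF bounded_bilinear_matrix_mult]
  bounded_bilinear.minus_left[OF bounded_bilinear_matrix_mult]
  bounded_bilinear.minus_right[OF bounded_bilinear_matrix_mult]
  bounded_bilinear.zero_left[OF bounded_bilinear_matrix_mult]
  bounded_bilinear.zero_right[OF bounded_bilinear_matrix_mult]
  bounded_bilinear.add_left[OF bounded_bilinear_matrix_vector_mult]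
  bounded_bilinear.add_right[OF bounded_bilinear_matrix_vector_mult]
  bounded_bilinear.diff_left[OF bounded_bilinear_matrix_vector_mult]
  bounded_bilinear.diff_right[OF bounded_bilinear_matrix_vector_mult]
  bounded_bilinear.minus_left[OF bounded_bilinear_matrix_vector_mult]
  bounded_bilinear.minus_right[OF bounded_bilinear_matrix_vector_mult]
  bounded_bilinear.zero_left[OF bounded_bilinear_matrix_vector_mult]
  bounded_bilinear.zero_right[OF bounded_bilinear_matrix_vector_mult]
  bounded_bilinear.scaleR_left[OF bounded_bilinear_matrix_vector_mult]
  bounded_bilinear.scaleR_right[OF bounded_bilinear_matrix_vector_mult]
  scaleR_matrix_mult

text \<open>The right form of the derivative for \<open>mexp A (- t)\<close> and the left form for
  \<open>mexp A t\<close> put the same factor \<open>A\<close> in the middle with opposite signs, so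
  the product is constant.\<close>

lemma mexp_minus_mult: "mexp A (- t) ** mexp A t = mat 1"
proof -
  have "((\<lambda>t. mexp A (- t) ** mexp A t) has_vector_derivative 0) (at t)" for t
  proof -
    have "(uminus has_real_derivative -1) (at t)" by (auto intro!: derivative_eq_intros)
    from has_vector_derivative_mult_mm[OF mexp_has_vector_derivative_right_compose[OF this, of A]
        mexp_has_vector_derivative_left[of A t UNIV]]
    show ?thesis by (simp add: matrix_bilinear matrix_mul_assoc)
  qed
  then obtain c where "\<And>t. mexp A (- t) ** mexp A t = c"
    using has_vector_derivative_zero_constant[of UNIV "\<lambda>t. mexp A (- t) ** mexp A t"] by auto
  then show ?thesis by (metis mexp_0 matrix_mul_lid minus_zero)
qed

lemma mexp_mult_minus: "mexp A t ** mexp A (- t) = mat 1"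
  using mexp_minus_mult[of A "-t"] by simp


lemma mexp_commute: "A ** mexp A t = mexp A t ** A"
  using vector_derivative_unique_at[OF mexp_has_vector_derivative_left mexp_has_vector_derivative_right] .

subsection \<open>Spectral decay of the matrix exponential\<close>

lemma cmat_mult: "cmat (A ** B) = cmat A ** cmat B"
  by (simp add: vec_eq_iff matrix_matrix_mult_def map_matrix_def)

lemma linear_cmat_apply: "linear (\<lambda>M :: real^'m^'n. cmat M *v v)"
  by (auto intro!: linearI simp: vec_eq_iff matrix_vector_mult_def map_matrix_def algebra_simps
      sum.distrib scaleR_sum_right scaleR_conv_of_real[where 'a=complex] sum_distrib_left)

lemma norm_complex_smult: "norm (c *s (v :: complex^'m)) = cmod c * norm v"
  by (simp add: norm_vec_def norm_mult L2_set_right_distrib)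

section \<open>Polynomials in a complex matrix, and eigenvectors modulo a subspace\<close>

definition papply :: "complex^'m^'m \<Rightarrow> complex poly \<Rightarrow> complex^'m \<Rightarrow> complex^'m" where
  "papply A p u = (\<Sum>i\<le>degree p. coeff p i *s (matpow A i *v u))"

lemma papply_extend: "degree p \<le> n \<Longrightarrow> papply A p u = (\<Sum>i\<le>n. coeff p i *s (matpow A i *v u))"
  unfolding papply_def by (rule sum.mono_neutral_left) (auto simp: coeff_eq_0)

lemma papply_add: "papply A (p + q) u = papply A p u + papply A q u"
  using degree_add_le_max[of p q]
  by (simp add: papply_extend[of _ "max (degree p) (degree q)"] vec.scale_left_distrib sum.distrib)

lemma papply_smult: "papply A (smult c p) u = c *s papply A p u"
  by (simp add: papply_extend[of "smult c p" "degree p"] degree_smult_le papply_def vec.scale_sum_right)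

lemma papply_pCons_0: "papply A (pCons 0 p) u = A *v papply A p u"
proof -
  have "papply A (pCons 0 p) u = (\<Sum>i\<le>Suc (degree p). coeff (pCons 0 p) i *s (matpow A i *v u))"
    by (rule papply_extend) (simp add: degree_pCons_le)
  also have "\<dots> = (\<Sum>i\<le>degree p. coeff p i *s (A *v (matpow A i *v u)))"
    by (subst sum.atMost_Suc_shift) (simp add: matrix_vector_mul_assoc)
  finally show ?thesis by (simp add: papply_def vec.sum vec.scale)
qed

lemma papply_linear_factor:
  "papply A ([:- r, 1:] * p) u = A *v papply A p u - r *s papply A p u"
proof -
  have "[:- r, 1:] * p = pCons 0 p + smult (- r) p" by simp
  then show ?thesis by (simp only: papply_add papply_smult papply_pCons_0) simp
qed

text \<open>The m + 1 vectors \<open>matpow A k *v u\<close> with k up to m are linearly dependent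
  in dimension m. Dependence speaks of sets, so a repetition among the vectors is treated apart; it
  gives the relation with coefficients 1 and -1.\<close>

lemma ex_annihilating_poly: "\<exists>p. p \<noteq> 0 \<and> papply A p (u :: complex^'m) = 0"
proof -
  define f where "f k = matpow A k *v u" for k
  define m where "m = CARD('m)"
  have "\<exists>c. (\<exists>k\<le>m. c k \<noteq> (0::complex)) \<and> (\<Sum>k\<le>m. c k *s f k) = 0"
  proof (cases "inj_on f {..m}")
    case False
    then obtain i j where ij: "i \<le> m" "j \<le> m" "i \<noteq> j" "f i = f j" by (auto simp: inj_on_def)
    have "(\<Sum>k\<le>m. (if k = i then 1 else if k = j then - 1 else 0) *s f k)
        = (\<Sum>k\<le>m. (if k = i then f i else 0) + (if k = j then - f j else 0))"
      using ij by (intro sum.cong) auto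
    also have "\<dots> = 0" using ij by (simp add: sum.distrib)
    finally show ?thesis using ij(1)
      by (intro exI[of _ "\<lambda>k. if k = i then 1 else if k = j then - 1 else 0"]) auto
  next
    case True
    have "card (f ` {..m}) > vec.dim (UNIV :: (complex^'m) set)"
      using True by (simp add: card_image m_def card_cart_basis)
    then have "vec.dependent (f ` {..m})"
      using vec.independent_card_le_dim[of "f ` {..m}" UNIV] by (meson not_less top_greatest)
    then obtain c where c: "\<exists>v\<in>f ` {..m}. c v \<noteq> 0" "(\<Sum>v\<in>f ` {..m}. c v *s v) = 0"
      by (auto simp: vec.dependent_finite)
    then show ?thesis using True
      by (intro exI[of _ "\<lambda>k. c (f k)"]) (auto simp: sum.reindex)
  qed
  then obtain c where c: "\<exists>k\<le>m. c k \<noteq> 0" "(\<Sum>k\<le>m. c k *s f k) = 0" by blast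
  define p where "p = (\<Sum>k\<le>m. monom (c k) k)"
  have cp: "coeff p k = (if k \<le> m then c k else 0)" for k
    by (simp add: p_def coeff_sum)
  have "degree p \<le> m" by (rule degree_le) (simp add: cp)
  then have "papply A p u = 0" using c(2) by (simp add: papply_extend[of p m] cp f_def)
  moreover have "p \<noteq> 0" using c(1) cp by (metis coeff_0)
  ultimately show ?thesis by blast
qed

text \<open>For an invariant \<open>D\<close> this is an eigenvector of the quotient map. Split
  linear factors off an annihilating polynomial: with p = (x - r) q, either q(A) u lies outside
  \<open>D\<close> and is the vector sought, or q has smaller degree and still sends u into
  \<open>D\<close>. Degree 0 would put u itself into \<open>D\<close>.\<close>

lemma ex_eigenvector_mod_subspace:
  fixes A :: "complex^'m^'m"
  assumes D: "vec.subspace D" and u: "u \<notin> D"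
  shows "\<exists>v r. v \<notin> D \<and> A *v v - r *s v \<in> D"
proof -
  have *: "\<exists>v r. v \<notin> D \<and> A *v v - r *s v \<in> D" if "p \<noteq> 0" "papply A p u \<in> D" for p
    using that
  proof (induction "degree p" arbitrary: p)
    case 0
    then obtain c where c: "p = [:c:]" "c \<noteq> 0" by (metis degree_eq_zeroE pCons_0_0)
    then have "c *s u \<in> D" using 0 by (simp add: papply_def)
    then have "inverse c *s (c *s u) \<in> D" using D vec.subspace_scale by blast
    then show ?case using u c by simp
  next
    case (Suc n)
    have "\<not> constant (poly p)" using Suc.hyps(2) by (simp add: constant_degree)
    then obtain r where "poly p r = 0" using fundamental_theorem_of_algebra by blast
    then obtain q where q: "p = [:- r, 1:] * q" by (auto simp: poly_eq_0_iff_dvd dvd_def)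
    with Suc.prems have q0: "q \<noteq> 0" by auto
    then have "degree p = Suc (degree q)" unfolding q by (subst degree_mult_eq) auto
    then have "n = degree q" using Suc.hyps(2) by simp
    moreover have "A *v papply A q u - r *s papply A q u \<in> D"
      using Suc.prems(2) unfolding q papply_linear_factor .
    ultimately show ?case using Suc.hyps(1)[of q] q0 by blast
  qed
  from ex_annihilating_poly[of A u] obtain p where "p \<noteq> 0" "papply A p u = 0" by blast
  then show ?thesis using *[of p] vec.subspace_0[OF D] by simp
qed

lemma exp_integral_bound:
  fixes y :: "real \<Rightarrow> 'a::banach"
  assumes y: "\<And>s. s \<in> {0..t} \<Longrightarrow> (y has_vector_derivative y' s) (at s within {0..t})"
    and b: "\<And>s. s \<in> {0..t} \<Longrightarrow> norm (y' s) \<le> C * exp (k * s)" and k: "k > 0" and t: "t \<ge> 0"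
  shows "norm (y t - y 0) \<le> C / k * (exp (k * t) - 1)"
proof -
  have 1: "(y' has_integral (y t - y 0)) {0..t}"
    using fundamental_theorem_of_calculus[OF t y] .
  have 2: "((\<lambda>s. C * exp (k * s)) has_integral (C / k * exp (k * t) - C / k * exp (k * 0))) {0..t}"
    by (rule fundamental_theorem_of_calculus[OF t])
      (use k in \<open>auto intro!: derivative_eq_intros simp: has_real_derivative_iff_has_vector_derivative[symmetric]\<close>)
  have "norm (integral {0..t} y') \<le> integral {0..t} (\<lambda>s. C * exp (k * s))"
    using 1 2 b by (intro integral_norm_bound_integral) (auto simp: has_integral_integrable_integral)
  also have "\<dots> = C / k * (exp (k * t) - 1)"
    using 2 by (simp add: integral_unique right_diff_distrib del: integral_mult_right)
  finally show ?thesis using 1 by (simp add: integral_unique)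
qed

lemma norm_vec_le_sum: "norm (x :: 'a::real_normed_vector^'n) \<le> (\<Sum>i\<in>UNIV. norm (x $ i))"
  unfolding norm_vec_def by (rule L2_set_le_sum) simp

text \<open>Invariant subspaces take the place of the Jordan form: the vectors whose orbit decays at
  rate \<open>l\<close> form an invariant subspace, and if it were proper, an eigenvector modulo it
  would decay as well. The strict inequality in the hypothesis absorbs the polynomial factors of
  Jordan blocks.\<close>

theorem mexp_decay:
  fixes A :: "real^'m^'m"
  assumes ev: "\<And>r. eigenvalue A r \<Longrightarrow> Re r < - l"
  shows "\<exists>C\<ge>0. \<forall>t\<ge>0. norm (mexp A t) \<le> C * exp (- l * t)"
proof -
  define D where "D = {v. \<exists>C. \<forall>t\<ge>0. norm (cmat (mexp A t) *v v) \<le> C * exp (- l * t)}"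
  have bl: "bounded_linear ((*v) (cmat A))" by simp
  obtain K where K: "K > 0" "\<And>v. norm (cmat A *v v) \<le> norm v * K"
    using bounded_linear.pos_bounded[OF bl] by blast
  have D: "vec.subspace D"
  proof (rule vec.subspaceI)
    show "0 \<in> D" by (auto simp: D_def intro!: exI[of _ 0])
  next
    fix x y assume "x \<in> D" "y \<in> D"
    then obtain C1 C2 where "\<forall>t\<ge>0. norm (cmat (mexp A t) *v x) \<le> C1 * exp (- l * t)"
      "\<forall>t\<ge>0. norm (cmat (mexp A t) *v y) \<le> C2 * exp (- l * t)" by (auto simp: D_def)
    then have "\<forall>t\<ge>0. norm (cmat (mexp A t) *v (x + y)) \<le> (C1 + C2) * exp (- l * t)"
      by (auto simp: matrix_vector_right_distrib algebra_simps intro!: norm_triangle_le add_mono)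
    then show "x + y \<in> D" by (auto simp: D_def)
  next
    fix c x assume "x \<in> D"
    then obtain C1 where C1: "\<forall>t\<ge>0. norm (cmat (mexp A t) *v x) \<le> C1 * exp (- l * t)" by (auto simp: D_def)
    then have "\<forall>t\<ge>0. norm (cmat (mexp A t) *v (c *s x)) \<le> (cmod c * C1) * exp (- l * t)"
      by (auto simp: vec.scale norm_complex_smult mult.assoc intro!: mult_left_mono)
    then show "c *s x \<in> D" by (auto simp: D_def)
  qed
  have inv: "cmat A *v v \<in> D" if v: "v \<in> D" for v
  proof -
    from v obtain C where C: "\<And>t. t \<ge> 0 \<Longrightarrow> norm (cmat (mexp A t) *v v) \<le> C * exp (- l * t)" by (auto simp: D_def)
    have "norm (cmat (mexp A t) *v (cmat A *v v)) \<le> (C * K) * exp (- l * t)" if "t \<ge> 0" for t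
    proof -
      have "cmat (mexp A t) *v (cmat A *v v) = cmat A *v (cmat (mexp A t) *v v)"
        by (simp add: matrix_vector_mul_assoc cmat_mult[symmetric] mexp_commute)
      also have "norm \<dots> \<le> norm (cmat (mexp A t) *v v) * K" by (rule K)
      also have "\<dots> \<le> (C * exp (- l * t)) * K" using C[OF that] K(1) by (intro mult_right_mono) auto
      finally show ?thesis by (simp add: mult_ac)
    qed
    then show ?thesis by (auto simp: D_def)
  qed
  have "v \<in> D" if vr: "cmat A *v v - r *s v \<in> D" for v r
  proof (rule ccontr)
    assume vD: "v \<notin> D"
    let ?f = "\<lambda>x. cmat A *v x - r *s x"
    have lin: "Vector_Spaces.linear (*s) (*s) ?f"
      by unfold_locales (auto simp: vec.add vec.scale algebra_simps vec.scale_right_diff_distrib vec.scale_right_distrib)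
    \<comment> \<open>Otherwise A - r is injective and maps \<open>D\<close> into \<open>D\<close>,
      hence onto \<open>D\<close> by dimension; as it sends \<open>v\<close> into \<open>D\<close>,
      injectivity puts \<open>v\<close> in \<open>D\<close>.\<close>
    have "eigenvalue A r"
    proof (rule ccontr)
      assume "\<not> eigenvalue A r"
      then have n0: "\<And>x. ?f x = 0 \<Longrightarrow> x = 0" by (auto simp: eigenvalue_def)
      have inj: "inj ?f"
        using n0 by (simp add: vec.linear_inj_iff_eq_0[OF lin])
      have sub: "?f ` D \<subseteq> D" using inv D by (auto intro: vec.subspace_diff vec.subspace_scale)
      have "vec.dim (?f ` D) = vec.dim D"
        by (rule vec.dim_image_eq[OF lin]) (rule inj_on_subset[OF inj], simp)
      then have "?f ` D = D"
        using sub D by (intro vec.subspace_dim_equal vec.linear_subspace_image[OF lin]) auto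
      then have "?f v \<in> ?f ` D" using vr by simp
      then obtain d where "d \<in> D" "?f v = ?f d" by (rule imageE) simp
      then show False using inj vD by (auto dest: injD)
    qed
    then have "Re r < - l" by (rule ev)
    define k where "k = - Re r - l"
    have k: "k > 0" using \<open>Re r < - l\<close> by (simp add: k_def)
    define w where "w = ?f v"
    have Av: "cmat A *v v = r *s v + w" by (simp add: w_def)
    obtain C where C: "\<And>t. t \<ge> 0 \<Longrightarrow> norm (cmat (mexp A t) *v w) \<le> C * exp (- l * t)"
      using vr by (auto simp: D_def w_def)
    \<comment> \<open>Removing the factor exp (r t) leaves a function with derivative exp (- r t)
      exp (t A) w, of size exp (k t) because w is in \<open>D\<close>; since k > 0, the integral of
      this bound is again of that size.\<close>
    define y where "y t = exp (- r * of_real t) *s (cmat (mexp A t) *v v)" for t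
    have dy: "(y has_vector_derivative exp (- r * of_real t) *s (cmat (mexp A t) *v w)) (at t within S)" for t S
    proof -
      have bl2: "bounded_linear (\<lambda>M. cmat M *v v)"
        using linear_cmat_apply linear_conv_bounded_linear by blast
      have "((\<lambda>t. cmat (mexp A t) *v v) has_vector_derivative cmat (mexp A t ** A) *v v) (at t within S)"
        by (rule bounded_linear.has_vector_derivative[OF bl2 mexp_has_vector_derivative_right])
      also have "cmat (mexp A t ** A) *v v = r *s (cmat (mexp A t) *v v) + cmat (mexp A t) *v w"
        by (simp add: cmat_mult matrix_vector_mul_assoc[symmetric] Av vec.add vec.scale)
      finally have X: "((\<lambda>t. (cmat (mexp A t) *v v) $ i) has_vector_derivative
          r * (cmat (mexp A t) *v v) $ i + (cmat (mexp A t) *v w) $ i) (at t within S)" for i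
        by (auto dest!: bounded_linear.has_vector_derivative[OF bounded_linear_vec_nth[of i]])
      have E: "((\<lambda>t. exp (- r * of_real t)) has_vector_derivative - r * exp (- r * of_real t)) (at t within S)"
        by (rule has_vector_derivative_real_field) (auto intro!: derivative_eq_intros)
      have "((\<lambda>t. \<chi> i. exp (- r * of_real t) * (cmat (mexp A t) *v v) $ i) has_vector_derivative
          (\<chi> i. exp (- r * of_real t) * (r * (cmat (mexp A t) *v v) $ i + (cmat (mexp A t) *v w) $ i)
            + (- r * exp (- r * of_real t)) * (cmat (mexp A t) *v v) $ i)) (at t within S)"
        by (intro has_vector_derivative_vec_lambda has_vector_derivative_mult E X)
      moreover have "(\<lambda>t. \<chi> i. exp (- r * of_real t) * (cmat (mexp A t) *v v) $ i) = y"
        by (simp add: y_def fun_eq_iff vec_eq_iff)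
      moreover have "(\<chi> i. exp (- r * of_real t) * (r * (cmat (mexp A t) *v v) $ i + (cmat (mexp A t) *v w) $ i)
            + (- r * exp (- r * of_real t)) * (cmat (mexp A t) *v v) $ i)
          = exp (- r * of_real t) *s (cmat (mexp A t) *v w)"
        by (simp add: vec_eq_iff algebra_simps)
      ultimately show ?thesis by simp
    qed
    have "norm (cmat (mexp A t) *v v) \<le> (norm v + \<bar>C\<bar> / k) * exp (- l * t)" if t: "t \<ge> 0" for t
    proof -
      have nexp: "cmod (exp (- r * of_real s)) = exp (- Re r * s)" for s by (simp add: norm_exp_eq_Re)
      have "norm (y t - y 0) \<le> \<bar>C\<bar> / k * (exp (k * t) - 1)"
      proof (rule exp_integral_bound[OF dy _ k t])
        fix s assume s: "s \<in> {0..t}"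
        have "norm (exp (- r * of_real s) *s (cmat (mexp A s) *v w)) = exp (- Re r * s) * norm (cmat (mexp A s) *v w)"
          by (simp add: norm_complex_smult nexp)
        also have "\<dots> \<le> exp (- Re r * s) * (\<bar>C\<bar> * exp (- l * s))"
          using C[of s] s by (intro mult_left_mono) (auto intro: order_trans[OF _ mult_right_mono[OF abs_ge_self]])
        also have "\<dots> = \<bar>C\<bar> * exp (k * s)" 
          unfolding k_def by (simp only: mult.left_commute[of "exp _"] exp_add[symmetric]) (simp add: algebra_simps)
        finally show "norm (exp (- r * of_real s) *s (cmat (mexp A s) *v w)) \<le> \<bar>C\<bar> * exp (k * s)" .
      qed
      also have "\<dots> \<le> \<bar>C\<bar> / k * exp (k * t)" using k by (intro mult_left_mono) auto
      finally have "norm (y t) \<le> norm v + \<bar>C\<bar> / k * exp (k * t)"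
      proof -
        have "cmat (mat 1) = (mat 1 :: complex^'m^'m)" by (auto simp: vec_eq_iff map_matrix_def mat_def)
        then have "y 0 = v" by (simp add: y_def)
        then show "norm (y t - y 0) \<le> \<bar>C\<bar> / k * exp (k * t) \<Longrightarrow> ?thesis"
          using norm_triangle_sub[of "y t" v] by simp
      qed
      then have "exp (- Re r * t) * norm (cmat (mexp A t) *v v) \<le> norm v + \<bar>C\<bar> / k * exp (k * t)"
        by (simp add: y_def norm_complex_smult nexp)
      also have "\<dots> \<le> (norm v + \<bar>C\<bar> / k) * exp (k * t)"
        using k t by (simp add: distrib_right mult_le_cancel_left1)
      finally have "exp (Re r * t) * (exp (- Re r * t) * norm (cmat (mexp A t) *v v))
          \<le> exp (Re r * t) * ((norm v + \<bar>C\<bar> / k) * exp (k * t))"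
        by (intro mult_left_mono) auto
      moreover have "exp (Re r * t) * exp (k * t) = exp (- l * t)"
        by (simp add: k_def exp_add[symmetric] algebra_simps)
      moreover have "exp (Re r * t) * exp (- Re r * t) = 1" by (simp add: exp_add[symmetric])
      ultimately show ?thesis by (simp only: mult.assoc[symmetric] mult_1)
          (simp only: mult.assoc mult.left_commute[of "exp _" "norm v + _"])
    qed
    then have "v \<in> D" by (auto simp: D_def)
    with vD show False ..
  qed
  with ex_eigenvector_mod_subspace[OF D] have DU: "v \<in> D" for v by blast
  have "\<exists>C. \<forall>j. \<forall>t\<ge>0. norm (cmat (mexp A t) *v axis j 1) \<le> C j * exp (- l * t)"
    using DU[unfolded D_def mem_Collect_eq] by (intro choice) blast
  then obtain C where C: "\<And>j t. t \<ge> 0 \<Longrightarrow> norm (cmat (mexp A t) *v axis j 1) \<le> C j * exp (- l * t)" by blast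
  have "norm (mexp A t) \<le> (\<Sum>i\<in>(UNIV::'m set). \<Sum>j\<in>UNIV. \<bar>C j\<bar>) * exp (- l * t)" if t: "t \<ge> 0" for t
  proof -
    have e: "\<bar>mexp A t $ i $ j\<bar> \<le> \<bar>C j\<bar> * exp (- l * t)" for i j
    proof -
      have "cmod ((cmat (mexp A t) *v axis j 1) $ i) \<le> norm (cmat (mexp A t) *v axis j 1)"
        by (rule Finite_Cartesian_Product.norm_nth_le)
      also have "\<dots> \<le> \<bar>C j\<bar> * exp (- l * t)" using C[OF t, of j]
        by (auto intro: order_trans[OF _ mult_right_mono[OF abs_ge_self]])
      finally show ?thesis
        by (simp add: matrix_vector_mult_def axis_def map_matrix_def if_distrib cong: if_cong)
    qed
    have "norm (mexp A t) \<le> (\<Sum>i\<in>UNIV. norm (mexp A t $ i))" by (rule norm_vec_le_sum)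
    also have "\<dots> \<le> (\<Sum>i\<in>UNIV. \<Sum>j\<in>UNIV. \<bar>mexp A t $ i $ j\<bar>)"
      by (intro sum_mono order_trans[OF norm_vec_le_sum]) simp
    also have "\<dots> \<le> (\<Sum>i\<in>(UNIV::'m set). \<Sum>j\<in>UNIV. \<bar>C j\<bar> * exp (- l * t))"
      by (intro sum_mono e)
    finally show ?thesis by (simp only: sum_distrib_right)
  qed
  then show ?thesis by (intro exI[of _ "\<Sum>i\<in>(UNIV::'m set). \<Sum>j\<in>UNIV. \<bar>C j\<bar>"]) (auto intro!: sum_nonneg)
qed

section \<open>Ordinary differential equations on a half-line\<close>

declare transpose_matrix_vector [simp del] vector_transpose_matrix [simp del]

lemma at_within_Icc_Ici: "(T::real) \<le> t \<Longrightarrow> t < u \<Longrightarrow> at t within {T..u} = at t within {T..}"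
  by (auto intro!: at_within_nhd[of t "{..<u}"])

lemma integral_has_vector_derivative_Ici:
  fixes f :: "real \<Rightarrow> 'a::banach"
  assumes f: "continuous_on {T..} f" and t: "T \<le> t"
  shows "((\<lambda>u. integral {T..u} f) has_vector_derivative f t) (at t within {T..})"
  using integral_has_vector_derivative[of T "t + 1" f t] at_within_Icc_Ici[of T t "t+1"] t
    continuous_on_subset[OF f, of "{T..t+1}"] by auto

lemma has_vector_derivative_interior:
  fixes f :: "real \<Rightarrow> 'a::real_normed_vector"
  assumes "(f has_vector_derivative d) (at t within {T..})" "T < t"
  shows "(f has_vector_derivative d) (at t)"
  using assms at_within_interior[of t "{T..}"] by simp

lemma continuous_on_Ici_derivative:
  assumes "\<And>t. T \<le> t \<Longrightarrow> (f has_vector_derivative f' t) (at t within {T..})"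
  shows "continuous_on {T..} f"
  using assms by (auto intro: continuous_on_vector_derivative)

lemma Ici_derivative_mono:
  fixes f :: "real \<Rightarrow> real"
  assumes d: "\<And>t. T \<le> t \<Longrightarrow> (f has_vector_derivative f' t) (at t within {T..})"
    and nn: "\<And>t. T < t \<Longrightarrow> 0 \<le> f' t" and st: "T \<le> s" "s \<le> t"
  shows "f s \<le> f t"
proof (rule DERIV_nonneg_imp_increasing_open[OF st(2)])
  fix x assume x: "s < x" "x < t"
  show "\<exists>y. DERIV f x :> y \<and> 0 \<le> y"
    using has_vector_derivative_interior[OF d, of x] nn[of x] x st
    by (auto simp: has_real_derivative_iff_has_vector_derivative)
next
  show "continuous_on {s..t} f"
    by (rule continuous_on_subset[OF continuous_on_Ici_derivative[OF d]]) (use st in auto)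
qed

lemma Ici_derivative_zero:
  fixes f :: "real \<Rightarrow> 'a::real_inner"
  assumes d: "\<And>t. T \<le> t \<Longrightarrow> (f has_vector_derivative 0) (at t within {T..})" and t: "T \<le> t"
  shows "f t = f T"
proof -
  obtain c where "\<And>t. t \<in> {T..} \<Longrightarrow> f t = c"
    using d by (rule has_vector_derivative_zero_constant[of "{T..}" f, rotated]) auto
  then show ?thesis using t by simp
qed

lemma Ici_FTC:
  fixes f :: "real \<Rightarrow> 'a::banach"
  assumes d: "\<And>t. T \<le> t \<Longrightarrow> (f has_vector_derivative f' t) (at t within {T..})" and st: "T \<le> s" "s \<le> t"
  shows "(f' has_integral (f t - f s)) {s..t}"
  using st by (intro fundamental_theorem_of_calculus)
    (auto intro!: has_vector_derivative_within_subset[OF d])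

lemma continuous_on_integral_Ici:
  fixes f :: "real \<Rightarrow> 'a::banach"
  assumes "continuous_on {T..} f"
  shows "continuous_on {T..} (\<lambda>t. integral {T..t} f)"
  by (rule continuous_on_Ici_derivative[OF integral_has_vector_derivative_Ici[OF assms]])

text \<open>With \<open>R\<close> the right-hand side of the integral inequality, R exp (- integral
  of k) does not increase. \<open>S\<close> is its negative because the monotonicity lemma is about
  nondecreasing functions.\<close>

lemma gronwall:
  fixes m k :: "real \<Rightarrow> real"
  assumes cm: "continuous_on {T..} m" and ck: "continuous_on {T..} k"
    and k0: "\<And>t. T \<le> t \<Longrightarrow> 0 \<le> k t"
    and le: "\<And>t. T \<le> t \<Longrightarrow> m t \<le> c + integral {T..t} (\<lambda>s. k s * m s)" and t: "T \<le> t"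
  shows "m t \<le> c * exp (integral {T..t} k)"
proof -
  define R where "R t = c + integral {T..t} (\<lambda>s. k s * m s)" for t
  define S where "S t = - (R t * exp (- integral {T..t} k))" for t
  have dR: "(R has_vector_derivative k t * m t) (at t within {T..})" if "T \<le> t" for t
    unfolding R_def using that
    by (auto intro!: derivative_eq_intros integral_has_vector_derivative_Ici continuous_intros cm ck)
  have dI: "((\<lambda>t. integral {T..t} k) has_vector_derivative k t) (at t within {T..})" if "T \<le> t" for t
    by (rule integral_has_vector_derivative_Ici[OF ck that])
  have "(S has_vector_derivative - (k t * m t - k t * R t) * exp (- integral {T..t} k)) (at t within {T..})"
    if "T \<le> t" for t
    unfolding S_def using dR[OF that] dI[OF that]
    by (auto intro!: derivative_eq_intros simp: has_real_derivative_iff_has_vector_derivative[symmetric] algebra_simps)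
  moreover have "0 \<le> - (k t * m t - k t * R t) * exp (- integral {T..t} k)" if "T < t" for t
  proof -
    have "k t * m t \<le> k t * R t" using le[of t] k0[of t] that unfolding R_def by (intro mult_left_mono) auto
    then show ?thesis by (intro mult_nonneg_nonneg) auto
  qed
  ultimately have "S T \<le> S t" by (rule Ici_derivative_mono) (use t in auto)
  then have "R t * exp (- integral {T..t} k) \<le> c" by (simp add: S_def R_def)
  then have "R t * exp (- integral {T..t} k) * exp (integral {T..t} k) \<le> c * exp (integral {T..t} k)"
    by (rule mult_right_mono) simp
  then have "R t \<le> c * exp (integral {T..t} k)" by (simp add: mult.assoc exp_add[symmetric])
  then show ?thesis using le[OF t] by (simp add: R_def)
qed

lemma linear_ode_zero:
  fixes q :: "real \<Rightarrow> real^'k^'m"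
  assumes d: "\<And>t. T \<le> t \<Longrightarrow> (q has_vector_derivative B t ** q t) (at t within {T..})"
    and B: "continuous_on {T..} B" and q0: "q T = 0" and t: "T \<le> t"
  shows "q t = 0"
proof -
  have cq: "continuous_on {T..} q" by (rule continuous_on_Ici_derivative[OF d])
  have "norm (q t) \<le> 0 * exp (integral {T..t} (\<lambda>s. norm (B s)))"
  proof (rule gronwall[OF _ _ _ _ t])
    show "continuous_on {T..} (\<lambda>s. norm (q s))" "continuous_on {T..} (\<lambda>s. norm (B s))"
      by (intro continuous_intros cq B)+
    fix t assume t: "T \<le> t"
    have i: "((\<lambda>s. B s ** q s) has_integral q t) {T..t}" using Ici_FTC[OF d order_refl t] q0 by simp
    have "norm (integral {T..t} (\<lambda>s. B s ** q s)) \<le> integral {T..t} (\<lambda>s. norm (B s) * norm (q s))"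
      using i by (intro integral_norm_bound_integral norm_matrix_mult_le)
        (auto intro!: integrable_continuous_real continuous_intros
          continuous_on_subset[OF cq] continuous_on_subset[OF B])
    then show "norm (q t) \<le> 0 + integral {T..t} (\<lambda>s. norm (B s) * norm (q s))"
      using i by (simp add: integral_unique)
  qed auto
  then show ?thesis by simp
qed

text \<open>Variation of constants, then Gronwall applied to \<open>exp (l * t) * norm (\<eta> t)\<close>.\<close>

lemma perturbed_linear_decay:
  fixes \<eta> :: "real \<Rightarrow> real^'m" and A :: "real^'m^'m"
  assumes d: "\<And>t. T \<le> t \<Longrightarrow> (\<eta> has_vector_derivative (A + B t) *v \<eta> t + \<phi> t) (at t within {T..})"
    and cB: "continuous_on {T..} B" and c\<phi>: "continuous_on {T..} \<phi>"
    and E: "\<And>t. 0 \<le> t \<Longrightarrow> norm (mexp A t) \<le> C * exp (- l' * t)"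
    and B: "\<And>t. T \<le> t \<Longrightarrow> norm (B t) \<le> C1 * exp (- k * t)"
    and \<phi>: "\<And>t. T \<le> t \<Longrightarrow> norm (\<phi> t) \<le> C2 * exp (- l * t)"
    and l: "l < l'" and k: "0 < k"
  shows "\<exists>C3. \<forall>t\<ge>T. norm (\<eta> t) \<le> C3 * exp (- l * t)"
proof -
  have C: "0 \<le> C" using order_trans[OF norm_ge_zero E[of 0]] by simp
  have C1: "0 \<le> C1" using order_trans[OF norm_ge_zero B[of T]] by (simp add: zero_le_mult_iff)
  have C2: "0 \<le> C2" using order_trans[OF norm_ge_zero \<phi>[of T]] by (simp add: zero_le_mult_iff)
  have c\<eta>: "continuous_on {T..} \<eta>" by (rule continuous_on_Ici_derivative[OF d])
  define m where "m t = exp (l * t) * norm (\<eta> t)" for t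
  \<comment> \<open>The part of the bound on exp (l t) norm (\<eta> t) that does not contain the
    unknown: the first summand comes from the value at \<open>T\<close>, the second from the forcing
    term, whose integral contributes 1 / (l' - l).\<close>
  define K where "K = C * exp (l' * T) * norm (\<eta> T) * exp ((l - l') * T) + C * C2 / (l' - l)"
  have cm: "continuous_on {T..} m" unfolding m_def by (intro continuous_intros c\<eta>)
  have mle: "m t \<le> K + integral {T..t} (\<lambda>s. (C * C1 * exp (- k * s)) * m s)" if t: "T \<le> t" for t
  proof -
    define y where "y s = mexp A (t - s) *v \<eta> s" for s
    have dy: "(y has_vector_derivative mexp A (t - s) *v (B s *v \<eta> s + \<phi> s)) (at s within {T..})"
      if s: "T \<le> s" for s
    proof -
      have u: "((\<lambda>s. t - s) has_real_derivative -1) (at s within {T..})" by (auto intro!: derivative_eq_intros)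
      from has_vector_derivative_mult_mv[OF mexp_has_vector_derivative_right_compose[OF u, of A] d[OF s]]
      show ?thesis unfolding y_def by (simp add: matrix_bilinear matrix_vector_mul_assoc)
    qed
    have i: "((\<lambda>s. mexp A (t - s) *v (B s *v \<eta> s + \<phi> s)) has_integral (y t - y T)) {T..t}"
      by (rule Ici_FTC[OF dy order_refl t])
    let ?b = "\<lambda>s. C * C1 * exp (- l * t) * exp (- k * s) * m s + C * C2 * exp (- l' * t) * exp ((l' - l) * s)"
    have ib: "?b integrable_on {T..t}"
      by (intro integrable_continuous_real continuous_intros continuous_on_subset[OF cm]) auto
    have "norm (y t - y T) \<le> integral {T..t} ?b"
      unfolding integral_unique[OF i, symmetric]
    proof (rule integral_norm_bound_integral[OF _ ib])
      fix s assume s: "s \<in> {T..t}"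
      then have sT: "T \<le> s" "0 \<le> t - s" by auto
      have "norm (mexp A (t - s) *v (B s *v \<eta> s + \<phi> s)) \<le> norm (mexp A (t - s)) * norm (B s *v \<eta> s + \<phi> s)"
        by (rule norm_matrix_vector_mult_le)
      also have "\<dots> \<le> (C * exp (- l' * (t - s))) * (C1 * exp (- k * s) * norm (\<eta> s) + C2 * exp (- l * s))"
        using C by (intro mult_mono E sT norm_triangle_le add_mono \<phi> order_trans[OF norm_matrix_vector_mult_le]
            mult_right_mono B) auto
      also have "\<dots> = C * C1 * (exp (- l' * (t - s)) * exp (- l * s)) * exp (- k * s) * m s
          + C * C2 * (exp (- l' * (t - s)) * exp (- l * s))"
        by (simp add: m_def algebra_simps exp_minus[of "l * s"])
      also have "exp (- l' * (t - s)) * exp (- l * s) = exp (- l' * t) * exp ((l' - l) * s)"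
        by (simp add: exp_add[symmetric] algebra_simps)
      also have "C * C1 * (exp (- l' * t) * exp ((l' - l) * s)) * exp (- k * s) * m s
          \<le> C * C1 * exp (- l * t) * exp (- k * s) * m s"
      proof (intro mult_right_mono mult_left_mono)
        have "(l' - l) * s \<le> (l' - l) * t" using s l by (intro mult_left_mono) auto
        then show "exp (- l' * t) * exp ((l' - l) * s) \<le> exp (- l * t)"
          by (simp add: exp_add[symmetric] algebra_simps)
      qed (use C C1 in \<open>auto simp: m_def\<close>)
      finally show "norm (mexp A (t - s) *v (B s *v \<eta> s + \<phi> s)) \<le> ?b s"
        by (simp add: mult_ac)
    qed (use i in auto)
    also have "\<dots> = exp (- l * t) * integral {T..t} (\<lambda>s. (C * C1 * exp (- k * s)) * m s)
        + C * C2 * exp (- l' * t) * integral {T..t} (\<lambda>s. exp ((l' - l) * s))"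
    proof -
      have "integral {T..t} ?b = integral {T..t} (\<lambda>s. exp (- l * t) * ((C * C1 * exp (- k * s)) * m s))
          + integral {T..t} (\<lambda>s. (C * C2 * exp (- l' * t)) * exp ((l' - l) * s))"
        by (subst integral_add[symmetric])
          (auto intro!: integrable_continuous_real continuous_intros continuous_on_subset[OF cm] simp: mult_ac)
      then show ?thesis by (simp only: integral_mult_right)
    qed
    also have "integral {T..t} (\<lambda>s. exp ((l' - l) * s)) \<le> exp ((l' - l) * t) / (l' - l)"
    proof -
      have "((\<lambda>s. exp ((l' - l) * s)) has_integral (exp ((l' - l) * t) / (l' - l) - exp ((l' - l) * T) / (l' - l))) {T..t}"
        by (rule fundamental_theorem_of_calculus[OF t])
          (use l in \<open>auto intro!: derivative_eq_intros simp: has_real_derivative_iff_has_vector_derivative[symmetric]\<close>)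
      then show ?thesis using l by (simp add: integral_unique)
    qed
    finally have n1: "norm (y t - y T) \<le> exp (- l * t) * integral {T..t} (\<lambda>s. (C * C1 * exp (- k * s)) * m s)
        + C * C2 * exp (- l' * t) * (exp ((l' - l) * t) / (l' - l))"
      using C C2 by (auto simp: mult_left_mono)
    have yt: "y t = \<eta> t" by (simp add: y_def)
    have "norm (y T) \<le> (C * exp (- l' * (t - T))) * norm (\<eta> T)"
      unfolding y_def using t by (intro order_trans[OF norm_matrix_vector_mult_le] mult_right_mono E) auto
    then have "norm (\<eta> t) \<le> (C * exp (- l' * (t - T))) * norm (\<eta> T) + (exp (- l * t) * integral {T..t} (\<lambda>s. (C * C1 * exp (- k * s)) * m s)
        + C * C2 * exp (- l' * t) * (exp ((l' - l) * t) / (l' - l)))"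
      using n1 norm_triangle_sub[of "y t" "y T"] unfolding yt by linarith
    then have "exp (l * t) * norm (\<eta> t) \<le> exp (l * t) * ((C * exp (- l' * (t - T))) * norm (\<eta> T) + (exp (- l * t) * integral {T..t} (\<lambda>s. (C * C1 * exp (- k * s)) * m s)
        + C * C2 * exp (- l' * t) * (exp ((l' - l) * t) / (l' - l))))"
      by (rule mult_left_mono) simp
    then have "m t \<le> exp (l * t) * ((C * exp (- l' * (t - T))) * norm (\<eta> T) + (exp (- l * t) * integral {T..t} (\<lambda>s. (C * C1 * exp (- k * s)) * m s)
        + C * C2 * exp (- l' * t) * (exp ((l' - l) * t) / (l' - l))))" by (simp add: m_def)
    also have "\<dots> = C * (exp (l * t) * exp (- l' * (t - T))) * norm (\<eta> T)
       + (exp (l * t) * exp (- l * t)) * integral {T..t} (\<lambda>s. (C * C1 * exp (- k * s)) * m s)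
       + C * C2 * (exp (l * t) * exp (- l' * t) * exp ((l' - l) * t)) / (l' - l)"
      by (simp only: distrib_left mult_ac times_divide_eq_right add.assoc)
    also have "exp (l * t) * exp (- l * t) = 1" by (simp add: exp_add[symmetric])
    also have "exp (l * t) * exp (- l' * t) * exp ((l' - l) * t) = 1"
      by (simp add: exp_add[symmetric] algebra_simps)
    also have "exp (l * t) * exp (- l' * (t - T)) = exp (l' * T) * exp ((l - l') * t)"
      by (simp add: exp_add[symmetric] algebra_simps)
    also have "C * (exp (l' * T) * exp ((l - l') * t)) * norm (\<eta> T)
        \<le> C * (exp (l' * T) * exp ((l - l') * T)) * norm (\<eta> T)"
      using l t C by (intro mult_right_mono mult_left_mono) auto
    finally show ?thesis by (simp add: K_def algebra_simps)
  qed
  have bd: "integral {T..t} (\<lambda>s. C * C1 * exp (- k * s)) \<le> C * C1 * exp (- k * T) / k" if t: "T \<le> t" for t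
  proof -
    have "((\<lambda>s. C * C1 * exp (- k * s)) has_integral (C * C1 * (- exp (- k * t) / k) - C * C1 * (- exp (- k * T) / k))) {T..t}"
      by (rule fundamental_theorem_of_calculus[OF t])
        (use k in \<open>auto intro!: derivative_eq_intros simp: has_real_derivative_iff_has_vector_derivative[symmetric]\<close>)
    then have "integral {T..t} (\<lambda>s. C * C1 * exp (- k * s)) = (C * C1 * (- exp (- k * t) / k) - C * C1 * (- exp (- k * T) / k))"
      by (rule integral_unique)
    also have "\<dots> \<le> C * C1 * exp (- k * T) / k" using C C1 k by simp
    finally show ?thesis .
  qed
  have K0: "0 \<le> K" unfolding K_def using C C2 l by simp
  have "m t \<le> K * exp (C * C1 * exp (- k * T) / k)" if t: "T \<le> t" for t
  proof -
    have "m t \<le> K * exp (integral {T..t} (\<lambda>s. C * C1 * exp (- k * s)))"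
      by (rule gronwall[OF cm _ _ mle t]) (use C C1 in \<open>auto intro!: continuous_intros\<close>)
    also have "\<dots> \<le> K * exp (C * C1 * exp (- k * T) / k)"
      using bd[OF t] K0 by (intro mult_left_mono) auto
    finally show ?thesis .
  qed
  moreover have "norm (\<eta> t) = m t * exp (- l * t)" for t
    by (simp add: m_def exp_minus)
  ultimately have "\<forall>t\<ge>T. norm (\<eta> t) \<le> K * exp (C * C1 * exp (- k * T) / k) * exp (- l * t)"
    by (simp add: mult_right_mono)
  then show ?thesis by blast
qed

section \<open>The Riccati equation\<close>

lemma inner_matrix_left: "(A *v x) \<bullet> y = x \<bullet> (transpose A *v (y :: real^'m))" for A :: "real^'n^'m"
  by (metis dot_lmul_matrix inner_commute transpose_matrix_vector)

lemma inner_matrix_right: "x \<bullet> (A *v y) = (transpose A *v x) \<bullet> (y :: real^'n)" for A :: "real^'n^'m"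
  by (metis inner_matrix_left transpose_transpose)

lemma transpose_bilinear:
  "transpose (A + B) = transpose A + transpose (B :: real^'n^'m)"
  "transpose (A - B) = transpose A - transpose B"
  "transpose (- A) = - transpose A"
  "transpose (c *\<^sub>R A) = c *\<^sub>R transpose A"
  by (simp_all add: transpose_def vec_eq_iff)

lemma norm_le_columns: "norm (M :: real^'n^'m) \<le> (\<Sum>j\<in>UNIV. norm (M *v axis j 1))"
proof -
  have "transpose M $ j = M *v axis j 1" for j
    by (simp add: vec_eq_iff transpose_def matrix_vector_mult_def axis_def if_distrib cong: if_cong)
  then show ?thesis using norm_vec_le_sum[of "transpose M"] by simp
qed

lemma norm_matrix_leI:
  assumes "\<And>x. norm (M *v x) \<le> C * norm x" shows "norm (M :: real^'n^'m) \<le> real CARD('n) * C"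
proof -
  have "(\<Sum>j\<in>UNIV. norm (M *v axis j 1)) \<le> (\<Sum>j\<in>(UNIV::'n set). C * norm (axis j (1::real) :: real^'n))"
    by (intro sum_mono assms)
  then show ?thesis using norm_le_columns[of M] by simp
qed

lemma power2_cancel: "n\<^sup>2 * n\<^sup>2 \<le> n\<^sup>2 * z \<Longrightarrow> n \<noteq> 0 \<Longrightarrow> n\<^sup>2 \<le> (z::real)"
  by (metis mult_le_cancel_left_pos zero_less_power2)

lemma quadratic_discriminant:
  fixes p q r :: real
  assumes e: "\<And>s. 0 \<le> p + 2 * s * q + s\<^sup>2 * r" and r0: "0 \<le> r"
  shows "q\<^sup>2 \<le> p * r"
proof (cases "r = 0")
  case True
  have "q = 0"
  proof (rule ccontr)
    assume "q \<noteq> 0"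
    \<comment> \<open>For r = 0 the expression is affine in s, and at this s its value is
      -1.\<close>
    then show False using e[of "- (p + 1) / (2 * q)"] True by (simp add: field_simps)
  qed
  then show ?thesis using True by simp
next
  case False
  then have "r > 0" using r0 by simp
  have "0 \<le> p + 2 * (- q / r) * q + (- q / r)\<^sup>2 * r" by (rule e)
  also have "\<dots> = p - q\<^sup>2 / r" using \<open>r > 0\<close> by (simp add: power2_eq_square field_simps)
  finally show "q\<^sup>2 \<le> p * r" using \<open>r > 0\<close> by (simp add: field_simps)
qed

lemma psd_cauchy_schwarz:
  fixes G :: "real^'m^'m"
  assumes sym: "transpose G = G" and nn: "\<And>x. 0 \<le> x \<bullet> (G *v x)"
  shows "(x \<bullet> (G *v y))\<^sup>2 \<le> (x \<bullet> (G *v x)) * (y \<bullet> (G *v y))"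
proof -
  define p q r where "p = x \<bullet> (G *v x)" and "q = x \<bullet> (G *v y)" and "r = y \<bullet> (G *v y)"
  have q': "y \<bullet> (G *v x) = q" unfolding q_def by (metis inner_commute inner_matrix_left sym)
  have e: "0 \<le> p + 2 * s * q + s\<^sup>2 * r" for s
  proof -
    have "(x + s *\<^sub>R y) \<bullet> (G *v (x + s *\<^sub>R y)) = p + 2 * s * q + s\<^sup>2 * r"
      using q' by (simp add: matrix_bilinear inner_add_left inner_add_right p_def q_def r_def power2_eq_square algebra_simps)
    then show ?thesis using nn[of "x + s *\<^sub>R y"] by simp
  qed
  have "0 \<le> r" using nn r_def by simp
  from quadratic_discriminant[OF e this] show ?thesis by (simp add: p_def q_def r_def)
qed

text \<open>Expand the form at x + s y and divide by s. The weight s will be chosen with (1 + s)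
  \<theta> < 1, so that the second term can be absorbed.\<close>

lemma psd_young:
  fixes G :: "real^'m^'m"
  assumes sym: "transpose G = G" and nn: "\<And>x. 0 \<le> x \<bullet> (G *v x)" and s: "s > 0"
  shows "(x - y) \<bullet> (G *v (x - y)) \<le> (1 + 1/s) * (x \<bullet> (G *v x)) + (1 + s) * (y \<bullet> (G *v y))"
proof -
  have q': "y \<bullet> (G *v x) = x \<bullet> (G *v y)" by (metis inner_commute inner_matrix_left sym)
  have "0 \<le> (x + s *\<^sub>R y) \<bullet> (G *v (x + s *\<^sub>R y)) / s" using nn s by simp
  also have "\<dots> = (x \<bullet> (G *v x)) / s + 2 * (x \<bullet> (G *v y)) + s * (y \<bullet> (G *v y))"
    using s by (simp add: matrix_bilinear inner_add_left inner_add_right q' field_simps power2_eq_square)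
  finally show ?thesis
    by (simp add: matrix_bilinear inner_diff_left inner_diff_right q' algebra_simps)
qed

text \<open>Everything follows from N s - N t = - N s (M s - M t) N t. The bound on \<open>N\<close>
  first makes \<open>N\<close> continuous at t; after division by s - t the same identity gives the
  derivative.\<close>

lemma matrix_inv_has_vector_derivative:
  fixes M :: "real \<Rightarrow> real^'m^'m"
  assumes M: "(M has_vector_derivative M') (at t within S)" and t: "t \<in> S"
    and inv: "\<And>s. s \<in> S \<Longrightarrow> N s ** M s = mat 1" "\<And>s. s \<in> S \<Longrightarrow> M s ** N s = mat 1"
    and b: "\<And>s. s \<in> S \<Longrightarrow> norm (N s) \<le> C"
  shows "(N has_vector_derivative - (N t ** M' ** N t)) (at t within S)"
proof -
  have diff: "N s - N t = - (N s ** (M s - M t) ** N t)" if "s \<in> S" for s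
    using inv(1)[OF that] inv(2)[OF t]
    by (simp add: matrix_bilinear matrix_mul_assoc[symmetric])
  have C: "0 \<le> C" using b[OF t] norm_ge_zero order_trans by blast
  have tM: "(M \<longlongrightarrow> M t) (at t within S)"
    using has_vector_derivative_continuous[OF M] by (simp add: continuous_within)
  have tN: "(N \<longlongrightarrow> N t) (at t within S)"
  proof (rule Lim_null[THEN iffD2], rule Lim_null_comparison)
    show "\<forall>\<^sub>F s in at t within S. norm (N s - N t) \<le> C * norm (M s - M t) * norm (N t)"
      unfolding eventually_at_filter
    proof (rule always_eventually, intro allI impI)
      fix s assume s: "s \<in> S"
      have "norm (N s - N t) \<le> norm (N s ** (M s - M t)) * norm (N t)"
        unfolding diff[OF s] norm_minus_cancel by (rule norm_matrix_mult_le)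
      also have "\<dots> \<le> (C * norm (M s - M t)) * norm (N t)"
        by (intro mult_right_mono order_trans[OF norm_matrix_mult_le] b s) auto
      finally show "norm (N s - N t) \<le> C * norm (M s - M t) * norm (N t)" .
    qed
    show "((\<lambda>s. C * norm (M s - M t) * norm (N t)) \<longlongrightarrow> 0) (at t within S)"
      using tM by (auto intro!: tendsto_eq_intros)
  qed
  have q: "(f has_vector_derivative f') (at t within S) \<longleftrightarrow>
      ((\<lambda>s. (f s - f t) /\<^sub>R (s - t)) \<longlongrightarrow> f') (at t within S)" for f :: "real \<Rightarrow> real^'m^'m" and f'
  proof -
    have "((\<lambda>s. norm (f s - f t - (s - t) *\<^sub>R f') / norm (s - t)) \<longlongrightarrow> 0) (at t within S)
       \<longleftrightarrow> ((\<lambda>s. (f s - f t) /\<^sub>R (s - t) - f') \<longlongrightarrow> 0) (at t within S)"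
      unfolding tendsto_norm_zero_iff[symmetric, of "\<lambda>s. (f s - f t) /\<^sub>R (s - t) - f'"]
    proof (rule tendsto_cong)
      show "\<forall>\<^sub>F s in at t within S. norm (f s - f t - (s - t) *\<^sub>R f') / norm (s - t)
          = norm ((f s - f t) /\<^sub>R (s - t) - f')"
        unfolding eventually_at_filter
      proof (rule always_eventually, intro allI impI)
        fix s assume "s \<noteq> t"
        then have "(f s - f t) /\<^sub>R (s - t) - f' = (f s - f t - (s - t) *\<^sub>R f') /\<^sub>R (s - t)"
          by (simp add: scaleR_diff_right)
        then show "norm (f s - f t - (s - t) *\<^sub>R f') / norm (s - t) = norm ((f s - f t) /\<^sub>R (s - t) - f')"
          by (simp add: divide_inverse mult.commute)
      qed
    qed
    then show ?thesis
      unfolding has_vector_derivative_def has_derivative_within_singleton_iff has_derivative_iff_norm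
      by (simp add: bounded_linear_scaleR_left Lim_null[of _ f'])
  qed
  have "((\<lambda>s. - (N s ** ((M s - M t) /\<^sub>R (s - t)) ** N t)) \<longlongrightarrow> - (N t ** M' ** N t)) (at t within S)"
    using M[unfolded q] tN
    by (intro tendsto_minus bounded_bilinear.tendsto[OF bounded_bilinear_matrix_mult] tendsto_const)
  then show ?thesis unfolding q
  proof (rule Lim_transform_eventually)
    show "\<forall>\<^sub>F s in at t within S. - (N s ** ((M s - M t) /\<^sub>R (s - t)) ** N t) = (N s - N t) /\<^sub>R (s - t)"
      unfolding eventually_at_filter by (rule always_eventually) (simp add: diff scaleR_matrix_mult)
  qed
qed

section \<open>The steady state: definiteness of \<gamma> and stability of the closed loop\<close>

locale steady_filter =
  fixes a :: "real^'m^'m" and h :: "real^'m^'n" and \<gamma> :: "real^'m^'m"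
  assumes gsym: "sym_nonneg \<gamma>" and gric: "riccati a h \<gamma> = 0"
begin

definition A :: "real^'m^'m" where "A = a - \<gamma> ** transpose h ** h"

definition hh :: "real^'m^'m" where "hh = transpose h ** h"

abbreviation E :: "real \<Rightarrow> real^'m^'m" where "E \<equiv> mexp A"

lemma transpose_gamma [simp]: "transpose \<gamma> = \<gamma>" and gamma_nonneg: "0 \<le> x \<bullet> (\<gamma> *v x)"
  using gsym by (auto simp: sym_nonneg_def)

lemma transpose_hh [simp]: "transpose hh = hh"
  by (simp add: hh_def matrix_transpose_mul)

lemma inner_hh: "x \<bullet> (hh *v y) = (h *v x) \<bullet> (h *v y)"
  by (simp add: hh_def matrix_vector_mul_assoc[symmetric] inner_matrix_left)

lemma riccati_eq: "riccati a h P = P ** transpose a + a ** P + mat 1 - P ** hh ** P"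
  by (simp add: riccati_def hh_def matrix_mul_assoc)

lemma A_eq: "A = a - \<gamma> ** hh" by (simp add: A_def hh_def matrix_mul_assoc)

lemma transpose_A: "transpose A = transpose a - hh ** \<gamma>"
  by (simp add: A_eq transpose_bilinear matrix_transpose_mul)

lemma lyapunov: "A ** \<gamma> + \<gamma> ** transpose A = - (mat 1 + \<gamma> ** hh ** \<gamma>)"
proof -
  have r: "\<gamma> ** transpose a + a ** \<gamma> + mat 1 - \<gamma> ** hh ** \<gamma> = 0"
    using gric by (simp only: riccati_eq)
  have "A ** \<gamma> + \<gamma> ** transpose A + (mat 1 + \<gamma> ** hh ** \<gamma>)
      = \<gamma> ** transpose a + a ** \<gamma> + mat 1 - \<gamma> ** hh ** \<gamma>"
    unfolding transpose_A unfolding A_eq by (simp add: matrix_bilinear matrix_mul_assoc)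
  then have "A ** \<gamma> + \<gamma> ** transpose A + (mat 1 + \<gamma> ** hh ** \<gamma>) = 0" by (simp only: r)
  then show ?thesis by (simp only: eq_neg_iff_add_eq_0)
qed

text \<open>In the Lyapunov equation, evaluated as a quadratic form at x, every term containing
  \<gamma> vanishes, and only x . x from the unit signal noise is left.\<close>

lemma gamma_kernel: assumes "\<gamma> *v x = 0" shows "x = 0"
proof -
  have "0 = x \<bullet> ((A ** \<gamma> + \<gamma> ** transpose A + (mat 1 + \<gamma> ** hh ** \<gamma>)) *v x)"
    by (simp add: lyapunov)
  also have "\<dots> = x \<bullet> x"
    using assms by (simp add: matrix_bilinear inner_add_right matrix_vector_mul_assoc[symmetric] inner_matrix_right[of x \<gamma>])
  finally show ?thesis by simp
qed

lemma gamma_invertible: "invertible \<gamma>"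
  using gamma_kernel by (auto simp: invertible_left_inverse matrix_left_invertible_ker)

definition gi :: "real^'m^'m" where "gi = matrix_inv \<gamma>"

lemma gi [simp]: "\<gamma> ** gi = mat 1" "gi ** \<gamma> = mat 1"
  using gamma_invertible unfolding gi_def matrix_inv_def invertible_def
  by (rule someI2_ex, simp)+

lemma gi_v [simp]: "\<gamma> *v (gi *v x) = x" "gi *v (\<gamma> *v x) = x"
  by (simp_all add: matrix_vector_mul_assoc)

lemma transpose_gi [simp]: "transpose gi = gi"
proof -
  have "transpose gi ** \<gamma> = mat 1"
    by (metis gi(1) matrix_transpose_mul transpose_gamma transpose_mat)
  then show ?thesis by (metis gi(1) matrix_mul_assoc matrix_mul_lid matrix_mul_rid)
qed

lemma gi_nonneg: "0 \<le> x \<bullet> (gi *v x)"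
  using gamma_nonneg[of "gi *v x"] by (simp add: inner_commute)

text \<open>Cauchy-Schwarz for the form \<gamma> between x and gi x, followed by division by the
  square of the norm of x.\<close>

lemma norm_le_gi: "(norm x)\<^sup>2 \<le> norm \<gamma> * (x \<bullet> (gi *v x))"
proof (cases "x = 0")
  case False
  have "(x \<bullet> (\<gamma> *v (gi *v x)))\<^sup>2 \<le> (x \<bullet> (\<gamma> *v x)) * ((gi *v x) \<bullet> (\<gamma> *v (gi *v x)))"
    by (rule psd_cauchy_schwarz) (simp_all add: gamma_nonneg)
  also have "\<dots> \<le> (norm x * (norm \<gamma> * norm x)) * (x \<bullet> (gi *v x))"
    using gi_nonneg by (auto simp: inner_commute intro!: mult_right_mono order_trans[OF norm_cauchy_schwarz]
        mult_left_mono norm_matrix_vector_mult_le)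
  finally have "(norm x)\<^sup>2 * (norm x)\<^sup>2 \<le> (norm x)\<^sup>2 * (norm \<gamma> * (x \<bullet> (gi *v x)))"
    by (simp add: power2_norm_eq_inner[symmetric] mult_ac power2_eq_square)
  then show ?thesis by (rule power2_cancel) (use False in simp)
qed simp

lemma norm_le_gamma: "(norm x)\<^sup>2 \<le> norm gi * (x \<bullet> (\<gamma> *v x))"
proof (cases "x = 0")
  case False
  have "(x \<bullet> (gi *v (\<gamma> *v x)))\<^sup>2 \<le> (x \<bullet> (gi *v x)) * ((\<gamma> *v x) \<bullet> (gi *v (\<gamma> *v x)))"
    by (rule psd_cauchy_schwarz) (simp_all add: gi_nonneg)
  also have "\<dots> \<le> (norm x * (norm gi * norm x)) * (x \<bullet> (\<gamma> *v x))"
    using gamma_nonneg by (auto simp: inner_commute intro!: mult_right_mono order_trans[OF norm_cauchy_schwarz]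
        mult_left_mono norm_matrix_vector_mult_le)
  finally have "(norm x)\<^sup>2 * (norm x)\<^sup>2 \<le> (norm x)\<^sup>2 * (norm gi * (x \<bullet> (\<gamma> *v x)))"
    by (simp add: power2_norm_eq_inner[symmetric] mult_ac power2_eq_square)
  then show ?thesis by (rule power2_cancel) (use False in simp)
qed simp

lemma norm_gamma_pos: "0 < norm \<gamma>" and norm_gi_pos: "0 < norm gi"
proof -
  have "(mat 1 :: real^'m^'m) \<noteq> 0"
    by (auto simp: vec_eq_iff mat_def intro!: exI[of _ undefined])
  then have "\<gamma> \<noteq> 0" "gi \<noteq> 0"
    using gi(1) by (metis matrix_bilinear(7), metis matrix_bilinear(8))
  then show "0 < norm \<gamma>" "0 < norm gi" by auto
qed

text \<open>The inverse of \<gamma> gives a Lyapunov function for exp (t A): this is the Lyapunov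
  equation evaluated at w = gi v. Of the two squares, the first stems from the signal noise and
  yields decay; the second is the output energy, whose integral is the observability
  Gramian.\<close>

lemma gi_quadratic_derivative:
  "((\<lambda>t. (E t *v x) \<bullet> (gi *v (E t *v x))) has_vector_derivative
     - ((gi *v (E t *v x)) \<bullet> (gi *v (E t *v x)) + (h *v (E t *v x)) \<bullet> (h *v (E t *v x)))) (at t within S)"
proof -
  let ?v = "E t *v x"
  have dv: "((\<lambda>t. E t *v x) has_vector_derivative A *v ?v) (at t within S)"
    using has_vector_derivative_mult_mv[OF mexp_has_vector_derivative_left[of A t S] has_vector_derivative_const[of x]]
    by (simp add: matrix_bilinear matrix_vector_mul_assoc)
  have dw: "((\<lambda>t. gi *v (E t *v x)) has_vector_derivative gi *v (A *v ?v)) (at t within S)"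
    using has_vector_derivative_mult_mv[OF has_vector_derivative_const[of gi] dv] by (simp add: matrix_bilinear)
  define w where "w = gi *v ?v"
  have v: "?v = \<gamma> *v w" by (simp add: w_def)
  have "w \<bullet> ((A ** \<gamma> + \<gamma> ** transpose A) *v w) = - (w \<bullet> w + (h *v (\<gamma> *v w)) \<bullet> (h *v (\<gamma> *v w)))"
    unfolding lyapunov by (simp add: matrix_bilinear inner_add_right inner_diff_right matrix_vector_mul_assoc[symmetric]
        inner_matrix_right[of w \<gamma>] inner_hh)
  moreover have "w \<bullet> ((A ** \<gamma> + \<gamma> ** transpose A) *v w) = 2 * (w \<bullet> (A *v (\<gamma> *v w)))"
    by (simp add: matrix_bilinear inner_add_right matrix_vector_mul_assoc[symmetric]
        inner_matrix_right[of w \<gamma>] inner_matrix_left[of A "\<gamma> *v w" w, symmetric] inner_commute)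
  ultimately have "2 * (w \<bullet> (A *v ?v)) = - (w \<bullet> w + (h *v ?v) \<bullet> (h *v ?v))" by (simp add: v)
  moreover have "?v \<bullet> (gi *v (A *v ?v)) = w \<bullet> (A *v ?v)"
    by (simp add: w_def inner_matrix_right[of ?v gi])
  ultimately show ?thesis
    using bounded_bilinear.has_vector_derivative[OF bounded_bilinear_inner dv dw]
    by (simp add: w_def[symmetric] inner_commute)
qed

lemma gi_decay: assumes "0 \<le> t" shows "(E t *v x) \<bullet> (gi *v (E t *v x)) \<le> exp (- t / norm \<gamma>) * (x \<bullet> (gi *v x))"
proof -
  define g where "g t = (E t *v x) \<bullet> (gi *v (E t *v x))" for t
  define c where "c = 1 / norm \<gamma>"
  define g' where "g' t = - ((gi *v (E t *v x)) \<bullet> (gi *v (E t *v x)) + (h *v (E t *v x)) \<bullet> (h *v (E t *v x)))" for t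
  have dg: "(g has_vector_derivative g' t) (at t within S)" for t S
    unfolding g_def g'_def by (rule gi_quadratic_derivative)
  have d: "((\<lambda>t. - (exp (c * t) * g t)) has_vector_derivative - (exp (c * t) * (c * g t + g' t))) (at t within {0..})" for t
    using dg[of t "{0..}"]
    by (auto intro!: derivative_eq_intros simp: has_real_derivative_iff_has_vector_derivative[symmetric] algebra_simps)
  have n: "c * g t + g' t \<le> 0" for t
  proof -
    let ?w = "gi *v (E t *v x)"
    have "g t = ?w \<bullet> (\<gamma> *v ?w)" by (simp add: g_def inner_commute)
    also have "\<dots> \<le> norm ?w * (norm \<gamma> * norm ?w)"
      by (intro order_trans[OF norm_cauchy_schwarz] mult_left_mono norm_matrix_vector_mult_le) auto
    finally have "c * g t \<le> ?w \<bullet> ?w"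
      using norm_gamma_pos by (simp add: c_def field_simps power2_norm_eq_inner[symmetric] power2_eq_square)
    moreover have "0 \<le> (h *v (E t *v x)) \<bullet> (h *v (E t *v x))" by simp
    ultimately show ?thesis unfolding g'_def by linarith
  qed
  have "- (exp (c * 0) * g 0) \<le> - (exp (c * t) * g t)"
    by (rule Ici_derivative_mono[OF d]) (use n assms in \<open>auto simp: mult_nonneg_nonpos\<close>)
  then have "exp (- c * t) * (exp (c * t) * g t) \<le> exp (- c * t) * g 0"
    by (intro mult_left_mono) auto
  then show ?thesis by (simp add: g_def c_def mult.assoc[symmetric] exp_add[symmetric])
qed

text \<open>The Lyapunov function loses at least the fraction 1 / norm \<gamma> of its value per
  unit time, and taking roots halves this rate; \<open>K\<close> compares it with the Euclidean
  norm. The rate ignores the spectrum but is certainly positive.\<close>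

lemma E_decay_some: "\<exists>l>0. \<exists>C. \<forall>t\<ge>0. norm (E t) \<le> C * exp (- l * t)"
proof -
  define c where "c = 1 / (2 * norm \<gamma>)"
  define K where "K = sqrt (norm \<gamma> * norm gi)"
  have "norm (E t *v x) \<le> (K * exp (- c * t)) * norm x" if t: "0 \<le> t" for t x
  proof (rule power2_le_imp_le)
    have "(norm (E t *v x))\<^sup>2 \<le> norm \<gamma> * ((E t *v x) \<bullet> (gi *v (E t *v x)))" by (rule norm_le_gi)
    also have "\<dots> \<le> norm \<gamma> * (exp (- t / norm \<gamma>) * (norm x * (norm gi * norm x)))"
      by (intro mult_left_mono order_trans[OF gi_decay[OF t]] order_trans[OF norm_cauchy_schwarz]
          norm_matrix_vector_mult_le) auto
    also have "exp (- t / norm \<gamma>) = (exp (- c * t))\<^sup>2"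
      by (simp add: c_def power2_eq_square exp_add[symmetric] field_simps)
    finally show "(norm (E t *v x))\<^sup>2 \<le> ((K * exp (- c * t)) * norm x)\<^sup>2"
      by (simp add: K_def power_mult_distrib power2_eq_square mult_ac)
  qed (simp add: K_def)
  then have "\<forall>t\<ge>0. norm (E t) \<le> (real CARD('m) * K) * exp (- c * t)"
    using norm_matrix_leI by (metis mult.assoc)
  moreover have "c > 0" using norm_gamma_pos by (simp add: c_def)
  ultimately show ?thesis by blast
qed

lemma decay_rate_A: "decay_rate a h \<gamma> = Inf {- Re l | l. eigenvalue A l}"
  by (simp add: decay_rate_def A_def)

text \<open>\<open>l\<close> may be negative, yet a positive \<open>l'\<close> is wanted. The
  midpoint \<open>l1\<close> of \<open>l\<close> and the spectral rate serves if it is at least the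
  Lyapunov rate \<open>l2\<close>; otherwise \<open>l2\<close> itself lies above
  \<open>l\<close>.\<close>

lemma E_decay:
  assumes "l < decay_rate a h \<gamma>"
  shows "\<exists>l'>0. l < l' \<and> (\<exists>C. \<forall>t\<ge>0. norm (E t) \<le> C * exp (- l' * t))"
proof -
  obtain K where K: "\<And>v. norm (cmat A *v v) \<le> norm v * K"
    using bounded_linear.pos_bounded[OF matrix_vector_mul_bounded_linear[of "cmat A"]] by blast
  \<comment> \<open>The infimum of a set of reals is a lower bound only if the set is bounded below;
    here an operator bound of the matrix bounds all eigenvalues.\<close>
  have "bdd_below {- Re l | l. eigenvalue A l}"
  proof (rule bdd_belowI)
    fix y assume "y \<in> {- Re l | l. eigenvalue A l}"
    then obtain r v where r: "y = - Re r" "v \<noteq> 0" "cmat A *v v = r *s v" by (auto simp: eigenvalue_def)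
    then have "cmod r * norm v \<le> norm v * K" using K[of v] by (simp add: norm_complex_smult)
    then have "cmod r \<le> K" using r(2) by (simp add: mult.commute)
    then show "- K \<le> y" using r(1) complex_Re_le_cmod[of r] by simp
  qed
  then have ev: "Re r \<le> - decay_rate a h \<gamma>" if "eigenvalue A r" for r
  proof -
    have "- Re r \<in> {- Re l | l. eigenvalue A l}" using that by blast
    from cInf_lower[OF this \<open>bdd_below _\<close>] show ?thesis unfolding decay_rate_A by simp
  qed
  define l1 where "l1 = (l + decay_rate a h \<gamma>) / 2"
  have l1: "l < l1" "l1 < decay_rate a h \<gamma>" using assms by (auto simp: l1_def)
  have "\<exists>C\<ge>0. \<forall>t\<ge>0. norm (mexp A t) \<le> C * exp (- l1 * t)"
    by (rule mexp_decay) (use ev l1 in force)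
  then obtain C where C: "\<forall>t\<ge>0. norm (E t) \<le> C * exp (- l1 * t)" by blast
  obtain l2 where l2: "l2 > 0" "\<exists>C. \<forall>t\<ge>0. norm (E t) \<le> C * exp (- l2 * t)" using E_decay_some by blast
  show ?thesis
  proof (cases "l2 \<le> l1")
    case True
    then have "0 < l1" using l2(1) by simp
    then show ?thesis using l1(1) C by blast
  next
    case False
    then have "l < l2" using l1(1) by simp
    then show ?thesis using l2 by blast
  qed
qed

subsection \<open>Explicit solutions\<close>

text \<open>The observability Gramian of the steady closed loop.\<close>

definition Ob :: "real \<Rightarrow> real^'m^'m" where
  "Ob t = integral {0..t} (\<lambda>s. transpose (E s) ** hh ** E s)"

lemma continuous_Ob': "continuous_on S (\<lambda>s. transpose (E s) ** hh ** E s)"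
  by (intro continuous_intros)

lemma Ob_derivative: "0 \<le> t \<Longrightarrow> (Ob has_vector_derivative transpose (E t) ** hh ** E t) (at t within {0..})"
  unfolding Ob_def by (rule integral_has_vector_derivative_Ici[OF continuous_Ob'])

lemma Ob_0 [simp]: "Ob 0 = 0" by (simp add: Ob_def)

lemma transpose_Ob: "transpose (Ob t) = Ob t"
proof -
  have "integral {0..t} (transpose \<circ> (\<lambda>s. transpose (E s) ** hh ** E s)) = transpose (Ob t)"
    unfolding Ob_def by (rule integral_linear[OF integrable_continuous_real[OF continuous_Ob'] bounded_linear_transpose])
  then show ?thesis by (simp add: Ob_def o_def matrix_transpose_mul matrix_mul_assoc)
qed

lemma Ob_quadratic_derivative:
  assumes "0 \<le> t"
  shows "((\<lambda>t. x \<bullet> (Ob t *v x)) has_vector_derivative (h *v (E t *v x)) \<bullet> (h *v (E t *v x))) (at t within {0..})"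
proof -
  have "((\<lambda>t. x \<bullet> (Ob t *v x)) has_vector_derivative x \<bullet> ((transpose (E t) ** hh ** E t) *v x)) (at t within {0..})"
    using has_vector_derivative_mult_mv[OF Ob_derivative[OF assms] has_vector_derivative_const[of x]]
    by (auto intro!: bounded_linear.has_vector_derivative[OF bounded_linear_inner_right] simp: matrix_bilinear)
  then show ?thesis
    by (simp add: matrix_vector_mul_assoc[symmetric] inner_matrix_right[of x "transpose (E t)"] inner_hh)
qed

lemma Ob_nonneg: "0 \<le> t \<Longrightarrow> 0 \<le> x \<bullet> (Ob t *v x)"
  using Ici_derivative_mono[OF Ob_quadratic_derivative[of _ x] _ order_refl, of t] by (simp add: matrix_bilinear)

text \<open>With c the square of norm h times norm \<gamma>, the output energy is at most c times
  the other dissipation term, so its share of the total is at most c / (c + 1). The slightly larger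
  (c + 1) / (c + 2) stays positive also for h = 0, and \<theta> will occur in a denominator.\<close>

definition \<theta> :: real where
  "\<theta> = ((norm h * norm \<gamma>)\<^sup>2 + 1) / ((norm h * norm \<gamma>)\<^sup>2 + 2)"

lemma theta: "0 < \<theta>" "\<theta> < 1"
  by (simp_all add: \<theta>_def add_nonneg_pos)

text \<open>Integrate \<open>pq\<close> along the orbit: the output energy is at most \<theta> times
  the loss of the Lyapunov function, which starts at x . gi x and stays nonnegative.\<close>

lemma Ob_le: assumes t: "0 \<le> t" shows "x \<bullet> (Ob t *v x) \<le> \<theta> * (x \<bullet> (gi *v x))"
proof -
  define g where "g t = (E t *v x) \<bullet> (gi *v (E t *v x))" for t
  define p where "p t = (gi *v (E t *v x)) \<bullet> (gi *v (E t *v x))" for t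
  define q where "q t = (h *v (E t *v x)) \<bullet> (h *v (E t *v x))" for t
  have pq: "q t \<le> \<theta> * (p t + q t)" for t
  proof -
    define c where "c = (norm h * norm \<gamma>)\<^sup>2"
    let ?w = "gi *v (E t *v x)"
    have "norm (h *v (\<gamma> *v ?w)) \<le> norm h * (norm \<gamma> * norm ?w)"
      by (intro order_trans[OF norm_matrix_vector_mult_le] mult_left_mono norm_matrix_vector_mult_le) auto
    then have "(norm (h *v (\<gamma> *v ?w)))\<^sup>2 \<le> (norm h * (norm \<gamma> * norm ?w))\<^sup>2" by (intro power_mono) auto
    then have "q t \<le> c * p t"
      by (simp add: p_def q_def c_def power2_norm_eq_inner[symmetric] power_mult_distrib mult.assoc)
    moreover have "0 \<le> p t" "0 \<le> q t" "0 \<le> c" by (auto simp: p_def q_def c_def)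
    ultimately have "q t \<le> c * p t + p t" by simp
    moreover have "q t * (c + 2) \<le> (c + 1) * (p t + q t) \<longleftrightarrow> q t \<le> c * p t + p t" by (simp add: algebra_simps)
    ultimately show ?thesis using \<open>0 \<le> c\<close> unfolding \<theta>_def c_def[symmetric] by (simp add: pos_le_divide_eq)
  qed
  have d: "((\<lambda>t. - \<theta> * g t - x \<bullet> (Ob t *v x)) has_vector_derivative - \<theta> * (- (p t + q t)) - q t) (at t within {0..})"
    if "0 \<le> t" for t
    unfolding g_def p_def q_def
    by (intro has_vector_derivative_diff Ob_quadratic_derivative that
        has_vector_derivative_mult_right gi_quadratic_derivative)
  have "- \<theta> * g 0 - x \<bullet> (Ob 0 *v x) \<le> - \<theta> * g t - x \<bullet> (Ob t *v x)"
    by (rule Ici_derivative_mono[OF d]) (use pq t in \<open>auto simp: algebra_simps\<close>)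
  moreover have "0 \<le> \<theta> * g t" using theta gi_nonneg by (simp add: g_def)
  ultimately show ?thesis by (simp add: g_def matrix_bilinear)
qed

text \<open>\<Delta> is the offset of an initial covariance from \<gamma>; it is the sum \<gamma> +
  \<Delta> that is nonnegative, while \<Delta> may be indefinite.\<close>

definition admissible :: "real^'m^'m \<Rightarrow> bool" where
  "admissible \<Delta> \<longleftrightarrow> transpose \<Delta> = \<Delta> \<and> (\<forall>x. 0 \<le> x \<bullet> ((\<gamma> + \<Delta>) *v x))"

text \<open>The denominator of the linear fractional solution \<gamma> + E \<Delta> (1 + Ob
  \<Delta>)^(-1) E^T of the Riccati equation.\<close>

definition Mt :: "real^'m^'m \<Rightarrow> real \<Rightarrow> real^'m^'m" where "Mt \<Delta> t = mat 1 + Ob t ** \<Delta>"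

definition Mi :: "real^'m^'m \<Rightarrow> real \<Rightarrow> real^'m^'m" where "Mi \<Delta> t = matrix_inv (Mt \<Delta> t)"

lemma quadratic_absorb:
  fixes n k C :: real
  assumes "n\<^sup>2 \<le> C * (n * k + k\<^sup>2)" "0 \<le> n" "0 \<le> k" "0 \<le> C"
  shows "n \<le> (C + 1) * k"
proof (rule ccontr)
  assume "\<not> n \<le> (C + 1) * k"
  then have d: "0 < n - (C + 1) * k" by simp
  have "0 \<le> (C + 1) * k" using assms by simp
  then have n: "0 < n" using d by linarith
  have "0 \<le> n - C * k" using d assms(3) by (simp add: algebra_simps)
  then have "0 \<le> k * (n - C * k)" using assms(3) by simp
  moreover have "0 < n * (n - (C + 1) * k)" using n d by simp
  moreover have "n\<^sup>2 - C * (n * k + k\<^sup>2) = n * (n - (C + 1) * k) + k * (n - C * k)"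
    by (simp add: algebra_simps power2_eq_square)
  ultimately show False using assms(1) by linarith
qed

text \<open>The uniform invertibility on which all convergence rests. Write x = z - w with z = Mt x,
  y = \<Delta> x, w = Ob y. Nonnegativity of \<gamma> + \<Delta> gives 0 \<le> x . \<gamma> x + z .
  y - y . w, while x . \<gamma> x is at most a multiple of the square of norm z plus (1 + s) w .
  \<gamma> w, and w . \<gamma> w \<le> \<theta> y . w. As (1 + s) \<theta> < 1, the term y . w is
  absorbed, and x . \<gamma> x is bounded by a multiple of norm x norm z + (norm z)^2; definiteness
  of \<gamma> turns this into a bound on norm x.\<close>

lemma Mt_lower:
  assumes "admissible \<Delta>"
  shows "\<exists>C. \<forall>t\<ge>0. \<forall>x. norm x \<le> C * norm (Mt \<Delta> t *v x)"
proof -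
  \<comment> \<open>Chosen so that (1 + s) \<theta> is \<open>q\<close>, the midpoint of \<theta>
    and 1.\<close>
  define s where "s = (1 - \<theta>) / (2 * \<theta>)"
  define q where "q = (1 + \<theta>) / 2"
  have s: "0 < s" "(1 + s) * \<theta> = q" using theta by (auto simp: s_def q_def field_simps)
  have q: "0 < q" "q < 1" using theta by (auto simp: q_def)
  define c where "c = (1 + 1 / s) * norm \<gamma>"
  define d where "d = norm \<Delta>"
  have cd: "0 \<le> c" "0 \<le> d" using s by (auto simp: c_def d_def)
  define c' where "c' = c + (c + d) / (1 - q)"
  have c': "0 \<le> c'" using cd q by (simp add: c'_def)
  have "norm x \<le> (norm gi * c' + 1) * norm (Mt \<Delta> t *v x)" if t: "0 \<le> t" for t x
  proof -
    define y where "y = \<Delta> *v x"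
    define w where "w = Ob t *v y"
    define z where "z = Mt \<Delta> t *v x"
    define ob where "ob = y \<bullet> w"
    have x: "x = z - w" by (simp add: z_def w_def y_def Mt_def matrix_bilinear matrix_vector_mul_assoc)
    have ob0: "0 \<le> ob" unfolding ob_def w_def by (rule Ob_nonneg[OF t])
    have 1: "0 \<le> x \<bullet> (\<gamma> *v x) + x \<bullet> y"
      using assms by (simp add: admissible_def y_def matrix_bilinear inner_add_right)
    have 2: "x \<bullet> y = z \<bullet> y - ob" unfolding ob_def by (subst x) (simp add: inner_diff_left inner_diff_right inner_commute)
    have "z \<bullet> (\<gamma> *v z) \<le> norm z * (norm \<gamma> * norm z)"
      by (intro order_trans[OF norm_cauchy_schwarz] mult_left_mono norm_matrix_vector_mult_le) auto
    then have "(1 + 1 / s) * (z \<bullet> (\<gamma> *v z)) \<le> (1 + 1 / s) * (norm z * (norm \<gamma> * norm z))"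
      using s by (intro mult_left_mono) auto
    also have "\<dots> = c * (norm z)\<^sup>2" by (simp add: c_def power2_eq_square mult_ac)
    finally have 3: "x \<bullet> (\<gamma> *v x) \<le> c * (norm z)\<^sup>2 + (1 + s) * (w \<bullet> (\<gamma> *v w))"
      using psd_young[OF transpose_gamma gamma_nonneg s(1), of z w] x by simp
    \<comment> \<open>Cauchy-Schwarz for the form \<open>Ob t\<close> between \<gamma> w and y,
      together with Ob \<le> \<theta> gi at the vector \<gamma> w; one factor w . \<gamma> w
      cancels.\<close>
    have 4: "w \<bullet> (\<gamma> *v w) \<le> \<theta> * ob"
    proof (cases "w \<bullet> (\<gamma> *v w) = 0")
      case True
      then show ?thesis using theta ob0 by simp
    next
      case False
      let ?v = "\<gamma> *v w"
      have "(?v \<bullet> (Ob t *v y))\<^sup>2 \<le> (?v \<bullet> (Ob t *v ?v)) * (y \<bullet> (Ob t *v y))"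
        by (rule psd_cauchy_schwarz) (simp_all add: transpose_Ob Ob_nonneg t)
      also have "\<dots> \<le> (\<theta> * (?v \<bullet> (gi *v ?v))) * ob"
        using Ob_le[OF t, of ?v] ob0 by (simp add: w_def[symmetric] ob_def[symmetric] mult_right_mono)
      finally have "(w \<bullet> (\<gamma> *v w)) * (w \<bullet> (\<gamma> *v w)) \<le> (w \<bullet> (\<gamma> *v w)) * (\<theta> * ob)"
        by (simp add: w_def[symmetric] inner_commute power2_eq_square mult_ac)
      moreover have "0 < w \<bullet> (\<gamma> *v w)" using False gamma_nonneg[of w] by simp
      ultimately show ?thesis by simp
    qed
    have "norm y \<le> d * norm x" unfolding y_def d_def by (rule norm_matrix_vector_mult_le)
    then have zy: "z \<bullet> y \<le> d * (norm x * norm z)"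
      by (intro order_trans[OF norm_cauchy_schwarz]) (metis mult.assoc mult.commute mult_left_mono norm_ge_zero)
    have 5: "(1 + s) * (w \<bullet> (\<gamma> *v w)) \<le> q * ob"
    proof -
      have "(1 + s) * (w \<bullet> (\<gamma> *v w)) \<le> (1 + s) * (\<theta> * ob)" using 4 s(1) by (intro mult_left_mono) auto
      then show ?thesis using s(2) by (simp add: mult.assoc[symmetric])
    qed
    have "ob \<le> d * (norm x * norm z) + c * (norm z)\<^sup>2 + q * ob" using 1 2 3 5 zy by linarith
    then have "ob * (1 - q) \<le> d * (norm x * norm z) + c * (norm z)\<^sup>2" by (simp add: algebra_simps)
    also have "\<dots> \<le> (c + d) * (norm x * norm z + (norm z)\<^sup>2)"
      using cd by (simp add: algebra_simps)
    finally have "ob \<le> (c + d) / (1 - q) * (norm x * norm z + (norm z)\<^sup>2)"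
      using q by (simp add: pos_le_divide_eq)
    moreover have "q * ob \<le> 1 * ob" using q ob0 by (intro mult_right_mono) auto
    moreover have "c * (norm z)\<^sup>2 \<le> c * (norm x * norm z + (norm z)\<^sup>2)" using cd by (intro mult_left_mono) auto
    ultimately have "x \<bullet> (\<gamma> *v x) \<le> c' * (norm x * norm z + (norm z)\<^sup>2)"
      using 3 5 unfolding c'_def distrib_right by linarith
    then have "norm gi * (x \<bullet> (\<gamma> *v x)) \<le> norm gi * (c' * (norm x * norm z + (norm z)\<^sup>2))"
      by (intro mult_left_mono) auto
    then have "(norm x)\<^sup>2 \<le> (norm gi * c') * (norm x * norm z + (norm z)\<^sup>2)"
      using norm_le_gamma[of x] by (simp add: mult.assoc)
    then show ?thesis unfolding z_def[symmetric] by (rule quadratic_absorb) (use c' in auto)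
  qed
  then show ?thesis by blast
qed

lemma Mi_inverse:
  assumes "admissible \<Delta>" "0 \<le> t"
  shows "Mt \<Delta> t ** Mi \<Delta> t = mat 1" "Mi \<Delta> t ** Mt \<Delta> t = mat 1"
proof -
  obtain C where C: "\<And>x. norm x \<le> C * norm (Mt \<Delta> t *v x)" using Mt_lower assms by blast
  then have "\<And>x. Mt \<Delta> t *v x = 0 \<Longrightarrow> x = 0" by (metis mult_zero_right norm_le_zero_iff norm_zero)
  then have "invertible (Mt \<Delta> t)" by (auto simp: invertible_left_inverse matrix_left_invertible_ker)
  then have ex: "\<exists>N. Mt \<Delta> t ** N = mat 1 \<and> N ** Mt \<Delta> t = mat 1" by (simp add: invertible_def)
  show "Mt \<Delta> t ** Mi \<Delta> t = mat 1" "Mi \<Delta> t ** Mt \<Delta> t = mat 1"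
    unfolding Mi_def matrix_inv_def by (rule someI2_ex[OF ex], simp)+
qed

lemma Mi_bounded:
  assumes "admissible \<Delta>" shows "\<exists>C. \<forall>t\<ge>0. norm (Mi \<Delta> t) \<le> C"
proof -
  obtain C where C: "\<And>t x. 0 \<le> t \<Longrightarrow> norm x \<le> C * norm (Mt \<Delta> t *v x)" using Mt_lower assms by blast
  have "norm (Mi \<Delta> t *v x) \<le> C * norm x" if "0 \<le> t" for t x
    using C[OF that, of "Mi \<Delta> t *v x"] by (simp add: matrix_vector_mul_assoc Mi_inverse assms that)
  then have "\<forall>t\<ge>0. norm (Mi \<Delta> t) \<le> real CARD('m) * C" by (auto intro: norm_matrix_leI)
  then show ?thesis by blast
qed

lemma Mt_derivative:
  "0 \<le> t \<Longrightarrow> (Mt \<Delta> has_vector_derivative (transpose (E t) ** hh ** E t) ** \<Delta>) (at t within {0..})"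
  unfolding Mt_def
  using has_vector_derivative_add[OF has_vector_derivative_const[of "mat 1"]
    has_vector_derivative_mult_mm[OF Ob_derivative[of t] has_vector_derivative_const[of \<Delta>]]]
  by (simp add: matrix_bilinear)

lemma Mi_derivative:
  assumes "admissible \<Delta>" "0 \<le> t"
  shows "(Mi \<Delta> has_vector_derivative - (Mi \<Delta> t ** ((transpose (E t) ** hh ** E t) ** \<Delta>) ** Mi \<Delta> t)) (at t within {0..})"
proof -
  obtain C where "\<And>t. 0 \<le> t \<Longrightarrow> norm (Mi \<Delta> t) \<le> C" using Mi_bounded assms by blast
  then show ?thesis
    by (intro matrix_inv_has_vector_derivative[OF Mt_derivative])
      (use assms in \<open>auto simp: Mi_inverse\<close>)
qed

definition Dt :: "real^'m^'m \<Rightarrow> real \<Rightarrow> real^'m^'m" where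
  "Dt \<Delta> t = E t ** \<Delta> ** Mi \<Delta> t ** transpose (E t)"

definition Pt :: "real^'m^'m \<Rightarrow> real \<Rightarrow> real^'m^'m" where "Pt \<Delta> t = \<gamma> + Dt \<Delta> t"

lemma Mi_0: "Mi \<Delta> 0 = mat 1"
  unfolding Mi_def matrix_inv_def by (rule some_equality) (auto simp: Mt_def matrix_bilinear)

lemma Pt_0: "Pt \<Delta> 0 = \<gamma> + \<Delta>"
  by (simp add: Pt_def Dt_def Mi_0)

text \<open>The push-through identity \<Delta> (1 + Ob \<Delta>) = (1 + \<Delta> Ob) \<Delta>,
  multiplied by the inverses on both sides; it makes \<open>Dt\<close> symmetric.\<close>

lemma Delta_Mi: assumes "admissible \<Delta>" "0 \<le> t" shows "transpose (Mi \<Delta> t) ** \<Delta> = \<Delta> ** Mi \<Delta> t"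
proof -
  have s: "transpose \<Delta> = \<Delta>" using assms by (simp add: admissible_def)
  have "transpose (Mt \<Delta> t) ** \<Delta> = \<Delta> ** Mt \<Delta> t"
    by (simp add: Mt_def transpose_bilinear matrix_transpose_mul transpose_Ob s matrix_bilinear matrix_mul_assoc)
  then have "transpose (Mi \<Delta> t) ** (transpose (Mt \<Delta> t) ** \<Delta>) ** Mi \<Delta> t
      = transpose (Mi \<Delta> t) ** (\<Delta> ** Mt \<Delta> t) ** Mi \<Delta> t" by simp
  moreover have "transpose (Mi \<Delta> t) ** transpose (Mt \<Delta> t) = mat 1"
    by (metis Mi_inverse(1) assms matrix_transpose_mul transpose_mat)
  moreover have "transpose (Mi \<Delta> t) ** (transpose (Mt \<Delta> t) ** \<Delta>) ** Mi \<Delta> t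
     = (transpose (Mi \<Delta> t) ** transpose (Mt \<Delta> t)) ** \<Delta> ** Mi \<Delta> t"
    "transpose (Mi \<Delta> t) ** (\<Delta> ** Mt \<Delta> t) ** Mi \<Delta> t = transpose (Mi \<Delta> t) ** \<Delta> ** (Mt \<Delta> t ** Mi \<Delta> t)"
    by (simp_all add: matrix_mul_assoc)
  ultimately show ?thesis using Mi_inverse[OF assms] by simp
qed

lemma transpose_Dt: assumes "admissible \<Delta>" "0 \<le> t" shows "transpose (Dt \<Delta> t) = Dt \<Delta> t"
proof -
  have s: "transpose \<Delta> = \<Delta>" using assms by (simp add: admissible_def)
  have "transpose (Dt \<Delta> t) = E t ** (transpose (Mi \<Delta> t) ** \<Delta>) ** transpose (E t)"
    by (simp add: Dt_def matrix_transpose_mul s matrix_mul_assoc)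
  then show ?thesis by (simp add: Delta_Mi[OF assms] Dt_def matrix_mul_assoc)
qed

lemma transpose_Pt: "admissible \<Delta> \<Longrightarrow> 0 \<le> t \<Longrightarrow> transpose (Pt \<Delta> t) = Pt \<Delta> t"
  by (simp add: Pt_def transpose_bilinear transpose_Dt)

text \<open>Around the stationary solution the constant part cancels, the linear part is the
  Lyapunov operator of the closed loop, and one quadratic term remains.\<close>

lemma riccati_gamma_plus: "riccati a h (\<gamma> + D) = A ** D + D ** transpose A - D ** hh ** D"
proof -
  have r: "\<gamma> ** transpose a + a ** \<gamma> + mat 1 - \<gamma> ** hh ** \<gamma> = 0"
    using gric by (simp only: riccati_eq)
  have "riccati a h (\<gamma> + D) = (\<gamma> ** transpose a + a ** \<gamma> + mat 1 - \<gamma> ** hh ** \<gamma>)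
      + (A ** D + D ** transpose A - D ** hh ** D)"
    unfolding riccati_eq transpose_A unfolding A_eq
    by (simp add: matrix_bilinear matrix_mul_assoc algebra_simps)
  then show ?thesis using r by simp
qed

lemma Dt_derivative:
  assumes "admissible \<Delta>" "0 \<le> t"
  shows "(Dt \<Delta> has_vector_derivative riccati a h (Pt \<Delta> t)) (at t within {0..})"
proof -
  have dET: "((\<lambda>t. transpose (E t)) has_vector_derivative transpose (E t) ** transpose A) (at t within {0..})"
    using has_vector_derivative_transpose[OF mexp_has_vector_derivative_left[of A t "{0..}"]]
    by (simp add: matrix_transpose_mul)
  have "(Dt \<Delta> has_vector_derivative
     E t ** \<Delta> ** Mi \<Delta> t ** (transpose (E t) ** transpose A) +
     (E t ** \<Delta> ** (- (Mi \<Delta> t ** ((transpose (E t) ** hh ** E t) ** \<Delta>) ** Mi \<Delta> t))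
      + (A ** E t ** \<Delta>) ** Mi \<Delta> t) ** transpose (E t)) (at t within {0..})"
    unfolding Dt_def
    using has_vector_derivative_mult_mm[OF has_vector_derivative_mult_mm[OF
        has_vector_derivative_mult_mm[OF mexp_has_vector_derivative_left[of A t "{0..}"] has_vector_derivative_const[of \<Delta>]]
        Mi_derivative[OF assms]] dET]
    by (simp add: matrix_bilinear)
  then show ?thesis
    by (simp add: riccati_gamma_plus Pt_def Dt_def matrix_bilinear matrix_mul_assoc algebra_simps)
qed

lemma Pt_derivative:
  assumes "admissible \<Delta>" "0 \<le> t"
  shows "(Pt \<Delta> has_vector_derivative riccati a h (Pt \<Delta> t)) (at t within {0..})"
  using has_vector_derivative_add[OF has_vector_derivative_const[of \<gamma>] Dt_derivative[OF assms]]
  by (simp add: Pt_def[abs_def])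

text \<open>\<open>Dt\<close> contains the decaying exponential once on each side, with bounded
  factors in between; hence the doubled rate.\<close>

lemma Dt_decay:
  assumes "admissible \<Delta>" and E: "\<And>t. 0 \<le> t \<Longrightarrow> norm (E t) \<le> C * exp (- l * t)"
  shows "\<exists>C'. \<forall>t\<ge>0. norm (Dt \<Delta> t) \<le> C' * exp (- (2 * l) * t)"
proof -
  obtain K where K: "\<And>t. 0 \<le> t \<Longrightarrow> norm (Mi \<Delta> t) \<le> K" using Mi_bounded assms by blast
  have K0: "0 \<le> K" using order_trans[OF norm_ge_zero K[of 0]] by simp
  have C0: "0 \<le> C" using order_trans[OF norm_ge_zero E[of 0]] by simp
  have "norm (Dt \<Delta> t) \<le> (C * norm \<Delta> * K * C) * exp (- (2 * l) * t)" if t: "0 \<le> t" for t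
  proof -
    have "norm (Dt \<Delta> t) \<le> ((norm (E t) * norm \<Delta>) * norm (Mi \<Delta> t)) * norm (E t)"
      unfolding Dt_def
      by (intro order_trans[OF norm_matrix_mult_le] mult_mono order_trans[OF norm_matrix_mult_le]) auto
    also have "\<dots> \<le> (((C * exp (- l * t)) * norm \<Delta>) * K) * (C * exp (- l * t))"
      using C0 K0 t by (intro mult_mono E K) auto
    also have "\<dots> = (C * norm \<Delta> * K * C) * (exp (- l * t) * exp (- l * t))" by (simp only: mult_ac)
    finally show ?thesis by (simp add: exp_add[symmetric] mult.assoc)
  qed
  then show ?thesis by blast
qed

text \<open>An integrating factor for the time-varying closed loop: multiplying an error by
  \<open>Th\<close> on the left removes the drift a - P h^T h, and its inverse \<open>Thi\<close>
  solves the homogeneous equation. Both are explicit because \<open>Mt\<close> is.\<close>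

definition Th :: "real^'m^'m \<Rightarrow> real \<Rightarrow> real^'m^'m" where
  "Th \<Delta> t = transpose (Mt \<Delta> t) ** E (- t)"

definition Thi :: "real^'m^'m \<Rightarrow> real \<Rightarrow> real^'m^'m" where
  "Thi \<Delta> t = E t ** transpose (Mi \<Delta> t)"

lemma Th_inverse:
  assumes "admissible \<Delta>" "0 \<le> t" shows "Thi \<Delta> t ** Th \<Delta> t = mat 1" "Th \<Delta> t ** Thi \<Delta> t = mat 1"
proof -
  have 1: "transpose (Mi \<Delta> t) ** transpose (Mt \<Delta> t) = mat 1" "transpose (Mt \<Delta> t) ** transpose (Mi \<Delta> t) = mat 1"
    by (metis Mi_inverse assms matrix_transpose_mul transpose_mat)+
  have "Thi \<Delta> t ** Th \<Delta> t = E t ** (transpose (Mi \<Delta> t) ** transpose (Mt \<Delta> t)) ** E (- t)"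
    by (simp add: Th_def Thi_def matrix_mul_assoc)
  then show "Thi \<Delta> t ** Th \<Delta> t = mat 1" by (simp add: 1 mexp_mult_minus)
  have "Th \<Delta> t ** Thi \<Delta> t = transpose (Mt \<Delta> t) ** (E (- t) ** E t) ** transpose (Mi \<Delta> t)"
    by (simp add: Th_def Thi_def matrix_mul_assoc)
  then show "Th \<Delta> t ** Thi \<Delta> t = mat 1" by (simp add: 1 mexp_minus_mult)
qed

lemma Th_derivative:
  assumes "admissible \<Delta>" "0 \<le> t"
  shows "(Th \<Delta> has_vector_derivative - (Th \<Delta> t ** (a - Pt \<Delta> t ** hh))) (at t within {0..})"
proof -
  have s: "transpose \<Delta> = \<Delta>" using assms by (simp add: admissible_def)
  have u: "(uminus has_real_derivative -1) (at t within {0..})" by (auto intro!: derivative_eq_intros)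
  have "(Th \<Delta> has_vector_derivative transpose (Mt \<Delta> t) ** (- (E (- t) ** A))
      + (\<Delta> ** (transpose (E t) ** hh ** E t)) ** E (- t)) (at t within {0..})"
    unfolding Th_def
    using has_vector_derivative_mult_mm[OF has_vector_derivative_transpose[OF Mt_derivative[OF assms(2), of \<Delta>]]
      mexp_has_vector_derivative_right_compose[OF u, of A]]
    by (simp add: matrix_transpose_mul s matrix_mul_assoc)
  also have "(\<Delta> ** (transpose (E t) ** hh ** E t)) ** E (- t) = \<Delta> ** transpose (E t) ** hh ** (E t ** E (- t))"
    by (simp add: matrix_mul_assoc)
  also have "\<dots> = Th \<Delta> t ** Dt \<Delta> t ** hh"
  proof -
    have "Th \<Delta> t ** Dt \<Delta> t = transpose (Mt \<Delta> t) ** (E (- t) ** E t) ** (\<Delta> ** Mi \<Delta> t) ** transpose (E t)"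
      by (simp add: Th_def Dt_def matrix_mul_assoc)
    also have "\<dots> = (transpose (Mt \<Delta> t) ** transpose (Mi \<Delta> t)) ** \<Delta> ** transpose (E t)"
      by (simp add: mexp_minus_mult Delta_Mi[OF assms, symmetric] matrix_mul_assoc)
    also have "transpose (Mt \<Delta> t) ** transpose (Mi \<Delta> t) = mat 1"
      by (metis Mi_inverse(2) assms matrix_transpose_mul transpose_mat)
    finally show ?thesis by (simp add: mexp_mult_minus)
  qed
  also have "transpose (Mt \<Delta> t) ** (- (E (- t) ** A)) = - (Th \<Delta> t ** A)"
    by (simp add: Th_def matrix_bilinear matrix_mul_assoc)
  also have "- (Th \<Delta> t ** A) + Th \<Delta> t ** Dt \<Delta> t ** hh = - (Th \<Delta> t ** (a - Pt \<Delta> t ** hh))"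
    unfolding A_eq Pt_def by (simp add: matrix_bilinear matrix_mul_assoc)
  finally show ?thesis .
qed

lemma Thi_derivative:
  assumes "admissible \<Delta>" "0 \<le> t"
  shows "(Thi \<Delta> has_vector_derivative (a - Pt \<Delta> t ** hh) ** Thi \<Delta> t) (at t within {0..})"
proof -
  have s: "transpose \<Delta> = \<Delta>" using assms by (simp add: admissible_def)
  have "(Thi \<Delta> has_vector_derivative E t ** (- (transpose (Mi \<Delta> t) ** (\<Delta> ** (transpose (E t) ** hh ** E t)) ** transpose (Mi \<Delta> t)))
      + (A ** E t) ** transpose (Mi \<Delta> t)) (at t within {0..})"
    unfolding Thi_def
    using has_vector_derivative_mult_mm[OF mexp_has_vector_derivative_left[of A t "{0..}"]
      has_vector_derivative_transpose[OF Mi_derivative[OF assms]]]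
    by (simp add: matrix_transpose_mul transpose_bilinear s matrix_mul_assoc)
  also have "E t ** (- (transpose (Mi \<Delta> t) ** (\<Delta> ** (transpose (E t) ** hh ** E t)) ** transpose (Mi \<Delta> t)))
     = - (E t ** (transpose (Mi \<Delta> t) ** \<Delta>) ** transpose (E t) ** hh ** Thi \<Delta> t)"
    by (simp add: Thi_def matrix_bilinear matrix_mul_assoc)
  also have "E t ** (transpose (Mi \<Delta> t) ** \<Delta>) ** transpose (E t) = Dt \<Delta> t"
    by (simp add: Delta_Mi[OF assms] Dt_def matrix_mul_assoc)
  also have "- (Dt \<Delta> t ** hh ** Thi \<Delta> t) + (A ** E t) ** transpose (Mi \<Delta> t) = (a - Pt \<Delta> t ** hh) ** Thi \<Delta> t"
    unfolding Thi_def A_eq Pt_def by (simp add: matrix_bilinear matrix_mul_assoc)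
  finally show ?thesis .
qed

text \<open>Conjugation by exp (- t A) removes the linear part of the equation for P - \<gamma> and
  leaves R' = - R O' R. The relation to be proved, R Mt = \<Delta>, has a defect \<open>q\<close>
  that satisfies a homogeneous linear equation, with the given solution R as a known coefficient,
  and starts at 0.\<close>

lemma riccati_unique:
  assumes adm: "admissible \<Delta>" and P0: "P 0 = \<gamma> + \<Delta>"
    and P: "\<And>t. 0 \<le> t \<Longrightarrow> (P has_vector_derivative riccati a h (P t)) (at t within {0..})"
    and t: "0 \<le> t"
  shows "P t = Pt \<Delta> t"
proof -
  define D where "D t = P t - \<gamma>" for t
  define R where "R t = E (- t) ** D t ** transpose (E (- t))" for t
  define O' where "O' t = transpose (E t) ** hh ** E t" for t
  define q where "q t = R t ** Mt \<Delta> t - \<Delta>" for t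
  have dD: "(D has_vector_derivative A ** D t + D t ** transpose A - D t ** hh ** D t) (at t within {0..})"
    if "0 \<le> t" for t
    using has_vector_derivative_diff[OF P[OF that] has_vector_derivative_const[of \<gamma>]]
      riccati_gamma_plus[of "D t"] by (simp add: D_def[abs_def])
  have ETE: "transpose (E (- t)) ** transpose (E t) = mat 1" for t
    by (metis matrix_transpose_mul mexp_mult_minus transpose_mat)
  have dR: "(R has_vector_derivative - (R t ** O' t ** R t)) (at t within {0..})" if t: "0 \<le> t" for t
  proof -
    have u: "(uminus has_real_derivative -1) (at t within {0..})" by (auto intro!: derivative_eq_intros)
    have d1: "((\<lambda>t. E (- t)) has_vector_derivative - (E (- t) ** A)) (at t within {0..})"
      using mexp_has_vector_derivative_right_compose[OF u, of A] by simp
    have d2: "((\<lambda>t. transpose (E (- t))) has_vector_derivative - (transpose A ** transpose (E (- t)))) (at t within {0..})"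
      using has_vector_derivative_transpose[OF d1] by (simp add: matrix_transpose_mul transpose_bilinear)
    have "(R has_vector_derivative E (- t) ** D t ** (- (transpose A ** transpose (E (- t)))) +
        (E (- t) ** (A ** D t + D t ** transpose A - D t ** hh ** D t) + (- (E (- t) ** A)) ** D t)
        ** transpose (E (- t))) (at t within {0..})"
      unfolding R_def by (rule has_vector_derivative_mult_mm[OF has_vector_derivative_mult_mm[OF d1 dD[OF t]] d2])
    also have "E (- t) ** D t ** (- (transpose A ** transpose (E (- t)))) +
        (E (- t) ** (A ** D t + D t ** transpose A - D t ** hh ** D t) + (- (E (- t) ** A)) ** D t)
        ** transpose (E (- t)) = - (E (- t) ** D t ** hh ** D t ** transpose (E (- t)))"
      by (simp add: matrix_bilinear matrix_mul_assoc algebra_simps)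
    also have "E (- t) ** D t ** hh ** D t ** transpose (E (- t))
        = E (- t) ** D t ** (transpose (E (- t)) ** transpose (E t)) ** hh ** (E t ** E (- t)) ** D t ** transpose (E (- t))"
      by (simp only: ETE mexp_mult_minus matrix_mul_rid)
    also have "\<dots> = R t ** O' t ** R t" by (simp add: R_def O'_def matrix_mul_assoc)
    finally show ?thesis .
  qed
  have dq: "(q has_vector_derivative - (R t ** O' t) ** q t) (at t within {0..})" if t: "0 \<le> t" for t
  proof -
    have "(q has_vector_derivative (R t ** (O' t ** \<Delta>) + (- (R t ** O' t ** R t)) ** Mt \<Delta> t) - 0) (at t within {0..})"
      unfolding q_def O'_def
      by (intro has_vector_derivative_diff has_vector_derivative_const
          has_vector_derivative_mult_mm[OF dR[OF t, unfolded O'_def] Mt_derivative[OF t]])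
    then show ?thesis by (simp add: q_def matrix_bilinear matrix_mul_assoc)
  qed
  have "q t = 0"
  proof (rule linear_ode_zero[OF dq _ _ t])
    show "continuous_on {0..} (\<lambda>t. - (R t ** O' t))"
      unfolding O'_def by (intro continuous_intros continuous_on_Ici_derivative[OF dR])
    show "q 0 = 0" by (simp add: q_def R_def D_def P0 Mt_def matrix_bilinear)
  qed
  then have "R t ** Mt \<Delta> t ** Mi \<Delta> t = \<Delta> ** Mi \<Delta> t" by (simp add: q_def)
  then have R: "R t = \<Delta> ** Mi \<Delta> t"
    using Mi_inverse(1)[OF adm t] by (simp add: matrix_mul_assoc[symmetric])
  have "D t = (E t ** E (- t)) ** D t ** (transpose (E (- t)) ** transpose (E t))"
    by (simp add: ETE mexp_mult_minus)
  also have "\<dots> = E t ** R t ** transpose (E t)" by (simp add: R_def matrix_mul_assoc)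
  finally show ?thesis by (simp add: R Pt_def Dt_def D_def matrix_mul_assoc algebra_simps)
qed

end

section \<open>Integration by parts against continuous paths\<close>

text \<open>For continuous \<open>v\<close> and differentiable \<open>f\<close> this is the integral of \<open>f\<close> against \<open>dv\<close>, where
  \<open>f'\<close> is the derivative of \<open>f\<close>; evaluated at Brownian paths it is the Wiener integral.\<close>

definition jint :: "('a \<Rightarrow> 'b \<Rightarrow> 'c::real_normed_vector) \<Rightarrow> (real \<Rightarrow> 'a) \<Rightarrow> (real \<Rightarrow> 'a) \<Rightarrow> (real \<Rightarrow> 'b) \<Rightarrow> real \<Rightarrow> real \<Rightarrow> 'c" where
  "jint bl f f' v T t = bl (f t) (v t) - bl (f T) (v T) - integral {T..t} (\<lambda>s. bl (f' s) (v s))"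

section \<open>Left-point sums over uniform partitions\<close>

definition upart :: "real \<Rightarrow> real \<Rightarrow> nat \<Rightarrow> nat \<Rightarrow> real" where
  "upart T t n k = T + (t - T) * (real k / real n)"

lemma upart_simps [simp]: "upart T t n 0 = T" "n > 0 \<Longrightarrow> upart T t n n = t"
  by (auto simp: upart_def)

lemma upart_mono: "T \<le> t \<Longrightarrow> j \<le> k \<Longrightarrow> upart T t n j \<le> upart T t n k"
  by (auto simp: upart_def intro!: mult_left_mono divide_right_mono)

lemma upart_in: "T \<le> t \<Longrightarrow> k \<le> n \<Longrightarrow> upart T t n k \<in> {T..t}"
  using upart_mono[of T t 0 k n] upart_mono[of T t k n n] by (cases "n = 0") auto

lemma upart_step: "upart T t n (Suc k) - upart T t n k = (t - T) / real n"
  by (simp add: upart_def field_simps diff_divide_distrib add_divide_distrib)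

lemma integral_upart:
  fixes g :: "real \<Rightarrow> 'a::banach"
  assumes "T \<le> t" "g integrable_on {T..t}" "m \<le> n"
  shows "(\<Sum>k<m. integral {upart T t n k..upart T t n (Suc k)} g) = integral {T..upart T t n m} g"
  using assms(3)
proof (induction m)
  case (Suc m)
  have "integral {T..upart T t n m} g + integral {upart T t n m..upart T t n (Suc m)} g = integral {T..upart T t n (Suc m)} g"
  proof (rule Henstock_Kurzweil_Integration.integral_combine)
    show "g integrable_on {T..upart T t n (Suc m)}"
      using upart_in[OF assms(1), of "Suc m" n] Suc.prems
      by (intro integrable_subinterval_real[OF assms(2)]) auto
  qed (use upart_in[OF assms(1), of m n] upart_mono[OF assms(1), of m "Suc m" n] Suc.prems in auto)
  with Suc show ?case by simp
qed simp

locale banach_bilinear = bounded_bilinear prod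
  for prod :: "'a::banach \<Rightarrow> 'b::real_normed_vector \<Rightarrow> 'c::banach"
begin

lemma jint_split:
  assumes "T \<le> s" "s \<le> t" "continuous_on {T..t} f'" "continuous_on {T..t} v"
  shows "jint prod f f' v T t = jint prod f f' v T s + jint prod f f' v s t"
proof -
  have "integral {T..s} (\<lambda>s. prod (f' s) (v s)) + integral {s..t} (\<lambda>s. prod (f' s) (v s)) = integral {T..t} (\<lambda>s. prod (f' s) (v s))"
    using assms by (intro Henstock_Kurzweil_Integration.integral_combine integrable_continuous_real continuous_on) auto
  then show ?thesis by (simp add: jint_def algebra_simps)
qed

text \<open>Abel summation moves the differences onto \<open>f\<close>, whose increments are
  integrals of \<open>f'\<close>; uniform continuity of \<open>v\<close> controls each cell. Thus
  left-point sums converge for every continuous \<open>v\<close>, in particular along every Brownian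
  path.\<close>

lemma jint_riemann:
  assumes f: "\<And>s. s \<in> {T..t} \<Longrightarrow> (f has_vector_derivative f' s) (at s within {T..t})"
    and cf: "continuous_on {T..t} f'" and cv: "continuous_on {T..t} v" and Tt: "T \<le> t"
  shows "(\<lambda>n. \<Sum>k<n. prod (f (upart T t n k)) (v (upart T t n (Suc k)) - v (upart T t n k)))
     \<longlonglongrightarrow> jint prod f f' v T t"
proof (rule LIMSEQ_I)
  fix e :: real assume e: "e > 0"
  obtain K where K: "K > 0" "\<And>a b. norm (prod a b) \<le> norm a * norm b * K" using pos_bounded by blast
  have "bounded (f' ` {T..t})" using compact_continuous_image[OF cf compact_Icc] by (rule compact_imp_bounded)
  then obtain B where B: "B > 0" "\<And>s. s \<in> {T..t} \<Longrightarrow> norm (f' s) \<le> B" unfolding bounded_pos by auto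
  \<comment> \<open>The cell errors add up to B e' K (t - T), which is below e; the added 1 keeps
    the denominator positive when t = T.\<close>
  define e' where "e' = e / (2 * B * K * (t - T + 1))"
  have e': "e' > 0" using e B K Tt by (simp add: e'_def)
  have "uniformly_continuous_on {T..t} v" using cv by (rule compact_uniformly_continuous) simp
  then obtain d where d: "d > 0" "\<And>s r. s \<in> {T..t} \<Longrightarrow> r \<in> {T..t} \<Longrightarrow> dist s r < d \<Longrightarrow> dist (v s) (v r) < e'"
    using e' unfolding uniformly_continuous_on_def by metis
  obtain N where N: "(t - T) / d < real N" using reals_Archimedean2 by blast
  show "\<exists>no. \<forall>n\<ge>no. norm ((\<Sum>k<n. prod (f (upart T t n k)) (v (upart T t n (Suc k)) - v (upart T t n k))) - jint prod f f' v T t) < e"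
  proof (intro exI[of _ "Suc N"] allI impI)
    fix n assume n: "Suc N \<le> n"
    then have n0: "n > 0" by simp
    let ?p = "upart T t n"
    have nn: "(t - T) / real n < d"
    proof -
      have "(t - T) / d < real n" using N n by (metis of_nat_less_iff less_trans Suc_le_lessD)
      then show ?thesis using d(1) n0 by (simp add: field_simps)
    qed
    have pin: "?p k \<in> {T..t}" if "k \<le> n" for k using upart_in[OF Tt that] .
    have sub: "{?p k..?p (Suc k)} \<subseteq> {T..t}" if "k < n" for k
      using pin[of k] pin[of "Suc k"] that by auto
    have step: "integral {?p k..?p (Suc k)} f' = f (?p (Suc k)) - f (?p k)" "f' integrable_on {?p k..?p (Suc k)}" if k: "k < n" for k
    proof -
      have "(f' has_integral (f (?p (Suc k)) - f (?p k))) {?p k..?p (Suc k)}"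
        using upart_mono[OF Tt, of k "Suc k" n] sub[OF k]
        by (intro fundamental_theorem_of_calculus has_vector_derivative_within_subset[OF f]) auto
      then show "integral {?p k..?p (Suc k)} f' = f (?p (Suc k)) - f (?p k)" "f' integrable_on {?p k..?p (Suc k)}"
        by (auto simp: integral_unique)
    qed
    have tele: "(\<Sum>k<n. prod (f (?p (Suc k))) (v (?p (Suc k))) - prod (f (?p k)) (v (?p k))) = prod (f t) (v t) - prod (f T) (v T)"
      using n0 by (subst sum_lessThan_telescope) simp
    have abel: "(\<Sum>k<n. prod (f (?p k)) (v (?p (Suc k)) - v (?p k)))
       = prod (f t) (v t) - prod (f T) (v T) - (\<Sum>k<n. prod (f (?p (Suc k)) - f (?p k)) (v (?p (Suc k))))"
      unfolding tele[symmetric] sum_subtractf[symmetric] by (intro sum.cong refl) (simp add: diff_left diff_right)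
    have ci: "(\<lambda>s. prod (f' s) (v s)) integrable_on S" if "S = {r..u}" "{r..u} \<subseteq> {T..t}" for S r u
      using that by (auto intro!: integrable_continuous_real continuous_on continuous_on_subset[OF cf] continuous_on_subset[OF cv])
    have split: "integral {T..t} (\<lambda>s. prod (f' s) (v s)) = (\<Sum>k<n. integral {?p k..?p (Suc k)} (\<lambda>s. prod (f' s) (v s)))"
      using integral_upart[OF Tt ci[OF refl order_refl] order_refl, of n] n0 by simp
    have "(\<Sum>k<n. prod (f (?p k)) (v (?p (Suc k)) - v (?p k))) - jint prod f f' v T t
       = (\<Sum>k<n. integral {?p k..?p (Suc k)} (\<lambda>s. prod (f' s) (v s)) - prod (f (?p (Suc k)) - f (?p k)) (v (?p (Suc k))))"
      unfolding jint_def abel split sum_subtractf by simp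
    also have "norm \<dots> \<le> (\<Sum>k<n. B * e' * K * ((t - T) / real n))"
    proof (rule sum_norm_le)
      fix k assume "k \<in> {..<n}" then have k: "k < n" by simp
      have "prod (f (?p (Suc k)) - f (?p k)) (v (?p (Suc k))) = integral {?p k..?p (Suc k)} (\<lambda>s. prod (f' s) (v (?p (Suc k))))"
        unfolding step(1)[OF k, symmetric]
        using integral_linear[OF step(2)[OF k] bounded_linear_left[of "v (?p (Suc k))"]] by (simp add: o_def)
      then have "integral {?p k..?p (Suc k)} (\<lambda>s. prod (f' s) (v s)) - prod (f (?p (Suc k)) - f (?p k)) (v (?p (Suc k)))
          = integral {?p k..?p (Suc k)} (\<lambda>s. prod (f' s) (v s) - prod (f' s) (v (?p (Suc k))))"
        by (simp only:) (subst integral_diff, auto intro!: ci[OF refl] integrable_continuous_real continuous_on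
            continuous_on_subset[OF cf] continuous_on_subset[OF cv] sub[OF k] dest: subsetD[OF sub[OF k]])
      also have "norm \<dots> \<le> integral {?p k..?p (Suc k)} (\<lambda>s. B * e' * K)"
      proof (rule integral_norm_bound_integral)
        show "(\<lambda>s. prod (f' s) (v s) - prod (f' s) (v (?p (Suc k)))) integrable_on {?p k..?p (Suc k)}"
          by (auto intro!: integrable_continuous_real continuous_on_diff continuous_on
              continuous_on_subset[OF cf] continuous_on_subset[OF cv] sub[OF k] dest: subsetD[OF sub[OF k]])
        fix s assume s: "s \<in> {?p k..?p (Suc k)}"
        then have sT: "s \<in> {T..t}" using sub[OF k] by auto
        have "dist s (?p (Suc k)) < d" using s nn upart_step[of T t n k] by (auto simp: dist_real_def)
        then have "norm (v s - v (?p (Suc k))) \<le> e'"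
          using d(2)[OF sT pin[of "Suc k"]] k by (simp add: dist_norm)
        then have "norm (prod (f' s) (v s - v (?p (Suc k)))) \<le> B * e' * K"
          using K B sT e' by (intro order_trans[OF K(2)] mult_mono) auto
        then show "norm (prod (f' s) (v s) - prod (f' s) (v (?p (Suc k)))) \<le> B * e' * K"
          by (simp add: diff_right)
      qed auto
      also have "\<dots> = B * e' * K * ((t - T) / real n)"
        using upart_step[of T t n k] upart_mono[OF Tt, of k "Suc k" n] by (simp add: mult.commute)
      finally show "norm (integral {?p k..?p (Suc k)} (\<lambda>s. prod (f' s) (v s)) - prod (f (?p (Suc k)) - f (?p k)) (v (?p (Suc k))))
          \<le> B * e' * K * ((t - T) / real n)" .
    qed
    also have "\<dots> = B * e' * K * (t - T)" using n0 by simp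
    also have "\<dots> = e * ((t - T) / (2 * (t - T + 1)))"
    proof -
      define c where "c = t - T + 1"
      have "c \<noteq> 0" using Tt by (simp add: c_def)
      then have "B * (e / (2 * B * K * c)) * K * (t - T) = e * ((t - T) / (2 * c))" using B K by (simp add: field_simps)
      then show ?thesis by (simp add: e'_def c_def)
    qed
    also have "\<dots> < e * 1"
      by (rule mult_strict_left_mono[OF _ e]) (use Tt in \<open>simp add: field_simps\<close>)
    also have "\<dots> = e" by simp
    finally show "norm ((\<Sum>k<n. prod (f (?p k)) (v (?p (Suc k)) - v (?p k))) - jint prod f f' v T t) < e" .
  qed
qed

end

lemma jint_inner_component:
  fixes F :: "real \<Rightarrow> real^'n^'m"
  assumes "continuous_on {T..t} F'" "continuous_on {T..t} v"
  shows "jint (*v) F F' v T t $ i = jint (\<bullet>) (\<lambda>s. F s $ i) (\<lambda>s. F' s $ i) v T t"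
proof -
  have "integral {T..t} (\<lambda>s. F' s *v v s) $ i = integral {T..t} (\<lambda>s. (F' s *v v s) $ i)"
  proof -
    have "(\<lambda>s. F' s *v v s) integrable_on {T..t}"
      by (intro integrable_continuous_real continuous_intros assms)
    from integral_linear[OF this bounded_linear_vec_nth[of i]] show ?thesis by (simp add: o_def)
  qed
  then show ?thesis by (simp add: jint_def matrix_vector_mul_component)
qed

subsection \<open>Exponential bounds\<close>

text \<open>f = O (exp (r t)) on [T, \<infinity>): r < 0 expresses decay, r = 0 boundedness, and all
  r > 0 together subexponential growth. Rates add under products.\<close>

definition ebd :: "real \<Rightarrow> real \<Rightarrow> (real \<Rightarrow> 'a::real_normed_vector) \<Rightarrow> bool" where
  "ebd T r f \<longleftrightarrow> (\<exists>C. \<forall>t\<ge>T. norm (f t) \<le> C * exp (r * t))"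

lemma ebdE: assumes "ebd T r f" obtains C where "C \<ge> 0" "\<And>t. T \<le> t \<Longrightarrow> norm (f t) \<le> C * exp (r * t)"
proof -
  from assms obtain C where C: "\<And>t. T \<le> t \<Longrightarrow> norm (f t) \<le> C * exp (r * t)" by (auto simp: ebd_def)
  have "C \<ge> 0" using order_trans[OF norm_ge_zero C[OF order_refl]] by (simp add: zero_le_mult_iff)
  with C that show ?thesis by blast
qed

lemma ebd_add: assumes "ebd T r f" "ebd T r g" shows "ebd T r (\<lambda>t. f t + g t)"
proof -
  obtain C D where "\<And>t. T \<le> t \<Longrightarrow> norm (f t) \<le> C * exp (r * t)" "\<And>t. T \<le> t \<Longrightarrow> norm (g t) \<le> D * exp (r * t)"
    using assms by (metis ebdE)
  then have "\<forall>t\<ge>T. norm (f t + g t) \<le> (C + D) * exp (r * t)"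
    by (auto simp: distrib_right intro!: norm_triangle_le add_mono)
  then show ?thesis unfolding ebd_def by blast
qed

lemma ebd_minus: "ebd T r f \<Longrightarrow> ebd T r (\<lambda>t. - f t)" by (simp add: ebd_def)

lemma ebd_diff: "ebd T r f \<Longrightarrow> ebd T r g \<Longrightarrow> ebd T r (\<lambda>t. f t - g t)"
  using ebd_add[of T r f "\<lambda>t. - g t"] ebd_minus[of T r g] by simp

lemma ebd_const: "ebd T 0 (\<lambda>t. c)" by (auto simp: ebd_def)

lemma ebd_mono: assumes "ebd T r f" "r \<le> r'" "T \<le> T'" shows "ebd T' r' f"
proof -
  obtain C where C: "C \<ge> 0" "\<And>t. T \<le> t \<Longrightarrow> norm (f t) \<le> C * exp (r * t)" using assms(1) by (metis ebdE)
  have "norm (f t) \<le> (C * exp ((r - r') * T')) * exp (r' * t)" if t: "T' \<le> t" for t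
  proof -
    have "(r' - r) * T' \<le> (r' - r) * t" using t assms(2) by (intro mult_left_mono) auto
    then have "exp (r * t) \<le> exp ((r - r') * T') * exp (r' * t)" by (simp add: exp_add[symmetric] algebra_simps)
    then have "C * exp (r * t) \<le> C * (exp ((r - r') * T') * exp (r' * t))" using C by (intro mult_left_mono) auto
    then show ?thesis using C(2)[of t] t assms(3) by (simp add: mult.assoc)
  qed
  then show ?thesis unfolding ebd_def by blast
qed

lemma ebd_mm: fixes f :: "real \<Rightarrow> real^'n^'m" and g :: "real \<Rightarrow> real^'k^'n"
  assumes "ebd T r f" "ebd T q g" shows "ebd T (r + q) (\<lambda>t. f t ** g t)"
proof -
  obtain C D where C: "C \<ge> 0" "\<And>t. T \<le> t \<Longrightarrow> norm (f t) \<le> C * exp (r * t)" "D \<ge> 0" "\<And>t. T \<le> t \<Longrightarrow> norm (g t) \<le> D * exp (q * t)"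
    using assms by (metis ebdE)
  have "norm (f t ** g t) \<le> (C * D) * exp ((r + q) * t)" if "T \<le> t" for t
  proof -
    have "norm (f t ** g t) \<le> (C * exp (r * t)) * (D * exp (q * t))"
      by (rule order_trans[OF norm_matrix_mult_le mult_mono]) (use C that in auto)
    then show ?thesis by (simp add: exp_add[symmetric] algebra_simps)
  qed
  then show ?thesis unfolding ebd_def by blast
qed

lemma ebd_mv: fixes f :: "real \<Rightarrow> real^'n^'m" and g :: "real \<Rightarrow> real^'n"
  assumes "ebd T r f" "ebd T q g" shows "ebd T (r + q) (\<lambda>t. f t *v g t)"
proof -
  obtain C D where C: "C \<ge> 0" "\<And>t. T \<le> t \<Longrightarrow> norm (f t) \<le> C * exp (r * t)" "D \<ge> 0" "\<And>t. T \<le> t \<Longrightarrow> norm (g t) \<le> D * exp (q * t)"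
    using assms by (metis ebdE)
  have "norm (f t *v g t) \<le> (C * D) * exp ((r + q) * t)" if "T \<le> t" for t
  proof -
    have "norm (f t *v g t) \<le> (C * exp (r * t)) * (D * exp (q * t))"
      by (rule order_trans[OF norm_matrix_vector_mult_le mult_mono]) (use C that in auto)
    then show ?thesis by (simp add: exp_add[symmetric] algebra_simps)
  qed
  then show ?thesis unfolding ebd_def by blast
qed

lemma ebd_tendsto:
  assumes "ebd T (- r) f" "l < r" shows "((\<lambda>t. exp (l * t) *\<^sub>R f t) \<longlongrightarrow> 0) at_top"
proof -
  obtain C where C: "\<And>t. T \<le> t \<Longrightarrow> norm (f t) \<le> C * exp (- r * t)" using assms(1) by (metis ebdE)
  show ?thesis
  proof (rule Lim_null_comparison)
    show "\<forall>\<^sub>F t in at_top. norm (exp (l * t) *\<^sub>R f t) \<le> C * exp ((l - r) * t)"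
      using eventually_ge_at_top[of T]
    proof eventually_elim
      case (elim t)
      have "norm (exp (l * t) *\<^sub>R f t) \<le> exp (l * t) * (C * exp (- r * t))" using C[OF elim] by simp
      also have "\<dots> = C * exp ((l - r) * t)"
        by (simp add: exp_add[symmetric] mult.left_commute[of _ C] left_diff_distrib del: exp_add)
      finally show ?case .
    qed
    have "filterlim (\<lambda>t. (l - r) * t) at_bot at_top"
      using assms(2) by (intro filterlim_tendsto_neg_mult_at_bot[OF tendsto_const] filterlim_ident) auto
    then have "((\<lambda>t. exp ((l - r) * t)) \<longlongrightarrow> 0) at_top" by (rule filterlim_compose[OF exp_at_bot])
    then show "((\<lambda>t. C * exp ((l - r) * t)) \<longlongrightarrow> 0) at_top" by (rule tendsto_mult_right_zero)
  qed
qed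


lemma banach_bilinear_mv: "banach_bilinear ((*v) :: real^'n^'m \<Rightarrow> real^'n \<Rightarrow> real^'m)"
  by (intro banach_bilinear.intro bounded_bilinear_matrix_vector_mult)

lemma banach_bilinear_inner: "banach_bilinear ((\<bullet>) :: 'a::euclidean_space \<Rightarrow> 'a \<Rightarrow> real)"
  by (intro banach_bilinear.intro bounded_bilinear_inner)

lemma has_vector_derivative_shift_Ici:
  assumes "(f has_vector_derivative d) (at (t - T) within {0..})"
  shows "((\<lambda>t. f (t - T)) has_vector_derivative d) (at t within {T..})"
proof -
  have "(\<lambda>t. t - T) ` {T..} = {0..}" by (auto simp: image_iff intro!: bexI[of _ "_ + T"])
  moreover have "((\<lambda>t. t - T) has_vector_derivative 1) (at t within {T..})"
    by (auto intro!: derivative_eq_intros)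
  ultimately show ?thesis
    using vector_diff_chain_within[of "\<lambda>t. t - T" 1 t "{T..}" f d] assms by (simp add: o_def)
qed

subsection \<open>Filter errors along a path\<close>

context steady_filter
begin

text \<open>The equation \<open>d\<epsilon> = (a - P h\<^sup>T h) \<epsilon> dt + dw - P h\<^sup>T dn\<close> of a filter error, where the
  combination of \<open>\<epsilon>\<close>, \<open>w\<close>, \<open>n\<close> that is differentiated has differentiable paths.\<close>

definition filter_error :: "real \<Rightarrow> (real \<Rightarrow> real^'m^'m) \<Rightarrow> (real \<Rightarrow> real^'m) \<Rightarrow> (real \<Rightarrow> real^'n) \<Rightarrow> (real \<Rightarrow> real^'m) \<Rightarrow> bool" where
  "filter_error T P w n \<epsilon> \<longleftrightarrow> (\<forall>t\<ge>T.
     ((\<lambda>t. \<epsilon> t - w t + (P t ** transpose h) *v n t) has_vector_derivative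
      (a - P t ** hh) *v \<epsilon> t + (riccati a h (P t) ** transpose h) *v n t) (at t within {T..}))"

text \<open>\<open>riccati\<close> vanishes at \<gamma>, so along P it is as small as P -
  \<gamma>.\<close>

lemma ebd_Pt:
  assumes D: "ebd T (- (2 * l)) (\<lambda>t. P t - \<gamma>)" and l: "0 < l"
  shows "ebd T 0 P" "ebd T (- (2 * l)) (\<lambda>t. riccati a h (P t))"
proof -
  have "ebd T 0 (\<lambda>t. (P t - \<gamma>) + \<gamma>)" by (intro ebd_add ebd_const ebd_mono[OF D]) (use l in auto)
  then show "ebd T 0 P" by simp
  have D0: "ebd T 0 (\<lambda>t. P t - \<gamma>)" by (intro ebd_mono[OF D]) (use l in auto)
  have "ebd T (- (2 * l)) (\<lambda>t. A ** (P t - \<gamma>) + (P t - \<gamma>) ** transpose A - (P t - \<gamma>) ** hh ** (P t - \<gamma>))"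
    using ebd_mm[OF ebd_const[of T A] D] ebd_mm[OF D ebd_const[of T "transpose A"]]
      ebd_mm[OF ebd_mm[OF D0 ebd_const[of T hh]] D]
    by (intro ebd_add ebd_diff) simp_all
  then show "ebd T (- (2 * l)) (\<lambda>t. riccati a h (P t))"
    using riccati_gamma_plus[of "P _ - \<gamma>"] by simp
qed

text \<open>The differentiable combination \<open>\<beta>\<close> satisfies the steady linear
  equation up to an exponentially small coefficient, and the noise paths appear only in its forcing
  term. The perturbation lemma, applied with the negative rate - d, transfers their growth to the
  error.\<close>

lemma filter_error_growth:
  assumes fe: "filter_error T P w n \<epsilon>"
    and P: "\<And>t. T \<le> t \<Longrightarrow> (P has_vector_derivative riccati a h (P t)) (at t within {T..})"
    and D: "ebd T (- (2 * l)) (\<lambda>t. P t - \<gamma>)" and l: "0 < l"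
    and E: "\<And>t. 0 \<le> t \<Longrightarrow> norm (E t) \<le> C * exp (- l * t)"
    and cw: "continuous_on {T..} w" and cn: "continuous_on {T..} n"
    and w: "ebd T d w" and n: "ebd T d n" and d: "0 < d"
  shows "ebd T d \<epsilon>"
proof -
  define \<beta> where "\<beta> t = \<epsilon> t - w t + (P t ** transpose h) *v n t" for t
  define \<phi> where "\<phi> t = (A - (P t - \<gamma>) ** hh) *v (w t - (P t ** transpose h) *v n t)
      + (riccati a h (P t) ** transpose h) *v n t" for t
  have cP: "continuous_on {T..} P" by (rule continuous_on_Ici_derivative[OF P])
  have ab: "a - P t ** hh = A + - ((P t - \<gamma>) ** hh)" for t
    unfolding A_eq by (simp add: matrix_bilinear)
  have e: "\<epsilon> t = \<beta> t + (w t - (P t ** transpose h) *v n t)" for t by (simp add: \<beta>_def)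
  have d\<beta>: "(\<beta> has_vector_derivative (A + - ((P t - \<gamma>) ** hh)) *v \<beta> t + \<phi> t) (at t within {T..})" if "T \<le> t" for t
  proof -
    have "(\<beta> has_vector_derivative (a - P t ** hh) *v \<epsilon> t + (riccati a h (P t) ** transpose h) *v n t) (at t within {T..})"
      using fe that unfolding filter_error_def \<beta>_def by blast
    also have "(a - P t ** hh) *v \<epsilon> t + (riccati a h (P t) ** transpose h) *v n t = (A + - ((P t - \<gamma>) ** hh)) *v \<beta> t + \<phi> t"
      unfolding ab e by (simp add: \<phi>_def matrix_vector_right_distrib)
    finally show ?thesis .
  qed
  have D0: "ebd T 0 (\<lambda>t. P t - \<gamma>)" by (intro ebd_mono[OF D]) (use l in auto)
  have R0: "ebd T 0 (\<lambda>t. riccati a h (P t))" by (intro ebd_mono[OF ebd_Pt(2)[OF D l]]) (use l in auto)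
  have Ph: "ebd T d (\<lambda>t. (P t ** transpose h) *v n t)"
    using ebd_mv[OF ebd_mm[OF ebd_Pt(1)[OF D l] ebd_const[of T "transpose h"]] n] by simp
  have wn: "ebd T d (\<lambda>t. w t - (P t ** transpose h) *v n t)" by (intro ebd_diff w Ph)
  have "ebd T d \<phi>" unfolding \<phi>_def
  proof (intro ebd_add)
    have "ebd T 0 (\<lambda>t. A - (P t - \<gamma>) ** hh)"
      using ebd_diff[OF ebd_const[of T A] ebd_mm[OF D0 ebd_const[of T hh], simplified]] by simp
    from ebd_mv[OF this wn] show "ebd T d (\<lambda>t. (A - (P t - \<gamma>) ** hh) *v (w t - (P t ** transpose h) *v n t))" by simp
    show "ebd T d (\<lambda>t. (riccati a h (P t) ** transpose h) *v n t)"
      using ebd_mv[OF ebd_mm[OF R0 ebd_const[of T "transpose h"]] n] by simp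
  qed
  then obtain C2 where C2: "\<And>t. T \<le> t \<Longrightarrow> norm (\<phi> t) \<le> C2 * exp (- (- d) * t)" by (auto elim!: ebdE)
  have "ebd T (- (2 * l)) (\<lambda>t. - ((P t - \<gamma>) ** hh))"
    using ebd_minus[OF ebd_mm[OF D ebd_const[of T hh]]] by simp
  then obtain C1 where C1: "\<And>t. T \<le> t \<Longrightarrow> norm (- ((P t - \<gamma>) ** hh)) \<le> C1 * exp (- (2 * l) * t)" by (metis ebdE)
  have "\<exists>C3. \<forall>t\<ge>T. norm (\<beta> t) \<le> C3 * exp (- (- d) * t)"
  proof (rule perturbed_linear_decay[OF d\<beta> _ _ E C1 C2])
    show "continuous_on {T..} (\<lambda>t. - ((P t - \<gamma>) ** hh))" by (intro continuous_intros cP)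
    show "continuous_on {T..} \<phi>" unfolding \<phi>_def riccati_eq by (intro continuous_intros cP cw cn)
  qed (use l d in auto)
  then have "ebd T d \<beta>" by (simp add: ebd_def)
  from ebd_add[OF this wn] show ?thesis by (simp add: e[symmetric])
qed

text \<open>Subtracting the two error equations removes w, and n survives only with factors of order
  exp (- 2 l t), such as P - Q. The error \<delta> also enters with the factor P - Q. Against such a
  factor, subexponential growth costs an arbitrarily small part of the rate.\<close>

lemma filter_error_difference:
  assumes f0: "filter_error T P w n \<epsilon>" and f1: "filter_error T Q w n \<delta>"
    and P: "\<And>t. T \<le> t \<Longrightarrow> (P has_vector_derivative riccati a h (P t)) (at t within {T..})"
    and Q: "\<And>t. T \<le> t \<Longrightarrow> (Q has_vector_derivative riccati a h (Q t)) (at t within {T..})"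
    and DP: "ebd T (- (2 * l)) (\<lambda>t. P t - \<gamma>)" and DQ: "ebd T (- (2 * l)) (\<lambda>t. Q t - \<gamma>)" and l: "0 < l"
    and E: "\<And>t. 0 \<le> t \<Longrightarrow> norm (E t) \<le> C * exp (- l * t)"
    and cw: "continuous_on {T..} w" and cn: "continuous_on {T..} n" and cd: "continuous_on {T..} \<delta>"
    and w: "\<And>d. 0 < d \<Longrightarrow> ebd T d w" and n: "\<And>d. 0 < d \<Longrightarrow> ebd T d n" and k: "k < l"
  shows "((\<lambda>t. exp (k * t) *\<^sub>R (\<epsilon> t - \<delta> t)) \<longlongrightarrow> 0) at_top"
proof -
  \<comment> \<open>A positive rate strictly between \<open>k\<close> and \<open>l\<close>, whatever
    the sign of \<open>k\<close>. With d = l - q the forcing term decays at rate 2 l - d = l + q,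
    which is more than q.\<close>
  define q where "q = (max k 0 + l) / 2"
  have q: "0 < q" "k < q" "q < l" using k l by (auto simp: q_def max_def field_simps)
  define d where "d = l - q"
  have d: "0 < d" using q by (simp add: d_def)
  have rate: "- (2 * l) + d \<le> - q" using q by (simp add: d_def)
  note cP = continuous_on_Ici_derivative[OF P] note cQ = continuous_on_Ici_derivative[OF Q]
  have \<delta>: "ebd T d \<delta>" by (rule filter_error_growth[OF f1 Q DQ l E cw cn w[OF d] n[OF d] d])
  have PQ: "ebd T (- (2 * l)) (\<lambda>t. P t - Q t)" using ebd_diff[OF DP DQ] by simp
  have nd: "ebd T d n" by (rule n[OF d])
  have PQn: "ebd T (- (2 * l) + d) (\<lambda>t. ((P t - Q t) ** transpose h) *v n t)"
    using ebd_mv[OF ebd_mm[OF PQ ebd_const[of T "transpose h"]] nd] by simp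
  define \<eta> where "\<eta> t = (\<epsilon> t - \<delta> t) + ((P t - Q t) ** transpose h) *v n t" for t
  define \<phi> where "\<phi> t = ((riccati a h (P t) - riccati a h (Q t)) ** transpose h) *v n t
     - (A - (P t - \<gamma>) ** hh) *v (((P t - Q t) ** transpose h) *v n t) - ((P t - Q t) ** hh) *v \<delta> t" for t
  have ab: "A + - ((P t - \<gamma>) ** hh) = a - P t ** hh" for t
    unfolding A_eq by (simp add: matrix_bilinear)
  have ab': "A - ((P t - \<gamma>) ** hh) = a - P t ** hh" for t
    unfolding A_eq by (simp add: matrix_bilinear)
  have d\<eta>: "(\<eta> has_vector_derivative (A + - ((P t - \<gamma>) ** hh)) *v \<eta> t + \<phi> t) (at t within {T..})" if "T \<le> t" for t
  proof -
    have "((\<lambda>t. (\<epsilon> t - w t + (P t ** transpose h) *v n t) - (\<delta> t - w t + (Q t ** transpose h) *v n t)) has_vector_derivative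
       ((a - P t ** hh) *v \<epsilon> t + (riccati a h (P t) ** transpose h) *v n t)
       - ((a - Q t ** hh) *v \<delta> t + (riccati a h (Q t) ** transpose h) *v n t)) (at t within {T..})"
      using f0 f1 that unfolding filter_error_def by (intro has_vector_derivative_diff) blast+
    moreover have "(\<lambda>t. (\<epsilon> t - w t + (P t ** transpose h) *v n t) - (\<delta> t - w t + (Q t ** transpose h) *v n t)) = \<eta>"
      by (simp add: \<eta>_def fun_eq_iff matrix_bilinear)
    moreover have "((a - P t ** hh) *v \<epsilon> t + (riccati a h (P t) ** transpose h) *v n t)
       - ((a - Q t ** hh) *v \<delta> t + (riccati a h (Q t) ** transpose h) *v n t)
      = (A + - ((P t - \<gamma>) ** hh)) *v \<eta> t + \<phi> t"
      unfolding \<phi>_def ab ab' \<eta>_def by (simp add: matrix_bilinear algebra_simps)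
    ultimately show ?thesis by simp
  qed
  have "ebd T (- q) \<phi>" unfolding \<phi>_def
  proof (intro ebd_diff)
    show "ebd T (- q) (\<lambda>t. ((riccati a h (P t) - riccati a h (Q t)) ** transpose h) *v n t)"
      using ebd_mv[OF ebd_mm[OF ebd_diff[OF ebd_Pt(2)[OF DP l] ebd_Pt(2)[OF DQ l]] ebd_const[of T "transpose h"]] nd]
      by (rule ebd_mono) (use rate in auto)
    have D0: "ebd T 0 (\<lambda>t. P t - \<gamma>)" by (intro ebd_mono[OF DP]) (use l in auto)
    have "ebd T 0 (\<lambda>t. A - (P t - \<gamma>) ** hh)"
      using ebd_diff[OF ebd_const[of T A] ebd_mm[OF D0 ebd_const[of T hh], simplified]] by simp
    from ebd_mv[OF this PQn] show "ebd T (- q) (\<lambda>t. (A - (P t - \<gamma>) ** hh) *v (((P t - Q t) ** transpose h) *v n t))"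
      by (rule ebd_mono) (use rate in auto)
    from ebd_mv[OF ebd_mm[OF PQ ebd_const[of T hh]] \<delta>] show "ebd T (- q) (\<lambda>t. ((P t - Q t) ** hh) *v \<delta> t)"
      by (rule ebd_mono) (use rate in auto)
  qed
  then obtain C2 where C2: "\<And>t. T \<le> t \<Longrightarrow> norm (\<phi> t) \<le> C2 * exp (- q * t)" by (metis ebdE)
  have "ebd T (- (2 * l)) (\<lambda>t. - ((P t - \<gamma>) ** hh))"
    using ebd_minus[OF ebd_mm[OF DP ebd_const[of T hh]]] by simp
  then obtain C1 where C1: "\<And>t. T \<le> t \<Longrightarrow> norm (- ((P t - \<gamma>) ** hh)) \<le> C1 * exp (- (2 * l) * t)" by (metis ebdE)
  have "\<exists>C3. \<forall>t\<ge>T. norm (\<eta> t) \<le> C3 * exp (- q * t)"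
  proof (rule perturbed_linear_decay[OF d\<eta> _ _ E C1 C2])
    show "continuous_on {T..} (\<lambda>t. - ((P t - \<gamma>) ** hh))" by (intro continuous_intros cP)
    show "continuous_on {T..} \<phi>" unfolding \<phi>_def riccati_eq by (intro continuous_intros cP cQ cd cn)
  qed (use l q in auto)
  then have "ebd T (- q) \<eta>" by (simp add: ebd_def)
  from ebd_diff[OF this ebd_mono[OF PQn rate order_refl]]
  have "ebd T (- q) (\<lambda>t. \<epsilon> t - \<delta> t)" by (simp add: \<eta>_def)
  then show ?thesis by (rule ebd_tendsto) (rule q)
qed

text \<open>The innovation z - integral of h y equals n + integral of h (x - y), so the observations
  drop out and only the error and the noises are left. The differentiable part is then read off from
  the formula of integration by parts.\<close>

lemma filter_error_kalman:
  assumes P: "\<And>t. 0 \<le> t \<Longrightarrow> (P has_vector_derivative riccati a h (P t)) (at t within {0..})"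
    and cx: "continuous_on {0..} x" and cy: "continuous_on {0..} y" and cn: "continuous_on {0..} n"
    and x: "\<And>t. 0 \<le> t \<Longrightarrow> ((\<lambda>s. a *v x s) has_integral (x t - x 0 - w t)) {0..t}"
    and z: "\<And>t. 0 \<le> t \<Longrightarrow> ((\<lambda>s. h *v x s) has_integral (z t - n t)) {0..t}"
    and n0: "n 0 = 0"
    and y: "\<And>t. 0 \<le> t \<Longrightarrow> y t - \<mu> - integral {0..t} (\<lambda>s. a *v y s) =
        jint (*v) (\<lambda>s. P s ** transpose h) (\<lambda>s. riccati a h (P s) ** transpose h)
          (\<lambda>s. z s - integral {0..s} (\<lambda>r. h *v y r)) 0 t"
  shows "filter_error 0 P w n (\<lambda>t. x t - y t)"
  unfolding filter_error_def
proof (intro allI impI)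
  fix t :: real assume t: "0 \<le> t"
  define \<epsilon> where "\<epsilon> t = x t - y t" for t
  define I where "I t = integral {0..t} (\<lambda>s. h *v \<epsilon> s)" for t
  define J where "J t = integral {0..t} (\<lambda>s. a *v \<epsilon> s)" for t
  have cP: "continuous_on {0..} P" by (rule continuous_on_Ici_derivative[OF P])
  have ce: "continuous_on {0..} \<epsilon>" unfolding \<epsilon>_def by (intro continuous_intros cx cy)
  have cI: "continuous_on {0..} I" unfolding I_def by (intro continuous_on_integral_Ici continuous_intros ce)
  define R where "R s = riccati a h (P s) ** transpose h" for s
  have cR: "continuous_on {0..} R" unfolding R_def riccati_eq by (intro continuous_intros cP)
  have io: "(\<lambda>s. a *v f s) integrable_on {0..t}" "(\<lambda>s. h *v f s) integrable_on {0..t}"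
    if "continuous_on {0..} f" for f and t :: real
    by (intro integrable_continuous_real continuous_intros continuous_on_subset[OF that], auto)+
  have V: "z s - integral {0..s} (\<lambda>r. h *v y r) = n s + I s" if "0 \<le> s" for s
    using integral_unique[OF z[OF that]] unfolding I_def \<epsilon>_def
    by (simp add: matrix_bilinear integral_diff[OF io(2)[OF cx] io(2)[OF cy]])
  define B where "B t = x 0 - \<mu> + J t - (P t ** transpose h) *v I t + integral {0..t} (\<lambda>s. R s *v (n s + I s))" for t
  have be: "x t - y t - w t + (P t ** transpose h) *v n t = B t" if t: "0 \<le> t" for t
  proof -
    have "x t = x 0 + w t + integral {0..t} (\<lambda>s. a *v x s)" using integral_unique[OF x[OF t]] by simp
    moreover have "y t = \<mu> + integral {0..t} (\<lambda>s. a *v y s) + (P t ** transpose h) *v (n t + I t)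
        - integral {0..t} (\<lambda>s. R s *v (n s + I s))"
    proof -
      have "integral {0..t} (\<lambda>s. R s *v (z s - integral {0..s} (\<lambda>r. h *v y r))) = integral {0..t} (\<lambda>s. R s *v (n s + I s))"
        by (intro integral_cong) (simp add: V)
      then show ?thesis
        using y[OF t] V[OF t] V[of 0] n0 unfolding jint_def R_def[symmetric] by (simp add: I_def algebra_simps matrix_bilinear)
    qed
    moreover have "J t = integral {0..t} (\<lambda>s. a *v x s) - integral {0..t} (\<lambda>s. a *v y s)"
      unfolding J_def \<epsilon>_def by (simp add: matrix_bilinear integral_diff[OF io(1)[OF cx] io(1)[OF cy]])
    ultimately show ?thesis by (simp add: B_def matrix_bilinear)
  qed
  have dPh: "((\<lambda>t. P t ** transpose h) has_vector_derivative R t) (at t within {0..})"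
    using has_vector_derivative_mult_mm[OF P[OF t] has_vector_derivative_const[of "transpose h"]]
    by (simp add: R_def matrix_bilinear)
  have "(B has_vector_derivative (0 + a *v \<epsilon> t) - ((P t ** transpose h) *v (h *v \<epsilon> t) + R t *v I t) + R t *v (n t + I t)) (at t within {0..})"
    unfolding B_def I_def J_def
    by (intro has_vector_derivative_add has_vector_derivative_diff has_vector_derivative_const
        integral_has_vector_derivative_Ici[OF _ t] has_vector_derivative_mult_mv dPh t
        cI[unfolded I_def] cR cn ce continuous_intros)
  then have "(B has_vector_derivative (a - P t ** hh) *v \<epsilon> t + R t *v n t) (at t within {0..})"
    by (simp add: matrix_bilinear hh_def matrix_vector_mul_assoc matrix_mul_assoc algebra_simps)
  then show "((\<lambda>t. x t - y t - w t + (P t ** transpose h) *v n t) has_vector_derivative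
      (a - P t ** hh) *v (x t - y t) + (riccati a h (P t) ** transpose h) *v n t) (at t within {0..})"
    unfolding R_def \<epsilon>_def
    by (rule has_vector_derivative_transform[rotated 2]) (use be t in auto)
qed

text \<open>The way back from the integrated to the differential form: the combination to be
  differentiated equals Fi B, where B is a constant plus integrals of continuous functions.\<close>

lemma filter_error_fundamental:
  fixes T :: real and \<Delta> :: "real^'m^'m"
  defines "P \<equiv> \<lambda>t. Pt \<Delta> (t - T)" and "F \<equiv> \<lambda>t. Th \<Delta> (t - T)"
  defines "F' \<equiv> \<lambda>t. - (F t ** (a - P t ** hh))" and "G \<equiv> \<lambda>t. F t ** (P t ** transpose h)"
  defines "G' \<equiv> \<lambda>t. F t ** (riccati a h (P t) ** transpose h) + F' t ** (P t ** transpose h)"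
  assumes adm: "admissible \<Delta>" and cw: "continuous_on {T..} w" and cn: "continuous_on {T..} n"
    and e: "\<And>t. T \<le> t \<Longrightarrow> F t *v \<epsilon> t = F T *v \<epsilon> T + jint (*v) F F' w T t - jint (*v) G G' n T t"
  shows "filter_error T P w n \<epsilon>"
  unfolding filter_error_def
proof (intro allI impI)
  fix t :: real assume t: "T \<le> t"
  define Fi where "Fi t = Thi \<Delta> (t - T)" for t
  have P: "(P has_vector_derivative riccati a h (P t)) (at t within {T..})" if "T \<le> t" for t
    unfolding P_def by (rule has_vector_derivative_shift_Ici[OF Pt_derivative[OF adm]]) (use that in simp)
  have F: "(F has_vector_derivative F' t) (at t within {T..})" if "T \<le> t" for t
    unfolding F'_def F_def P_def by (rule has_vector_derivative_shift_Ici[OF Th_derivative[OF adm]]) (use that in simp)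
  have Fi: "(Fi has_vector_derivative (a - P t ** hh) ** Fi t) (at t within {T..})" if "T \<le> t" for t
    unfolding Fi_def P_def by (rule has_vector_derivative_shift_Ici[OF Thi_derivative[OF adm]]) (use that in simp)
  have inv: "Fi t ** F t = mat 1" "F t ** Fi t = mat 1" if "T \<le> t" for t
    using Th_inverse[OF adm, of "t - T"] that by (auto simp: Fi_def F_def)
  have cP: "continuous_on {T..} P" by (rule continuous_on_Ici_derivative[OF P])
  have cF: "continuous_on {T..} F" by (rule continuous_on_Ici_derivative[OF F])
  have cF': "continuous_on {T..} F'" unfolding F'_def by (intro continuous_intros cF cP)
  have cG': "continuous_on {T..} G'" unfolding G'_def riccati_eq by (intro continuous_intros cF cP cF')
  define c where "c = F T *v \<epsilon> T - F T *v w T + G T *v n T"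
  define B where "B t = c - integral {T..t} (\<lambda>s. F' s *v w s) + integral {T..t} (\<lambda>s. G' s *v n s)" for t
  have be: "\<epsilon> t - w t + (P t ** transpose h) *v n t = Fi t *v B t" if t: "T \<le> t" for t
  proof -
    have "F t *v (\<epsilon> t - w t + (P t ** transpose h) *v n t) = B t"
      using e[OF t] by (simp add: jint_def B_def c_def G_def matrix_bilinear matrix_vector_mul_assoc algebra_simps)
    then have "Fi t *v B t = (Fi t ** F t) *v (\<epsilon> t - w t + (P t ** transpose h) *v n t)"
      by (simp add: matrix_vector_mul_assoc[symmetric])
    then show ?thesis by (simp add: inv t)
  qed
  have dB: "(B has_vector_derivative (0 - F' t *v w t) + G' t *v n t) (at t within {T..})"
    unfolding B_def
    by (intro has_vector_derivative_add has_vector_derivative_diff has_vector_derivative_const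
        integral_has_vector_derivative_Ici[OF _ t] cF' cG' cn cw continuous_intros)
  have "((\<lambda>t. Fi t *v B t) has_vector_derivative Fi t *v ((0 - F' t *v w t) + G' t *v n t) + ((a - P t ** hh) ** Fi t) *v B t) (at t within {T..})"
    by (rule has_vector_derivative_mult_mv[OF Fi[OF t] dB])
  moreover have "Fi t *v ((0 - F' t *v w t) + G' t *v n t) + ((a - P t ** hh) ** Fi t) *v B t
     = (a - P t ** hh) *v \<epsilon> t + (riccati a h (P t) ** transpose h) *v n t"
  proof -
    let ?L = "a - P t ** hh"
    have 1: "Fi t *v (F' t *v w t) = - (?L *v w t)"
      by (simp add: F'_def matrix_vector_mul_assoc matrix_bilinear(5,6) matrix_mul_assoc inv t del: matrix_bilinear(3,4)) (simp add: matrix_bilinear)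
    have 2: "Fi t *v (G' t *v n t) = (riccati a h (P t) ** transpose h) *v n t - ?L *v ((P t ** transpose h) *v n t)"
    proof -
      have "Fi t ** G' t = (Fi t ** F t) ** (riccati a h (P t) ** transpose h) - (Fi t ** F t) ** (?L ** (P t ** transpose h))"
        unfolding G'_def F'_def by (simp add: matrix_bilinear matrix_mul_assoc)
      then have "Fi t ** G' t = riccati a h (P t) ** transpose h - ?L ** (P t ** transpose h)" by (simp add: inv t)
      then show ?thesis by (simp add: matrix_vector_mul_assoc) (simp add: matrix_bilinear(11) matrix_vector_mul_assoc)
    qed
    have 3: "(?L ** Fi t) *v B t = ?L *v (\<epsilon> t - w t + (P t ** transpose h) *v n t)"
      by (simp add: be[OF t] matrix_vector_mul_assoc)
    show ?thesis unfolding 3 by (simp add: matrix_bilinear(9-14) 1 2)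
  qed
  ultimately have "((\<lambda>t. Fi t *v B t) has_vector_derivative
      (a - P t ** hh) *v \<epsilon> t + (riccati a h (P t) ** transpose h) *v n t) (at t within {T..})" by simp
  then show "((\<lambda>t. \<epsilon> t - w t + (P t ** transpose h) *v n t) has_vector_derivative
      (a - P t ** hh) *v \<epsilon> t + (riccati a h (P t) ** transpose h) *v n t) (at t within {T..})"
    by (rule has_vector_derivative_transform[rotated 2]) (use be t in auto)
qed

text \<open>The observed part of \<open>F t *v x t\<close>: the remainder is the right-hand side of the error equation.\<close>

lemma signal_decomposition:
  fixes T :: real and \<Delta> :: "real^'m^'m"
  defines "P \<equiv> \<lambda>t. Pt \<Delta> (t - T)" and "F \<equiv> \<lambda>t. Th \<Delta> (t - T)"
  defines "F' \<equiv> \<lambda>t. - (F t ** (a - P t ** hh))" and "G \<equiv> \<lambda>t. F t ** (P t ** transpose h)"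
  defines "G' \<equiv> \<lambda>t. F t ** (riccati a h (P t) ** transpose h) + F' t ** (P t ** transpose h)"
  assumes adm: "admissible \<Delta>" and cw: "continuous_on {T..} w" and cn: "continuous_on {T..} n"
    and cx: "continuous_on {T..} x" and cz: "continuous_on {T..} z"
    and x: "\<And>t. T \<le> t \<Longrightarrow> ((\<lambda>t. x t - w t) has_vector_derivative a *v x t) (at t within {T..})"
    and z: "\<And>t. T \<le> t \<Longrightarrow> ((\<lambda>t. z t - n t) has_vector_derivative h *v x t) (at t within {T..})"
    and t: "T \<le> t"
  shows "F t *v x t = F T *v x T + jint (*v) F F' w T t - jint (*v) G G' n T t + jint (*v) G G' z T t"
proof -
  have P: "(P has_vector_derivative riccati a h (P t)) (at t within {T..})" if "T \<le> t" for t
    unfolding P_def by (rule has_vector_derivative_shift_Ici[OF Pt_derivative[OF adm]]) (use that in simp)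
  have F: "(F has_vector_derivative F' t) (at t within {T..})" if "T \<le> t" for t
    unfolding F'_def F_def P_def by (rule has_vector_derivative_shift_Ici[OF Th_derivative[OF adm]]) (use that in simp)
  have cP: "continuous_on {T..} P" by (rule continuous_on_Ici_derivative[OF P])
  have cF: "continuous_on {T..} F" by (rule continuous_on_Ici_derivative[OF F])
  have cF': "continuous_on {T..} F'" unfolding F'_def by (intro continuous_intros cF cP)
  have cG': "continuous_on {T..} G'" unfolding G'_def riccati_eq by (intro continuous_intros cF cP cF')
  have G: "(G has_vector_derivative G' t) (at t within {T..})" if t: "T \<le> t" for t
    unfolding G_def G'_def
    using has_vector_derivative_mult_mm[OF F[OF t] has_vector_derivative_mult_mm[OF P[OF t] has_vector_derivative_const[of "transpose h"]]]
    by (simp add: matrix_bilinear)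
  define Q where "Q t = F t *v (x t - w t) + integral {T..t} (\<lambda>s. F' s *v w s)
     - (G t *v (z t - n t) - integral {T..t} (\<lambda>s. G' s *v (z s - n s)))" for t
  have "(Q has_vector_derivative (F t *v (a *v x t) + F' t *v (x t - w t)) + F' t *v w t
     - ((G t *v (h *v x t) + G' t *v (z t - n t)) - G' t *v (z t - n t))) (at t within {T..})" if t: "T \<le> t" for t
    unfolding Q_def
    by (intro has_vector_derivative_add has_vector_derivative_diff has_vector_derivative_mult_mv F G x z t
        integral_has_vector_derivative_Ici[OF _ t] continuous_intros cF' cG' cw cz cn)
  moreover have "(F t *v (a *v x t) + F' t *v (x t - w t)) + F' t *v w t
     - ((G t *v (h *v x t) + G' t *v (z t - n t)) - G' t *v (z t - n t)) = 0" for t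
  proof -
    have "F' t *v x t = - (F t *v (a *v x t)) + G t *v (h *v x t)"
      unfolding F'_def G_def hh_def by (simp add: matrix_bilinear matrix_vector_mul_assoc matrix_mul_assoc)
    then show ?thesis by (simp add: matrix_bilinear(9-14))
  qed
  ultimately have Q: "Q t = Q T" using t by (intro Ici_derivative_zero) simp_all
  have I: "integral {T..t} (\<lambda>s. G' s *v (z s - n s)) = integral {T..t} (\<lambda>s. G' s *v z s) - integral {T..t} (\<lambda>s. G' s *v n s)"
    unfolding matrix_bilinear(12)
    by (intro integral_diff integrable_continuous_real continuous_intros)
      (auto intro: continuous_on_subset[OF cG'] continuous_on_subset[OF cz] continuous_on_subset[OF cn])
  show ?thesis using Q unfolding Q_def I by (simp add: jint_def matrix_bilinear algebra_simps)
qed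

end

text \<open>Observations contain the time integral of the state, so covariances with them require
  that integral, like the state itself, as an integral against w. Both formulas come from a quantity
  whose derivative vanishes on the interval.\<close>

lemma state_representation:
  fixes a :: "real^'m^'m" and h :: "real^'m^'n"
  defines "K \<equiv> \<lambda>u. integral {0..u} (mexp a)"
  assumes cw: "continuous_on {T..s} w" and cx: "continuous_on {T..s} x" and Ts: "T \<le> s"
    and x: "\<And>t. t \<in> {T..s} \<Longrightarrow> ((\<lambda>t. x t - w t) has_vector_derivative a *v x t) (at t within {T..s})"
  shows "x s = mexp a (s - T) *v x T + jint (*v) (\<lambda>r. mexp a (s - r)) (\<lambda>r. - (mexp a (s - r) ** a)) w T s"
    and "integral {T..s} x = K (s - T) *v x T + jint (*v) (\<lambda>r. K (s - r)) (\<lambda>r. - mexp a (s - r)) w T s"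
    and "\<And>r. r \<in> {T..s} \<Longrightarrow> ((\<lambda>r. K (s - r)) has_vector_derivative - mexp a (s - r)) (at r within {T..s})"
    and "K 0 = 0" and "\<And>u. 0 \<le> u \<Longrightarrow> a ** K u = mexp a u - mat 1" and "\<And>u. 0 \<le> u \<Longrightarrow> K u ** a = mexp a u - mat 1"
proof -
  show K0: "K 0 = 0" by (simp add: K_def)
  have ce: "continuous_on S (mexp a)" for S by (intro continuous_intros)
  have dK: "(K has_vector_derivative mexp a u) (at u within {0..})" if "0 \<le> u" for u
    unfolding K_def by (rule integral_has_vector_derivative_Ici[OF ce that])
  have aK: "a ** K u = mexp a u - mat 1" if u: "0 \<le> u" for u
  proof -
    have "((\<lambda>u. a ** K u - mexp a u) has_vector_derivative (a ** mexp a u + 0 ** K u) - a ** mexp a u) (at u within {0..})" if "0 \<le> u" for u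
      by (intro has_vector_derivative_diff has_vector_derivative_mult_mm has_vector_derivative_const dK that mexp_has_vector_derivative_left)
    then have "a ** K u - mexp a u = a ** K 0 - mexp a 0"
      using u by (intro Ici_derivative_zero) (simp_all add: matrix_bilinear)
    then show ?thesis by (simp add: K0 matrix_bilinear algebra_simps)
  qed
  then show "\<And>u. 0 \<le> u \<Longrightarrow> a ** K u = mexp a u - mat 1" by blast
  show Ka: "K u ** a = mexp a u - mat 1" if u: "0 \<le> u" for u
  proof -
    have "((\<lambda>u. K u ** a - mexp a u) has_vector_derivative (K u ** 0 + mexp a u ** a) - mexp a u ** a) (at u within {0..})" if "0 \<le> u" for u
      by (intro has_vector_derivative_diff has_vector_derivative_mult_mm has_vector_derivative_const dK that mexp_has_vector_derivative_right)
    then have "K u ** a - mexp a u = K 0 ** a - mexp a 0"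
      using u by (intro Ici_derivative_zero) (simp_all add: matrix_bilinear)
    then show ?thesis by (simp add: K0 matrix_bilinear algebra_simps)
  qed
  have rd: "((\<lambda>r. s - r) has_real_derivative -1) (at r within S)" for r S by (auto intro!: derivative_eq_intros)
  show dKs: "((\<lambda>r. K (s - r)) has_vector_derivative - mexp a (s - r)) (at r within {T..s})" if r: "r \<in> {T..s}" for r
  proof -
    have "(K has_vector_derivative mexp a (s - r)) (at (s - r) within (\<lambda>r. s - r) ` {T..s})"
      by (rule has_vector_derivative_within_subset[OF dK]) (use r in auto)
    from vector_diff_chain_within[OF rd[unfolded has_real_derivative_iff_has_vector_derivative] this]
    show ?thesis by (simp add: o_def)
  qed
  have dEs: "((\<lambda>r. mexp a (s - r)) has_vector_derivative - (mexp a (s - r) ** a)) (at r within S)" for r S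
    using mexp_has_vector_derivative_right_compose[OF rd] by simp
  have cK: "continuous_on {T..s} (\<lambda>r. K (s - r))" by (rule continuous_on_vector_derivative[OF dKs])
  have zero: "f s = f T" if fz: "\<And>r. r \<in> {T..s} \<Longrightarrow> (f has_vector_derivative 0) (at r within {T..s})" for f :: "real \<Rightarrow> real^'m"
  proof -
    obtain c where "\<And>t. t \<in> {T..s} \<Longrightarrow> f t = c"
      using fz by (rule has_vector_derivative_zero_constant[of "{T..s}" f, rotated]) auto
    then show ?thesis using Ts by simp
  qed
  let ?E = "\<lambda>r. mexp a (s - r)" and ?E' = "\<lambda>r. - (mexp a (s - r) ** a)"
  have "?E s *v (x s - w s) + integral {T..s} (\<lambda>r. ?E' r *v w r) = ?E T *v (x T - w T) + integral {T..T} (\<lambda>r. ?E' r *v w r)"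
  proof (rule zero)
    fix r assume r: "r \<in> {T..s}"
    have "((\<lambda>r. ?E r *v (x r - w r) + integral {T..r} (\<lambda>r. ?E' r *v w r)) has_vector_derivative
       (?E r *v (a *v x r) + ?E' r *v (x r - w r)) + ?E' r *v w r) (at r within {T..s})"
      by (intro has_vector_derivative_add has_vector_derivative_mult_mv dEs x r integral_has_vector_derivative continuous_intros cw)
    then show "((\<lambda>r. ?E r *v (x r - w r) + integral {T..r} (\<lambda>r. ?E' r *v w r)) has_vector_derivative 0) (at r within {T..s})"
      by (simp add: matrix_bilinear matrix_vector_mul_assoc)
  qed
  then show "x s = mexp a (s - T) *v x T + jint (*v) ?E ?E' w T s"
    by (simp add: jint_def matrix_bilinear algebra_simps)
  let ?K' = "\<lambda>r. - mexp a (s - r)"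
  have "K (s - s) *v (x s - w s) + integral {T..s} (\<lambda>r. ?K' r *v w r) + integral {T..s} x
     = K (s - T) *v (x T - w T) + integral {T..T} (\<lambda>r. ?K' r *v w r) + integral {T..T} x"
  proof (rule zero)
    fix r assume r: "r \<in> {T..s}"
    have "((\<lambda>r. K (s - r) *v (x r - w r) + integral {T..r} (\<lambda>r. ?K' r *v w r) + integral {T..r} x) has_vector_derivative
       (K (s - r) *v (a *v x r) + ?K' r *v (x r - w r)) + ?K' r *v w r + x r) (at r within {T..s})"
      by (intro has_vector_derivative_add has_vector_derivative_mult_mv dKs x r integral_has_vector_derivative continuous_intros cw cx)
    moreover have "(K (s - r) *v (a *v x r) + ?K' r *v (x r - w r)) + ?K' r *v w r + x r = 0"
      using Ka[of "s - r"] r by (simp add: matrix_vector_mul_assoc) (simp add: matrix_bilinear)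
    ultimately show "((\<lambda>r. K (s - r) *v (x r - w r) + integral {T..r} (\<lambda>r. ?K' r *v w r) + integral {T..r} x) has_vector_derivative 0) (at r within {T..s})"
      by simp
  qed
  then show "integral {T..s} x = K (s - T) *v x T + jint (*v) (\<lambda>r. K (s - r)) ?K' w T s"
    by (simp add: jint_def matrix_bilinear K0 algebra_simps)
qed

section \<open>Square-integrable random variables\<close>

context prob_space
begin

definition sqi :: "('a \<Rightarrow> real) \<Rightarrow> bool" where
  "sqi f \<longleftrightarrow> f \<in> borel_measurable M \<and> integrable M (\<lambda>w. (f w)\<^sup>2)"

lemma sqi_measurable [measurable_dest]: "sqi f \<Longrightarrow> f \<in> borel_measurable M" by (simp add: sqi_def)

lemma sqi_const [simp]: "sqi (\<lambda>w. c)" by (simp add: sqi_def)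

lemma integrable_sqi_mult: assumes "sqi f" "sqi g" shows "integrable M (\<lambda>w. f w * g w)"
proof (rule Bochner_Integration.integrable_bound)
  show "integrable M (\<lambda>w. (f w)\<^sup>2 + (g w)\<^sup>2)" using assms by (auto simp: sqi_def)
  show "(\<lambda>w. f w * g w) \<in> borel_measurable M" using assms by (auto simp: sqi_def)
  have "\<bar>x * y\<bar> \<le> \<bar>x\<^sup>2 + y\<^sup>2\<bar>" for x y :: real
  proof -
    have "0 \<le> (\<bar>x\<bar> - \<bar>y\<bar>)\<^sup>2" by simp
    then have "2 * (\<bar>x\<bar> * \<bar>y\<bar>) \<le> x\<^sup>2 + y\<^sup>2" by (simp add: power2_diff)
    moreover have "0 \<le> \<bar>x\<bar> * \<bar>y\<bar>" by simp
    ultimately have "\<bar>x\<bar> * \<bar>y\<bar> \<le> x\<^sup>2 + y\<^sup>2" by linarith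
    then show ?thesis by (simp add: abs_mult)
  qed
  then show "AE w in M. norm (f w * g w) \<le> norm ((f w)\<^sup>2 + (g w)\<^sup>2)" by simp
qed

lemma integrable_sqi: "sqi f \<Longrightarrow> integrable M f"
  using integrable_sqi_mult[of f "\<lambda>_. 1"] by simp

lemma integrable_sqi_power2: "sqi f \<Longrightarrow> integrable M (\<lambda>w. (f w)\<^sup>2)" by (simp add: sqi_def)

lemma sqi_add: assumes "sqi f" "sqi g" shows "sqi (\<lambda>w. f w + g w)"
  using integrable_sqi_mult[OF assms] assms
  by (auto simp: sqi_def power2_sum mult.assoc intro!: Bochner_Integration.integrable_add)

lemma sqi_cmult: "sqi f \<Longrightarrow> sqi (\<lambda>w. c * f w)" by (auto simp: sqi_def power_mult_distrib)

lemma sqi_diff: "sqi f \<Longrightarrow> sqi g \<Longrightarrow> sqi (\<lambda>w. f w - g w)"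
  using sqi_add[of f "\<lambda>w. -1 * g w"] sqi_cmult[of g "-1"] by simp

lemma sqi_AE: "sqi f \<Longrightarrow> g \<in> borel_measurable M \<Longrightarrow> (AE w in M. f w = g w) \<Longrightarrow> sqi g"
  unfolding sqi_def by (auto intro: integrable_cong_AE_imp)

text \<open>The squared L2 distance; without the root the triangle inequality costs a factor 2,
  which is harmless for limits.\<close>

definition sqd :: "('a \<Rightarrow> real) \<Rightarrow> ('a \<Rightarrow> real) \<Rightarrow> real" where
  "sqd f g = (\<integral>w. (f w - g w)\<^sup>2 \<partial>M)"

lemma sqd_nonneg [simp]: "0 \<le> sqd f g" by (simp add: sqd_def)

lemma sqd_triangle: assumes "sqi f" "sqi g" "sqi h" shows "sqd f h \<le> 2 * sqd f g + 2 * sqd g h"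
proof -
  have "sqd f h \<le> (\<integral>w. 2 * (f w - g w)\<^sup>2 + 2 * (g w - h w)\<^sup>2 \<partial>M)"
    unfolding sqd_def
  proof (rule integral_mono)
    show "integrable M (\<lambda>w. (f w - h w)\<^sup>2)" by (intro integrable_sqi_power2 sqi_diff assms)
    show "integrable M (\<lambda>w. 2 * (f w - g w)\<^sup>2 + 2 * (g w - h w)\<^sup>2)"
      by (intro Bochner_Integration.integrable_add integrable_mult_right integrable_sqi_power2 sqi_diff assms)
    fix w
    have "0 \<le> ((f w - g w) - (g w - h w))\<^sup>2" by simp
    then show "(f w - h w)\<^sup>2 \<le> 2 * (f w - g w)\<^sup>2 + 2 * (g w - h w)\<^sup>2"
      by (simp add: power2_eq_square algebra_simps)
  qed
  also have "\<dots> = 2 * sqd f g + 2 * sqd g h"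
    unfolding sqd_def using assms by (simp add: integrable_sqi_power2 sqi_diff)
  finally show ?thesis .
qed

lemma sqi_cauchy_schwarz:
  assumes "sqi f" "sqi g"
  shows "(\<integral>w. f w * g w \<partial>M)\<^sup>2 \<le> (\<integral>w. (f w)\<^sup>2 \<partial>M) * (\<integral>w. (g w)\<^sup>2 \<partial>M)"
proof (rule quadratic_discriminant)
  fix s
  have "(\<integral>w. (f w + s * g w)\<^sup>2 \<partial>M) = (\<integral>w. (f w)\<^sup>2 + (2 * s) * (f w * g w) + s\<^sup>2 * (g w)\<^sup>2 \<partial>M)"
    by (intro Bochner_Integration.integral_cong refl) (simp add: power2_eq_square algebra_simps)
  also have "\<dots> = (\<integral>w. (f w)\<^sup>2 \<partial>M) + 2 * s * (\<integral>w. f w * g w \<partial>M) + s\<^sup>2 * (\<integral>w. (g w)\<^sup>2 \<partial>M)"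
    using assms integrable_sqi_mult[OF assms]
    by (simp add: integrable_sqi_power2 Bochner_Integration.integral_add)
  finally have eq: "(\<integral>w. (f w + s * g w)\<^sup>2 \<partial>M) = \<dots>" .
  show "0 \<le> (\<integral>w. (f w)\<^sup>2 \<partial>M) + 2 * s * (\<integral>w. f w * g w \<partial>M) + s\<^sup>2 * (\<integral>w. (g w)\<^sup>2 \<partial>M)"
    unfolding eq[symmetric] by simp
qed simp

lemma tendsto_expectation_mult:
  assumes f: "\<And>n. sqi (fs n)" "sqi f" and lim: "(\<lambda>n. sqd f (fs n)) \<longlonglongrightarrow> 0" and g: "sqi g"
  shows "(\<lambda>n. \<integral>w. fs n w * g w \<partial>M) \<longlonglongrightarrow> (\<integral>w. f w * g w \<partial>M)"
proof (rule LIM_zero_cancel, rule Lim_null_comparison)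
  show "\<forall>\<^sub>F n in sequentially. norm ((\<integral>w. fs n w * g w \<partial>M) - (\<integral>w. f w * g w \<partial>M))
      \<le> sqrt (sqd f (fs n) * (\<integral>w. (g w)\<^sup>2 \<partial>M))"
  proof (rule always_eventually, rule allI)
    fix n
    have "(\<integral>w. fs n w * g w \<partial>M) - (\<integral>w. f w * g w \<partial>M) = - (\<integral>w. (f w - fs n w) * g w \<partial>M)"
      using integrable_sqi_mult[OF f(1) g, of n] integrable_sqi_mult[OF f(2) g]
      by (simp add: left_diff_distrib)
    moreover have "(\<integral>w. (f w - fs n w) * g w \<partial>M)\<^sup>2 \<le> sqd f (fs n) * (\<integral>w. (g w)\<^sup>2 \<partial>M)"
      unfolding sqd_def by (intro sqi_cauchy_schwarz sqi_diff f g)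
    ultimately show "norm ((\<integral>w. fs n w * g w \<partial>M) - (\<integral>w. f w * g w \<partial>M))
      \<le> sqrt (sqd f (fs n) * (\<integral>w. (g w)\<^sup>2 \<partial>M))"
      by (simp add: real_le_rsqrt)
  qed
  show "(\<lambda>n. sqrt (sqd f (fs n) * (\<integral>w. (g w)\<^sup>2 \<partial>M))) \<longlonglongrightarrow> 0"
    using tendsto_real_sqrt[OF tendsto_mult_left_zero[OF lim]] by simp
qed

lemma tendsto_expectation:
  assumes "\<And>n. sqi (fs n)" "sqi f" "(\<lambda>n. sqd f (fs n)) \<longlonglongrightarrow> 0"
  shows "(\<lambda>n. \<integral>w. fs n w \<partial>M) \<longlonglongrightarrow> (\<integral>w. f w \<partial>M)"
  using tendsto_expectation_mult[OF assms, of "\<lambda>_. 1"] by simp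

lemma tendsto_expectation_mult2:
  assumes f: "\<And>n. sqi (fs n)" "sqi f" and lf: "(\<lambda>n. sqd f (fs n)) \<longlonglongrightarrow> 0"
    and g: "\<And>n. sqi (gs n)" "sqi g" and lg: "(\<lambda>n. sqd g (gs n)) \<longlonglongrightarrow> 0"
  shows "(\<lambda>n. \<integral>w. fs n w * gs n w \<partial>M) \<longlonglongrightarrow> (\<integral>w. f w * g w \<partial>M)"
proof -
  have e: "(\<integral>w. fs n w * gs n w \<partial>M) = (\<integral>w. (f w - fs n w) * (g w - gs n w) \<partial>M)
     + (\<integral>w. fs n w * g w \<partial>M) + (\<integral>w. gs n w * f w \<partial>M) - (\<integral>w. f w * g w \<partial>M)" for n
  proof -
    have "(\<integral>w. fs n w * gs n w \<partial>M) = (\<integral>w. (f w - fs n w) * (g w - gs n w) + fs n w * g w + gs n w * f w - f w * g w \<partial>M)"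
      by (intro Bochner_Integration.integral_cong refl) (simp add: algebra_simps)
    then show ?thesis
      using integrable_sqi_mult[OF sqi_diff[OF f(2) f(1)[of n]] sqi_diff[OF g(2) g(1)[of n]]]
        integrable_sqi_mult[OF f(1)[of n] g(2)] integrable_sqi_mult[OF g(1)[of n] f(2)] integrable_sqi_mult[OF f(2) g(2)]
      by simp
  qed
  have "(\<lambda>n. \<integral>w. (f w - fs n w) * (g w - gs n w) \<partial>M) \<longlonglongrightarrow> 0"
  proof (rule Lim_null_comparison)
    show "\<forall>\<^sub>F n in sequentially. norm (\<integral>w. (f w - fs n w) * (g w - gs n w) \<partial>M) \<le> sqrt (sqd f (fs n) * sqd g (gs n))"
      unfolding sqd_def
      by (rule always_eventually) (auto intro!: real_le_rsqrt sqi_cauchy_schwarz sqi_diff f g)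
    show "(\<lambda>n. sqrt (sqd f (fs n) * sqd g (gs n))) \<longlonglongrightarrow> 0"
      using tendsto_real_sqrt[OF tendsto_mult[OF lf lg]] by simp
  qed
  from tendsto_diff[OF tendsto_add[OF tendsto_add[OF this tendsto_expectation_mult[OF f lf g(2)]]
      tendsto_expectation_mult[OF g lg f(2)]] tendsto_const[of "\<integral>w. f w * g w \<partial>M"]]
  show ?thesis unfolding e[abs_def] by (simp add: mult.commute)
qed

text \<open>Fatou's lemma, as j grows, in the distances from \<open>Ys j\<close> to
  \<open>Ys n\<close>: the pointwise limit is within e of every late term.\<close>

lemma sqi_limit:
  assumes Y: "\<And>n. sqi (Ys n)" and Ym: "Y \<in> borel_measurable M"
    and ae: "AE w in M. (\<lambda>n. Ys n w) \<longlonglongrightarrow> Y w"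
    and cauchy: "\<And>e. e > 0 \<Longrightarrow> \<exists>N. \<forall>i\<ge>N. \<forall>j\<ge>N. sqd (Ys i) (Ys j) < e"
  shows "sqi Y" "(\<lambda>n. sqd Y (Ys n)) \<longlonglongrightarrow> 0"
proof -
  note [measurable] = Ym sqi_measurable[OF Y]
  have bound: "integrable M (\<lambda>w. (Y w - Ys n w)\<^sup>2) \<and> sqd Y (Ys n) \<le> e"
    if e: "e > 0" and N: "\<And>j. j \<ge> N \<Longrightarrow> sqd (Ys j) (Ys n) < e" for e N n
  proof -
    have "(\<integral>\<^sup>+w. ennreal ((Y w - Ys n w)\<^sup>2) \<partial>M) = (\<integral>\<^sup>+w. liminf (\<lambda>j. ennreal ((Ys j w - Ys n w)\<^sup>2)) \<partial>M)"
    proof (rule nn_integral_cong_AE, use ae in eventually_elim)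
      fix w assume "(\<lambda>n. Ys n w) \<longlonglongrightarrow> Y w"
      then have "(\<lambda>j. ennreal ((Ys j w - Ys n w)\<^sup>2)) \<longlonglongrightarrow> ennreal ((Y w - Ys n w)\<^sup>2)"
        by (intro tendsto_intros) auto
      then show "ennreal ((Y w - Ys n w)\<^sup>2) = liminf (\<lambda>j. ennreal ((Ys j w - Ys n w)\<^sup>2))"
        by (rule lim_imp_Liminf[symmetric, rotated]) simp
    qed
    also have "\<dots> \<le> liminf (\<lambda>j. \<integral>\<^sup>+w. ennreal ((Ys j w - Ys n w)\<^sup>2) \<partial>M)"
      by (rule nn_integral_liminf) measurable
    also have "\<dots> \<le> ennreal e"
    proof (rule Liminf_le)
      show "\<forall>\<^sub>F j in sequentially. (\<integral>\<^sup>+w. ennreal ((Ys j w - Ys n w)\<^sup>2) \<partial>M) \<le> ennreal e"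
        using eventually_ge_at_top[of N]
      proof eventually_elim
        case (elim j)
        have "(\<integral>\<^sup>+w. ennreal ((Ys j w - Ys n w)\<^sup>2) \<partial>M) = ennreal (sqd (Ys j) (Ys n))"
          unfolding sqd_def by (intro nn_integral_eq_integral integrable_sqi_power2 sqi_diff Y) auto
        then show ?case using N[OF elim] by (simp add: ennreal_leI)
      qed
    qed simp
    finally have le: "(\<integral>\<^sup>+w. ennreal ((Y w - Ys n w)\<^sup>2) \<partial>M) \<le> ennreal e" .
    then have int: "integrable M (\<lambda>w. (Y w - Ys n w)\<^sup>2)"
      by (intro integrableI_nonneg) (auto intro: le_less_trans)
    moreover have "sqd Y (Ys n) \<le> e"
      using le nn_integral_eq_integral[OF int] e by (simp add: sqd_def)
    ultimately show ?thesis by simp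
  qed
  obtain N where "\<And>j. j \<ge> N \<Longrightarrow> sqd (Ys j) (Ys N) < 1" using cauchy[of 1] by auto
  from bound[OF _ this] have "sqi (\<lambda>w. Y w - Ys N w)" by (simp add: sqi_def)
  from sqi_add[OF this Y[of N]] show "sqi Y" by simp
  show "(\<lambda>n. sqd Y (Ys n)) \<longlonglongrightarrow> 0"
  proof (rule LIMSEQ_I)
    fix r :: real assume r: "0 < r"
    obtain N where N: "\<And>i j. i \<ge> N \<Longrightarrow> j \<ge> N \<Longrightarrow> sqd (Ys i) (Ys j) < r / 2" using cauchy[of "r/2"] r by auto
    have "sqd Y (Ys n) \<le> r / 2" if "n \<ge> N" for n
      using bound[of "r/2" N n] N[OF _ that] r by auto
    then show "\<exists>no. \<forall>n\<ge>no. norm (sqd Y (Ys n) - 0) < r" using r by (intro exI[of _ N]) force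
  qed
qed

section \<open>Gaussian spaces\<close>

text \<open>The linear span of S and the constants, as a set of functions rather than of classes
  modulo null sets, so that measurability with respect to a sub-sigma-algebra keeps its exact
  meaning.\<close>

inductive_set lsp :: "('a \<Rightarrow> real) set \<Rightarrow> ('a \<Rightarrow> real) set" for S where
  lsp_const: "(\<lambda>w. c) \<in> lsp S"
| lsp_step: "f \<in> lsp S \<Longrightarrow> s \<in> S \<Longrightarrow> (\<lambda>w. f w + c * s w) \<in> lsp S"

lemma lsp_base: "s \<in> S \<Longrightarrow> s \<in> lsp S"
  using lsp_step[OF lsp_const[of 0], of s S 1] by simp

lemma lsp_add: "f \<in> lsp S \<Longrightarrow> g \<in> lsp S \<Longrightarrow> (\<lambda>w. f w + g w) \<in> lsp S"
proof (induction f rule: lsp.induct)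
  case (lsp_const c)
  then show ?case
  proof (induction g rule: lsp.induct)
    case (lsp_step g s d)
    then show ?case using lsp.lsp_step[of "\<lambda>w. c + g w" S s d] by (simp add: add.assoc)
  qed (rule lsp.lsp_const)
next
  case (lsp_step f s c)
  then show ?case using lsp.lsp_step[of "\<lambda>w. f w + g w" S s c] by (simp add: add.assoc add.commute add.left_commute)
qed

lemma lsp_cmult: "f \<in> lsp S \<Longrightarrow> (\<lambda>w. c * f w) \<in> lsp S"
proof (induction f rule: lsp.induct)
  case (lsp_step f s d)
  then show ?case using lsp.lsp_step[of "\<lambda>w. c * f w" S s "c * d"] by (simp add: distrib_left mult.assoc)
qed (rule lsp_const)

lemma lsp_closed:
  assumes "f \<in> lsp V" "\<And>c. Q (\<lambda>w. c)" "\<And>f g. Q f \<Longrightarrow> Q g \<Longrightarrow> Q (\<lambda>w. f w + g w)"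
    "\<And>c f. Q f \<Longrightarrow> Q (\<lambda>w. c * f w)" "\<And>v. v \<in> V \<Longrightarrow> Q v"
  shows "Q f"
  using assms(1)
proof induction
  case (lsp_step f s c)
  show ?case by (rule assms(3)[OF lsp_step.IH assms(4)[OF assms(5)[OF lsp_step.hyps(2)]]])
qed (rule assms(2))

text \<open>The L2 closure of the span. It contains every measurable version of its members, which
  is how pathwise expressions enter it.\<close>

definition gcl :: "('a \<Rightarrow> real) set \<Rightarrow> ('a \<Rightarrow> real) set" where
  "gcl S = {f. sqi f \<and> (\<forall>e>0. \<exists>g\<in>lsp S. sqd f g < e)}"

lemma gcl_sqi: "f \<in> gcl S \<Longrightarrow> sqi f" by (simp add: gcl_def)

context
  fixes S assumes sqi_ball: "\<forall>s\<in>S. sqi s"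
begin

lemma lsp_sqi: "f \<in> lsp S \<Longrightarrow> sqi f"
  by (erule lsp_closed) (use sqi_ball in \<open>auto intro: sqi_add sqi_cmult\<close>)

lemma lsp_gcl: "f \<in> lsp S \<Longrightarrow> f \<in> gcl S"
  using lsp_sqi by (auto simp: gcl_def sqd_def intro!: bexI[of _ f])

lemma gcl_limit:
  assumes "\<And>n. fs n \<in> gcl S" "sqi f" "(\<lambda>n. sqd f (fs n)) \<longlonglongrightarrow> 0"
  shows "f \<in> gcl S"
  unfolding gcl_def
proof (intro CollectI conjI allI impI)
  fix e :: real assume e: "e > 0"
  obtain n where n: "sqd f (fs n) < e / 4"
    using order_tendstoD(2)[OF assms(3), of "e/4"] e by (auto simp: eventually_sequentially)
  obtain g where g: "g \<in> lsp S" "sqd (fs n) g < e / 4" using assms(1)[of n] e unfolding gcl_def by (auto dest!: spec[of _ "e/4"])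
  have "sqd f g \<le> 2 * sqd f (fs n) + 2 * sqd (fs n) g"
    using assms(2) gcl_sqi[OF assms(1)] lsp_sqi[OF g(1)] by (rule sqd_triangle)
  then show "\<exists>g\<in>lsp S. sqd f g < e" using n g by (intro bexI[of _ g]) auto
qed (rule assms)

lemma gcl_seq: assumes "f \<in> gcl S" shows "\<exists>fs. (\<forall>n. fs n \<in> lsp S) \<and> (\<lambda>n. sqd f (fs n)) \<longlonglongrightarrow> 0"
proof -
  have "\<forall>n. \<exists>g\<in>lsp S. sqd f g < inverse (real (Suc n))" using assms by (auto simp: gcl_def)
  then obtain fs where fs: "\<And>n. fs n \<in> lsp S" "\<And>n. sqd f (fs n) < inverse (real (Suc n))" by metis
  have "(\<lambda>n. sqd f (fs n)) \<longlonglongrightarrow> 0"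
    by (rule tendsto_sandwich[OF _ _ tendsto_const LIMSEQ_inverse_real_of_nat])
      (auto intro!: always_eventually less_imp_le[OF fs(2)] simp del: of_nat_Suc)
  with fs(1) show ?thesis by blast
qed

lemma gcl_add: assumes "f \<in> gcl S" "g \<in> gcl S" shows "(\<lambda>w. f w + g w) \<in> gcl S"
proof -
  obtain fs where fs: "\<And>n. fs n \<in> lsp S" "(\<lambda>n. sqd f (fs n)) \<longlonglongrightarrow> 0" using gcl_seq[OF assms(1)] by blast
  obtain gs where gs: "\<And>n. gs n \<in> lsp S" "(\<lambda>n. sqd g (gs n)) \<longlonglongrightarrow> 0" using gcl_seq[OF assms(2)] by blast
  note sq = gcl_sqi[OF assms(1)] gcl_sqi[OF assms(2)] lsp_sqi[OF fs(1)] lsp_sqi[OF gs(1)]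
  show ?thesis
  proof (rule gcl_limit)
    show "(\<lambda>w. fs n w + gs n w) \<in> gcl S" for n by (intro lsp_gcl lsp_add fs gs)
    show "sqi (\<lambda>w. f w + g w)" by (intro sqi_add sq)
    have le: "sqd (\<lambda>w. f w + g w) (\<lambda>w. fs n w + gs n w) \<le> 2 * sqd f (fs n) + 2 * sqd g (gs n)" for n
    proof -
      have "sqd (\<lambda>w. f w + g w) (\<lambda>w. fs n w + gs n w)
          \<le> 2 * sqd (\<lambda>w. f w + g w) (\<lambda>w. fs n w + g w) + 2 * sqd (\<lambda>w. fs n w + g w) (\<lambda>w. fs n w + gs n w)"
        by (intro sqd_triangle sqi_add sq)
      then show ?thesis by (simp add: sqd_def)
    qed
    show "(\<lambda>n. sqd (\<lambda>w. f w + g w) (\<lambda>w. fs n w + gs n w)) \<longlonglongrightarrow> 0"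
      by (rule tendsto_sandwich[OF _ _ tendsto_const, of _ _ _ "\<lambda>n. 2 * sqd f (fs n) + 2 * sqd g (gs n)"])
        (use fs(2) gs(2) le in \<open>auto intro!: always_eventually tendsto_eq_intros\<close>)
  qed
qed

lemma gcl_cmult: assumes "f \<in> gcl S" shows "(\<lambda>w. c * f w) \<in> gcl S"
proof -
  obtain fs where fs: "\<And>n. fs n \<in> lsp S" "(\<lambda>n. sqd f (fs n)) \<longlonglongrightarrow> 0" using gcl_seq[OF assms] by blast
  have e: "sqd (\<lambda>w. c * f w) (\<lambda>w. c * fs n w) = c\<^sup>2 * sqd f (fs n)" for n
    unfolding sqd_def right_diff_distrib[symmetric] power_mult_distrib by simp
  show ?thesis
  proof (rule gcl_limit[of "\<lambda>n w. c * fs n w"])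
    show "(\<lambda>w. c * fs n w) \<in> gcl S" for n by (rule lsp_gcl[OF lsp_cmult[OF fs(1)]])
    show "sqi (\<lambda>w. c * f w)" by (rule sqi_cmult[OF gcl_sqi[OF assms]])
    show "(\<lambda>n. sqd (\<lambda>w. c * f w) (\<lambda>w. c * fs n w)) \<longlonglongrightarrow> 0"
      unfolding e by (rule tendsto_mult_right_zero[OF fs(2)])
  qed
qed

lemma gcl_const: "(\<lambda>w. c) \<in> gcl S" by (intro lsp_gcl lsp_const)

lemma gcl_base: "s \<in> S \<Longrightarrow> s \<in> gcl S" by (intro lsp_gcl lsp_base)

lemma gcl_diff: "f \<in> gcl S \<Longrightarrow> g \<in> gcl S \<Longrightarrow> (\<lambda>w. f w - g w) \<in> gcl S"
  using gcl_add[of f "\<lambda>w. -1 * g w"] gcl_cmult[of g "-1"] by simp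

lemma gcl_sum: "(\<And>i. i \<in> I \<Longrightarrow> f i \<in> gcl S) \<Longrightarrow> (\<lambda>w. \<Sum>i\<in>I. f i w) \<in> gcl S"
  by (induction I rule: infinite_finite_induct) (auto intro: gcl_add gcl_const)

lemma lsp_subset_gcl: "V \<subseteq> gcl S \<Longrightarrow> f \<in> lsp V \<Longrightarrow> f \<in> gcl S"
  by (erule lsp_closed) (auto intro: gcl_add gcl_cmult gcl_const)

lemma gcl_AE:
  assumes "f \<in> gcl S" "g \<in> borel_measurable M" "AE w in M. f w = g w" shows "g \<in> gcl S"
proof (rule gcl_limit[of "\<lambda>_. f"])
  show "sqi g" using sqi_AE[OF gcl_sqi[OF assms(1)] assms(2,3)] .
  have "sqd g f = (\<integral>w. 0 \<partial>M)" unfolding sqd_def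
    using assms(3) gcl_sqi[OF assms(1)] assms(2) by (intro integral_cong_AE) (auto dest: sqi_measurable)
  then show "(\<lambda>n. sqd g f) \<longlonglongrightarrow> 0" by simp
qed (rule assms)

end

section \<open>Gaussian characteristic functions and uniqueness by Fourier transform\<close>

abbreviation "iexpv f \<equiv> (CLINT w|M. iexp (f w))"

text \<open>The characteristic function is Gaussian at the single argument 1. This carries the full
  information once it is known for all multiples of f, and the spaces used are closed under
  multiples.\<close>

definition gchar :: "('a \<Rightarrow> real) \<Rightarrow> bool" where
  "gchar f \<longleftrightarrow> iexpv f = iexp (\<integral>w. f w \<partial>M)
     * of_real (exp (- ((\<integral>w. (f w)\<^sup>2 \<partial>M) - (\<integral>w. f w \<partial>M)\<^sup>2) / 2))"

lemma integrable_iexpv: "f \<in> borel_measurable M \<Longrightarrow> integrable M (\<lambda>w. iexp (f w))"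
  by (rule integrable_iexp) auto

text \<open>exp (i x) is 1-Lipschitz in x, and mean and second moment are continuous in L2; so the
  Gaussian form passes to L2 limits.\<close>

lemma gchar_limit:
  assumes f: "\<And>n. sqi (fs n)" "sqi f" and lim: "(\<lambda>n. sqd f (fs n)) \<longlonglongrightarrow> 0" and g: "\<And>n. gchar (fs n)"
  shows "gchar f"
proof -
  have "(\<lambda>n. iexpv (fs n)) \<longlonglongrightarrow> iexpv f"
  proof (rule LIM_zero_cancel, rule Lim_null_comparison)
    show "\<forall>\<^sub>F n in sequentially. norm (iexpv (fs n) - iexpv f) \<le> sqrt (sqd f (fs n))"
    proof (rule always_eventually, rule allI)
      fix n
      have i: "integrable M (\<lambda>w. iexp (fs n w))" "integrable M (\<lambda>w. iexp (f w))"
        using f by (auto intro!: integrable_iexpv dest: sqi_measurable)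
      have lip: "cmod (iexp x - iexp y) \<le> \<bar>x - y\<bar>" for x y :: real
      proof -
        have "iexp x - iexp y = iexp y * (iexp (x - y) - 1)"
          by (simp add: right_diff_distrib exp_add[symmetric] algebra_simps)
        then show ?thesis using iexp_approx1[of "x - y" 0] by (simp add: norm_mult)
      qed
      have sq: "sqi (\<lambda>w. \<bar>fs n w - f w\<bar>)" using sqi_diff[OF f(1)[of n] f(2)] by (auto simp: sqi_def)
      have "norm (iexpv (fs n) - iexpv f) = norm (\<integral>w. (iexp (fs n w) - iexp (f w)) \<partial>M)"
        using i by simp
      also have "\<dots> \<le> (\<integral>w. \<bar>fs n w - f w\<bar> * 1 \<partial>M)"
        by (rule order_trans[OF integral_norm_bound integral_mono])
          (use i lip integrable_sqi[OF sq] in \<open>auto intro!: integrable_norm Bochner_Integration.integrable_diff\<close>)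
      also have "\<dots> \<le> sqrt ((\<integral>w. \<bar>fs n w - f w\<bar>\<^sup>2 \<partial>M) * (\<integral>w. 1\<^sup>2 \<partial>M))"
        by (intro real_le_rsqrt sqi_cauchy_schwarz sq sqi_const)
      also have "\<dots> = sqrt (sqd f (fs n))" by (simp add: sqd_def power2_commute prob_space)
      finally show "norm (iexpv (fs n) - iexpv f) \<le> sqrt (sqd f (fs n))" .
    qed
    show "(\<lambda>n. sqrt (sqd f (fs n))) \<longlonglongrightarrow> 0" using tendsto_real_sqrt[OF lim] by simp
  qed
  moreover have "(\<lambda>n. iexp (\<integral>w. fs n w \<partial>M) * of_real (exp (- ((\<integral>w. (fs n w)\<^sup>2 \<partial>M) - (\<integral>w. fs n w \<partial>M)\<^sup>2) / 2)))
     \<longlonglongrightarrow> iexp (\<integral>w. f w \<partial>M) * of_real (exp (- ((\<integral>w. (f w)\<^sup>2 \<partial>M) - (\<integral>w. f w \<partial>M)\<^sup>2) / 2))"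
    using tendsto_expectation_mult2[OF f lim f lim]
    by (intro tendsto_intros tendsto_expectation[OF f lim]) (auto simp: power2_eq_square)
  ultimately show ?thesis unfolding gchar_def using g[unfolded gchar_def] LIMSEQ_unique by simp
qed

lemma distr_std_normal:
  assumes d: "distr M borel Y = distr (density lborel (\<lambda>x. ennreal (std_normal_density x))) borel (\<lambda>x. \<mu> + \<sigma> * x)"
    and Y[measurable]: "Y \<in> borel_measurable M" and f[measurable]: "f \<in> borel_measurable borel"
  shows "(\<integral>w. f (Y w) \<partial>M) = (\<integral>x. std_normal_density x *\<^sub>R (f (\<mu> + \<sigma> * x) :: 'b::{banach,second_countable_topology}) \<partial>lborel)"
    "integrable M (\<lambda>w. f (Y w)) \<longleftrightarrow> integrable lborel (\<lambda>x. std_normal_density x *\<^sub>R f (\<mu> + \<sigma> * x))"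
proof -
  let ?N = "density lborel (\<lambda>x. ennreal (std_normal_density x))"
  have "(\<integral>w. f (Y w) \<partial>M) = (\<integral>y. f y \<partial>distr M borel Y)" by (simp add: integral_distr)
  also have "\<dots> = (\<integral>x. f (\<mu> + \<sigma> * x) \<partial>?N)" unfolding d by (subst integral_distr) auto
  also have "\<dots> = (\<integral>x. std_normal_density x *\<^sub>R f (\<mu> + \<sigma> * x) \<partial>lborel)"
    by (subst integral_density) auto
  finally show "(\<integral>w. f (Y w) \<partial>M) = (\<integral>x. std_normal_density x *\<^sub>R f (\<mu> + \<sigma> * x) \<partial>lborel)" .
  have "integrable M (\<lambda>w. f (Y w)) \<longleftrightarrow> integrable (distr M borel Y) f" by (simp add: integrable_distr_eq)
  also have "\<dots> \<longleftrightarrow> integrable ?N (\<lambda>x. f (\<mu> + \<sigma> * x))" unfolding d by (subst integrable_distr_eq) auto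
  also have "\<dots> \<longleftrightarrow> integrable lborel (\<lambda>x. std_normal_density x *\<^sub>R f (\<mu> + \<sigma> * x))"
    by (subst integrable_density) auto
  finally show "integrable M (\<lambda>w. f (Y w)) \<longleftrightarrow> integrable lborel (\<lambda>x. std_normal_density x *\<^sub>R f (\<mu> + \<sigma> * x))" .
qed

lemma std_normal_moments:
  "(\<integral>x. std_normal_density x * x \<partial>lborel) = 0" "integrable lborel (\<lambda>x. std_normal_density x * x)"
  "(\<integral>x. std_normal_density x * x\<^sup>2 \<partial>lborel) = 1" "integrable lborel (\<lambda>x. std_normal_density x * x\<^sup>2)"
  "(\<integral>x. std_normal_density x * x ^ 4 \<partial>lborel) = 3" "integrable lborel (\<lambda>x. std_normal_density x * x ^ 4)"
proof -
  show "(\<integral>x. std_normal_density x * x \<partial>lborel) = 0" using integral_std_normal_moment_odd[of 0] by simp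
  show "integrable lborel (\<lambda>x. std_normal_density x * x)" using integrable_std_normal_moment[of 1] by simp
  show "(\<integral>x. std_normal_density x * x\<^sup>2 \<partial>lborel) = 1" using integral_std_normal_moment_even[of 1] by (simp add: fact_numeral)
  show "integrable lborel (\<lambda>x. std_normal_density x * x\<^sup>2)" by (rule integrable_std_normal_moment)
  show "(\<integral>x. std_normal_density x * x ^ 4 \<partial>lborel) = 3" using integral_std_normal_moment_even[of 2] by (simp add: fact_numeral)
  show "integrable lborel (\<lambda>x. std_normal_density x * x ^ 4)" by (rule integrable_std_normal_moment)
qed

lemma gaussian_rv_sqi_gchar:
  assumes "gaussian_rv M Y" shows "sqi Y" "gchar Y"
    "(\<integral>w. Y w \<partial>M) = 0 \<Longrightarrow> integrable M (\<lambda>w. (Y w) ^ 4) \<and> (\<integral>w. (Y w) ^ 4 \<partial>M) = 3 * (\<integral>w. (Y w)\<^sup>2 \<partial>M)\<^sup>2"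
proof -
  from assms obtain \<mu> \<sigma> where Y[measurable]: "Y \<in> borel_measurable M"
    and d: "distr M borel Y = distr (density lborel (\<lambda>x. ennreal (std_normal_density x))) borel (\<lambda>x. \<mu> + \<sigma> * x)"
    by (auto simp: gaussian_rv_def)
  note D = distr_std_normal[OF d Y]
  note m = std_normal_moments
  have e2: "std_normal_density x * (\<mu> + \<sigma> * x)\<^sup>2 = \<mu>\<^sup>2 * std_normal_density x + (2 * \<mu> * \<sigma>) * (std_normal_density x * x) + \<sigma>\<^sup>2 * (std_normal_density x * x\<^sup>2)" for x
    by (simp add: power2_eq_square algebra_simps)
  have "integrable M (\<lambda>w. (Y w)\<^sup>2)"
    unfolding D(2)[of "\<lambda>y. y\<^sup>2", simplified] e2
    by (intro Bochner_Integration.integrable_add integrable_mult_right m integrable_normal_density) auto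
  then show "sqi Y" by (simp add: sqi_def)
  have E2: "(\<integral>w. (Y w)\<^sup>2 \<partial>M) = \<mu>\<^sup>2 + \<sigma>\<^sup>2"
    unfolding D(1)[of "\<lambda>y. y\<^sup>2", simplified] e2
    by (simp add: m Bochner_Integration.integral_add Bochner_Integration.integrable_add)
  have e1: "std_normal_density x * (\<mu> + \<sigma> * x) = \<mu> * std_normal_density x + \<sigma> * (std_normal_density x * x)" for x
    by (simp add: algebra_simps)
  have E1: "(\<integral>w. Y w \<partial>M) = \<mu>"
    unfolding D(1)[of "\<lambda>y. y", simplified] e1 by (simp add: m)
  have "iexpv Y = (\<integral>x. std_normal_density x *\<^sub>R iexp (\<mu> + \<sigma> * x) \<partial>lborel)"
    by (rule D(1)[of iexp]) simp
  also have "\<dots> = (\<integral>x. iexp \<mu> * (std_normal_density x *\<^sub>R iexp (\<sigma> * x)) \<partial>lborel)"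
    by (simp add: exp_add distrib_left)
  also have "\<dots> = iexp \<mu> * (\<integral>x. std_normal_density x *\<^sub>R iexp (\<sigma> * x) \<partial>lborel)"
    by (rule integral_mult_right_zero)
  also have "(\<integral>x. std_normal_density x *\<^sub>R iexp (\<sigma> * x) \<partial>lborel) = char std_normal_distribution \<sigma>"
    unfolding char_def by (subst integral_density) auto
  finally show "gchar Y" unfolding gchar_def E1 E2 by (simp add: char_std_normal_distribution)
  assume "(\<integral>w. Y w \<partial>M) = 0"
  then have mu: "\<mu> = 0" using E1 by simp
  have e4: "std_normal_density x * (\<sigma> * x) ^ 4 = \<sigma> ^ 4 * (std_normal_density x * x ^ 4)" for x
    by (simp add: power_mult_distrib)
  have "integrable M (\<lambda>w. (Y w) ^ 4)"
    unfolding D(2)[of "\<lambda>y. y ^ 4", simplified] mu add_0 e4 by (intro integrable_mult_right m)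
  moreover have "(\<integral>w. (Y w) ^ 4 \<partial>M) = 3 * \<sigma> ^ 4"
    unfolding D(1)[of "\<lambda>y. y ^ 4", simplified] mu add_0 e4 by (simp add: m)
  ultimately show "integrable M (\<lambda>w. (Y w) ^ 4) \<and> (\<integral>w. (Y w) ^ 4 \<partial>M) = 3 * (\<integral>w. (Y w)\<^sup>2 \<partial>M)\<^sup>2"
    unfolding E2 mu by (simp add: power2_eq_square numeral_eq_Suc)
qed

lemma gchar_add_const: assumes "sqi f" "gchar f" shows "gchar (\<lambda>w. c + f w)"
proof -
  have i: "integrable M f" "integrable M (\<lambda>w. (f w)\<^sup>2)" using assms by (auto intro: integrable_sqi integrable_sqi_power2)
  have "(\<integral>w. (c + f w)\<^sup>2 \<partial>M) = (\<integral>w. c\<^sup>2 + 2 * c * f w + (f w)\<^sup>2 \<partial>M)" by (simp add: power2_sum algebra_simps)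
  also have "\<dots> = c\<^sup>2 + 2 * c * (\<integral>w. f w \<partial>M) + (\<integral>w. (f w)\<^sup>2 \<partial>M)" using i by (simp add: prob_space)
  finally have v: "(\<integral>w. (c + f w)\<^sup>2 \<partial>M) = c\<^sup>2 + 2 * c * (\<integral>w. f w \<partial>M) + (\<integral>w. (f w)\<^sup>2 \<partial>M)" .
  have e: "(\<integral>w. c + f w \<partial>M) = c + (\<integral>w. f w \<partial>M)" using i by (simp add: prob_space)
  have "iexpv (\<lambda>w. c + f w) = iexp c * iexpv f" by (simp add: distrib_left exp_add)
  then show ?thesis using assms(2) unfolding gchar_def v e
    by (simp add: distrib_left exp_add power2_sum mult.assoc)
qed

text \<open>Repeated generators are merged, because a Gaussian family is defined by sums over sets
  of distinct functions.\<close>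

lemma lsp_finite_sum:
  assumes "f \<in> lsp S" shows "\<exists>F c c0. finite F \<and> F \<subseteq> S \<and> f = (\<lambda>w. c0 + (\<Sum>s\<in>F. c s * s w))"
  using assms
proof induction
  case (lsp_const c)
  show ?case by (intro exI[of _ "{}"] exI[of _ c]) auto
next
  case (lsp_step f s d)
  then obtain F c c0 where F: "finite F" "F \<subseteq> S" "f = (\<lambda>w. c0 + (\<Sum>s\<in>F. c s * s w))" by blast
  define c' where "c' = (\<lambda>r. (if r \<in> F then c r else 0) + (if r = s then d else 0))"
  have "(\<Sum>r\<in>insert s F. c' r * r w) = (\<Sum>r\<in>F. c r * r w) + d * s w" for w
  proof -
    have "(\<Sum>r\<in>insert s F. c' r * r w) = (\<Sum>r\<in>insert s F. (if r \<in> F then c r * r w else 0) + (if r = s then d * s w else 0))"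
      by (intro sum.cong refl) (auto simp: c'_def algebra_simps)
    also have "\<dots> = (\<Sum>r\<in>insert s F. if r \<in> F then c r * r w else 0) + d * s w"
      using F(1) by (simp add: sum.distrib)
    also have "(\<Sum>r\<in>insert s F. if r \<in> F then c r * r w else 0) = (\<Sum>r\<in>F. c r * r w)"
      using F(1) by (intro sum.mono_neutral_cong_right) auto
    finally show ?thesis .
  qed
  then have "(\<lambda>w. f w + d * s w) = (\<lambda>w. c0 + (\<Sum>r\<in>insert s F. c' r * r w))" using F(3) by (simp add: add.assoc)
  then show ?case using F lsp_step.hyps by (intro exI[of _ "insert s F"] exI[of _ c'] exI[of _ c0]) auto
qed

text \<open>A change of measure: u = 0 shows that G is centred, so d = 1 + G / L is a probability
  density, and the hypothesis says that V has the same characteristic function under this density as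
  under \<open>M\<close>. Uniqueness equates the two laws of V; subtracting them leaves G.\<close>

lemma fourier_null:
  fixes G :: "'a \<Rightarrow> real"
  assumes G[measurable]: "G \<in> borel_measurable M" and K: "\<And>w. \<bar>G w\<bar> \<le> K"
    and V[measurable]: "V \<in> borel_measurable M"
    and zero: "\<And>u. (CLINT w|M. of_real (G w) * iexp (u * V w)) = 0" and B[measurable]: "B \<in> sets borel"
  shows "(\<integral>w. G w * indicator B (V w) \<partial>M) = 0"
proof -
  define L where "L = K + 1"
  have L: "0 < L" using order_trans[OF abs_ge_zero K] by (simp add: L_def add_nonneg_pos)
  define d where "d w = (G w + L) / L" for w
  have d0: "0 \<le> d w" for w using K[of w] L by (auto simp: d_def L_def)
  have [measurable]: "d \<in> borel_measurable M" unfolding d_def by measurable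
  have iG: "integrable M G" by (rule integrable_const_bound[where B = K]) (use K in auto)
  have id: "integrable M d" unfolding d_def using iG by simp
  have G0: "(\<integral>w. G w \<partial>M) = 0" using zero[of 0] by (simp add: integral_complex_of_real)
  have "(\<integral>w. d w \<partial>M) = ((\<integral>w. G w \<partial>M) + L) / L" unfolding d_def using iG by (simp add: prob_space)
  then have d1: "(\<integral>w. d w \<partial>M) = 1" using L G0 by simp
  define D where "D = density M (\<lambda>w. ennreal (d w))"
  have [simp]: "sets D = sets M" "space D = space M" by (auto simp: D_def)
  have [measurable_cong]: "sets D = sets M" by simp
  interpret D: prob_space D
    by (rule prob_spaceI) (use nn_integral_eq_integral[OF id] d0 d1 in \<open>simp add: D_def emeasure_density cong: nn_integral_cong\<close>)
  have rd: "real_distribution (distr D borel V)" "real_distribution (distr M borel V)"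
    by (auto intro!: D.real_distribution_distr real_distribution_distr)
  have "char (distr D borel V) = char (distr M borel V)"
  proof
    fix u
    have "char (distr D borel V) u = (CLINT w|M. d w *\<^sub>R iexp (u * V w))"
      unfolding char_def D_def by (subst integral_distr, simp, simp) (subst integral_density, use d0 in auto)
    also have "\<dots> = (CLINT w|M. (1 / of_real L) * (of_real (G w) * iexp (u * V w)) + iexp (u * V w))"
      using L by (intro Bochner_Integration.integral_cong refl) (simp add: d_def scaleR_conv_of_real field_simps)
    also have "\<dots> = (1 / of_real L) * (CLINT w|M. of_real (G w) * iexp (u * V w)) + (CLINT w|M. iexp (u * V w))"
    proof -
      have "integrable M (\<lambda>w. of_real (G w) * iexp (u * V w))"
        by (rule integrable_const_bound[where B = K]) (use K in \<open>auto simp: norm_mult\<close>)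
      moreover have "integrable M (\<lambda>w. iexp (u * V w))" by (rule integrable_iexpv) simp
      ultimately show ?thesis by simp
    qed
    also have "\<dots> = char (distr M borel V) u" unfolding zero char_def by (simp add: integral_distr)
    finally show "char (distr D borel V) u = char (distr M borel V) u" .
  qed
  then have eq: "distr D borel V = distr M borel V" using Levy_uniqueness rd by blast
  have "integral\<^sup>L (distr D borel V) (indicator B :: real \<Rightarrow> real) = (\<integral>w. d w * indicator B (V w) \<partial>M)"
    unfolding D_def by (subst integral_distr, simp, simp) (subst integral_density, use d0 in auto)
  moreover have "integral\<^sup>L (distr M borel V) (indicator B :: real \<Rightarrow> real) = (\<integral>w. indicator B (V w) \<partial>M)" by (subst integral_distr) auto
  ultimately have "(\<integral>w. d w * indicator B (V w) \<partial>M) = (\<integral>w. indicator B (V w) \<partial>M :: real)" using eq by simp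
  moreover have "(\<integral>w. d w * indicator B (V w) \<partial>M) = (\<integral>w. (1 / L) * (G w * indicator B (V w)) + indicator B (V w) \<partial>M)"
    using L by (intro Bochner_Integration.integral_cong refl) (simp add: d_def field_simps)
  moreover have "\<dots> = (1 / L) * (\<integral>w. G w * indicator B (V w) \<partial>M) + (\<integral>w. indicator B (V w) \<partial>M)"
  proof -
    have "integrable M (\<lambda>w. G w * indicator B (V w))"
      by (rule integrable_const_bound[where B = K])
        (use K order_trans[OF abs_ge_zero K] in \<open>auto simp: indicator_def\<close>)
    moreover have "integrable M (\<lambda>w. indicator B (V w) :: real)"
      by (rule integrable_const_bound[where B = 1]) (auto simp: indicator_def)
    ultimately show ?thesis by simp
  qed
  ultimately show ?thesis using L by simp
qed

text \<open>Real and imaginary parts are combinations of H and its conjugate, and conjugation turns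
  the hypothesis at - u into the one at u.\<close>

lemma fourier_null_complex:
  fixes H :: "'a \<Rightarrow> complex"
  assumes H[measurable]: "H \<in> borel_measurable M" and K: "\<And>w. cmod (H w) \<le> K"
    and V[measurable]: "V \<in> borel_measurable M"
    and zero: "\<And>u. (CLINT w|M. H w * iexp (u * V w)) = 0" and B[measurable]: "B \<in> sets borel"
  shows "(CLINT w|M. H w * indicator B (V w)) = 0"
proof -
  have iH: "integrable M (\<lambda>w. H w * iexp (u * V w))" for u
    by (rule integrable_const_bound[where B = K]) (use K in \<open>auto simp: norm_mult\<close>)
  have [measurable]: "(\<lambda>w. cnj (H w)) \<in> borel_measurable M"
    by (intro measurable_compose[OF H borel_measurable_continuous_onI] continuous_intros)
  have cz: "(CLINT w|M. cnj (H w) * iexp (u * V w)) = 0" for u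
  proof -
    have "(CLINT w|M. cnj (H w) * iexp (u * V w)) = (CLINT w|M. cnj (H w * iexp (- u * V w)))"
      by (intro Bochner_Integration.integral_cong refl) (simp add: exp_cnj)
    also have "\<dots> = cnj (CLINT w|M. H w * iexp (- u * V w))" by (rule Bochner_Integration.integral_cnj)
    finally show ?thesis using zero[of "- u"] by simp
  qed
  have icH: "integrable M (\<lambda>w. cnj (H w) * iexp (u * V w))" for u
    by (rule integrable_const_bound[where B = K]) (use K in \<open>auto simp: norm_mult\<close>)
  have 1: "(\<integral>w. Re (H w) * indicator B (V w) \<partial>M) = 0"
  proof (rule fourier_null[OF _ _ V _ B, of _ K])
    show "\<bar>Re (H w)\<bar> \<le> K" for w using abs_Re_le_cmod K order_trans by blast
    fix u
    have "(CLINT w|M. of_real (Re (H w)) * iexp (u * V w)) = (CLINT w|M. (1/2) * (H w * iexp (u * V w)) + (1/2) * (cnj (H w) * iexp (u * V w)))"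
      by (intro Bochner_Integration.integral_cong refl) (simp add: complex_eq_iff field_simps)
    then show "(CLINT w|M. of_real (Re (H w)) * iexp (u * V w)) = 0" using iH[of u] icH[of u] zero[of u] cz[of u] by simp
  qed simp
  have 2: "(\<integral>w. Im (H w) * indicator B (V w) \<partial>M) = 0"
  proof (rule fourier_null[OF _ _ V _ B, of _ K])
    show "\<bar>Im (H w)\<bar> \<le> K" for w using abs_Im_le_cmod K order_trans by blast
    fix u
    have "(CLINT w|M. of_real (Im (H w)) * iexp (u * V w)) = (CLINT w|M. (- \<i>/2) * (H w * iexp (u * V w)) + (\<i>/2) * (cnj (H w) * iexp (u * V w)))"
      by (intro Bochner_Integration.integral_cong refl) (simp add: complex_eq_iff field_simps)
    then show "(CLINT w|M. of_real (Im (H w)) * iexp (u * V w)) = 0" using iH[of u] icH[of u] zero[of u] cz[of u] by simp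
  qed simp
  have iB: "integrable M (\<lambda>w. H w * indicator B (V w))"
    by (rule integrable_const_bound[where B = K])
      (use K order_trans[OF norm_ge_zero K] in \<open>auto simp: indicator_def\<close>)
  show ?thesis
  proof (rule complex_eqI)
    have r: "Re (indicator B x) = indicator B x" "Im (indicator B x) = 0" for x :: real by (auto simp: indicator_def)
    show "Re (CLINT w|M. H w * indicator B (V w)) = Re 0" using 1 integral_Re[OF iB] by (simp add: r)
    show "Im (CLINT w|M. H w * indicator B (V w)) = Im 0" using 2 integral_Im[OF iB] by (simp add: r)
  qed
qed

text \<open>Indicators replace exponentials one coordinate at a time. As the span is closed under
  adding u j, the product with the indicators already placed integrates to 0 against all
  exponentials exp (i u j), so Fourier uniqueness applies to the next coordinate j.\<close>

lemma fourier_null_cylinder: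
  fixes H :: "'a \<Rightarrow> complex"
  assumes H[measurable]: "H \<in> borel_measurable M" and K: "\<And>w. cmod (H w) \<le> K"
    and V: "\<And>v. v \<in> V \<Longrightarrow> v \<in> borel_measurable M"
    and zero: "\<And>v. v \<in> lsp V \<Longrightarrow> (CLINT w|M. H w * iexp (v w)) = 0"
    and J: "finite J" "J \<subseteq> V" and B: "\<And>s. B s \<in> sets borel"
    and v: "v \<in> lsp V"
  shows "(CLINT w|M. (H w * (\<Prod>s\<in>J. indicator (B s) (s w))) * iexp (v w)) = 0"
  using J v
proof (induction J arbitrary: v rule: finite_induct)
  case (insert j J)
  have [measurable]: "s \<in> borel_measurable M" if "s \<in> insert j J" for s using V insert.prems that by auto
  have Vm: "v \<in> borel_measurable M" if "v \<in> lsp V" for v using that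
    by (rule lsp_closed) (auto intro: V)
  note [measurable] = Vm[OF insert.prems(2)] B
  have jm[measurable]: "j \<in> borel_measurable M" using V insert.prems by auto
  let ?H = "\<lambda>w. (H w * (\<Prod>s\<in>J. indicator (B s) (s w))) * iexp (v w)"
  have "(CLINT w|M. ?H w * indicator (B j) (j w)) = 0"
  proof (rule fourier_null_complex)
    have [measurable]: "(\<lambda>w. \<Prod>s\<in>J. indicator (B s) (s w) :: complex) \<in> borel_measurable M"
    proof (rule borel_measurable_prod)
      fix s assume "s \<in> J"
      then have [measurable]: "s \<in> borel_measurable M" using V insert.prems by auto
      show "(\<lambda>w. indicator (B s) (s w) :: complex) \<in> borel_measurable M" by measurable
    qed
    show "?H \<in> borel_measurable M" by measurable
    show "cmod (?H w) \<le> K" for w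
    proof -
      have "cmod (\<Prod>s\<in>J. indicator (B s) (s w)) \<le> 1"
        unfolding prod_norm[symmetric] by (intro prod_le_1) (auto simp: indicator_def)
      then have "cmod (H w) * cmod (\<Prod>s\<in>J. indicator (B s) (s w)) \<le> K * 1"
        using K order_trans[OF norm_ge_zero K] by (intro mult_mono) auto
      then show ?thesis by (simp add: norm_mult)
    qed
    fix u
    have "(\<lambda>w. v w + u * j w) \<in> lsp V" using insert.prems by (intro lsp_step) auto
    then have "(CLINT w|M. (H w * (\<Prod>s\<in>J. indicator (B s) (s w))) * iexp (v w + u * j w)) = 0"
      using insert.IH[of "\<lambda>w. v w + u * j w"] insert.prems by blast
    then show "(CLINT w|M. ?H w * iexp (u * j w)) = 0" by (simp add: distrib_left exp_add mult.assoc)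
  qed (rule jm, rule B)
  then show ?case using insert.hyps by (simp add: mult_ac)
qed (simp add: zero)

end

section \<open>Conditioning in Gaussian spaces\<close>

lemma borel_measurable_vec_nth: "(\<lambda>x :: real^'n. x $ i) \<in> borel_measurable borel"
  by (intro borel_measurable_continuous_onI continuous_intros)

locale gaussian_space = prob_space M for M :: "'a measure" +
  fixes S :: "('a \<Rightarrow> real) set"
  assumes gaussian: "gaussian_family M S"
begin

lemma gaussian_sum: "finite F \<Longrightarrow> F \<subseteq> S \<Longrightarrow> gaussian_rv M (\<lambda>w. \<Sum>f\<in>F. c f * f w)"
  using gaussian unfolding gaussian_family_def by blast

lemma S_sqi: "s \<in> S \<Longrightarrow> sqi s"
  using gaussian_rv_sqi_gchar(1)[OF gaussian_sum[of "{s}" "\<lambda>_. 1"]] by simp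

lemma S_ball: "\<forall>s\<in>S. sqi s" using S_sqi by blast

definition L :: "('a \<Rightarrow> real) set" where "L = gcl S"

lemma L_sqi: "f \<in> L \<Longrightarrow> sqi f" by (simp add: L_def gcl_sqi)

lemmas L_add = gcl_add[OF S_ball, folded L_def]
lemmas L_cmult = gcl_cmult[OF S_ball, folded L_def]
lemmas L_const = gcl_const[OF S_ball, folded L_def]
lemmas L_base = gcl_base[OF S_ball, folded L_def]
lemmas L_diff = gcl_diff[OF S_ball, folded L_def]
lemmas L_sum = gcl_sum[OF S_ball, folded L_def]
lemmas L_limit = gcl_limit[OF S_ball, folded L_def]
lemmas L_AE = gcl_AE[OF S_ball, folded L_def]
lemmas L_lsp = lsp_subset_gcl[OF S_ball, folded L_def]

lemma L_gchar: assumes "f \<in> L" shows "gchar f"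
proof -
  obtain fs where fs: "\<And>n. fs n \<in> lsp S" "(\<lambda>n. sqd f (fs n)) \<longlonglongrightarrow> 0"
    using gcl_seq[OF S_ball assms[unfolded L_def]] by blast
  have "gchar (fs n)" for n
  proof -
    obtain F c c0 where F: "finite F" "F \<subseteq> S" "fs n = (\<lambda>w. c0 + (\<Sum>s\<in>F. c s * s w))"
      using lsp_finite_sum[OF fs(1)[of n]] by (elim exE conjE)
    show ?thesis unfolding F(3)
      by (intro gchar_add_const gaussian_rv_sqi_gchar[OF gaussian_sum[OF F(1,2)]])
  qed
  from gchar_limit[OF lsp_sqi[OF S_ball fs(1)] L_sqi[OF assms] fs(2) this] show ?thesis .
qed

section \<open>Uncorrelated variables of a Gaussian space are independent\<close>

definition cyl :: "('a \<Rightarrow> real) set \<Rightarrow> 'a set set" where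
  "cyl V = {{w\<in>space M. \<forall>s\<in>J. s w \<in> B s} | J B. finite J \<and> J \<subseteq> V \<and> (\<forall>s. B s \<in> sets borel)}"

lemma Int_stable_cyl: "Int_stable (cyl V)"
proof (rule Int_stableI)
  fix a b assume "a \<in> cyl V" "b \<in> cyl V"
  then obtain J B K C where J: "finite J" "J \<subseteq> V" "\<And>s. B s \<in> sets borel" "a = {w\<in>space M. \<forall>s\<in>J. s w \<in> B s}"
    and K: "finite K" "K \<subseteq> V" "\<And>s. C s \<in> sets borel" "b = {w\<in>space M. \<forall>s\<in>K. s w \<in> C s}"
    unfolding cyl_def by blast
  define D where "D s = (if s \<in> J then B s else UNIV) \<inter> (if s \<in> K then C s else UNIV)" for s
  have "a \<inter> b = {w\<in>space M. \<forall>s\<in>J \<union> K. s w \<in> D s}" unfolding J(4) K(4) D_def by auto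
  moreover have "D s \<in> sets borel" for s using J(3) K(3) by (auto simp: D_def)
  ultimately show "a \<inter> b \<in> cyl V" using J(1,2) K(1,2) unfolding cyl_def by blast
qed

lemma cyl_Pow: "cyl V \<subseteq> Pow (space M)" by (auto simp: cyl_def)

definition uncorrelated :: "('a \<Rightarrow> real) \<Rightarrow> ('a \<Rightarrow> real) \<Rightarrow> bool" where
  "uncorrelated U v \<longleftrightarrow> (\<integral>w. U w * v w \<partial>M) = (\<integral>w. U w \<partial>M) * (\<integral>w. v w \<partial>M)"

context
  fixes U V
  assumes U: "U \<in> L" and V: "V \<subseteq> L" and unc: "\<And>v. v \<in> V \<Longrightarrow> uncorrelated U v"
begin

lemma uncorrelated_lsp: assumes "v \<in> lsp V" shows "uncorrelated U v"
proof -
  have "sqi v \<and> uncorrelated U v"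
    using assms
  proof (rule lsp_closed)
    fix f g assume fg: "sqi f \<and> uncorrelated U f" "sqi g \<and> uncorrelated U g"
    then show "sqi (\<lambda>w. f w + g w) \<and> uncorrelated U (\<lambda>w. f w + g w)"
      using integrable_sqi_mult[OF L_sqi[OF U], of f] integrable_sqi_mult[OF L_sqi[OF U], of g]
      by (auto simp: uncorrelated_def distrib_left integrable_sqi intro: sqi_add)
  next
    fix c f assume "sqi f \<and> uncorrelated U f"
    then show "sqi (\<lambda>w. c * f w) \<and> uncorrelated U (\<lambda>w. c * f w)"
      by (auto simp: uncorrelated_def mult.left_commute[of _ c] intro: sqi_cmult)
  qed (use V unc L_sqi in \<open>auto simp: uncorrelated_def prob_space\<close>)
  then show ?thesis ..
qed

text \<open>Uncorrelatedness removes the mixed term from the variance of u U + v, and mean and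
  variance determine a Gaussian characteristic function.\<close>

lemma char_factor: assumes v: "v \<in> lsp V"
  shows "iexpv (\<lambda>w. u * U w + v w) = iexpv (\<lambda>w. u * U w) * iexpv v"
proof -
  have vL: "v \<in> L" using L_lsp[OF V v] .
  have uL: "(\<lambda>w. u * U w) \<in> L" by (rule L_cmult[OF U])
  note sq = L_sqi[OF U] L_sqi[OF vL] L_sqi[OF uL]
  define m1 m2 s1 s2 where "m1 = (\<integral>w. U w \<partial>M)" and "m2 = (\<integral>w. v w \<partial>M)"
    and "s1 = (\<integral>w. (U w)\<^sup>2 \<partial>M)" and "s2 = (\<integral>w. (v w)\<^sup>2 \<partial>M)"
  have m: "(\<integral>w. u * U w + v w \<partial>M) = u * m1 + m2" "(\<integral>w. u * U w \<partial>M) = u * m1"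
    using sq by (simp_all add: integrable_sqi m1_def m2_def)
  have "(\<integral>w. (u * U w + v w)\<^sup>2 \<partial>M) = (\<integral>w. u\<^sup>2 * (U w)\<^sup>2 + (2 * u) * (U w * v w) + (v w)\<^sup>2 \<partial>M)"
    by (intro Bochner_Integration.integral_cong refl) (simp add: power2_eq_square algebra_simps)
  also have "\<dots> = u\<^sup>2 * s1 + (2 * u) * (m1 * m2) + s2"
    using sq integrable_sqi_mult[OF sq(1,2)] uncorrelated_lsp[OF v]
    by (simp add: integrable_sqi_power2 s1_def s2_def m1_def m2_def uncorrelated_def)
  finally have s: "(\<integral>w. (u * U w + v w)\<^sup>2 \<partial>M) = u\<^sup>2 * s1 + (2 * u) * (m1 * m2) + s2" .
  have s': "(\<integral>w. (u * U w)\<^sup>2 \<partial>M) = u\<^sup>2 * s1" by (simp add: power_mult_distrib s1_def)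
  have "exp (- ((u\<^sup>2 * s1 + (2 * u) * (m1 * m2) + s2) - (u * m1 + m2)\<^sup>2) / 2)
      = exp (- (u\<^sup>2 * s1 - (u * m1)\<^sup>2) / 2) * exp (- (s2 - m2\<^sup>2) / 2)"
    by (simp add: exp_add[symmetric] power2_eq_square field_simps)
  then show ?thesis
    using L_gchar[OF L_add[OF uL vL]] L_gchar[OF uL] L_gchar[OF vL]
    unfolding gchar_def m s s' s2_def[symmetric] m2_def[symmetric]
    by (simp add: exp_add distrib_left mult_ac)
qed

text \<open>Fourier uniqueness is used twice: over the variables of V with the centred function exp
  (i u U) - E exp (i u U), which turns exponentials of V into the indicator of \<open>A\<close>;
  then over U with indicator A - prob A.\<close>

lemma cylinder_factor:
  assumes A: "A \<in> cyl V" and B: "B \<in> sets borel"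
  shows "prob (A \<inter> (U -` B \<inter> space M)) = prob A * prob (U -` B \<inter> space M)" "A \<in> events"
proof -
  obtain J C where J: "finite J" "J \<subseteq> V" "\<And>s. C s \<in> sets borel" "A = {w\<in>space M. \<forall>s\<in>J. s w \<in> C s}"
    using A unfolding cyl_def by blast
  have Um[measurable]: "U \<in> borel_measurable M" using L_sqi[OF U] by (rule sqi_measurable)
  have Vm: "v \<in> borel_measurable M" if "v \<in> V" for v using L_sqi V that by (auto intro: sqi_measurable)
  note [measurable] = J(3) B
  show Am[measurable]: "A \<in> events" unfolding J(4)
  proof (rule sets.sets_Collect_finite_All)
    show "{w \<in> space M. s w \<in> C s} \<in> events" if "s \<in> J" for s
      using measurable_sets[OF Vm J(3), of s s] J(2) that by (auto simp: vimage_def Int_def conj_commute)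
  qed (use J in auto)
  have ind: "(\<Prod>s\<in>J. indicator (C s) (s w)) = (indicator A w :: complex)" if om: "w \<in> space M" for w
  proof (cases "w \<in> A")
    case True
    then show ?thesis unfolding J(4) by (simp add: indicator_def)
  next
    case False
    then obtain s where "s \<in> J" "s w \<notin> C s" using om unfolding J(4) by blast
    then have "(\<Prod>s\<in>J. indicator (C s) (s w)) = (0 :: complex)" using J(1) by (intro prod_zero) (auto simp: indicator_def)
    then show ?thesis using False by simp
  qed
  have G: "(CLINT w|M. of_real (indicator A w - prob A) * iexp (u * U w)) = 0" for u
  proof -
    define c where "c = iexpv (\<lambda>w. u * U w)"
    define H where "H w = iexp (u * U w) - c" for w
    have iU: "integrable M (\<lambda>w. iexp (u * U w))" by (rule integrable_iexpv) simp
    have "(CLINT w|M. (H w * (\<Prod>s\<in>J. indicator (C s) (s w))) * iexp ((\<lambda>w. 0) w)) = 0"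
    proof (rule fourier_null_cylinder[OF _ _ Vm _ J(1,2,3) lsp_const])
      show "H \<in> borel_measurable M" unfolding H_def by measurable
      show "cmod (H w) \<le> 1 + cmod c" for w unfolding H_def by (rule order_trans[OF norm_triangle_ineq4]) simp
      fix v assume v: "v \<in> lsp V"
      then have vm: "v \<in> borel_measurable M" using L_lsp[OF V] L_sqi sqi_measurable by blast
      have i: "integrable M (\<lambda>w. iexp (u * U w + v w))" "integrable M (\<lambda>w. iexp (v w))"
        by (rule integrable_iexpv, use vm in simp)+
      have "(CLINT w|M. H w * iexp (v w)) = (CLINT w|M. iexp (u * U w + v w) - c * iexp (v w))"
        by (intro Bochner_Integration.integral_cong refl) (simp add: H_def left_diff_distrib exp_add distrib_left)
      also have "\<dots> = iexpv (\<lambda>w. u * U w + v w) - c * iexpv v" using i by simp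
      finally show "(CLINT w|M. H w * iexp (v w)) = 0" using char_factor[OF v] by (simp add: c_def)
    qed
    then have "(CLINT w|M. H w * indicator A w) = 0"
      using Bochner_Integration.integral_cong[OF refl, of M "\<lambda>w. H w * indicator A w" "\<lambda>w. (H w * (\<Prod>s\<in>J. indicator (C s) (s w))) * iexp ((\<lambda>w. 0) w)"] ind by simp
    moreover have iA: "integrable M (\<lambda>w. iexp (u * U w) * indicator A w)" "integrable M (indicator A :: _ \<Rightarrow> complex)"
      by (rule integrable_const_bound[where B = 1], auto simp: indicator_def norm_mult)+
    moreover have "(CLINT w|M. H w * indicator A w) = (CLINT w|M. iexp (u * U w) * indicator A w) - c * (CLINT w|M. indicator A w)"
      unfolding H_def left_diff_distrib using iA by simp
    moreover have "(CLINT w|M. indicator A w) = of_real (prob A)"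
    proof -
      have "(CLINT w|M. indicator A w) = (CLINT w|M. of_real (indicator A w))"
        by (intro Bochner_Integration.integral_cong refl) (auto simp: indicator_def)
      then show ?thesis by (simp add: integral_complex_of_real)
    qed
    ultimately have 1: "(CLINT w|M. iexp (u * U w) * indicator A w) = c * of_real (prob A)" by simp
    have "(CLINT w|M. of_real (indicator A w - prob A) * iexp (u * U w))
        = (CLINT w|M. iexp (u * U w) * indicator A w - of_real (prob A) * iexp (u * U w))"
      by (intro Bochner_Integration.integral_cong refl) (auto simp: indicator_def algebra_simps)
    also have "\<dots> = c * of_real (prob A) - of_real (prob A) * c"
      unfolding c_def 1[symmetric, unfolded c_def] using iA iU by (subst Bochner_Integration.integral_diff) (simp_all add: 1[unfolded c_def])
    finally show ?thesis by simp
  qed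
  have "(\<integral>w. (indicator A w - prob A) * indicator B (U w) \<partial>M) = 0"
  proof (rule fourier_null[where K = 2, OF _ _ Um G B])
    fix w
    have "0 \<le> prob A" "prob A \<le> 1" by simp_all
    then have "\<bar>1 - prob A\<bar> \<le> 2" "\<bar>0 - prob A\<bar> \<le> 2" by linarith+
    then show "\<bar>indicator A w - prob A\<bar> \<le> 2" by (simp add: indicator_def)
  qed simp
  moreover have "(\<integral>w. (indicator A w - prob A) * indicator B (U w) \<partial>M)
      = (\<integral>w. indicator (A \<inter> (U -` B \<inter> space M)) w - prob A * indicator (U -` B \<inter> space M) w \<partial>M)"
    by (intro Bochner_Integration.integral_cong refl) (auto simp: indicator_def)
  ultimately show "prob (A \<inter> (U -` B \<inter> space M)) = prob A * prob (U -` B \<inter> space M)"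
    by (simp add: integrable_real_indicator less_top[symmetric] Int_absorb2 sets.sets_into_space)
qed

text \<open>Independence passes from the two pi-systems to the sigma-algebras they generate; the
  expectations against an indicator then factor for U and for its square.\<close>

lemma sigma_factor:
  assumes A: "A \<in> sigma_sets (space M) (cyl V)"
  shows "A \<in> events" "(\<integral>w. U w * indicator A w \<partial>M) = (\<integral>w. U w \<partial>M) * prob A"
    "(\<integral>w. (U w)\<^sup>2 * indicator A w \<partial>M) = (\<integral>w. (U w)\<^sup>2 \<partial>M) * prob A"
proof -
  have Um[measurable]: "U \<in> borel_measurable M" using L_sqi[OF U] by (rule sqi_measurable)
  have cE: "cyl V \<subseteq> events" using cylinder_factor(2)[of _ UNIV] by auto
  then have sE: "sigma_sets (space M) (cyl V) \<subseteq> events" by (rule sets.sigma_sets_subset)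
  then show Am[measurable]: "A \<in> events" using A by blast
  let ?U = "{U -` B \<inter> space M | B. B \<in> sets borel}"
  have "indep_set ?U (cyl V)"
    by (rule indep_setI) (use cE cylinder_factor in \<open>auto simp: Int_commute\<close>)
  moreover have "Int_stable ?U"
  proof (rule Int_stableI)
    fix a b assume "a \<in> ?U" "b \<in> ?U"
    then obtain B C where "B \<in> sets borel" "C \<in> sets borel" "a = U -` B \<inter> space M" "b = U -` C \<inter> space M" by blast
    then show "a \<inter> b \<in> ?U" by (intro CollectI exI[of _ "B \<inter> C"]) auto
  qed
  ultimately have ind: "indep_set (sigma_sets (space M) ?U) (sigma_sets (space M) (cyl V))"
    by (intro indep_set_sigma_sets Int_stable_cyl)
  interpret N: sigma_algebra "space M" "sigma_sets (space M) (cyl V)"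
    by (rule sigma_algebra_sigma_sets[OF cyl_Pow])
  let ?A = "{(indicator A :: _ \<Rightarrow> real) -` B \<inter> space M | B. B \<in> sets borel}"
  have "?A \<subseteq> sigma_sets (space M) (cyl V)"
  proof
    fix a assume "a \<in> ?A"
    then obtain B where a: "a = (indicator A :: _ \<Rightarrow> real) -` B \<inter> space M" by blast
    have "a = (if 1 \<in> B then A else {}) \<union> (if 0 \<in> B then space M - A else {})"
      using sets.sets_into_space[OF Am] unfolding a by (auto simp: indicator_def of_bool_def split: if_splits)
    also have "\<dots> \<in> sigma_sets (space M) (cyl V)" using A by auto
    finally show "a \<in> sigma_sets (space M) (cyl V)" .
  qed
  then have "sigma_sets (space M) ?A \<subseteq> sigma_sets (space M) (cyl V)" by (rule N.sigma_sets_subset)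
  then have "indep_set (sigma_sets (space M) ?U) (sigma_sets (space M) ?A)"
    using ind unfolding indep_set_def by (elim indep_sets_mono_sets) (auto split: bool.split)
  then have iv: "indep_var borel U borel (indicator A :: _ \<Rightarrow> real)"
    unfolding indep_var_eq by simp
  have iA: "integrable M (indicator A :: _ \<Rightarrow> real)"
    by (rule integrable_const_bound[where B = 1]) (auto simp: indicator_def)
  show "(\<integral>w. U w * indicator A w \<partial>M) = (\<integral>w. U w \<partial>M) * prob A"
    using indep_var_lebesgue_integral[OF iv integrable_sqi[OF L_sqi[OF U]] iA] by (simp add: Int_absorb2 sets.sets_into_space)
  have iv2: "indep_var borel ((\<lambda>x. x\<^sup>2) \<circ> U) borel ((\<lambda>x. x) \<circ> (indicator A :: _ \<Rightarrow> real))"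
    by (rule indep_var_compose[OF iv]) auto
  show "(\<integral>w. (U w)\<^sup>2 * indicator A w \<partial>M) = (\<integral>w. (U w)\<^sup>2 \<partial>M) * prob A"
    using indep_var_lebesgue_integral[OF iv2] integrable_sqi_power2[OF L_sqi[OF U]] iA
    by (simp add: o_def Int_absorb2 sets.sets_into_space)
qed

end

lemma uncorrelated_centered: "(\<integral>w. U w \<partial>M) = 0 \<Longrightarrow> uncorrelated U v \<longleftrightarrow> (\<integral>w. U w * v w \<partial>M) = 0"
  by (simp add: uncorrelated_def)

section \<open>Conditional expectations as orthogonal projections\<close>

definition orth :: "('a \<Rightarrow> real) \<Rightarrow> ('a \<Rightarrow> real) set \<Rightarrow> bool" where
  "orth U V \<longleftrightarrow> U \<in> L \<and> (\<integral>w. U w \<partial>M) = 0 \<and> (\<forall>v\<in>V. (\<integral>w. U w * v w \<partial>M) = 0)"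

lemma orth_add: assumes "orth U V" "orth W V" "V \<subseteq> L" shows "orth (\<lambda>w. U w + W w) V"
  using assms L_sqi integrable_sqi_mult
  unfolding orth_def by (auto simp: distrib_right integrable_sqi subset_iff intro!: L_add)

text \<open>U is centred and independent of the sigma-algebra generated by V, hence of F, so its
  integral over every event of F is 0.\<close>

lemma cond_exp_gaussian:
  assumes F: "subalgebra M F" and FV: "sets F \<subseteq> sigma_sets (space M) (cyl V)" and V: "V \<subseteq> L"
    and U: "orth U V" and X: "integrable M X" and Y: "integrable M Y" "Y \<in> borel_measurable F"
    and XY: "AE w in M. X w - Y w = U w"
  shows "AE w in M. real_cond_exp M F X w = Y w"
proof -
  interpret finite_measure_subalgebra M F by unfold_locales (rule F)
  show ?thesis
  proof (rule real_cond_exp_charact[OF _ X Y])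
    fix A assume A: "A \<in> sets F"
    then have As: "A \<in> sigma_sets (space M) (cyl V)" using FV by blast
    have Am: "A \<in> events" using A F by (auto simp: subalgebra_def)
    have "(\<integral>w. U w * indicator A w \<partial>M) = 0"
      using sigma_factor(2)[OF _ V _ As, of U] U by (auto simp: orth_def uncorrelated_centered)
    moreover have "(\<integral>w. U w * indicator A w \<partial>M) = (\<integral>w. indicator A w * X w - indicator A w * Y w \<partial>M)"
      using XY X Y(1) U Am by (intro integral_cong_AE)
        (auto simp: orth_def algebra_simps dest!: L_sqi elim!: eventually_mono intro: sqi_measurable)
    moreover have "integrable M (\<lambda>w. indicator A w * X w)" "integrable M (\<lambda>w. indicator A w * Y w)"
      using integrable_mult_indicator[OF Am X] integrable_mult_indicator[OF Am Y(1)] by simp_all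
    ultimately show "(\<integral>w\<in>A. X w \<partial>M) = (\<integral>w\<in>A. Y w \<partial>M)" by (simp add: set_lebesgue_integral_def)
  qed
qed

text \<open>Products follow from squares by polarization, as U + W is orthogonal as well. This is
  why conditional covariances are deterministic.\<close>

lemma cond_exp_gaussian_prod:
  assumes F: "subalgebra M F" and FV: "sets F \<subseteq> sigma_sets (space M) (cyl V)" and V: "V \<subseteq> L"
    and U: "orth U V" and W: "orth W V"
  shows "AE w in M. real_cond_exp M F (\<lambda>w. U w * W w) w = (\<integral>w. U w * W w \<partial>M)"
proof -
  interpret finite_measure_subalgebra M F by unfold_locales (rule F)
  have UL: "U \<in> L" "W \<in> L" using U W by (auto simp: orth_def)
  note sq = L_sqi[OF UL(1)] L_sqi[OF UL(2)]
  have UW: "orth (\<lambda>w. U w + W w) V" by (rule orth_add[OF U W V])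
  have fac: "(\<integral>w. (f w)\<^sup>2 * indicator A w \<partial>M) = (\<integral>w. (f w)\<^sup>2 \<partial>M) * prob A"
    if "orth f V" "A \<in> sigma_sets (space M) (cyl V)" for f A
    using sigma_factor(3)[OF _ V _ that(2), of f] that(1) by (auto simp: orth_def uncorrelated_centered)
  show ?thesis
  proof (rule real_cond_exp_charact[OF _ integrable_sqi_mult[OF sq]])
    fix A assume A: "A \<in> sets F"
    then have As: "A \<in> sigma_sets (space M) (cyl V)" using FV by blast
    have Am: "A \<in> events" using A F by (auto simp: subalgebra_def)
    have i2: "integrable M (\<lambda>w. (f w)\<^sup>2 * indicator A w)" if "sqi f" for f
      using integrable_mult_indicator[OF Am integrable_sqi_power2[OF that]] by (simp add: mult.commute)
    have pol: "U w * W w * c = (1/2) * ((U w + W w)\<^sup>2 * c) - (1/2) * ((U w)\<^sup>2 * c) - (1/2) * ((W w)\<^sup>2 * c)" for w c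
      by (simp add: power2_eq_square algebra_simps)
    have "(\<integral>w. U w * W w * indicator A w \<partial>M)
        = (1/2) * ((\<integral>w. (U w + W w)\<^sup>2 \<partial>M) * prob A) - (1/2) * ((\<integral>w. (U w)\<^sup>2 \<partial>M) * prob A) - (1/2) * ((\<integral>w. (W w)\<^sup>2 \<partial>M) * prob A)"
      unfolding pol fac[OF U As, symmetric] fac[OF W As, symmetric] fac[OF UW As, symmetric]
      using i2[OF sq(1)] i2[OF sq(2)] i2[OF sqi_add[OF sq]] by simp
    moreover have "(\<integral>w. U w * W w \<partial>M)
        = (1/2) * (\<integral>w. (U w + W w)\<^sup>2 \<partial>M) - (1/2) * (\<integral>w. (U w)\<^sup>2 \<partial>M) - (1/2) * (\<integral>w. (W w)\<^sup>2 \<partial>M)"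
      using pol[of _ 1] integrable_sqi_power2[OF sq(1)] integrable_sqi_power2[OF sq(2)] integrable_sqi_power2[OF sqi_add[OF sq]]
      by simp
    ultimately have "(\<integral>w. U w * W w * indicator A w \<partial>M) = (\<integral>w. U w * W w \<partial>M) * prob A"
      by (simp only: left_diff_distrib mult.assoc)
    then show "(\<integral>w\<in>A. U w * W w \<partial>M) = (\<integral>w\<in>A. (\<integral>w. U w * W w \<partial>M) \<partial>M)"
      using Am by (simp add: set_lebesgue_integral_def mult.commute Int_absorb2 sets.sets_into_space)
  qed auto
qed

text \<open>The Hilbert space projection onto the closed span of V, carried out on functions: the
  parallelogram identity makes a minimizing sequence Cauchy, and an almost surely convergent
  subsequence gives a limit that is exactly F-measurable, not only up to a null set. The last clause
  holds because the projection is an L2 limit of elements of the span.\<close>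

lemma gaussian_projection:
  assumes F: "subalgebra M F" and VF: "\<And>v. v \<in> V \<Longrightarrow> v \<in> borel_measurable F" and V: "V \<subseteq> L" and X: "X \<in> L"
  shows "\<exists>Y. Y \<in> borel_measurable F \<and> Y \<in> L \<and> orth (\<lambda>w. X w - Y w) V
     \<and> (\<forall>U. orth U V \<longrightarrow> (\<integral>w. U w * Y w \<partial>M) = 0)"
proof -
  define d where "d = (INF v\<in>lsp V. sqd X v)"
  have bdd: "bdd_below (sqd X ` lsp V)" by (rule bdd_belowI[of _ 0]) auto
  have ne: "lsp V \<noteq> {}" using lsp_const by blast
  have dle: "d \<le> sqd X v" if "v \<in> lsp V" for v unfolding d_def using bdd that by (rule cINF_lower)
  have "\<forall>n. \<exists>v\<in>lsp V. sqd X v < d + inverse (real (Suc n))"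
  proof
    fix n
    have "(INF v\<in>lsp V. sqd X v) < d + inverse (real (Suc n))" by (simp add: d_def)
    then show "\<exists>v\<in>lsp V. sqd X v < d + inverse (real (Suc n))"
      using cINF_less_iff[OF ne bdd] by blast
  qed
  then obtain Y where Y: "\<And>n. Y n \<in> lsp V" "\<And>n. sqd X (Y n) < d + inverse (real (Suc n))" by metis
  have YL: "Y n \<in> L" for n using L_lsp[OF V Y(1)] .
  note sX = L_sqi[OF X] note sY = L_sqi[OF YL]
  have par: "sqd (Y i) (Y j) \<le> 2 * inverse (real (Suc i)) + 2 * inverse (real (Suc j))" for i j
  proof -
    define c where "c w = (1/2) * (Y i w + Y j w)" for w
    have "c \<in> lsp V" unfolding c_def by (intro lsp_cmult lsp_add Y)
    then have dc: "d \<le> sqd X c" by (rule dle)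
    have sc: "sqi c" unfolding c_def by (intro sqi_cmult sqi_add sY)
    have "(Y i w - Y j w)\<^sup>2 = 2 * (X w - Y i w)\<^sup>2 + 2 * (X w - Y j w)\<^sup>2 - 4 * (X w - c w)\<^sup>2" for w
      by (simp add: c_def power2_eq_square algebra_simps)
    then have "sqd (Y i) (Y j) = 2 * sqd X (Y i) + 2 * sqd X (Y j) - 4 * sqd X c"
      unfolding sqd_def
      using integrable_sqi_power2[OF sqi_diff[OF sX sY[of i]]] integrable_sqi_power2[OF sqi_diff[OF sX sY[of j]]]
        integrable_sqi_power2[OF sqi_diff[OF sX sc]] by simp
    then show ?thesis using Y(2)[of i] Y(2)[of j] dc by linarith
  qed
  have cauchy: "\<exists>N. \<forall>i\<ge>N. \<forall>j\<ge>N. sqd (Y i) (Y j) < e" if e: "e > 0" for e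
  proof -
    obtain N where N: "inverse (real (Suc N)) < e / 4" using reals_Archimedean[of "e/4"] e by auto
    have mono: "inverse (real (Suc i)) \<le> inverse (real (Suc N))" if "i \<ge> N" for i using that by simp
    then have "sqd (Y i) (Y j) < e" if "i \<ge> N" "j \<ge> N" for i j
      using par[of i j] N mono[OF that(1)] mono[OF that(2)] by linarith
    then show ?thesis by blast
  qed
  have l1: "\<exists>N. \<forall>i\<ge>N. \<forall>j\<ge>N. (\<integral>w. norm (Y i w - Y j w) \<partial>M) < e" if e: "e > 0" for e
  proof -
    have "e\<^sup>2 > 0" using e by simp
    then obtain N where N: "\<And>i j. i \<ge> N \<Longrightarrow> j \<ge> N \<Longrightarrow> sqd (Y i) (Y j) < e\<^sup>2" using cauchy by blast
    have "(\<integral>w. norm (Y i w - Y j w) \<partial>M) < e" if ij: "i \<ge> N" "j \<ge> N" for i j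
    proof (rule power2_less_imp_less)
      have "sqi (\<lambda>w. \<bar>Y i w - Y j w\<bar>)" using sqi_diff[OF sY sY, of i j] by (auto simp: sqi_def)
      from sqi_cauchy_schwarz[OF this sqi_const[of 1]]
      have "(\<integral>w. norm (Y i w - Y j w) \<partial>M)\<^sup>2 \<le> sqd (Y i) (Y j)" by (simp add: sqd_def prob_space)
      then show "(\<integral>w. norm (Y i w - Y j w) \<partial>M)\<^sup>2 < e\<^sup>2" using N[OF ij] by simp
    qed (use e in simp)
    then show ?thesis by blast
  qed
  obtain r where r: "strict_mono r" "AE w in M. Cauchy (\<lambda>i. Y (r i) w)"
    by (rule cauchy_L1_AE_cauchy_subseq[of M Y, OF integrable_sqi[OF sY] l1])
  define Z where "Z w = lim (\<lambda>i. Y (r i) w)" for w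
  have YF: "Y n \<in> borel_measurable F" for n
    using Y(1)[of n] by (rule lsp_closed) (auto intro: VF)
  have ZF: "Z \<in> borel_measurable F" unfolding Z_def by (intro borel_measurable_lim_metric YF)
  have ZM: "Z \<in> borel_measurable M" using F ZF by (rule measurable_from_subalg)
  have ae: "AE w in M. (\<lambda>i. Y (r i) w) \<longlonglongrightarrow> Z w"
    using r(2) by eventually_elim (simp add: Z_def Cauchy_convergent convergent_LIMSEQ_iff[symmetric])
  have c2: "\<exists>N. \<forall>i\<ge>N. \<forall>j\<ge>N. sqd (Y (r i)) (Y (r j)) < e" if "e > 0" for e
    using cauchy[OF that] by (meson le_trans seq_suble[OF r(1)])
  note Zs = sqi_limit[OF sY ZM ae c2]
  have ZL: "Z \<in> L" by (rule L_limit[OF YL Zs])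
  have orthY: "(\<integral>w. U w * Y n w \<partial>M) = 0" if "orth U V" for U n
    using uncorrelated_lsp[OF _ V _ Y(1), of U] that by (auto simp: orth_def uncorrelated_centered)
  have "(\<integral>w. U w * Z w \<partial>M) = 0" if U: "orth U V" for U
  proof -
    have "(\<lambda>n. \<integral>w. Y (r n) w * U w \<partial>M) \<longlonglongrightarrow> (\<integral>w. Z w * U w \<partial>M)"
      using U by (intro tendsto_expectation_mult[OF sY Zs]) (auto simp: orth_def intro: L_sqi)
    moreover have "(\<integral>w. Y (r n) w * U w \<partial>M) = 0" for n using orthY[OF U] by (simp add: mult.commute)
    ultimately show ?thesis by (simp add: LIMSEQ_const_iff mult.commute)
  qed
  moreover have B: "(\<integral>w. (X w - Z w) * v w \<partial>M) = 0" if v: "v \<in> lsp V" for v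
  proof -
    have sv: "sqi v" using L_sqi[OF L_lsp[OF V v]] .
    define q where "q = (\<integral>w. (X w - Z w) * v w \<partial>M)"
    \<comment> \<open>Moving the near-minimizer \<open>Y n\<close> by a multiple s of v cannot bring
      the squared distance below \<open>d\<close>; so a quadratic polynomial in s is nonnegative up
      to the slack 1 / (n + 1), and its discriminant bounds the cross moment.\<close>
    have bd: "(\<integral>w. (X w - Y n w) * v w \<partial>M)\<^sup>2 \<le> inverse (real (Suc n)) * (\<integral>w. (v w)\<^sup>2 \<partial>M)" for n
    proof (rule quadratic_discriminant)
      fix s
      have "(\<lambda>w. Y n w + (- s) * v w) \<in> lsp V" by (intro lsp_add lsp_cmult Y v)
      then have "d \<le> sqd X (\<lambda>w. Y n w + (- s) * v w)" by (rule dle)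
      also have "\<dots> = (\<integral>w. (X w - Y n w)\<^sup>2 + (2 * s) * ((X w - Y n w) * v w) + s\<^sup>2 * (v w)\<^sup>2 \<partial>M)"
        unfolding sqd_def by (intro Bochner_Integration.integral_cong refl) (simp add: power2_eq_square algebra_simps)
      also have "\<dots> = sqd X (Y n) + 2 * s * (\<integral>w. (X w - Y n w) * v w \<partial>M) + s\<^sup>2 * (\<integral>w. (v w)\<^sup>2 \<partial>M)"
        using integrable_sqi_power2[OF sqi_diff[OF sX sY[of n]]] integrable_sqi_mult[OF sqi_diff[OF sX sY[of n]] sv]
          integrable_sqi_power2[OF sv] by (simp add: sqd_def)
      finally show "0 \<le> inverse (real (Suc n)) + 2 * s * (\<integral>w. (X w - Y n w) * v w \<partial>M) + s\<^sup>2 * (\<integral>w. (v w)\<^sup>2 \<partial>M)"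
        using Y(2)[of n] by linarith
    qed simp
    have "(\<lambda>n. (\<integral>w. (X w - Y (r n) w) * v w \<partial>M)) \<longlonglongrightarrow> q"
    proof -
      have "(\<lambda>n. (\<integral>w. X w * v w \<partial>M) - (\<integral>w. Y (r n) w * v w \<partial>M)) \<longlonglongrightarrow> (\<integral>w. X w * v w \<partial>M) - (\<integral>w. Z w * v w \<partial>M)"
        by (intro tendsto_intros tendsto_expectation_mult[OF sY Zs sv])
      then show ?thesis unfolding q_def left_diff_distrib
        using integrable_sqi_mult[OF sX sv] integrable_sqi_mult[OF sY sv] integrable_sqi_mult[OF Zs(1) sv] by simp
    qed
    then have "(\<lambda>n. (\<integral>w. (X w - Y (r n) w) * v w \<partial>M)\<^sup>2) \<longlonglongrightarrow> q\<^sup>2" by (intro tendsto_intros)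
    moreover have "(\<lambda>n. (\<integral>w. (X w - Y (r n) w) * v w \<partial>M)\<^sup>2) \<longlonglongrightarrow> 0"
    proof (rule tendsto_sandwich[OF _ _ tendsto_const])
      show "\<forall>\<^sub>F n in sequentially. (\<integral>w. (X w - Y (r n) w) * v w \<partial>M)\<^sup>2 \<le> inverse (real (Suc (r n))) * (\<integral>w. (v w)\<^sup>2 \<partial>M)"
        using bd by (intro always_eventually) blast
      show "(\<lambda>n. inverse (real (Suc (r n))) * (\<integral>w. (v w)\<^sup>2 \<partial>M)) \<longlonglongrightarrow> 0"
        using LIMSEQ_subseq_LIMSEQ[OF LIMSEQ_inverse_real_of_nat r(1)] by (intro tendsto_mult_left_zero) (simp add: o_def)
    qed auto
    ultimately have "q\<^sup>2 = 0" by (rule LIMSEQ_unique)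
    then show ?thesis by (simp add: q_def)
  qed
  then have "orth (\<lambda>w. X w - Z w) V"
    unfolding orth_def using L_diff[OF X ZL] B[OF lsp_const[of 1 V]] B[OF lsp_base] by auto
  ultimately show ?thesis using ZF ZL by blast
qed

lemma generated_sigma_cyl:
  fixes Z :: "real \<Rightarrow> 'a \<Rightarrow> real^'n"
  assumes Zm: "\<And>s. s \<in> I \<Longrightarrow> Z s \<in> borel_measurable M"
  defines "V \<equiv> {(\<lambda>w. Z s w $ i) | s i. s \<in> I}"
  shows "subalgebra M (generated_sigma M I Z)" "sets (generated_sigma M I Z) \<subseteq> sigma_sets (space M) (cyl V)"
    "\<And>v. v \<in> V \<Longrightarrow> v \<in> borel_measurable (generated_sigma M I Z)"
    "\<And>s. s \<in> I \<Longrightarrow> Z s \<in> borel_measurable (generated_sigma M I Z)"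
proof -
  let ?G = "\<Union>s\<in>I. {Z s -` A \<inter> space M | A. A \<in> sets borel}"
  have G: "?G \<subseteq> Pow (space M)" by auto
  have sG: "sets (generated_sigma M I Z) = sigma_sets (space M) ?G" "space (generated_sigma M I Z) = space M"
    unfolding generated_sigma_def using G by (auto simp: space_measure_of_conv)
  have "?G \<subseteq> events" using Zm by (auto intro: measurable_sets)
  then show "subalgebra M (generated_sigma M I Z)"
    unfolding subalgebra_def sG by (auto dest: sets.sigma_sets_subset)
  show Zs: "Z s \<in> borel_measurable (generated_sigma M I Z)" if "s \<in> I" for s
    by (rule measurableI) (use that in \<open>auto simp: sG intro!: sigma_sets.Basic\<close>)
  show "v \<in> borel_measurable (generated_sigma M I Z)" if "v \<in> V" for v
    using that measurable_compose[OF Zs borel_measurable_vec_nth] unfolding V_def by blast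
  define N where "N = sigma (space M) (cyl V)"
  have sN: "sets N = sigma_sets (space M) (cyl V)" "space N = space M"
    unfolding N_def using cyl_Pow by (auto simp: space_measure_of_conv)
  have ZN: "Z s \<in> borel_measurable N" if s: "s \<in> I" for s
  proof (subst borel_measurable_euclidean_space, intro ballI)
    fix b :: "real^'n" assume "b \<in> Basis"
    then obtain i where b: "b = axis i 1" by (auto simp: Basis_vec_def)
    have "(\<lambda>w. Z s w $ i) \<in> borel_measurable N"
    proof (rule measurableI)
      fix A :: "real set" assume A: "A \<in> sets borel"
      have "(\<lambda>w. Z s w $ i) -` A \<inter> space N = {w\<in>space M. \<forall>v\<in>{\<lambda>w. Z s w $ i}. v w \<in> (\<lambda>_. A) v}"
        by (auto simp: sN)
      also have "\<dots> \<in> cyl V" unfolding cyl_def using A s by (auto simp: V_def intro!: exI[of _ "{\<lambda>w. Z s w $ i}"] exI[of _ "\<lambda>_. A"])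
      finally show "(\<lambda>w. Z s w $ i) -` A \<inter> space N \<in> sets N" unfolding sN by (rule sigma_sets.Basic)
    qed simp
    then show "(\<lambda>w. Z s w \<bullet> b) \<in> borel_measurable N" by (simp add: b inner_axis)
  qed
  have "?G \<subseteq> sigma_sets (space M) (cyl V)"
    using measurable_sets[OF ZN] unfolding sN by auto
  then show "sets (generated_sigma M I Z) \<subseteq> sigma_sets (space M) (cyl V)"
    unfolding sG(1) by (rule sigma_algebra.sigma_sets_subset[OF sigma_algebra_sigma_sets[OF cyl_Pow]])
qed

end

section \<open>Standard Gaussian vectors\<close>

lemma Basis_real_vec: "(Basis :: (real^'m) set) = range (\<lambda>i. axis i 1)"
  by (auto simp: Basis_vec_def)

lemma prod_Basis_vec: "(\<Prod>b\<in>(Basis :: (real^'m) set). f b) = (\<Prod>i\<in>UNIV. f (axis i 1))"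
  unfolding Basis_real_vec by (subst prod.reindex) (auto simp: inj_on_def axis_eq_axis)

definition std_gaussian_density :: "real^'m \<Rightarrow> real" where
  "std_gaussian_density x = (\<Prod>i\<in>UNIV. std_normal_density (x $ i))"

lemma std_gaussian_eq: "std_gaussian = density lborel (\<lambda>x. ennreal (std_gaussian_density x))"
  by (simp add: std_gaussian_def std_gaussian_density_def)

lemma std_gaussian_density_norm:
  "std_gaussian_density (x :: real^'m) = (1 / sqrt (2 * pi)) ^ CARD('m) * exp (- (norm x)\<^sup>2 / 2)"
proof -
  have "(norm x)\<^sup>2 = (\<Sum>i\<in>UNIV. (x $ i)\<^sup>2)"
    by (simp add: norm_vec_def L2_set_def sum_nonneg)
  then have "exp (- (norm x)\<^sup>2 / 2) = (\<Prod>i\<in>UNIV. exp (- (x $ i)\<^sup>2 / 2))"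
    by (simp add: exp_sum[symmetric] sum_negf sum_divide_distrib)
  then show ?thesis
    by (simp only: std_gaussian_density_def std_normal_density_def prod.distrib prod_constant)
qed

lemma std_gaussian_density_nonneg [simp]: "0 \<le> std_gaussian_density x"
  by (simp add: std_gaussian_density_def prod_nonneg)

lemma borel_measurable_std_gaussian_density [measurable]: "std_gaussian_density \<in> borel_measurable borel"
  unfolding std_gaussian_density_norm[abs_def] by measurable

lemma sets_std_gaussian [simp, measurable_cong]: "sets std_gaussian = sets borel" "space std_gaussian = UNIV"
  by (auto simp: std_gaussian_def)

lemma nn_integral_std_gaussian_prod:
  assumes [measurable]: "\<And>i. f i \<in> borel_measurable borel" and f: "\<And>i x. 0 \<le> f i x"
  shows "(\<integral>\<^sup>+x. ennreal (\<Prod>i\<in>UNIV. f i (x $ i)) \<partial>std_gaussian)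
    = (\<Prod>i\<in>(UNIV :: 'm::finite set). \<integral>\<^sup>+x. ennreal (std_normal_density x * f i x) \<partial>lborel)"
proof -
  have m: "(\<lambda>x :: real^'m. f i (x $ i)) \<in> borel_measurable borel" for i
    by (rule measurable_compose[OF borel_measurable_vec_nth]) simp
  have "(\<integral>\<^sup>+x. ennreal (\<Prod>i\<in>(UNIV :: 'm set). f i (x $ i)) \<partial>std_gaussian)
      = (\<integral>\<^sup>+x. ennreal (std_gaussian_density x) * ennreal (\<Prod>i\<in>(UNIV :: 'm set). f i (x $ i)) \<partial>lborel)"
    unfolding std_gaussian_eq using m by (subst nn_integral_density) (auto intro!: borel_measurable_prod)
  \<comment> \<open>Lebesgue measure factors over \<open>Basis\<close>; \<open>THE\<close> recovers
    the index of a basis vector.\<close>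
  also have "\<dots> = (\<integral>\<^sup>+x. (\<Prod>b\<in>(Basis :: (real^'m) set). ennreal (std_normal_density (x \<bullet> b) * f (THE i. b = axis i 1) (x \<bullet> b))) \<partial>lborel)"
  proof (rule nn_integral_cong)
    fix x :: "real^'m"
    have "(THE i. axis j (1::real) = axis i 1) = j" for j :: 'm
      by (rule the_equality) (auto simp: axis_eq_axis)
    then show "ennreal (std_gaussian_density x) * ennreal (\<Prod>i\<in>UNIV. f i (x $ i))
        = (\<Prod>b\<in>Basis. ennreal (std_normal_density (x \<bullet> b) * f (THE i. b = axis i 1) (x \<bullet> b)))"
      unfolding prod_Basis_vec std_gaussian_density_def
      by (simp add: inner_axis prod_ennreal[symmetric] prod.distrib ennreal_mult f prod_nonneg)
  qed
  also have "\<dots> = (\<Prod>b\<in>(Basis :: (real^'m) set). \<integral>\<^sup>+x. ennreal (std_normal_density x * f (THE i. b = axis i 1) x) \<partial>lborel)"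
    by (rule nn_integral_lborel_prod) (auto simp: f)
  also have "\<dots> = (\<Prod>i\<in>(UNIV :: 'm set). \<integral>\<^sup>+x. ennreal (std_normal_density x * f i x) \<partial>lborel)"
  proof -
    have "(THE i. axis j (1::real) = axis i 1) = j" for j :: 'm
      by (rule the_equality) (auto simp: axis_eq_axis)
    then show ?thesis unfolding prod_Basis_vec by simp
  qed
  finally show ?thesis .
qed

lemma nn_integral_std_normal: "(\<integral>\<^sup>+x. ennreal (std_normal_density x) \<partial>lborel) = 1"
  "(\<integral>\<^sup>+x. ennreal (std_normal_density x * x\<^sup>2) \<partial>lborel) = 1"
proof -
  show "(\<integral>\<^sup>+x. ennreal (std_normal_density x) \<partial>lborel) = 1"
    by (subst nn_integral_eq_integral) auto
  have "integrable lborel (\<lambda>x. std_normal_density x * x\<^sup>2)" by (rule integrable_std_normal_moment)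
  moreover have "(\<integral>x. std_normal_density x * x\<^sup>2 \<partial>lborel) = 1"
    using integral_std_normal_moment_even[of 1] by (simp add: fact_numeral)
  ultimately show "(\<integral>\<^sup>+x. ennreal (std_normal_density x * x\<^sup>2) \<partial>lborel) = 1"
    by (subst nn_integral_eq_integral) auto
qed

lemma prob_space_std_gaussian: "prob_space (std_gaussian :: (real^'m) measure)"
proof (rule prob_spaceI)
  have "emeasure (std_gaussian :: (real^'m) measure) (space std_gaussian) = (\<integral>\<^sup>+x. ennreal (\<Prod>i\<in>(UNIV :: 'm set). (\<lambda>i x. 1) i (x $ i)) \<partial>(std_gaussian :: (real^'m) measure))"
    by simp
  also have "\<dots> = 1" by (subst nn_integral_std_gaussian_prod) (auto simp: nn_integral_std_normal)
  finally show "emeasure (std_gaussian :: (real^'m) measure) (space std_gaussian) = 1" .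
qed

abbreviation std_cyl :: "'m set \<Rightarrow> ('m \<Rightarrow> real set) \<Rightarrow> (real^'m) set" where
  "std_cyl J B \<equiv> {x. \<forall>i\<in>J. x $ i \<in> B i}"

lemma std_cyl_borel: assumes "\<And>i. B i \<in> sets borel" shows "std_cyl J B \<in> sets (borel :: (real^'m) measure)"
proof -
  have "std_cyl J B = {x \<in> space borel. \<forall>i\<in>J. x $ i \<in> B i}" by simp
  also have "\<dots> \<in> sets (borel :: (real^'m) measure)"
  proof (rule sets.sets_Collect_finite_All)
    fix i show "{x \<in> space borel. (x :: real^'m) $ i \<in> B i} \<in> sets borel"
      using measurable_sets[OF borel_measurable_vec_nth assms, of i i] by (simp add: vimage_def)
  qed simp
  finally show ?thesis .
qed

lemma emeasure_std_gaussian_cyl: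
  assumes B[measurable]: "\<And>i. B i \<in> sets borel"
  shows "emeasure (std_gaussian :: (real^'m) measure) (std_cyl J B) = (\<Prod>i\<in>J. emeasure std_normal_distribution (B i))"
proof -
  define f where "f i x = (if i \<in> J then indicator (B i) x else 1 :: real)" for i x
  have "emeasure (std_gaussian :: (real^'m) measure) (std_cyl J B) = (\<integral>\<^sup>+x. indicator (std_cyl J B) x \<partial>(std_gaussian :: (real^'m) measure))"
    using std_cyl_borel[OF B] by simp
  also have "\<dots> = (\<integral>\<^sup>+x. ennreal (\<Prod>i\<in>UNIV. f i (x $ i)) \<partial>(std_gaussian :: (real^'m) measure))"
  proof (rule nn_integral_cong)
    fix x :: "real^'m"
    show "indicator (std_cyl J B) x = ennreal (\<Prod>i\<in>UNIV. f i (x $ i))"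
    proof (cases "x \<in> std_cyl J B")
      case True
      then have "(\<Prod>i\<in>UNIV. f i (x $ i)) = 1" by (intro prod.neutral) (auto simp: f_def)
      then show ?thesis using True by simp
    next
      case False
      then obtain i where "i \<in> J" "x $ i \<notin> B i" by blast
      then have "(\<Prod>i\<in>UNIV. f i (x $ i)) = 0" by (intro prod_zero) (auto simp: f_def intro!: exI[of _ i])
      with False show ?thesis by (simp only: indicator_simps ennreal_0 not_False_eq_True)
    qed
  qed
  also have "\<dots> = (\<Prod>i\<in>(UNIV :: 'm set). \<integral>\<^sup>+x. ennreal (std_normal_density x * f i x) \<partial>lborel)"
    by (rule nn_integral_std_gaussian_prod) (auto simp: f_def)
  also have "\<dots> = (\<Prod>i\<in>(UNIV :: 'm set). if i \<in> J then emeasure std_normal_distribution (B i) else 1)"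
  proof (rule prod.cong[OF refl])
    fix i :: 'm
    show "(\<integral>\<^sup>+x. ennreal (std_normal_density x * f i x) \<partial>lborel) = (if i \<in> J then emeasure std_normal_distribution (B i) else 1)"
    proof (cases "i \<in> J")
      case True
      then have "(\<integral>\<^sup>+x. ennreal (std_normal_density x * f i x) \<partial>lborel) = (\<integral>\<^sup>+x. ennreal (std_normal_density x) * indicator (B i) x \<partial>lborel)"
        by (intro nn_integral_cong) (auto simp: f_def indicator_def)
      then show ?thesis using True by (simp add: emeasure_density)
    qed (simp add: f_def nn_integral_std_normal)
  qed
  also have "\<dots> = (\<Prod>i\<in>J. emeasure std_normal_distribution (B i))" by (simp add: prod.If_cases)
  finally show ?thesis .
qed

lemma measurable_std_gaussian_component: "(\<lambda>x :: real^'m. x $ i) \<in> borel_measurable std_gaussian"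
  by (simp add: measurable_cong_sets[OF sets_std_gaussian(1) refl] borel_measurable_vec_nth)

lemma distr_std_gaussian_component:
  "distr (std_gaussian :: (real^'m) measure) borel (\<lambda>x. x $ i) = std_normal_distribution"
proof (rule measure_eqI)
  fix A assume "A \<in> sets (distr (std_gaussian :: (real^'m) measure) borel (\<lambda>x. x $ i))"
  then have A: "A \<in> sets borel" by simp
  have "emeasure (distr (std_gaussian :: (real^'m) measure) borel (\<lambda>x. x $ i)) A = emeasure (std_gaussian :: (real^'m) measure) (std_cyl {i} (\<lambda>_. A))"
    by (subst emeasure_distr[OF measurable_std_gaussian_component A]) (simp add: vimage_def)
  then show "emeasure (distr (std_gaussian :: (real^'m) measure) borel (\<lambda>x. x $ i)) A = emeasure std_normal_distribution A"
    by (subst (asm) emeasure_std_gaussian_cyl) (use A in auto)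
qed simp

lemma prob_space_std_normal: "prob_space std_normal_distribution"
  by (rule prob_space_normal_density) simp

lemma indep_vars_std_gaussian:
  "prob_space.indep_vars (std_gaussian :: (real^'m) measure) (\<lambda>_. borel) (\<lambda>i x. x $ i) UNIV"
proof -
  interpret prob_space "std_gaussian :: (real^'m) measure" by (rule prob_space_std_gaussian)
  interpret N: prob_space std_normal_distribution by (rule prob_space_std_normal)
  have pre: "(\<lambda>x :: real^'m. x $ i) -` A \<in> sets borel" if "A \<in> sets borel" for i A
    using measurable_sets[OF borel_measurable_vec_nth that] by simp
  show ?thesis unfolding indep_vars_def2
  proof (intro conjI ballI indep_setsI)
    fix A :: "'m \<Rightarrow> (real^'m) set" and J :: "'m set"
    assume J: "J \<noteq> {}" "finite J" and A: "\<forall>j\<in>J. A j \<in> {(\<lambda>x. x $ j) -` B \<inter> space std_gaussian | B. B \<in> sets borel}"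
    then obtain B where B: "\<And>j. j \<in> J \<Longrightarrow> B j \<in> sets borel \<and> A j = (\<lambda>x. x $ j) -` B j"
      by simp metis
    define C where "C j = (if j \<in> J then B j else UNIV)" for j
    have C: "C j \<in> sets borel" for j using B by (auto simp: C_def)
    have p: "prob (std_cyl K C) = (\<Prod>j\<in>K. measure std_normal_distribution (C j))" for K
      using emeasure_std_gaussian_cyl[of C K] C
      by (simp add: emeasure_eq_measure N.emeasure_eq_measure prod_ennreal prod_nonneg)
    have "(\<Inter>j\<in>J. A j) = std_cyl J C" using B J by (auto simp: C_def)
    moreover have "A j = std_cyl {j} C" if "j \<in> J" for j using B[OF that] that by (auto simp: C_def)
    ultimately show "prob (\<Inter>j\<in>J. A j) = (\<Prod>j\<in>J. prob (A j))" using p p[of "{_}"] by simp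
  qed (use measurable_std_gaussian_component pre in auto)
qed

lemma std_gaussian_moments:
  "integrable (std_gaussian :: (real^'m) measure) (\<lambda>x. x $ i)" "(\<integral>x. x $ i \<partial>(std_gaussian :: (real^'m) measure)) = 0"
  "integrable (std_gaussian :: (real^'m) measure) (\<lambda>x. x $ i * x $ j)"
  "(\<integral>x. x $ i * x $ j \<partial>(std_gaussian :: (real^'m) measure)) = (if i = j then 1 else 0)"
proof -
  interpret prob_space "std_gaussian :: (real^'m) measure" by (rule prob_space_std_gaussian)
  have "gaussian_rv (std_gaussian :: (real^'m) measure) (\<lambda>x. x $ i)" for i
    unfolding gaussian_rv_def distr_std_gaussian_component
    using measurable_std_gaussian_component by (intro conjI exI[of _ 0] exI[of _ 1]) (auto simp: distr_id2)
  note s = gaussian_rv_sqi_gchar(1)[OF this]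
  have d: "distr (std_gaussian :: (real^'m) measure) borel (\<lambda>x. x $ i) = distr (density lborel (\<lambda>x. ennreal (std_normal_density x))) borel (\<lambda>x. 0 + 1 * x)" for i
    by (simp add: distr_std_gaussian_component distr_id2)
  show 1: "integrable (std_gaussian :: (real^'m) measure) (\<lambda>x. x $ i)" "integrable (std_gaussian :: (real^'m) measure) (\<lambda>x. x $ i * x $ j)" for i j
    by (intro integrable_sqi integrable_sqi_mult s)+
  show m: "(\<integral>x. x $ i \<partial>(std_gaussian :: (real^'m) measure)) = 0" for i
    using distr_std_normal(1)[OF d measurable_std_gaussian_component, of "\<lambda>y. y" i] by (simp add: std_normal_moments)
  have v: "(\<integral>x. (x $ i)\<^sup>2 \<partial>(std_gaussian :: (real^'m) measure)) = 1" for i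
    using distr_std_normal(1)[OF d measurable_std_gaussian_component, of "\<lambda>y. y\<^sup>2" i] by (simp add: std_normal_moments)
  show "(\<integral>x. x $ i * x $ j \<partial>(std_gaussian :: (real^'m) measure)) = (if i = j then 1 else 0)"
  proof (cases "i = j")
    case True
    then show ?thesis using v by (simp add: power2_eq_square)
  next
    case False
    have "indep_vars (\<lambda>_. borel) (\<lambda>i x. x $ i) {i, j}"
      by (rule indep_vars_subset[OF indep_vars_std_gaussian]) simp
    then have "(\<integral>x. (\<Prod>k\<in>{i, j}. x $ k) \<partial>(std_gaussian :: (real^'m) measure)) = (\<Prod>k\<in>{i, j}. \<integral>x. x $ k \<partial>(std_gaussian :: (real^'m) measure))"
      by (intro indep_vars_lebesgue_integral) (auto simp: 1)
    then show ?thesis using False by (simp add: m)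
  qed
qed

text \<open>By independence the characteristic function of a linear form is a product of Gaussian
  ones, so the form has the law of a multiple of one standard normal variable; the multiple is the
  Euclidean norm of the coefficients.\<close>

lemma gaussian_space_std_gaussian:
  "gaussian_space (std_gaussian :: (real^'m) measure) (range (\<lambda>i x. x $ i))"
  "distr (std_gaussian :: (real^'m) measure) borel (\<lambda>x. \<Sum>i\<in>UNIV. c i * x $ i)
     = distr std_normal_distribution borel (\<lambda>x. 0 + sqrt (\<Sum>i\<in>UNIV. (c i)\<^sup>2) * x)"
proof -
  interpret prob_space "std_gaussian :: (real^'m) measure" by (rule prob_space_std_gaussian)
  interpret N: prob_space std_normal_distribution by (rule prob_space_std_normal)
  have law: "distr (std_gaussian :: (real^'m) measure) borel (\<lambda>x. \<Sum>i\<in>UNIV. c i * x $ i)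
     = distr std_normal_distribution borel (\<lambda>x. 0 + sqrt (\<Sum>i\<in>UNIV. (c i)\<^sup>2) * x)" for c :: "'m \<Rightarrow> real"
  proof (rule Levy_uniqueness)
    have m: "(\<lambda>x :: real^'m. c i * x $ i) \<in> borel_measurable std_gaussian" for i
      by (intro borel_measurable_times borel_measurable_const measurable_std_gaussian_component)
    show "real_distribution (distr (std_gaussian :: (real^'m) measure) borel (\<lambda>x. \<Sum>i\<in>UNIV. c i * x $ i))"
      by (intro real_distribution_distr borel_measurable_sum m)
    show "real_distribution (distr std_normal_distribution borel (\<lambda>x. 0 + sqrt (\<Sum>i\<in>UNIV. (c i)\<^sup>2) * x))"
      by (intro N.real_distribution_distr) simp
    show "char (distr (std_gaussian :: (real^'m) measure) borel (\<lambda>x. \<Sum>i\<in>UNIV. c i * x $ i))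
       = char (distr std_normal_distribution borel (\<lambda>x. 0 + sqrt (\<Sum>i\<in>UNIV. (c i)\<^sup>2) * x))"
    proof
      fix t
      have scale: "char (distr std_normal_distribution borel (\<lambda>x. b * x)) t = of_real (exp (- (t * b)\<^sup>2 / 2))" for b
      proof -
        have "char (distr std_normal_distribution borel (\<lambda>x. b * x)) t = char std_normal_distribution (t * b)"
          unfolding char_def by (subst integral_distr) (auto simp: mult.assoc)
        then show ?thesis by (simp add: char_std_normal_distribution)
      qed
      have iv: "indep_vars (\<lambda>_. borel) (\<lambda>i x. c i * x $ i) UNIV"
        using indep_vars_compose2[OF indep_vars_std_gaussian, of "\<lambda>i y. c i * y" "\<lambda>_. borel"] by simp
      have dc: "distr (std_gaussian :: (real^'m) measure) borel (\<lambda>x. c i * x $ i) = distr std_normal_distribution borel (\<lambda>x. c i * x)" for i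
        unfolding distr_std_gaussian_component[of i, symmetric]
        by (subst distr_distr) (auto simp: o_def measurable_std_gaussian_component)
      have "char (distr (std_gaussian :: (real^'m) measure) borel (\<lambda>x. \<Sum>i\<in>UNIV. c i * x $ i)) t
         = (\<Prod>i\<in>UNIV. char (distr (std_gaussian :: (real^'m) measure) borel (\<lambda>x. c i * x $ i)) t)"
        by (rule char_distr_sum[OF iv])
      also have "\<dots> = (\<Prod>i\<in>(UNIV :: 'm set). of_real (exp (- (t * c i)\<^sup>2 / 2)))" by (simp add: dc scale)
      also have "\<dots> = of_real (exp (\<Sum>i\<in>(UNIV :: 'm set). - (t * c i)\<^sup>2 / 2))" by (simp add: exp_sum del: of_real_exp)
      also have "(\<Sum>i\<in>(UNIV :: 'm set). - (t * c i)\<^sup>2 / 2) = - (t * sqrt (\<Sum>i\<in>UNIV. (c i)\<^sup>2))\<^sup>2 / 2"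
        by (simp add: power_mult_distrib sum_nonneg sum_distrib_left sum_divide_distrib[symmetric] sum_negf)
      also have "of_real (exp \<dots>) = char (distr std_normal_distribution borel (\<lambda>x. 0 + sqrt (\<Sum>i\<in>UNIV. (c i)\<^sup>2) * x)) t"
        using scale[of "sqrt (\<Sum>i\<in>UNIV. (c i)\<^sup>2)"] by simp
      finally show "char (distr (std_gaussian :: (real^'m) measure) borel (\<lambda>x. \<Sum>i\<in>UNIV. c i * x $ i)) t
         = char (distr std_normal_distribution borel (\<lambda>x. 0 + sqrt (\<Sum>i\<in>UNIV. (c i)\<^sup>2) * x)) t" .
    qed
  qed
  show "distr (std_gaussian :: (real^'m) measure) borel (\<lambda>x. \<Sum>i\<in>UNIV. c i * x $ i)
     = distr std_normal_distribution borel (\<lambda>x. 0 + sqrt (\<Sum>i\<in>UNIV. (c i)\<^sup>2) * x)" by (rule law)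
  show "gaussian_space (std_gaussian :: (real^'m) measure) (range (\<lambda>i x. x $ i))"
  proof (unfold_locales, unfold gaussian_family_def, intro allI impI)
    fix F :: "((real^'m) \<Rightarrow> real) set" and c :: "((real^'m) \<Rightarrow> real) \<Rightarrow> real" assume F: "finite F \<and> F \<subseteq> range (\<lambda>i x. x $ i)"
    define d where "d i = (if (\<lambda>x. x $ i) \<in> F then c (\<lambda>x. x $ i) else 0)" for i :: 'm
    have inj: "inj (\<lambda>(i::'m) (x :: real^'m). x $ i)"
    proof (rule injI)
      fix i j :: 'm assume "(\<lambda>x :: real^'m. x $ i) = (\<lambda>x. x $ j)"
      then have "axis i (1::real) $ i = axis i 1 $ j" by (rule fun_cong)
      then show "i = j" by (simp add: axis_def split: if_splits)
    qed
    have sum: "(\<Sum>f\<in>F. c f * f x) = (\<Sum>i\<in>UNIV. d i * x $ i)" for x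
    proof -
      have "(\<Sum>f\<in>F. c f * f x) = (\<Sum>f\<in>range (\<lambda>i x. x $ i). if f \<in> F then c f * f x else 0)"
        using F by (intro sum.mono_neutral_cong_left) auto
      also have "\<dots> = (\<Sum>i\<in>UNIV. d i * x $ i)"
        by (subst sum.reindex[OF inj]) (auto simp: d_def intro!: sum.cong)
      finally show ?thesis .
    qed
    have "(\<lambda>x :: real^'m. \<Sum>i\<in>UNIV. d i * x $ i) \<in> borel_measurable std_gaussian"
      by (intro borel_measurable_sum borel_measurable_times borel_measurable_const measurable_std_gaussian_component)
    then show "gaussian_rv std_gaussian (\<lambda>\<omega>. \<Sum>f\<in>F. c f * f \<omega>)"
      unfolding gaussian_rv_def sum using law[of d] by blast
  qed
qed

text \<open>The coordinates of \<open>U *v x\<close> are uncorrelated, hence independent.\<close>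

lemma std_gaussian_orthogonal:
  fixes U :: "real^'m^'m" assumes U: "orthogonal_matrix U"
  shows "distr std_gaussian borel ((*v) U) = (std_gaussian :: (real^'m) measure)"
proof -
  interpret gaussian_space "std_gaussian :: (real^'m) measure" "range (\<lambda>i x. x $ i)" by (rule gaussian_space_std_gaussian)
  interpret N: prob_space std_normal_distribution by (rule prob_space_std_normal)
  define Y where "Y i x = (U *v x) $ i" for i x
  have Yi: "Y i = (\<lambda>x. \<Sum>k\<in>UNIV. U $ i $ k * x $ k)" for i by (simp add: Y_def matrix_vector_mult_def fun_eq_iff)
  have YL: "Y i \<in> L" for i unfolding Yi by (intro L_sum L_cmult L_base) auto
  have Ym: "Y i \<in> borel_measurable std_gaussian" for i using L_sqi[OF YL] by (rule sqi_measurable)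
  have row: "(\<Sum>k\<in>UNIV. U $ i $ k * U $ j $ k) = (if i = j then 1 else 0)" for i j
  proof -
    have "(U ** transpose U) $ i $ j = (mat 1 :: real^'m^'m) $ i $ j" using U by (simp add: orthogonal_matrix_def)
    then show ?thesis by (simp add: matrix_matrix_mult_def transpose_def mat_def)
  qed
  have mean: "expectation (Y i) = 0" for i unfolding Yi by (simp add: std_gaussian_moments)
  have cov: "expectation (\<lambda>x. Y i x * Y j x) = (if i = j then 1 else 0)" for i j
  proof -
    have "Y i x * Y j x = (\<Sum>k\<in>UNIV. \<Sum>l\<in>UNIV. (U $ i $ k * U $ j $ l) * (x $ k * x $ l))" for x
      unfolding Yi sum_product by (intro sum.cong refl) (simp add: mult_ac)
    then have "expectation (\<lambda>x. Y i x * Y j x) = (\<Sum>k\<in>UNIV. \<Sum>l\<in>UNIV. (U $ i $ k * U $ j $ l) * (if k = l then 1 else 0))"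
      by (simp add: std_gaussian_moments)
    also have "\<dots> = (\<Sum>k\<in>UNIV. U $ i $ k * U $ j $ k)" by (simp add: if_distrib cong: if_cong)
    finally show ?thesis by (simp add: row)
  qed
  have law: "distr std_gaussian borel (Y i) = std_normal_distribution" for i
    using row[of i i] unfolding Yi gaussian_space_std_gaussian(2) by (simp add: power2_eq_square distr_id2)
  have pY: "prob {x. \<forall>j\<in>J. Y j x \<in> B j} = (\<Prod>j\<in>J. measure std_normal_distribution (B j))"
    if "finite J" and B: "\<And>j. B j \<in> sets borel" for J B
    using that(1)
  proof (induction J rule: finite_induct)
    case empty
    show ?case using prob_space by simp
  next
    case (insert i J)
    have cylJ: "{x. \<forall>j\<in>J. Y j x \<in> B j} \<in> cyl (Y ` J)"
    proof -
      \<comment> \<open>Cylinders are indexed by functions, the sets B by indices. Distinct indices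
        give distinct functions, since the coordinates are uncorrelated with second moment
        1.\<close>
      have injY: "j = k" if "Y j = Y k" for j k
        using cov[of j k] cov[of j j] that by (auto split: if_splits)
      define C where "C s = (if s \<in> Y ` J then B (THE j. s = Y j) else UNIV)" for s
      have CY: "C (Y j) = B j" if "j \<in> J" for j
      proof -
        have "(THE k. Y j = Y k) = j" using injY by (intro the_equality) auto
        then show ?thesis using that by (simp add: C_def)
      qed
      have "{x. \<forall>j\<in>J. Y j x \<in> B j} = {x \<in> space std_gaussian. \<forall>s\<in>Y ` J. s x \<in> C s}" using CY by auto
      moreover have "C s \<in> sets borel" for s using B by (auto simp: C_def)
      ultimately show ?thesis unfolding cyl_def using insert.hyps(1) by blast
    qed
    have "prob ({x. \<forall>j\<in>J. Y j x \<in> B j} \<inter> (Y i -` B i \<inter> space std_gaussian)) = prob {x. \<forall>j\<in>J. Y j x \<in> B j} * prob (Y i -` B i \<inter> space std_gaussian)"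
    proof (rule cylinder_factor(1)[OF YL _ _ cylJ B])
      show "Y ` J \<subseteq> L" using YL by auto
      show "uncorrelated (Y i) v" if "v \<in> Y ` J" for v
        using that insert.hyps(2) cov by (auto simp: uncorrelated_centered mean)
    qed
    moreover have "prob (Y i -` B i \<inter> space std_gaussian) = measure std_normal_distribution (B i)"
      using measure_distr[OF Ym B, of i i] by (simp add: law)
    moreover have "{x. \<forall>j\<in>insert i J. Y j x \<in> B j} = {x. \<forall>j\<in>J. Y j x \<in> B j} \<inter> (Y i -` B i \<inter> space std_gaussian)" by auto
    ultimately show ?case using insert by simp
  qed
  have mU: "(*v) U \<in> borel_measurable borel" by (intro borel_measurable_continuous_onI continuous_intros)
  then have mU': "(*v) U \<in> borel_measurable std_gaussian" by (simp add: measurable_cong_sets[OF sets_std_gaussian(1) refl])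
  interpret Q: prob_space "distr std_gaussian borel ((*v) U)" by (rule prob_space_distr[OF mU'])
  define E where "E = range (\<lambda>(a, b). box a b :: (real^'m) set)"
  show ?thesis
  proof (rule measure_eqI_generator_eq[where E = E and \<Omega> = UNIV and A = "\<lambda>n::nat. box (- (real n *\<^sub>R One)) (real n *\<^sub>R One)"])
    show "Int_stable E"
    proof (rule Int_stableI)
      fix a b assume "a \<in> E" "b \<in> E"
      then obtain l u l' u' where "a = box l u" "b = box l' u'" by (auto simp: E_def)
      then show "a \<inter> b \<in> E" by (auto simp: E_def box_Int_box)
    qed
    show "sets (distr std_gaussian borel ((*v) U)) = sigma_sets UNIV E" "sets std_gaussian = sigma_sets UNIV E"
      by (simp_all add: E_def borel_eq_box)
    fix X assume "X \<in> E"
    then obtain l u where X: "X = box l u" by (auto simp: E_def)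
    define B where "B i = {l $ i <..< u $ i}" for i
    have XB: "X = std_cyl UNIV B" by (auto simp: X B_def mem_box_cart)
    have BB: "B i \<in> sets borel" for i by (simp add: B_def)
    have "emeasure (distr std_gaussian borel ((*v) U)) X = emeasure std_gaussian {x. \<forall>j\<in>UNIV. Y j x \<in> B j}"
      using std_cyl_borel[of B UNIV, OF BB] by (subst emeasure_distr[OF mU']) (simp_all add: XB Y_def vimage_def)
    also have "\<dots> = emeasure std_gaussian X"
      using pY[of UNIV B, OF finite BB] emeasure_std_gaussian_cyl[of B UNIV, OF BB]
      by (simp add: XB emeasure_eq_measure N.emeasure_eq_measure prod_ennreal prod_nonneg)
    finally show "emeasure (distr std_gaussian borel ((*v) U)) X = emeasure std_gaussian X" .
  next
    show "range (\<lambda>n::nat. box (- (real n *\<^sub>R One)) (real n *\<^sub>R One)) \<subseteq> E" by (auto simp: E_def)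
    show "(\<Union>n::nat. box (- (real n *\<^sub>R One)) (real n *\<^sub>R One)) = (UNIV :: (real^'m) set)" by (rule UN_box_eq_UNIV)
    show "emeasure (distr std_gaussian borel ((*v) U)) (box (- (real n *\<^sub>R One)) (real n *\<^sub>R One)) \<noteq> \<infinity>" for n :: nat
      using Q.emeasure_finite by simp
  qed (auto simp: E_def)
qed

lemma integrable_norm_std_gaussian: "integrable (std_gaussian :: (real^'m) measure) norm"
proof (rule Bochner_Integration.integrable_bound)
  show "integrable (std_gaussian :: (real^'m) measure) (\<lambda>x. \<Sum>i\<in>UNIV. \<bar>x $ i\<bar>)"
    by (intro Bochner_Integration.integrable_sum integrable_abs std_gaussian_moments)
  show "AE x in (std_gaussian :: (real^'m) measure). norm (norm x) \<le> norm (\<Sum>i\<in>UNIV. \<bar>x $ i\<bar>)"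
  proof (rule AE_I2)
    fix x :: "real^'m"
    show "norm (norm x) \<le> norm (\<Sum>i\<in>UNIV. \<bar>x $ i\<bar>)" using norm_vec_le_sum[of x] by (simp add: sum_nonneg)
  qed
qed simp

section \<open>Matrix square roots\<close>

text \<open>(1 + Y)^2 = 1 + E means Y = (E - Y^2) / 2, a fixed point problem on the symmetric
  matrices of norm at most r = norm E. As r \<le> 1/2, the map sends this set into itself and
  contracts with constant 1/2.\<close>

lemma sqrt_near_identity:
  fixes E :: "real^'m^'m"
  assumes sym: "transpose E = E" and small: "norm E \<le> 1/2"
  shows "\<exists>Y. transpose Y = Y \<and> norm Y \<le> norm E \<and> (mat 1 + Y) ** (mat 1 + Y) = mat 1 + E"
proof -
  define r where "r = norm E"
  define B where "B = {Y :: real^'m^'m. transpose Y = Y \<and> norm Y \<le> r}"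
  define f where "f Y = (1/2) *\<^sub>R (E - Y ** Y)" for Y
  have r: "0 \<le> r" "r \<le> 1/2" using small by (auto simp: r_def)
  have "closed {Y :: real^'m^'m. transpose Y - Y = 0}"
    by (rule continuous_closed_vimage[of "{0}" "\<lambda>Y. transpose Y - Y", simplified vimage_def, simplified])
      (auto intro!: continuous_intros linear_continuous_at[OF bounded_linear_transpose])
  then have "closed ({Y :: real^'m^'m. transpose Y - Y = 0} \<inter> cball 0 r)" by (intro closed_Int) auto
  moreover have "{Y :: real^'m^'m. transpose Y - Y = 0} \<inter> cball 0 r = B" by (auto simp: B_def)
  ultimately have "Topological_Spaces.complete B" by (simp add: complete_eq_closed)
  moreover have "0 \<in> B" using r by (simp add: B_def) (simp add: vec_eq_iff transpose_def)
  then have "B \<noteq> {}" by blast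
  moreover have "f ` B \<subseteq> B"
  proof
    fix Z assume "Z \<in> f ` B"
    then obtain Y where Y: "transpose Y = Y" "norm Y \<le> r" "Z = f Y" by (auto simp: B_def)
    have "norm (Y ** Y) \<le> r * r" using Y(2) r by (intro order_trans[OF norm_matrix_mult_le] mult_mono) auto
    also have "\<dots> \<le> r * 1" using r by (intro mult_left_mono) auto
    finally have "norm (E - Y ** Y) \<le> r + r" using norm_triangle_ineq4[of E "Y ** Y"] by (simp add: r_def)
    then show "Z \<in> B" using Y sym by (simp add: B_def f_def transpose_bilinear matrix_transpose_mul)
  qed
  moreover have "dist (f X) (f Y) \<le> (1/2) * dist X Y" if "X \<in> B" "Y \<in> B" for X Y
  proof -
    have "f X - f Y = (1/2) *\<^sub>R (Y ** (Y - X) + (Y - X) ** X)"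
      by (simp add: f_def matrix_bilinear scaleR_diff_right[symmetric] del: scaleR_diff_right)
    then have "norm (f X - f Y) = (1/2) * norm (Y ** (Y - X) + (Y - X) ** X)" by simp
    also have "\<dots> \<le> (1/2) * (r * norm (X - Y) + norm (X - Y) * r)"
      using that by (intro mult_left_mono norm_triangle_le add_mono order_trans[OF norm_matrix_mult_le] mult_mono)
        (auto simp: B_def norm_minus_commute r)
    also have "\<dots> \<le> (1/2) * norm (X - Y)"
      using mult_right_mono[OF r(2) norm_ge_zero[of "X - Y"]] by (simp add: mult.commute)
    finally show ?thesis by (simp add: dist_norm)
  qed
  ultimately have "\<exists>!Y. Y \<in> B \<and> f Y = Y"
    using Banach_fix[of B "1/2" f] by auto
  then obtain Y where Y: "transpose Y = Y" "norm Y \<le> r" "f Y = Y" by (auto simp: B_def)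
  have "(2::real) *\<^sub>R Y = E - Y ** Y" using arg_cong[OF Y(3), of "\<lambda>Z. 2 *\<^sub>R Z"] by (simp add: f_def)
  then have "Y + Y + Y ** Y = E" by (simp add: scaleR_2 algebra_simps)
  then have "(mat 1 + Y) ** (mat 1 + Y) = mat 1 + E" by (simp add: matrix_bilinear algebra_simps)
  then show ?thesis using Y r_def by blast
qed

lemma invertible_perturbation:
  fixes Y :: "real^'m^'m" assumes "norm Y \<le> 1/2" shows "invertible (mat 1 + Y)"
proof -
  have "x = 0" if "(mat 1 + Y) *v x = 0" for x
  proof -
    have "x = - (Y *v x)" using that by (simp add: matrix_bilinear eq_neg_iff_add_eq_0)
    then have "norm x \<le> norm Y * norm x" by (metis norm_matrix_vector_mult_le norm_minus_cancel)
    also have "\<dots> \<le> (1/2) * norm x" by (intro mult_right_mono assms) auto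
    finally show "x = 0" by simp
  qed
  then show ?thesis by (auto simp: invertible_left_inverse matrix_left_invertible_ker)
qed

lemma matrix_inv_cancel:
  fixes S :: "real^'m^'m" assumes "invertible S"
  shows "S ** matrix_inv S = mat 1" "matrix_inv S ** S = mat 1"
  using assms unfolding matrix_inv_def invertible_def by (rule someI2_ex, simp)+

text \<open>H = S (1 + E) S^T, so a symmetric square root 1 + Y of 1 + E gives the factor S (1 + Y),
  and Y is no larger than E.\<close>

lemma factor_near:
  fixes G H S :: "real^'m^'m"
  assumes S: "S ** transpose S = G" "invertible S" and sym: "transpose G = G" "transpose H = H"
  defines "E \<equiv> matrix_inv S ** (H - G) ** transpose (matrix_inv S)"
  assumes small: "norm E \<le> 1/2"
  shows "\<exists>R :: real^'m^'m. R ** transpose R = H \<and> invertible R \<and> norm (R - S) \<le> norm S * norm E"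
proof -
  note inv = matrix_inv_cancel[OF S(2)]
  have tinv: "transpose (matrix_inv S) ** transpose S = mat 1"
    by (metis inv(1) matrix_transpose_mul transpose_mat)
  have "transpose E = E" by (simp add: E_def matrix_transpose_mul transpose_bilinear sym matrix_mul_assoc)
  from sqrt_near_identity[OF this small] obtain Y where
    Y: "transpose Y = Y" "norm Y \<le> norm E" "(mat 1 + Y) ** (mat 1 + Y) = mat 1 + E" by blast
  define R where "R = S ** (mat 1 + Y)"
  have "R ** transpose R = S ** ((mat 1 + Y) ** (mat 1 + Y)) ** transpose S"
    by (simp add: R_def matrix_transpose_mul transpose_bilinear Y(1) matrix_mul_assoc)
  also have "\<dots> = G + (S ** matrix_inv S) ** (H - G) ** (transpose (matrix_inv S) ** transpose S)"
    unfolding Y(3) E_def by (simp add: matrix_bilinear S(1) matrix_mul_assoc)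
  also have "\<dots> = H" by (simp add: inv tinv)
  finally have "R ** transpose R = H" .
  moreover have "invertible R" unfolding R_def
    by (intro invertible_mult S invertible_perturbation) (use Y small in linarith)
  moreover have "norm (R - S) \<le> norm S * norm E"
  proof -
    have "R - S = S ** Y" by (simp add: R_def matrix_bilinear)
    then show ?thesis using order_trans[OF norm_matrix_mult_le[of S Y] mult_left_mono[OF Y(2) norm_ge_zero[of S]]] by simp
  qed
  ultimately show ?thesis by blast
qed

text \<open>Continuity method along the segment from the identity to \<open>G\<close>.\<close>

lemma posdef_factor:
  fixes G :: "real^'m^'m"
  assumes sym: "transpose G = G" and c: "0 < c" "\<And>x. c * (norm x)\<^sup>2 \<le> x \<bullet> (G *v x)"
  shows "\<exists>S :: real^'m^'m. S ** transpose S = G \<and> invertible S"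
proof -
  define d where "d = min c 1"
  have d: "0 < d" using c by (simp add: d_def)
  define H where "H s = mat 1 + s *\<^sub>R (G - mat 1)" for s
  have symH: "transpose (H s) = H s" for s by (simp add: H_def transpose_bilinear sym)
  have low: "d * (norm x)\<^sup>2 \<le> x \<bullet> (H s *v x)" if "0 \<le> s" "s \<le> 1" for s x
  proof -
    have "x \<bullet> (H s *v x) = (1 - s) * (norm x)\<^sup>2 + s * (x \<bullet> (G *v x))"
      by (simp add: H_def matrix_bilinear inner_add_right inner_diff_right power2_norm_eq_inner algebra_simps)
    moreover have "(1 - s) * (d * (norm x)\<^sup>2) \<le> (1 - s) * (norm x)\<^sup>2"
      using that d by (intro mult_left_mono mult_left_le_one_le) (auto simp: d_def)
    moreover have "s * (d * (norm x)\<^sup>2) \<le> s * (x \<bullet> (G *v x))"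
    proof (rule mult_left_mono[OF _ that(1)])
      have "d * (norm x)\<^sup>2 \<le> c * (norm x)\<^sup>2" by (intro mult_right_mono) (auto simp: d_def)
      then show "d * (norm x)\<^sup>2 \<le> x \<bullet> (G *v x)" using c(2)[of x] by linarith
    qed
    ultimately show ?thesis by (simp add: algebra_simps)
  qed
  \<comment> \<open>One bound on the inverse of every factor along the segment, because the forms
    there are bounded below by \<open>d\<close>. Therefore a number n of steps fixed in advance
    keeps every relative increment within the threshold 1/2.\<close>
  define K where "K = real CARD('m) * (1 / sqrt d)"
  have K: "norm (matrix_inv S) \<le> K" if S: "S ** transpose S = H s" "invertible S" and s: "0 \<le> s" "s \<le> 1" for S :: "real^'m^'m" and s
  proof -
    note inv = matrix_inv_cancel[OF S(2)]
    have tinv: "transpose S ** transpose (matrix_inv S) = mat 1"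
      by (metis inv(2) matrix_transpose_mul transpose_mat)
    have "norm (transpose (matrix_inv S) *v y) \<le> (1 / sqrt d) * norm y" for y
    proof -
      let ?x = "transpose (matrix_inv S) *v y"
      have "d * (norm ?x)\<^sup>2 \<le> ?x \<bullet> (H s *v ?x)" by (rule low[OF s])
      also have "\<dots> = (transpose S *v ?x) \<bullet> (transpose S *v ?x)"
        by (simp add: S(1)[symmetric] matrix_vector_mul_assoc[symmetric] inner_matrix_right[of _ S])
      also have "transpose S *v ?x = y" by (simp add: matrix_vector_mul_assoc tinv)
      finally have "d * (norm ?x)\<^sup>2 \<le> (norm y)\<^sup>2" by (simp add: power2_norm_eq_inner)
      then have "(sqrt d * norm ?x)\<^sup>2 \<le> (norm y)\<^sup>2" using d by (simp add: power_mult_distrib)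
      then have "sqrt d * norm ?x \<le> norm y" by (rule power2_le_imp_le) simp
      then show ?thesis using d by (simp add: field_simps)
    qed
    then have "norm (transpose (matrix_inv S)) \<le> K" unfolding K_def by (rule norm_matrix_leI)
    then show ?thesis by simp
  qed
  have K0: "0 < K" using d by (simp add: K_def)
  obtain n :: nat where n: "2 * (K * norm (G - mat 1) * K) < real n" using reals_Archimedean2 by blast
  then have n0: "n > 0" using K0 by (cases n) (auto simp: mult_less_0_iff not_less[symmetric] dest: not_less_iff_gr_or_eq[THEN iffD1])
  have "k \<le> n \<Longrightarrow> \<exists>S :: real^'m^'m. S ** transpose S = H (real k / real n) \<and> invertible S" for k
  proof (induction k)
    case 0
    show ?case by (intro exI[of _ "mat 1 :: real^'m^'m"]) (auto simp: H_def invertible_def matrix_bilinear intro!: exI[of _ "mat 1"])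
  next
    case (Suc k)
    then obtain S :: "real^'m^'m" where S: "S ** transpose S = H (real k / real n)" "invertible S" by auto
    let ?E = "matrix_inv S ** (H (real (Suc k) / real n) - H (real k / real n)) ** transpose (matrix_inv S)"
    have diff: "H (real (Suc k) / real n) - H (real k / real n) = (1 / real n) *\<^sub>R (G - mat 1)"
      by (simp add: H_def scaleR_left_diff_distrib[symmetric] diff_divide_distrib[symmetric])
    have "norm (matrix_inv S) \<le> K" using Suc.prems n0 by (intro K[OF S]) auto
    then have "norm ?E \<le> (K * ((1 / real n) * norm (G - mat 1))) * K"
      unfolding diff using K0
      by (intro order_trans[OF norm_matrix_mult_le] mult_mono order_trans[OF norm_matrix_mult_le]) auto
    also have "\<dots> \<le> 1/2" using n n0 by (simp add: field_simps)
    finally have "norm ?E \<le> 1/2" .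
    from factor_near[OF S symH symH this] show ?case by blast
  qed
  from this[of n] show ?thesis using n0 by (simp add: H_def)
qed

section \<open>Wasserstein distance between Gaussian laws\<close>

text \<open>The factor R chosen in the definition differs from S by U = S^(-1) R, which is
  orthogonal because R R^T = S S^T; the standard Gaussian law is invariant under U.\<close>

lemma gaussian_measure_factor:
  fixes S :: "real^'m^'m"
  assumes S: "S ** transpose S = G" "invertible S"
  shows "gaussian_measure \<mu> G = distr std_gaussian borel (\<lambda>x. \<mu> + S *v x)"
proof -
  define R where "R = (SOME R :: real^'m^'m. R ** transpose R = G)"
  have R: "R ** transpose R = G" unfolding R_def by (rule someI[of _ S]) (rule S)
  note inv = matrix_inv_cancel[OF S(2)]
  have tinv: "transpose S ** transpose (matrix_inv S) = mat 1"
    by (metis inv(2) matrix_transpose_mul transpose_mat)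
  define U where "U = matrix_inv S ** R"
  have "U ** transpose U = matrix_inv S ** (R ** transpose R) ** transpose (matrix_inv S)"
    by (simp add: U_def matrix_transpose_mul matrix_mul_assoc)
  also have "\<dots> = (matrix_inv S ** S) ** (transpose S ** transpose (matrix_inv S))"
    by (simp add: R S(1)[symmetric] matrix_mul_assoc)
  finally have "U ** transpose U = mat 1" by (simp add: inv tinv)
  then have U: "orthogonal_matrix U" by (simp add: orthogonal_matrix_def matrix_left_right_inverse)
  have RU: "R *v x = S *v (U *v x)" for x by (simp add: U_def matrix_vector_mul_assoc matrix_mul_assoc inv)
  have [measurable]: "(*v) U \<in> borel_measurable borel" "(\<lambda>x. \<mu> + S *v x) \<in> borel_measurable borel"
    by (intro borel_measurable_continuous_onI continuous_intros)+
  have "gaussian_measure \<mu> G = distr std_gaussian borel ((\<lambda>x. \<mu> + S *v x) \<circ> (*v) U)"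
    unfolding gaussian_measure_def R_def[symmetric] by (simp add: RU o_def)
  also have "\<dots> = distr (distr std_gaussian borel ((*v) U)) borel (\<lambda>x. \<mu> + S *v x)"
    by (subst distr_distr) auto
  finally show ?thesis by (simp add: std_gaussian_orthogonal[OF U])
qed

lemma wasserstein_gaussian_le:
  fixes S R :: "real^'m^'m"
  assumes S: "S ** transpose S = G" "invertible S" and R: "R ** transpose R = H" "invertible R"
  shows "wasserstein (gaussian_measure \<mu> G) (gaussian_measure \<nu> H)
     \<le> ennreal (norm (\<mu> - \<nu>) + norm (S - R) * (\<integral>x. norm x \<partial>(std_gaussian :: (real^'m) measure)))"
proof -
  interpret prob_space "std_gaussian :: (real^'m) measure" by (rule prob_space_std_gaussian)
  define f where "f x = (\<mu> + S *v x, \<nu> + R *v x)" for x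
  have fm[measurable]: "f \<in> borel_measurable borel"
    unfolding f_def by (intro borel_measurable_continuous_onI continuous_intros)
  have [measurable]: "(\<lambda>x. \<mu> + S *v x) \<in> borel_measurable borel" "(\<lambda>x. \<nu> + R *v x) \<in> borel_measurable borel"
    by (intro borel_measurable_continuous_onI continuous_intros)+
  define \<kappa> where "\<kappa> = distr std_gaussian borel f"
  have mfs: "fst \<in> borel_measurable (borel :: ((real^'m) \<times> (real^'m)) measure)" "snd \<in> borel_measurable (borel :: ((real^'m) \<times> (real^'m)) measure)"
    by (intro borel_measurable_continuous_onI continuous_intros)+
  have "distr \<kappa> borel fst = gaussian_measure \<mu> G" "distr \<kappa> borel snd = gaussian_measure \<nu> H"
    unfolding \<kappa>_def gaussian_measure_factor[OF S] gaussian_measure_factor[OF R]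
    by (subst distr_distr, use mfs in \<open>auto simp: f_def o_def\<close>)+
  then have "\<kappa> \<in> couplings (gaussian_measure \<mu> G) (gaussian_measure \<nu> H)" by (simp add: couplings_def \<kappa>_def)
  then have "wasserstein (gaussian_measure \<mu> G) (gaussian_measure \<nu> H) \<le> (\<integral>\<^sup>+ z. ennreal (dist (fst z) (snd z)) \<partial>\<kappa>)"
    unfolding wasserstein_def by (rule INF_lower)
  also have "\<dots> = (\<integral>\<^sup>+ x. ennreal (norm ((\<mu> - \<nu>) + (S - R) *v x)) \<partial>std_gaussian)"
    unfolding \<kappa>_def
    by (subst nn_integral_distr)
      (auto simp: f_def dist_norm matrix_bilinear algebra_simps intro!: borel_measurable_continuous_onI continuous_intros)
  also have "\<dots> \<le> (\<integral>\<^sup>+ x. ennreal (norm (\<mu> - \<nu>) + norm (S - R) * norm x) \<partial>(std_gaussian :: (real^'m) measure))"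
    by (intro nn_integral_mono ennreal_leI norm_triangle_le add_left_mono norm_matrix_vector_mult_le)
  also have "\<dots> = ennreal (\<integral>x. norm (\<mu> - \<nu>) + norm (S - R) * norm x \<partial>(std_gaussian :: (real^'m) measure))"
    by (intro nn_integral_eq_integral Bochner_Integration.integrable_add integrable_mult_right integrable_norm_std_gaussian) auto
  also have "(\<integral>x. norm (\<mu> - \<nu>) + norm (S - R) * norm x \<partial>(std_gaussian :: (real^'m) measure))
      = norm (\<mu> - \<nu>) + norm (S - R) * (\<integral>x. norm x \<partial>(std_gaussian :: (real^'m) measure))"
    by (simp add: integrable_norm_std_gaussian prob_space[simplified])
  finally show ?thesis .
qed

text \<open>The factors of G t and H t are both taken near one fixed factor S of \<gamma>, because
  arbitrary factors of nearby covariances can be far apart.\<close>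

lemma wasserstein_gaussian_tendsto:
  fixes G H :: "real \<Rightarrow> real^'m^'m" and \<gamma> :: "real^'m^'m"
  assumes sym: "transpose \<gamma> = \<gamma>" and c: "0 < c" "\<And>x. c * (norm x)\<^sup>2 \<le> x \<bullet> (\<gamma> *v x)"
    and G: "(G \<longlongrightarrow> \<gamma>) at_top" "\<forall>\<^sub>F t in at_top. transpose (G t) = G t"
    and H: "(H \<longlongrightarrow> \<gamma>) at_top" "\<forall>\<^sub>F t in at_top. transpose (H t) = H t"
    and \<mu>: "((\<lambda>t. \<mu> t - \<nu> t) \<longlongrightarrow> 0) at_top"
  shows "((\<lambda>t. wasserstein (gaussian_measure (\<mu> t) (G t)) (gaussian_measure (\<nu> t) (H t))) \<longlongrightarrow> 0) at_top"
proof -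
  obtain S :: "real^'m^'m" where S: "S ** transpose S = \<gamma>" "invertible S" using posdef_factor[OF sym c] by blast
  define e where "e P = norm (matrix_inv S ** (P - \<gamma>) ** transpose (matrix_inv S))" for P
  define K where "K = (\<integral>x. norm x \<partial>(std_gaussian :: (real^'m) measure))"
  have K0: "0 \<le> K" by (simp add: K_def)
  define b where "b t = norm (\<mu> t - \<nu> t) + (norm S * e (G t) + norm S * e (H t)) * K" for t
  have te: "((\<lambda>t. e (P t)) \<longlongrightarrow> 0) at_top" if "(P \<longlongrightarrow> \<gamma>) at_top" for P
  proof -
    have "((\<lambda>t. matrix_inv S ** (P t - \<gamma>) ** transpose (matrix_inv S)) \<longlongrightarrow> matrix_inv S ** (\<gamma> - \<gamma>) ** transpose (matrix_inv S)) at_top"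
      by (intro bounded_bilinear.tendsto[OF bounded_bilinear_matrix_mult] tendsto_const tendsto_diff that)
    then show ?thesis unfolding e_def by (intro tendsto_norm_zero) (simp add: matrix_bilinear)
  qed
  have "(b \<longlongrightarrow> 0 + (norm S * 0 + norm S * 0) * K) at_top"
    unfolding b_def by (intro tendsto_add tendsto_mult tendsto_const te G H tendsto_norm_zero \<mu>)
  then have "((\<lambda>t. ennreal (b t)) \<longlongrightarrow> ennreal 0) at_top" by (intro tendsto_ennrealI) simp
  then have lim: "((\<lambda>t. ennreal (b t)) \<longlongrightarrow> 0) at_top" by simp
  have small: "\<forall>\<^sub>F t in at_top. e (P t) < 1/2" if "(P \<longlongrightarrow> \<gamma>) at_top" for P
    using order_tendstoD(2)[OF te[OF that], of "1/2"] by simp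
  have "\<forall>\<^sub>F t in at_top. wasserstein (gaussian_measure (\<mu> t) (G t)) (gaussian_measure (\<nu> t) (H t)) \<le> ennreal (b t)"
    using small[OF G(1)] small[OF H(1)] G(2) H(2)
  proof eventually_elim
    case (elim t)
    obtain R1 :: "real^'m^'m" where R1: "R1 ** transpose R1 = G t" "invertible R1" "norm (R1 - S) \<le> norm S * e (G t)"
      using factor_near[OF S sym elim(3)] elim(1) unfolding e_def by auto
    obtain R2 :: "real^'m^'m" where R2: "R2 ** transpose R2 = H t" "invertible R2" "norm (R2 - S) \<le> norm S * e (H t)"
      using factor_near[OF S sym elim(4)] elim(2) unfolding e_def by auto
    have "norm (R1 - R2) \<le> norm S * e (G t) + norm S * e (H t)"
      using norm_triangle_ineq4[of "R1 - S" "R2 - S"] R1(3) R2(3) by simp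
    then have "norm (\<mu> t - \<nu> t) + norm (R1 - R2) * K \<le> b t"
      unfolding b_def using K0 by (intro add_left_mono mult_right_mono) auto
    with wasserstein_gaussian_le[OF R1(1,2) R2(1,2), of "\<mu> t" "\<nu> t", folded K_def] show ?case
      by (meson ennreal_leI order_trans)
  qed
  then show ?thesis by (intro tendsto_sandwich[OF _ _ tendsto_const lim]) auto
qed

text \<open>The existence of some factor makes the one chosen in the definition a factor too.
  Singular covariances, such as that of an increment over an interval of length 0, are
  covered.\<close>

lemma gaussian_measure_moments:
  fixes S :: "real^'m^'m" assumes S: "S ** transpose S = G"
  shows "integrable (gaussian_measure 0 G) (\<lambda>y. y $ i)" "(\<integral>y. y $ i \<partial>gaussian_measure 0 G) = 0"
    "integrable (gaussian_measure 0 G) (\<lambda>y. y $ i * y $ j)" "(\<integral>y. y $ i * y $ j \<partial>gaussian_measure 0 G) = G $ i $ j"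
proof -
  define R where "R = (SOME R :: real^'m^'m. R ** transpose R = G)"
  have R: "R ** transpose R = G" unfolding R_def by (rule someI[of _ S]) (rule S)
  have [measurable]: "(*v) R \<in> borel_measurable borel" by (intro borel_measurable_continuous_onI continuous_intros)
  have [measurable]: "(\<lambda>x :: real^'m. x $ i) \<in> borel_measurable borel" for i by (rule borel_measurable_vec_nth)
  have gm: "gaussian_measure 0 G = distr std_gaussian borel ((*v) R)"
    unfolding gaussian_measure_def R_def[symmetric] by simp
  have 1: "(R *v x) $ i = (\<Sum>k\<in>UNIV. R $ i $ k * x $ k)" for x i by (simp add: matrix_vector_mult_def)
  have 2: "(R *v x) $ i * (R *v x) $ j = (\<Sum>k\<in>UNIV. \<Sum>l\<in>UNIV. (R $ i $ k * R $ j $ l) * (x $ k * x $ l))" for x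
    unfolding 1 sum_product by (intro sum.cong refl) (simp add: mult_ac)
  show "integrable (gaussian_measure 0 G) (\<lambda>y. y $ i)"
    unfolding gm by (subst integrable_distr_eq) (auto simp: 1 intro!: std_gaussian_moments)
  show "(\<integral>y. y $ i \<partial>gaussian_measure 0 G) = 0"
    unfolding gm by (subst integral_distr) (auto simp: 1 std_gaussian_moments)
  show "integrable (gaussian_measure 0 G) (\<lambda>y. y $ i * y $ j)"
    unfolding gm by (subst integrable_distr_eq)
      (auto simp: 2 intro!: std_gaussian_moments Bochner_Integration.integrable_sum)
  have "(\<integral>y. y $ i * y $ j \<partial>gaussian_measure 0 G) = (\<integral>x. (\<Sum>k\<in>UNIV. \<Sum>l\<in>UNIV. (R $ i $ k * R $ j $ l) * (x $ k * x $ l)) \<partial>std_gaussian)"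
    unfolding gm by (subst integral_distr) (auto simp: 2)
  also have "\<dots> = (\<Sum>k\<in>UNIV. \<Sum>l\<in>UNIV. (R $ i $ k * R $ j $ l) * (if k = l then 1 else 0))"
    by (simp add: std_gaussian_moments)
  also have "\<dots> = (R ** transpose R) $ i $ j"
    by (simp add: matrix_matrix_mult_def transpose_def if_distrib cong: if_cong)
  finally show "(\<integral>y. y $ i * y $ j \<partial>gaussian_measure 0 G) = G $ i $ j" by (simp add: R)
qed

section \<open>Brownian motion\<close>

context gaussian_space
begin

text \<open>The Gaussian form at 1 for all multiples u f is the full characteristic function of
  f.\<close>

lemma L_gaussian_rv: assumes "f \<in> L" shows "gaussian_rv M f"
proof -
  define m v where "m = (\<integral>w. f w \<partial>M)" and "v = (\<integral>w. (f w)\<^sup>2 \<partial>M) - (\<integral>w. f w \<partial>M)\<^sup>2"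
  note sq = L_sqi[OF assms]
  note [measurable] = sqi_measurable[OF sq]
  have "(\<integral>w. f w * 1 \<partial>M)\<^sup>2 \<le> (\<integral>w. (f w)\<^sup>2 \<partial>M) * (\<integral>w. 1\<^sup>2 \<partial>M)" by (rule sqi_cauchy_schwarz[OF sq sqi_const])
  then have v: "0 \<le> v" by (simp add: v_def prob_space)
  interpret N: prob_space std_normal_distribution by (rule prob_space_std_normal)
  have "distr M borel f = distr std_normal_distribution borel (\<lambda>x. m + sqrt v * x)"
  proof (rule Levy_uniqueness)
    show "real_distribution (distr M borel f)" by (rule real_distribution_distr) simp
    show "real_distribution (distr std_normal_distribution borel (\<lambda>x. m + sqrt v * x))"
      by (rule N.real_distribution_distr) simp
    show "char (distr M borel f) = char (distr std_normal_distribution borel (\<lambda>x. m + sqrt v * x))"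
    proof
      fix u
      have "char (distr M borel f) u = iexpv (\<lambda>w. u * f w)" unfolding char_def by (subst integral_distr) auto
      also have "\<dots> = iexp (u * m) * of_real (exp (- (u\<^sup>2 * v) / 2))"
        using L_gchar[OF L_cmult[OF assms, of u]] unfolding gchar_def
        by (simp add: m_def v_def power_mult_distrib right_diff_distrib)
      also have "\<dots> = iexp (u * m) * char std_normal_distribution (u * sqrt v)"
        using v by (simp add: char_std_normal_distribution power_mult_distrib)
      also have "\<dots> = (CLINT x|std_normal_distribution. iexp (u * m) * iexp ((u * sqrt v) * x))"
        unfolding char_def by simp
      also have "\<dots> = (CLINT x|std_normal_distribution. iexp (u * (m + sqrt v * x)))"
        by (intro Bochner_Integration.integral_cong refl) (simp add: exp_add[symmetric] algebra_simps)
      also have "\<dots> = char (distr std_normal_distribution borel (\<lambda>x. m + sqrt v * x)) u"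
        unfolding char_def by (subst integral_distr) auto
      finally show "char (distr M borel f) u = char (distr std_normal_distribution borel (\<lambda>x. m + sqrt v * x)) u" .
    qed
  qed
  then show ?thesis unfolding gaussian_rv_def by auto
qed

end

section \<open>Increments of a Brownian motion inside a Gaussian space\<close>

locale gaussian_brownian = gaussian_space M S for M :: "'a measure" and S +
  fixes B :: "real \<Rightarrow> 'a \<Rightarrow> real^'n"
  assumes bm: "brownian_motion M B"
    and BS: "\<And>t i. 0 \<le> t \<Longrightarrow> (\<lambda>w. B t w $ i) \<in> S"
begin

lemma B_measurable [measurable]: "0 \<le> t \<Longrightarrow> B t \<in> borel_measurable M"
  and B_continuous: "w \<in> space M \<Longrightarrow> continuous_on {0..} (\<lambda>t. B t w)"
  and B_0: "AE w in M. B 0 w = 0"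
  using bm by (auto simp: brownian_motion_def continuous_process_def)

lemma B_L: "0 \<le> t \<Longrightarrow> (\<lambda>w. B t w $ i) \<in> L"
  using BS L_base by blast

definition dB :: "real \<Rightarrow> real \<Rightarrow> 'n \<Rightarrow> 'a \<Rightarrow> real" where
  "dB s t i w = B t w $ i - B s w $ i"

lemma dB_L: "0 \<le> s \<Longrightarrow> 0 \<le> t \<Longrightarrow> dB s t i \<in> L"
  unfolding dB_def[abs_def] by (intro L_diff B_L)

lemma dB_moments:
  assumes st: "0 \<le> s" "s \<le> t"
  shows "expectation (dB s t i) = 0" "expectation (\<lambda>w. dB s t i w * dB s t j w) = (if i = j then t - s else 0)"
proof -
  define R :: "real^'n^'n" where "R = sqrt (t - s) *\<^sub>R mat 1"
  have R: "R ** transpose R = (t - s) *\<^sub>R mat 1"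
    using st by (simp add: R_def transpose_bilinear scaleR_matrix_mult)
  have [measurable]: "B s \<in> borel_measurable M" "B t \<in> borel_measurable M" using st by auto
  have [measurable]: "(\<lambda>x :: real^'n. x $ i) \<in> borel_measurable borel" for i by (rule borel_measurable_vec_nth)
  have d: "distr M borel (\<lambda>w. B t w - B s w) = gaussian_measure 0 ((t - s) *\<^sub>R mat 1)"
    using bm st by (simp add: brownian_motion_def)
  have e: "expectation (\<lambda>w. f (B t w - B s w)) = integral\<^sup>L (gaussian_measure 0 ((t - s) *\<^sub>R mat 1)) f"
    if "f \<in> borel_measurable borel" for f :: "real^'n \<Rightarrow> real"
    unfolding d[symmetric] using that by (subst integral_distr) auto
  show "expectation (dB s t i) = 0"
    using e[of "\<lambda>x. x $ i"] gaussian_measure_moments(2)[OF R, of i] by (simp add: dB_def[abs_def])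
  show "expectation (\<lambda>w. dB s t i w * dB s t j w) = (if i = j then t - s else 0)"
    using e[of "\<lambda>x. x $ i * x $ j"] gaussian_measure_moments(4)[OF R, of i j] by (simp add: dB_def[abs_def] mat_def)
qed

lemma dB_orth:
  assumes "0 \<le> s" "s \<le> t" "t \<le> u" "u \<le> v"
  shows "expectation (\<lambda>w. dB s t i w * dB u v j w) = 0"
proof -
  \<comment> \<open>Of the increments between these four times, those numbered 0 and 2 are wanted;
    number 1 is the gap from t to u.\<close>
  define \<tau> where "\<tau> = (\<lambda>k::nat. if k = 0 then s else if k = 1 then t else if k = 2 then u else v)"
  have "0 \<le> \<tau> 0 \<and> (\<forall>k<3. \<tau> k \<le> \<tau> (Suc k))" using assms by (auto simp: \<tau>_def)
  then have "indep_vars (\<lambda>_. borel) (\<lambda>k w. B (\<tau> (Suc k)) w - B (\<tau> k) w) {..<3}"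
    using bm unfolding brownian_motion_def by blast
  then have iv: "indep_vars (\<lambda>_. borel) (\<lambda>k w. B (\<tau> (Suc k)) w - B (\<tau> k) w) {0, 2}"
    by (rule indep_vars_subset) auto
  have "indep_vars (\<lambda>_. borel) (\<lambda>k w. (B (\<tau> (Suc k)) w - B (\<tau> k) w) $ (if k = 0 then i else j)) {0, 2}"
    by (rule indep_vars_compose2[OF iv]) (simp add: borel_measurable_vec_nth)
  moreover have "integrable M (\<lambda>w. (B (\<tau> (Suc k)) w - B (\<tau> k) w) $ (if k = 0 then i else j))" if "k \<in> {0, 2}" for k
    using that integrable_sqi[OF L_sqi[OF dB_L[of s t i]]] integrable_sqi[OF L_sqi[OF dB_L[of u v j]]] assms
    by (auto simp: \<tau>_def dB_def[abs_def])
  ultimately have "expectation (\<lambda>w. \<Prod>k\<in>{0, 2::nat}. (B (\<tau> (Suc k)) w - B (\<tau> k) w) $ (if k = 0 then i else j))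
     = (\<Prod>k\<in>{0, 2}. expectation (\<lambda>w. (B (\<tau> (Suc k)) w - B (\<tau> k) w) $ (if k = 0 then i else j)))"
    by (intro indep_vars_lebesgue_integral) auto
  moreover have "expectation (\<lambda>w. (B (\<tau> (Suc 0)) w - B (\<tau> 0) w) $ i) = 0"
    using dB_moments(1)[of s t i] assms by (simp add: \<tau>_def dB_def[abs_def])
  ultimately show ?thesis by (simp add: \<tau>_def dB_def numeral_2_eq_2)
qed

lemma dB_past: assumes "0 \<le> r" "r \<le> u" "u \<le> v" shows "expectation (\<lambda>w. dB u v i w * B r w $ j) = 0"
proof -
  have [measurable]: "(\<lambda>w. B r w $ j) \<in> borel_measurable M" "dB u v i \<in> borel_measurable M" "dB 0 r j \<in> borel_measurable M"
    using assms by (auto intro!: sqi_measurable[OF L_sqi] B_L dB_L)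
  have "expectation (\<lambda>w. dB u v i w * B r w $ j) = expectation (\<lambda>w. dB 0 r j w * dB u v i w)"
  proof (rule integral_cong_AE)
    show "(\<lambda>w. dB u v i w * B r w $ j) \<in> borel_measurable M" "(\<lambda>w. dB 0 r j w * dB u v i w) \<in> borel_measurable M"
      by measurable
    show "AE w in M. dB u v i w * B r w $ j = dB 0 r j w * dB u v i w"
      using B_0 by eventually_elim (simp add: dB_def mult.commute)
  qed
  then show ?thesis using dB_orth[of 0 r u v j i] assms by simp
qed

subsection \<open>Wiener integrals\<close>

definition wsum :: "(nat \<Rightarrow> real^'n) \<Rightarrow> real \<Rightarrow> real \<Rightarrow> nat \<Rightarrow> 'a \<Rightarrow> real" where
  "wsum c T t N w = (\<Sum>k<N. c k \<bullet> (B (upart T t N (Suc k)) w - B (upart T t N k) w))"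

lemma wsum_dB: "wsum c T t N w = (\<Sum>k<N. \<Sum>i\<in>UNIV. c k $ i * dB (upart T t N k) (upart T t N (Suc k)) i w)"
  by (simp add: wsum_def dB_def inner_vec_def)

lemma wsum_L: assumes "0 \<le> T" "T \<le> t" shows "wsum c T t N \<in> L"
proof -
  have "upart T t N k \<ge> 0" if "k \<le> N" for k using upart_in[OF assms(2) that] assms(1) by auto
  then show ?thesis unfolding wsum_dB[abs_def] by (intro L_sum L_cmult dB_L) auto
qed

lemma wsum_isometry:
  assumes T: "0 \<le> T" "T \<le> t"
  shows "expectation (\<lambda>w. wsum c T t N w * wsum d T t N w) = (\<Sum>k<N. (c k \<bullet> d k) * ((t - T) / real N))"
proof -
  let ?p = "upart T t N"
  have p: "?p k \<ge> 0" if "k \<le> N" for k using upart_in[OF T(2) that] T(1) by auto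
  have pm: "?p j \<le> ?p k" if "j \<le> k" for j k using upart_mono[OF T(2) that] .
  define X where "X k i = dB (?p (min k N)) (?p (min (Suc k) N)) i" for k i
  have X: "X k i = dB (?p k) (?p (Suc k)) i" if "k < N" for k i using that by (simp add: X_def)
  have XL: "X k i \<in> L" for k i unfolding X_def by (intro dB_L p) auto
  have int: "integrable M (\<lambda>w. X k i w * X l j w)" for k l i j
    by (intro integrable_sqi_mult L_sqi XL)
  have E: "expectation (\<lambda>w. X k i w * X l j w) = (if k = l \<and> i = j then (t - T) / real N else 0)"
    if kl: "k < N" "l < N" for k l i j
  proof (cases k l rule: linorder_cases)
    case less
    then show ?thesis unfolding X[OF kl(1)] X[OF kl(2)] using dB_orth[OF p pm pm pm, of k "Suc k" l "Suc l" i j] kl by simp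
  next
    case equal
    then show ?thesis unfolding X[OF kl(1)] X[OF kl(2)] using dB_moments(2)[OF p pm, of k "Suc k" i j] kl by (simp add: upart_step)
  next
    case greater
    then show ?thesis unfolding X[OF kl(1)] X[OF kl(2)] using dB_orth[OF p pm pm pm, of l "Suc l" k "Suc k" j i] kl
      by (simp add: mult.commute)
  qed
  have "wsum c T t N w * wsum d T t N w
      = (\<Sum>k<N. \<Sum>l<N. \<Sum>i\<in>UNIV. \<Sum>j\<in>UNIV. (c k $ i * d l $ j) * (X k i w * X l j w))" for w
    unfolding wsum_dB sum_product by (intro sum.cong refl) (simp add: X mult_ac)
  then have "expectation (\<lambda>w. wsum c T t N w * wsum d T t N w)
      = (\<Sum>k<N. \<Sum>l<N. \<Sum>i\<in>UNIV. \<Sum>j\<in>UNIV. (c k $ i * d l $ j) * expectation (\<lambda>w. X k i w * X l j w))"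
    by (simp add: int)
  also have "\<dots> = (\<Sum>k<N. \<Sum>l<N. \<Sum>i\<in>UNIV. \<Sum>j\<in>UNIV. if k = l \<and> i = j then (c k $ i * d l $ j) * ((t - T) / real N) else 0)"
    by (intro sum.cong refl) (simp add: E)
  also have "\<dots> = (\<Sum>k<N. \<Sum>l<N. if k = l then (c k \<bullet> d l) * ((t - T) / real N) else 0)"
  proof (intro sum.cong refl)
    fix k l
    show "(\<Sum>i\<in>UNIV. \<Sum>j\<in>UNIV. if k = l \<and> i = j then (c k $ i * d l $ j) * ((t - T) / real N) else 0)
      = (if k = l then (c k \<bullet> d l) * ((t - T) / real N) else 0)"
      by (cases "k = l") (simp_all add: inner_vec_def sum_distrib_right sum_divide_distrib)
  qed
  also have "\<dots> = (\<Sum>k<N. (c k \<bullet> d k) * ((t - T) / real N))" by simp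
  finally show ?thesis .
qed

text \<open>Each coefficient is repeated q times and the increments telescope. Sums over nested
  partitions can thereby be compared on the finer one, where the isometry applies.\<close>

lemma wsum_refine:
  assumes q: "0 < q"
  shows "wsum c T t N w = wsum (\<lambda>j. c (j div q)) T t (N * q) w"
proof -
  let ?f = "\<lambda>j. c (j div q) \<bullet> (B (upart T t (N * q) (Suc j)) w - B (upart T t (N * q) j) w)"
  have up: "upart T t (N * q) (k * q) = upart T t N k" for k using q by (simp add: upart_def)
  have "(\<Sum>j<N * q. ?f j) = (\<Sum>k<N. sum ?f {k * q..<k * q + q})" by (rule sum.nat_group[symmetric])
  also have "\<dots> = (\<Sum>k<N. c k \<bullet> (B (upart T t N (Suc k)) w - B (upart T t N k) w))"
  proof (rule sum.cong[OF refl])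
    fix k
    have "sum ?f {k * q..<k * q + q} = (\<Sum>j\<in>{k * q..<k * q + q}. c k \<bullet> (B (upart T t (N * q) (Suc j)) w - B (upart T t (N * q) j) w))"
    proof (rule sum.cong[OF refl])
      fix j assume j: "j \<in> {k * q..<k * q + q}"
      then have "j div q = k" using q by (intro div_nat_eqI) (auto simp: mult.commute)
      then show "?f j = c k \<bullet> (B (upart T t (N * q) (Suc j)) w - B (upart T t (N * q) j) w)" by simp
    qed
    also have "\<dots> = c k \<bullet> (\<Sum>j\<in>{k * q..<k * q + q}. B (upart T t (N * q) (Suc j)) w - B (upart T t (N * q) j) w)"
      by (simp add: inner_sum_right)
    also have "(\<Sum>j\<in>{k * q..<k * q + q}. B (upart T t (N * q) (Suc j)) w - B (upart T t (N * q) j) w)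
        = B (upart T t (N * q) (k * q + q)) w - B (upart T t (N * q) (k * q)) w"
      using sum_Suc_diff'[of "k * q" "k * q + q" "\<lambda>j. B (upart T t (N * q) j) w"] by simp
    also have "\<dots> = B (upart T t N (Suc k)) w - B (upart T t N k) w"
      using up[of k] up[of "Suc k"] by (simp add: add.commute)
    finally show "sum ?f {k * q..<k * q + q} = c k \<bullet> (B (upart T t N (Suc k)) w - B (upart T t N k) w)" .
  qed
  finally show ?thesis by (simp add: wsum_def)
qed

abbreviation wint :: "(real \<Rightarrow> real^'n) \<Rightarrow> (real \<Rightarrow> real^'n) \<Rightarrow> real \<Rightarrow> real \<Rightarrow> 'a \<Rightarrow> real" where
  "wint f f' T t w \<equiv> jint (\<bullet>) f f' (\<lambda>s. B s w) T t"

text \<open>Partitions into 2^n cells, so that the later of any two refines the earlier.\<close>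

definition wseq :: "(real \<Rightarrow> real^'n) \<Rightarrow> real \<Rightarrow> real \<Rightarrow> nat \<Rightarrow> 'a \<Rightarrow> real" where
  "wseq f T t n = wsum (\<lambda>k. f (upart T t (2 ^ n) k)) T t (2 ^ n)"

context
  fixes f f' :: "real \<Rightarrow> real^'n" and T t :: real
  assumes T: "0 \<le> T" "T \<le> t"
    and f: "\<And>s. s \<in> {T..t} \<Longrightarrow> (f has_vector_derivative f' s) (at s within {T..t})"
    and cf: "continuous_on {T..t} f'"
begin

lemma wseq_tendsto: assumes "w \<in> space M" shows "(\<lambda>n. wseq f T t n w) \<longlonglongrightarrow> wint f f' T t w"
proof -
  have cB: "continuous_on {T..t} (\<lambda>s. B s w)" by (rule continuous_on_subset[OF B_continuous[OF assms]]) (use T in auto)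
  have "strict_mono (\<lambda>n::nat. 2 ^ n :: nat)" by (rule strict_monoI) simp
  from LIMSEQ_subseq_LIMSEQ[OF banach_bilinear.jint_riemann[OF banach_bilinear_inner f cf cB T(2)] this]
  show ?thesis by (simp add: wseq_def wsum_def o_def)
qed

lemma wseq_L: "wseq f T t n \<in> L" unfolding wseq_def by (rule wsum_L[OF T])

text \<open>The isometry and uniform continuity of \<open>f\<close> make the left-point sums Cauchy
  in L2; their pathwise limit, the expression by parts, is then also their L2 limit. This identifies
  the pathwise object with the Wiener integral.\<close>

lemma wint_limit: "sqi (wint f f' T t)" "(\<lambda>n. sqd (wint f f' T t) (wseq f T t n)) \<longlonglongrightarrow> 0"
proof -
  have ae: "AE w in M. (\<lambda>n. wseq f T t n w) \<longlonglongrightarrow> wint f f' T t w" using wseq_tendsto by auto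
  have m: "wint f f' T t \<in> borel_measurable M"
    by (rule borel_measurable_LIMSEQ_real[OF wseq_tendsto]) (use wseq_L L_sqi sqi_measurable in blast)+
  have cauchy: "\<exists>N. \<forall>i\<ge>N. \<forall>j\<ge>N. sqd (wseq f T t i) (wseq f T t j) < e" if e: "e > 0" for e
  proof -
    have "uniformly_continuous_on {T..t} f"
      by (rule compact_uniformly_continuous[OF continuous_on_vector_derivative[OF f]]) auto
    moreover define e' where "e' = sqrt (e / (2 * (t - T + 1)))"
    have e': "e' > 0" using e T by (simp add: e'_def)
    ultimately obtain d where d: "d > 0" "\<And>s r. s \<in> {T..t} \<Longrightarrow> r \<in> {T..t} \<Longrightarrow> dist s r < d \<Longrightarrow> dist (f s) (f r) < e'"
      unfolding uniformly_continuous_on_def by metis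
    obtain N :: nat where N: "(t - T) / d < real N" using reals_Archimedean2 by blast
    have le: "sqd (wseq f T t i) (wseq f T t j) < e" if ij: "N \<le> i" "i \<le> j" for i j
    proof -
      define q :: nat where "q = 2 ^ (j - i)"
      have q: "q > 0" "2 ^ i * q = (2 ^ j :: nat)" using ij by (simp_all add: q_def power_add[symmetric])
      define c where "c k = f (upart T t (2 ^ i) (k div q)) - f (upart T t (2 ^ j) k)" for k
      have "wseq f T t i w - wseq f T t j w = wsum c T t (2 ^ j) w" for w
        unfolding wseq_def wsum_refine[OF q(1), of _ T t "2 ^ i"] q(2)
        by (simp add: wsum_def c_def inner_diff_left sum_subtractf)
      then have "sqd (wseq f T t i) (wseq f T t j) = (\<Sum>k<2 ^ j. (c k \<bullet> c k) * ((t - T) / real (2 ^ j)))"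
        unfolding sqd_def using wsum_isometry[OF T, of c "2 ^ j" c] by (simp add: power2_eq_square)
      also have "\<dots> \<le> (\<Sum>k<(2::nat) ^ j. (e / (2 * (t - T + 1))) * ((t - T) / real (2 ^ j)))"
      proof (intro sum_mono mult_right_mono)
        fix k assume k: "k \<in> {..<(2::nat) ^ j}"
        have kq: "k div q < 2 ^ i" using k q by (simp add: less_mult_imp_div_less)
        have in1: "upart T t (2 ^ i) (k div q) \<in> {T..t}" using upart_in[OF T(2), of "k div q" "2 ^ i"] kq by simp
        have in2: "upart T t (2 ^ j) k \<in> {T..t}" using upart_in[OF T(2), of k "2 ^ j"] k by simp
        have e1: "upart T t (2 ^ i) (k div q) = upart T t (2 ^ j) ((k div q) * q)"
          using q(1) by (simp add: upart_def q(2)[symmetric])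
        have "upart T t (2 ^ j) ((k div q) * q) \<le> upart T t (2 ^ j) k"
          by (rule upart_mono[OF T(2)]) simp
        moreover have "upart T t (2 ^ j) k \<le> upart T t (2 ^ j) (Suc (k div q) * q)"
          by (rule upart_mono[OF T(2)]) (use q(1) dividend_less_div_times[of q k] in \<open>simp add: add.commute\<close>)
        moreover have "upart T t (2 ^ j) (Suc (k div q) * q) = upart T t (2 ^ i) (Suc (k div q))"
          using q(1) by (simp add: upart_def q(2)[symmetric] del: mult_Suc)
        moreover have "upart T t (2 ^ i) (Suc (k div q)) - upart T t (2 ^ i) (k div q) < d"
        proof -
          have "real N \<le> real i" using ij by simp
          also have "\<dots> < 2 ^ i" by (rule of_nat_less_two_power)
          finally have "(t - T) / d < 2 ^ i" using N by linarith
          then show ?thesis unfolding upart_step using d(1) by (simp add: field_simps)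
        qed
        ultimately have "dist (upart T t (2 ^ i) (k div q)) (upart T t (2 ^ j) k) < d"
          unfolding dist_real_def e1 by linarith
        then have "norm (c k) < e'" unfolding c_def using d(2)[OF in1 in2] by (simp add: dist_norm)
        then have "(norm (c k))\<^sup>2 \<le> e'\<^sup>2" by (intro power_mono) auto
        also have "e'\<^sup>2 = e / (2 * (t - T + 1))" using e T by (simp add: e'_def)
        finally show "c k \<bullet> c k \<le> e / (2 * (t - T + 1))" by (simp add: power2_norm_eq_inner)
      qed (use T in auto)
      also have "\<dots> = e * ((t - T) / (2 * (t - T + 1)))" by simp
      also have "\<dots> < e * 1" by (rule mult_strict_left_mono[OF _ e]) (use T in \<open>simp add: field_simps\<close>)
      finally show ?thesis by simp
    qed
    have sym: "sqd f g = sqd g f" for f g unfolding sqd_def by (simp add: power2_commute)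
    have "sqd (wseq f T t i) (wseq f T t j) < e" if "N \<le> i" "N \<le> j" for i j
      using le[of i j] le[of j i] that sym[of "wseq f T t i" "wseq f T t j"] by (cases "i \<le> j") auto
    then show ?thesis by blast
  qed
  from sqi_limit[OF L_sqi[OF wseq_L] m ae cauchy]
  show "sqi (wint f f' T t)" "(\<lambda>n. sqd (wint f f' T t) (wseq f T t n)) \<longlonglongrightarrow> 0" by auto
qed

lemma wint_L: "wint f f' T t \<in> L"
  by (rule L_limit[OF wseq_L wint_limit])

lemma wint_orth:
  assumes R: "sqi R" and o: "\<And>u v i. T \<le> u \<Longrightarrow> u \<le> v \<Longrightarrow> v \<le> t \<Longrightarrow> expectation (\<lambda>w. dB u v i w * R w) = 0"
  shows "expectation (\<lambda>w. wint f f' T t w * R w) = 0"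
proof -
  have "(\<lambda>n. expectation (\<lambda>w. wseq f T t n w * R w)) \<longlonglongrightarrow> expectation (\<lambda>w. wint f f' T t w * R w)"
    by (rule tendsto_expectation_mult[OF L_sqi[OF wseq_L] wint_limit R])
  moreover have "expectation (\<lambda>w. wseq f T t n w * R w) = 0" for n
  proof -
    let ?p = "upart T t (2 ^ n)"
    have p: "?p k \<in> {T..t}" if "k \<le> 2 ^ n" for k by (rule upart_in[OF T(2) that])
    have int: "integrable M (\<lambda>w. dB (?p k) (?p (Suc k)) i w * R w)" if "k < 2 ^ n" for k i
      using p[of k] p[of "Suc k"] that T(1) by (intro integrable_sqi_mult L_sqi dB_L R) auto
    have "wseq f T t n w * R w = (\<Sum>k<2 ^ n. \<Sum>i\<in>UNIV. f (?p k) $ i * (dB (?p k) (?p (Suc k)) i w * R w))" for w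
      unfolding wseq_def wsum_dB by (simp add: sum_distrib_right mult.assoc)
    then have "expectation (\<lambda>w. wseq f T t n w * R w)
       = (\<Sum>k<2 ^ n. \<Sum>i\<in>UNIV. f (?p k) $ i * expectation (\<lambda>w. dB (?p k) (?p (Suc k)) i w * R w))"
      by (simp add: int)
    also have "\<dots> = 0"
    proof (intro sum.neutral ballI)
      fix k i assume "k \<in> {..<(2::nat) ^ n}"
      then show "f (?p k) $ i * expectation (\<lambda>w. dB (?p k) (?p (Suc k)) i w * R w) = 0"
        using o[of "?p k" "?p (Suc k)" i] p[of k] p[of "Suc k"] upart_mono[OF T(2), of k "Suc k" "2 ^ n"] by auto
    qed
    finally show ?thesis .
  qed
  ultimately show ?thesis by (simp add: LIMSEQ_const_iff)
qed

end

text \<open>The limit of the discrete isometry. Its right-hand sides are left-point sums of f . g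
  against the path s, so the convergence result for left-point sums evaluates them too.\<close>

lemma wint_isometry:
  assumes T: "0 \<le> T" "T \<le> t"
    and f: "\<And>s. s \<in> {T..t} \<Longrightarrow> (f has_vector_derivative f' s) (at s within {T..t})" "continuous_on {T..t} f'"
    and g: "\<And>s. s \<in> {T..t} \<Longrightarrow> (g has_vector_derivative g' s) (at s within {T..t})" "continuous_on {T..t} g'"
  shows "expectation (\<lambda>w. wint f f' T t w * wint g g' T t w) = integral {T..t} (\<lambda>s. f s \<bullet> g s)"
proof -
  have cf: "continuous_on {T..t} f" "continuous_on {T..t} g"
    by (rule continuous_on_vector_derivative, rule f g, simp)+
  define F where "F s = f s \<bullet> g s" for s
  define F' where "F' s = f s \<bullet> g' s + f' s \<bullet> g s" for s
  have dF: "(F has_vector_derivative F' s) (at s within {T..t})" if "s \<in> {T..t}" for s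
    unfolding F_def F'_def
    by (rule bounded_bilinear.has_vector_derivative[OF bounded_bilinear_inner f(1)[OF that] g(1)[OF that]])
  have cF': "continuous_on {T..t} F'" unfolding F'_def by (intro continuous_intros cf f g)
  have "(\<lambda>n. expectation (\<lambda>w. wseq f T t n w * wseq g T t n w)) \<longlonglongrightarrow> expectation (\<lambda>w. wint f f' T t w * wint g g' T t w)"
    by (rule tendsto_expectation_mult2[OF L_sqi[OF wseq_L[OF T f]] wint_limit[OF T f] L_sqi[OF wseq_L[OF T g]] wint_limit[OF T g]])
  moreover have "(\<lambda>n. expectation (\<lambda>w. wseq f T t n w * wseq g T t n w)) \<longlonglongrightarrow> integral {T..t} F"
  proof -
    have bb: "banach_bilinear ((\<bullet>) :: real \<Rightarrow> real \<Rightarrow> real)" by (rule banach_bilinear_inner)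
    have "(\<lambda>n. \<Sum>k<n. F (upart T t n k) \<bullet> (upart T t n (Suc k) - upart T t n k)) \<longlonglongrightarrow> jint (\<bullet>) F F' (\<lambda>s. s) T t"
      by (rule banach_bilinear.jint_riemann[OF bb dF cF' _ T(2)]) (auto intro: continuous_intros)
    moreover have "jint (\<bullet>) F F' (\<lambda>s. s) T t = integral {T..t} F"
    proof -
      have "((\<lambda>s. F s * s) has_vector_derivative F s * 1 + F' s * s) (at s within {T..t})" if "s \<in> {T..t}" for s
        by (intro has_vector_derivative_mult dF that has_vector_derivative_id)
      then have "((\<lambda>s. F s * 1 + F' s * s) has_integral (F t * t - F T * T)) {T..t}"
        by (rule fundamental_theorem_of_calculus[OF T(2)])
      then have "integral {T..t} (\<lambda>s. F s + F' s * s) = F t * t - F T * T" by (simp add: integral_unique)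
      moreover have "integral {T..t} (\<lambda>s. F s + F' s * s) = integral {T..t} F + integral {T..t} (\<lambda>s. F' s * s)"
        by (intro Henstock_Kurzweil_Integration.integral_add integrable_continuous_real continuous_intros cF'
            continuous_on_vector_derivative[OF dF])
      ultimately show ?thesis by (simp add: jint_def)
    qed
    moreover have "strict_mono (\<lambda>n::nat. 2 ^ n :: nat)" by (rule strict_monoI) simp
    ultimately have "(\<lambda>n. \<Sum>k<2 ^ n. F (upart T t (2 ^ n) k) \<bullet> (upart T t (2 ^ n) (Suc k) - upart T t (2 ^ n) k)) \<longlonglongrightarrow> integral {T..t} F"
      using LIMSEQ_subseq_LIMSEQ by (fastforce simp: o_def)
    moreover have "expectation (\<lambda>w. wseq f T t n w * wseq g T t n w)
        = (\<Sum>k<2 ^ n. F (upart T t (2 ^ n) k) \<bullet> (upart T t (2 ^ n) (Suc k) - upart T t (2 ^ n) k))" for n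
      unfolding wseq_def wsum_isometry[OF T] by (simp add: F_def upart_step)
    ultimately show ?thesis by simp
  qed
  ultimately show ?thesis unfolding F_def[symmetric] by (rule LIMSEQ_unique)
qed

subsection \<open>Growth of Brownian paths\<close>

lemma dB_fourth_moment:
  assumes "0 \<le> s" "s \<le> t"
  shows "(\<integral>\<^sup>+w. ennreal (dB s t i w ^ 4) \<partial>M) = ennreal (3 * (t - s)\<^sup>2)"
proof -
  have e2: "expectation (\<lambda>w. (dB s t i w)\<^sup>2) = t - s"
    using dB_moments(2)[OF assms, of i i] by (simp add: power2_eq_square)
  have "dB s t i \<in> L" using assms by (intro dB_L) auto
  from gaussian_rv_sqi_gchar(3)[OF L_gaussian_rv[OF this] dB_moments(1)[OF assms]]
  show ?thesis unfolding e2 by (subst nn_integral_eq_integral) auto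
qed

text \<open>A point of level n + 1 with odd numerator is one step of that level away from a point of
  level n.\<close>

lemma dyadic_bound:
  fixes b :: "real \<Rightarrow> real"
  assumes d: "\<And>n k. k < 2 ^ n \<Longrightarrow> \<bar>b (p + real (Suc k) / 2 ^ n) - b (p + real k / 2 ^ n)\<bar> \<le> K * (9/10) ^ n"
    and k: "k \<le> 2 ^ n"
  shows "\<bar>b (p + real k / 2 ^ n) - b p\<bar> \<le> (\<Sum>j\<le>n. K * (9/10) ^ j)"
  using k
proof (induction n arbitrary: k)
  case 0
  then have "k = 0 \<or> k = 1" by auto
  moreover have "0 \<le> K" using d[of 0 0] by simp
  ultimately show ?case using d[of 0 0] by auto
next
  case (Suc n)
  have h: "real (2 * j) / 2 ^ Suc n = real j / 2 ^ n" for j by (simp add: field_simps)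
  have K: "0 \<le> K" using order_trans[OF abs_ge_zero d[of 0 0]] by simp
  show ?case
  proof (cases "even k")
    case True
    then obtain j where j: "k = 2 * j" by (auto elim: evenE)
    then have "j \<le> 2 ^ n" using Suc.prems by simp
    from Suc.IH[OF this] have "\<bar>b (p + real k / 2 ^ Suc n) - b p\<bar> \<le> (\<Sum>j\<le>n. K * (9/10) ^ j)" unfolding j h .
    then show ?thesis using K by (simp add: add_increasing2)
  next
    case False
    then obtain j where j: "k = Suc (2 * j)" by (auto elim: oddE)
    then have jn: "j \<le> 2 ^ n" "2 * j < 2 ^ Suc n" using Suc.prems by auto
    have "\<bar>b (p + real k / 2 ^ Suc n) - b (p + real (2 * j) / 2 ^ Suc n)\<bar> \<le> K * (9/10) ^ Suc n"
      unfolding j by (rule d[OF jn(2)])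
    moreover have "\<bar>b (p + real (2 * j) / 2 ^ Suc n) - b p\<bar> \<le> (\<Sum>j\<le>n. K * (9/10) ^ j)"
      using Suc.IH[OF jn(1)] unfolding h .
    ultimately show ?thesis unfolding sum.atMost_Suc by linarith
  qed
qed

text \<open>Dyadic approximations of t from below converge to t, and the geometric series of ratio
  9/10 has sum 10.\<close>

lemma chaining_bound:
  fixes b :: "real \<Rightarrow> real"
  assumes d: "\<And>n k. k < 2 ^ n \<Longrightarrow> \<bar>b (p + real (Suc k) / 2 ^ n) - b (p + real k / 2 ^ n)\<bar> \<le> K * (9/10) ^ n"
    and c: "continuous_on {p..p+1} b" and t: "t \<in> {p..p+1}"
  shows "\<bar>b t - b p\<bar> \<le> 10 * K"
proof -
  define k where "k n = nat \<lfloor>(t - p) * 2 ^ n\<rfloor>" for n :: nat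
  define s where "s n = p + real (k n) / 2 ^ n" for n
  have K: "0 \<le> K" using order_trans[OF abs_ge_zero d[of 0 0]] by simp
  have kr: "real (k n) \<le> (t - p) * 2 ^ n" "(t - p) * 2 ^ n < real (k n) + 1" for n
  proof -
    have "0 \<le> (t - p) * 2 ^ n" using t by simp
    then show "real (k n) \<le> (t - p) * 2 ^ n" "(t - p) * 2 ^ n < real (k n) + 1" unfolding k_def by linarith+
  qed
  have kn: "k n \<le> 2 ^ n" for n
  proof -
    have "(t - p) * 2 ^ n \<le> 1 * 2 ^ n" using t by (intro mult_right_mono) auto
    then have "real (k n) \<le> 2 ^ n" using kr(1)[of n] by linarith
    also have "\<dots> = real (2 ^ n)" by simp
    finally show ?thesis by (simp only: of_nat_le_iff)
  qed
  have sin: "s n \<in> {p..p+1}" for n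
  proof -
    have "real (k n) \<le> real (2 ^ n)" using kn by (simp only: of_nat_le_iff)
    then show ?thesis by (simp add: s_def)
  qed
  have "s \<longlonglongrightarrow> t"
  proof (rule tendsto_sandwich)
    show "\<forall>\<^sub>F n in sequentially. t - (1/2) ^ n \<le> s n"
    proof (intro always_eventually allI)
      fix n
      have "(t - p) < (real (k n) + 1) / 2 ^ n" using kr(2)[of n] by (simp add: pos_less_divide_eq)
      then show "t - (1/2) ^ n \<le> s n" by (simp add: s_def add_divide_distrib power_one_over)
    qed
    show "\<forall>\<^sub>F n in sequentially. s n \<le> t"
    proof (intro always_eventually allI)
      fix n
      have "real (k n) / 2 ^ n \<le> t - p" using kr(1)[of n] by (simp add: pos_divide_le_eq)
      then show "s n \<le> t" by (simp add: s_def)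
    qed
    have "(\<lambda>n. t - (1/2) ^ n) \<longlonglongrightarrow> t - 0" by (intro tendsto_intros LIMSEQ_realpow_zero) auto
    then show "(\<lambda>n. t - (1/2) ^ n) \<longlonglongrightarrow> t" by simp
  qed simp
  then have "(\<lambda>n. b (s n)) \<longlonglongrightarrow> b t"
    using c t sin unfolding continuous_on_sequentially by (auto simp: o_def)
  then have "(\<lambda>n. \<bar>b (s n) - b p\<bar>) \<longlonglongrightarrow> \<bar>b t - b p\<bar>" by (intro tendsto_intros)
  moreover have "\<bar>b (s n) - b p\<bar> \<le> 10 * K" for n
  proof -
    have "\<bar>b (s n) - b p\<bar> \<le> (\<Sum>j\<le>n. K * (9/10) ^ j)" unfolding s_def by (rule dyadic_bound[OF d kn])
    also have "\<dots> = K * (\<Sum>j\<le>n. (9/10) ^ j)" by (simp add: sum_distrib_left)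
    also have "\<dots> \<le> K * 10"
    proof (rule mult_left_mono[OF _ K])
      have "(\<Sum>j\<le>n. (9/10) ^ j) = (1 - (9/10) ^ Suc n) / (1 - 9/10 :: real)" by (simp add: sum_gp0)
      then show "(\<Sum>j\<le>n. (9/10) ^ j) \<le> (10::real)" by simp
    qed
    finally show ?thesis by simp
  qed
  ultimately show ?thesis by (intro tendsto_upperbound[where F = sequentially]) auto
qed

text \<open>The weighted sum of the fourth powers of all dyadic increments that drives the chaining.\<close>

definition chain :: "'n \<Rightarrow> nat \<Rightarrow> 'a \<Rightarrow> ennreal" where
  "chain i p w = (\<Sum>n. \<Sum>k<2 ^ n. ennreal ((10/9) ^ (4 * n)) *
     ennreal (dB (real p + real k / 2 ^ n) (real p + real (Suc k) / 2 ^ n) i w ^ 4))"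

lemma measurable_dB [measurable]: "0 \<le> s \<Longrightarrow> 0 \<le> t \<Longrightarrow> dB s t i \<in> borel_measurable M"
  using dB_L L_sqi sqi_measurable by blast

lemma measurable_chain [measurable]: "chain i p \<in> borel_measurable M"
  unfolding chain_def[abs_def] by measurable

text \<open>Level n has 2^n increments with fourth moment 3 / 4^n, weighted by (10/9)^(4 n), which
  makes 3 (5000/6561)^n. The chaining ratio 9/10 works because (10/9)^4 / 2 < 1; the sum is below
  20.\<close>

lemma nn_integral_chain: "(\<integral>\<^sup>+w. chain i p w \<partial>M) \<le> ennreal 20"
proof -
  have "(\<integral>\<^sup>+w. chain i p w \<partial>M) = (\<Sum>n. \<Sum>k<2 ^ n. ennreal ((10/9) ^ (4 * n)) *
     (\<integral>\<^sup>+w. ennreal (dB (real p + real k / 2 ^ n) (real p + real (Suc k) / 2 ^ n) i w ^ 4) \<partial>M))"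
    unfolding chain_def by (subst nn_integral_suminf, measurable) (simp add: nn_integral_sum nn_integral_cmult)
  also have "\<dots> = (\<Sum>n. ennreal (3 * (5000/6561) ^ n))"
  proof (rule suminf_cong)
    fix n :: nat
    have "(\<integral>\<^sup>+w. ennreal (dB (real p + real k / 2 ^ n) (real p + real (Suc k) / 2 ^ n) i w ^ 4) \<partial>M) = ennreal (3 * (1 / 2 ^ n)\<^sup>2)" for k
      by (subst dB_fourth_moment) (auto simp: divide_right_mono add_divide_distrib)
    then have "(\<Sum>k<(2::nat) ^ n. ennreal ((10/9) ^ (4 * n)) *
       (\<integral>\<^sup>+w. ennreal (dB (real p + real k / 2 ^ n) (real p + real (Suc k) / 2 ^ n) i w ^ 4) \<partial>M))
      = (\<Sum>k<(2::nat) ^ n. ennreal ((10/9) ^ (4 * n) * (3 * (1 / 2 ^ n)\<^sup>2)))"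
      by (simp add: ennreal_mult)
    also have "\<dots> = ennreal (\<Sum>k<(2::nat) ^ n. (10/9) ^ (4 * n) * (3 * (1 / 2 ^ n)\<^sup>2))" by (rule sum_ennreal) simp
    also have "(\<Sum>k<(2::nat) ^ n. (10/9) ^ (4 * n) * (3 * (1 / 2 ^ n)\<^sup>2)) = 3 * ((10/9) ^ (4 * n) * (1 / 2) ^ n :: real)"
      by (simp add: power2_eq_square power_one_over field_simps)
    also have "(10/9) ^ (4 * n) * (1 / 2) ^ n = (5000/6561 :: real) ^ n"
      unfolding power_mult power_mult_distrib[symmetric] by (rule arg_cong[where f = "\<lambda>x. x ^ n"]) (simp add: eval_nat_numeral)
    finally show "(\<Sum>k<2 ^ n. ennreal ((10/9) ^ (4 * n)) *
       (\<integral>\<^sup>+w. ennreal (dB (real p + real k / 2 ^ n) (real p + real (Suc k) / 2 ^ n) i w ^ 4) \<partial>M)) = ennreal (3 * (5000/6561) ^ n)" .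
  qed
  also have "\<dots> = ennreal (\<Sum>n. 3 * (5000/6561) ^ n)"
    by (intro suminf_ennreal2 summable_mult summable_geometric) auto
  also have "(\<Sum>n. 3 * (5000/6561 :: real) ^ n) \<le> 20"
    by (subst suminf_mult) (auto simp: suminf_geometric summable_geometric)
  finally show ?thesis by (simp add: ennreal_leI)
qed

lemma chain_path_bound:
  assumes om: "w \<in> space M" and X: "chain i p w \<le> ennreal X" "0 \<le> X" and t: "t \<in> {real p..real p + 1}"
  shows "\<bar>B t w $ i - B (real p) w $ i\<bar> \<le> 10 * (X + 1)"
proof (rule chaining_bound[OF _ _ t])
  show "continuous_on {real p..real p + 1} (\<lambda>t. B t w $ i)"
    by (intro continuous_on_component continuous_on_subset[OF B_continuous[OF om]]) auto
  fix n k :: nat assume k: "k < 2 ^ n"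
  let ?g = "\<lambda>n k. ennreal ((10/9) ^ (4 * n)) *
     ennreal (dB (real p + real k / 2 ^ n) (real p + real (Suc k) / 2 ^ n) i w ^ 4)"
  define D where "D = B (real p + real (Suc k) / 2 ^ n) w $ i - B (real p + real k / 2 ^ n) w $ i"
  have "?g n k \<le> (\<Sum>k<2 ^ n. ?g n k)" by (rule member_le_sum) (use k in auto)
  also have "\<dots> \<le> (\<Sum>n. \<Sum>k<2 ^ n. ?g n k)" using sum_le_suminf[of "\<lambda>n. \<Sum>k<2 ^ n. ?g n k" "{n}"] by simp
  also have "\<dots> \<le> ennreal X" using X(1) by (simp add: chain_def)
  finally have "ennreal ((10/9) ^ (4 * n) * D ^ 4) \<le> ennreal X" by (simp add: ennreal_mult D_def dB_def)
  then have "(10/9) ^ (4 * n) * D ^ 4 \<le> X" using X(2) by simp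
  then have "((10/9) ^ n * \<bar>D\<bar>) ^ 4 \<le> X"
    by (simp add: power_mult_distrib power_mult[symmetric] mult.commute)
  \<comment> \<open>X + 1 stands in for the fourth root of X and covers X < 1 as well.\<close>
  also have "X \<le> (X + 1) ^ 4" using X(2) self_le_power[of "X + 1" 4] by simp
  finally have "(10/9) ^ n * \<bar>D\<bar> \<le> X + 1"
    using X(2) by (subst (asm) power_mono_iff) auto
  then have "(9/10) ^ n * ((10/9) ^ n * \<bar>D\<bar>) \<le> (9/10) ^ n * (X + 1)" by (intro mult_left_mono) auto
  then show "\<bar>B (real p + real (Suc k) / 2 ^ n) w $ i - B (real p + real k / 2 ^ n) w $ i\<bar> \<le> (X + 1) * (9/10) ^ n"
    by (simp add: D_def mult.assoc[symmetric] power_mult_distrib[symmetric] mult.commute)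
qed

text \<open>Summed over the integers p with weights exp (- d p), the chaining sums and the squares
  of B at p have finite expectation, since these have expectations at most 20 and equal to p. Where
  the total is finite, it bounds the path on [p, p + 1] by a multiple of exp (d p).\<close>

lemma B_growth_component:
  assumes d: "0 < d" shows "AE w in M. \<exists>C. \<forall>t\<ge>0. \<bar>B t w $ i\<bar> \<le> C * exp (d * t)"
proof -
  define T where "T w = (\<Sum>p. ennreal (exp (- d * real p)) * (chain i p w + ennreal ((B (real p) w $ i)\<^sup>2)))" for w
  have Bm[measurable]: "(\<lambda>w. B (real p) w $ i) \<in> borel_measurable M" for p :: nat
    using B_L[of "real p" i] L_sqi sqi_measurable by auto
  have [measurable]: "T \<in> borel_measurable M" unfolding T_def by measurable
  have sq: "(\<integral>\<^sup>+w. ennreal ((B (real p) w $ i)\<^sup>2) \<partial>M) = ennreal (real p)" for p :: nat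
  proof -
    have "(\<integral>\<^sup>+w. ennreal ((B (real p) w $ i)\<^sup>2) \<partial>M) = (\<integral>\<^sup>+w. ennreal ((dB 0 (real p) i w)\<^sup>2) \<partial>M)"
      by (rule nn_integral_cong_AE) (use B_0 in eventually_elim, simp add: dB_def)
    also have "\<dots> = ennreal (expectation (\<lambda>w. (dB 0 (real p) i w)\<^sup>2))"
      by (intro nn_integral_eq_integral integrable_sqi_power2 L_sqi dB_L) auto
    finally show ?thesis using dB_moments(2)[of 0 "real p" i i] by (simp add: power2_eq_square)
  qed
  have "(\<integral>\<^sup>+w. T w \<partial>M) = (\<Sum>p. ennreal (exp (- d * real p)) * ((\<integral>\<^sup>+w. chain i p w \<partial>M) + ennreal (real p)))"
    unfolding T_def by (subst nn_integral_suminf, measurable) (simp add: nn_integral_cmult nn_integral_add sq)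
  also have "\<dots> \<le> (\<Sum>p. ennreal ((20 + 2 / d) * exp (- d / 2) ^ p))"
  proof (intro suminf_le allI)
    fix p :: nat
    have "ennreal (exp (- d * real p)) * ((\<integral>\<^sup>+w. chain i p w \<partial>M) + ennreal (real p))
        \<le> ennreal (exp (- d * real p)) * (ennreal 20 + ennreal (real p))"
      by (intro mult_left_mono add_mono nn_integral_chain) auto
    also have "\<dots> = ennreal (exp (- d * real p) * (20 + real p))" by (simp add: ennreal_mult)
    also have "\<dots> \<le> ennreal ((20 + 2 / d) * exp (- d / 2) ^ p)"
    proof (rule ennreal_leI)
      \<comment> \<open>Half of the exponent in exp (- d p) absorbs the linear growth of p, and a
        geometric series is left.\<close>
      have "d / 2 * real p \<le> exp (d / 2 * real p)" using exp_ge_add_one_self[of "d / 2 * real p"] by linarith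
      then have "real p \<le> 2 / d * exp (d / 2 * real p)" using d by (simp add: field_simps)
      moreover have "20 \<le> 20 * exp (d / 2 * real p)" using d by simp
      ultimately have "20 + real p \<le> 20 * exp (d / 2 * real p) + 2 / d * exp (d / 2 * real p)" by (intro add_mono)
      then have "20 + real p \<le> (20 + 2 / d) * exp (d / 2 * real p)" by (simp only: distrib_right)
      then have "exp (- d * real p) * (20 + real p) \<le> exp (- d * real p) * ((20 + 2 / d) * exp (d / 2 * real p))"
        by (intro mult_left_mono) auto
      also have "\<dots> = (20 + 2 / d) * (exp (- d * real p) * exp (d / 2 * real p))" by (simp only: mult.left_commute)
      also have "exp (- d * real p) * exp (d / 2 * real p) = exp (- d / 2) ^ p"
        by (simp add: exp_add[symmetric] exp_of_nat_mult[symmetric] field_simps)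
      finally show "exp (- d * real p) * (20 + real p) \<le> (20 + 2 / d) * exp (- d / 2) ^ p" .
    qed
    finally show "ennreal (exp (- d * real p)) * ((\<integral>\<^sup>+w. chain i p w \<partial>M) + ennreal (real p)) \<le> ennreal ((20 + 2 / d) * exp (- d / 2) ^ p)" .
  qed auto
  also have "\<dots> = ennreal (\<Sum>p. (20 + 2 / d) * exp (- d / 2) ^ p)"
    using d by (intro suminf_ennreal2 summable_mult summable_geometric) auto
  also have "\<dots> < \<infinity>" by simp
  finally have "(\<integral>\<^sup>+w. T w \<partial>M) \<noteq> \<infinity>" by simp
  then have "AE w in M. T w \<noteq> \<infinity>" by (intro nn_integral_PInf_AE) auto
  moreover have "AE w in M. w \<in> space M" by (rule AE_space)
  ultimately show ?thesis
  proof eventually_elim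
    case (elim w)
    define X where "X = enn2real (T w)"
    have X: "T w = ennreal X" "0 \<le> X" using elim(1) by (auto simp: X_def less_top)
    have "\<bar>B t w $ i\<bar> \<le> (11 * X + 11) * exp (d * t)" if t: "0 \<le> t" for t
    proof -
      define p where "p = nat \<lfloor>t\<rfloor>"
      have p: "t \<in> {real p..real p + 1}" using t by (auto simp: p_def)
      let ?g = "\<lambda>p. ennreal (exp (- d * real p)) * (chain i p w + ennreal ((B (real p) w $ i)\<^sup>2))"
      define e where "e = exp (d * real p)"
      have e1: "1 \<le> e" using d by (simp add: e_def)
      have ee: "exp (- d * real p) * e = 1" by (simp add: e_def exp_add[symmetric])
      have "?g p \<le> T w" unfolding T_def using sum_le_suminf[of ?g "{p}"] by simp
      then have "ennreal e * ?g p \<le> ennreal e * ennreal X" unfolding X(1) by (rule mult_left_mono) simp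
      moreover have "ennreal e * ?g p = chain i p w + ennreal ((B (real p) w $ i)\<^sup>2)"
        using ee e1 by (simp add: mult.assoc[symmetric] ennreal_mult[symmetric] mult.commute)
      moreover have "ennreal e * ennreal X = ennreal (e * X)" using e1 X(2) by (simp add: ennreal_mult)
      ultimately have le: "chain i p w + ennreal ((B (real p) w $ i)\<^sup>2) \<le> ennreal (e * X)" by simp
      have eX: "0 \<le> e * X" using e1 X(2) by simp
      have c1: "chain i p w \<le> ennreal (e * X)" using le by (rule order_trans[rotated]) simp
      have "ennreal ((B (real p) w $ i)\<^sup>2) \<le> ennreal (e * X)" using le by (rule order_trans[rotated]) simp
      then have c2: "(B (real p) w $ i)\<^sup>2 \<le> e * X" using eX by simp
      have "\<bar>B t w $ i - B (real p) w $ i\<bar> \<le> 10 * (e * X + 1)" by (rule chain_path_bound[OF elim(2) c1 eX p])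
      moreover have "\<bar>B (real p) w $ i\<bar> \<le> 1 + e * X"
      proof -
        have "0 \<le> (\<bar>B (real p) w $ i\<bar> - 1)\<^sup>2" by simp
        then have "2 * \<bar>B (real p) w $ i\<bar> \<le> 1 + (B (real p) w $ i)\<^sup>2" by (simp add: power2_diff)
        then show ?thesis using c2 eX by linarith
      qed
      moreover have "\<bar>B t w $ i\<bar> \<le> \<bar>B t w $ i - B (real p) w $ i\<bar> + \<bar>B (real p) w $ i\<bar>" by linarith
      moreover have "10 * (e * X + 1) + (1 + e * X) = 11 * (e * X) + 11" by simp
      ultimately have "\<bar>B t w $ i\<bar> \<le> 11 * (e * X) + 11" by linarith
      also have "\<dots> \<le> (11 * X + 11) * e" using e1 by (simp add: distrib_right)
      also have "\<dots> \<le> (11 * X + 11) * exp (d * t)"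
        using p d X(2) unfolding e_def by (intro mult_left_mono) auto
      finally show ?thesis .
    qed
    then show ?case by blast
  qed
qed

text \<open>The rates 1 / (q + 1) are countably many, so one null set serves all d.\<close>

lemma B_growth: "AE w in M. \<forall>d>0. ebd 0 d (\<lambda>t. B t w)"
proof -
  have "AE w in M. \<forall>q::nat. \<forall>i. \<exists>C. \<forall>t\<ge>0. \<bar>B t w $ i\<bar> \<le> C * exp (inverse (real (Suc q)) * t)"
    unfolding AE_all_countable
  proof (intro allI)
    fix q i show "AE w in M. \<exists>C. \<forall>t\<ge>0. \<bar>B t w $ i\<bar> \<le> C * exp (inverse (real (Suc q)) * t)"
      by (rule B_growth_component) simp
  qed
  then show ?thesis
  proof eventually_elim
    case (elim w)
    show ?case
    proof (intro allI impI)
      fix d :: real assume "0 < d"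
      then obtain q where q: "inverse (real (Suc q)) < d" using reals_Archimedean by blast
      have "\<forall>i. \<exists>C. \<forall>t\<ge>0. \<bar>B t w $ i\<bar> \<le> C * exp (inverse (real (Suc q)) * t)" using elim by blast
      then obtain C where C: "\<And>i t. 0 \<le> t \<Longrightarrow> \<bar>B t w $ i\<bar> \<le> C i * exp (inverse (real (Suc q)) * t)" by metis
      have "norm (B t w) \<le> (\<Sum>i\<in>UNIV. C i) * exp (inverse (real (Suc q)) * t)" if "0 \<le> t" for t
        unfolding sum_distrib_right by (rule order_trans[OF norm_vec_le_sum sum_mono]) (use C[OF that] in simp)
      then have "ebd 0 (inverse (real (Suc q))) (\<lambda>t. B t w)" unfolding ebd_def by blast
      then show "ebd 0 d (\<lambda>t. B t w)" by (rule ebd_mono) (use q in auto)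
    qed
  qed
qed

end

section \<open>Gaussian vectors\<close>

lemma transpose_zero: "transpose 0 = (0 :: real^'n^'m)"
  by (simp add: transpose_def vec_eq_iff)

context gaussian_space
begin

definition vL :: "('a \<Rightarrow> real^'k) \<Rightarrow> bool" where
  "vL Y \<longleftrightarrow> (\<forall>i. (\<lambda>w. Y w $ i) \<in> L)"

text \<open>Cross moments without centring; they are covariances as soon as one argument has mean
  zero.\<close>

definition cross :: "('a \<Rightarrow> real^'k) \<Rightarrow> ('a \<Rightarrow> real^'l) \<Rightarrow> real^'l^'k" where
  "cross Y R = (\<chi> i j. expectation (\<lambda>w. Y w $ i * R w $ j))"

lemma vL_add: "vL Y \<Longrightarrow> vL R \<Longrightarrow> vL (\<lambda>w. Y w + R w)"
  by (simp add: vL_def L_add)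

lemma vL_diff: "vL Y \<Longrightarrow> vL R \<Longrightarrow> vL (\<lambda>w. Y w - R w)"
  by (simp add: vL_def L_diff)

lemma vL_const: "vL (\<lambda>w. c)"
  by (simp add: vL_def L_const)

lemma vL_mv: fixes A :: "real^'k^'l" shows "vL Y \<Longrightarrow> vL (\<lambda>w. A *v Y w)"
  unfolding vL_def by (simp add: matrix_vector_mult_def L_sum L_cmult)

lemma vL_sqi: "vL Y \<Longrightarrow> sqi (\<lambda>w. Y w $ i)"
  by (simp add: vL_def L_sqi)

lemma vL_measurable: "vL Y \<Longrightarrow> Y \<in> borel_measurable M"
  by (subst borel_measurable_euclidean_space)
    (auto simp: Basis_real_vec inner_axis intro: sqi_measurable[OF vL_sqi])

lemma vL_AE:
  assumes "vL Y" "R \<in> borel_measurable M" "AE w in M. Y w = R w" shows "vL R"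
  unfolding vL_def
proof
  fix i
  show "(\<lambda>w. R w $ i) \<in> L"
  proof (rule L_AE)
    show "(\<lambda>w. Y w $ i) \<in> L" using assms(1) by (simp add: vL_def)
    show "(\<lambda>w. R w $ i) \<in> borel_measurable M"
      by (rule measurable_compose[OF assms(2) borel_measurable_vec_nth])
  qed (use assms(3) in eventually_elim, simp)
qed

lemma cross_AE:
  assumes "vL Y" "vL R" "Y' \<in> borel_measurable M" "R' \<in> borel_measurable M"
    and "AE w in M. Y w = Y' w" "AE w in M. R w = R' w"
  shows "cross Y R = cross Y' R'"
  unfolding cross_def
proof (intro arg_cong[where f = vec_lambda] ext integral_cong_AE)
  show "AE w in M. Y w $ i * R w $ j = Y' w $ i * R' w $ j" for i j
    using assms(5,6) by eventually_elim simp
qed (intro borel_measurable_times measurable_compose[OF _ borel_measurable_vec_nth] vL_measurable assms)+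

lemma transpose_cross: "transpose (cross Y R) = cross R Y"
  by (simp add: cross_def transpose_def vec_eq_iff mult.commute)

lemma cross_add_left: "vL Y \<Longrightarrow> vL Y' \<Longrightarrow> vL R \<Longrightarrow> cross (\<lambda>w. Y w + Y' w) R = cross Y R + cross Y' R"
  by (simp add: cross_def vec_eq_iff distrib_right integrable_sqi_mult vL_sqi)

lemma cross_diff_left: "vL Y \<Longrightarrow> vL Y' \<Longrightarrow> vL R \<Longrightarrow> cross (\<lambda>w. Y w - Y' w) R = cross Y R - cross Y' R"
  by (simp add: cross_def vec_eq_iff left_diff_distrib integrable_sqi_mult vL_sqi)

lemma cross_mv_left:
  fixes A :: "real^'k^'l"
  shows "vL Y \<Longrightarrow> vL R \<Longrightarrow> cross (\<lambda>w. A *v Y w) R = A ** cross Y R"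
  by (simp add: cross_def vec_eq_iff matrix_matrix_mult_def matrix_vector_mult_def sum_distrib_right mult.assoc
      Bochner_Integration.integral_sum integrable_sqi_mult vL_sqi)

lemma cross_add_right: "vL Y \<Longrightarrow> vL Y' \<Longrightarrow> vL R \<Longrightarrow> cross R (\<lambda>w. Y w + Y' w) = cross R Y + cross R Y'"
  by (subst (1 2 3) transpose_cross[symmetric]) (simp add: cross_add_left transpose_bilinear)

lemma cross_diff_right: "vL Y \<Longrightarrow> vL Y' \<Longrightarrow> vL R \<Longrightarrow> cross R (\<lambda>w. Y w - Y' w) = cross R Y - cross R Y'"
  by (subst (1 2 3) transpose_cross[symmetric]) (simp add: cross_diff_left transpose_bilinear)

lemma cross_mv_right:
  fixes A :: "real^'k^'l"
  shows "vL Y \<Longrightarrow> vL R \<Longrightarrow> cross R (\<lambda>w. A *v Y w) = cross R Y ** transpose A"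
  by (subst (1 2) transpose_cross[symmetric]) (simp add: cross_mv_left matrix_transpose_mul)

lemma cross_zero_sym: "cross Y R = 0 \<longleftrightarrow> cross R Y = 0"
  by (metis transpose_cross transpose_zero)

lemma cross_self_nonneg:
  assumes "vL Y" shows "transpose (cross Y Y) = cross Y Y" "0 \<le> x \<bullet> (cross Y Y *v x)"
proof -
  show "transpose (cross Y Y) = cross Y Y" by (rule transpose_cross)
  have "x \<bullet> (cross Y Y *v x) = (\<Sum>i\<in>UNIV. \<Sum>j\<in>UNIV. expectation (\<lambda>w. (x $ i * Y w $ i) * (x $ j * Y w $ j)))"
    by (simp add: inner_vec_def matrix_vector_mult_def cross_def sum_distrib_left mult_ac)
  also have "\<dots> = expectation (\<lambda>w. \<Sum>i\<in>UNIV. \<Sum>j\<in>UNIV. (x $ i * Y w $ i) * (x $ j * Y w $ j))"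
    using assms by (simp add: Bochner_Integration.integral_sum integrable_sqi_mult vL_sqi sqi_cmult)
  also have "\<dots> = expectation (\<lambda>w. (\<Sum>i\<in>UNIV. x $ i * Y w $ i)\<^sup>2)"
    by (simp add: power2_eq_square sum_product)
  also have "\<dots> \<ge> 0" by simp
  finally show "0 \<le> x \<bullet> (cross Y Y *v x)" .
qed

end

context gaussian_brownian
begin

lemma B_vL: "0 \<le> t \<Longrightarrow> vL (B t)"
  by (simp add: vL_def B_L)

abbreviation mwint :: "(real \<Rightarrow> real^'n^'k) \<Rightarrow> (real \<Rightarrow> real^'n^'k) \<Rightarrow> real \<Rightarrow> real \<Rightarrow> 'a \<Rightarrow> real^'k" where
  "mwint F F' T t w \<equiv> jint (*v) F F' (\<lambda>s. B s w) T t"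

context
  fixes F F' :: "real \<Rightarrow> real^'n^'k" and T t :: real
  assumes T: "0 \<le> T" "T \<le> t"
    and F: "\<And>s. s \<in> {T..t} \<Longrightarrow> (F has_vector_derivative F' s) (at s within {T..t})"
    and cF: "continuous_on {T..t} F'"
begin

lemma row_derivative:
  "s \<in> {T..t} \<Longrightarrow> ((\<lambda>s. F s $ i) has_vector_derivative F' s $ i) (at s within {T..t})"
  by (rule bounded_linear.has_vector_derivative[OF bounded_linear_vec_nth F])

lemma row_continuous: "continuous_on {T..t} (\<lambda>s. F' s $ i)"
  by (intro continuous_intros cF)

lemma mwint_row: "w \<in> space M \<Longrightarrow> mwint F F' T t w $ i = wint (\<lambda>s. F s $ i) (\<lambda>s. F' s $ i) T t w"
  by (rule jint_inner_component[OF cF]) (use T in \<open>auto intro: continuous_on_subset[OF B_continuous]\<close>)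

lemma mwint_vL: "vL (mwint F F' T t)"
  unfolding vL_def
proof
  fix i
  have wL: "wint (\<lambda>s. F s $ i) (\<lambda>s. F' s $ i) T t \<in> L"
    by (rule wint_L[OF T row_derivative row_continuous])
  show "(\<lambda>w. mwint F F' T t w $ i) \<in> L"
  proof (rule L_AE[OF wL])
    show "(\<lambda>w. mwint F F' T t w $ i) \<in> borel_measurable M"
      using sqi_measurable[OF L_sqi[OF wL]] by (subst measurable_cong[OF mwint_row])
    show "AE w in M. wint (\<lambda>s. F s $ i) (\<lambda>s. F' s $ i) T t w = mwint F F' T t w $ i"
      by (rule AE_I2) (simp add: mwint_row)
  qed
qed

lemma mwint_orth:
  assumes R: "vL R" and o: "\<And>u v. T \<le> u \<Longrightarrow> u \<le> v \<Longrightarrow> v \<le> t \<Longrightarrow> cross (\<lambda>w. B v w - B u w) R = 0"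
  shows "cross (mwint F F' T t) R = 0"
proof -
  have "expectation (\<lambda>w. mwint F F' T t w $ i * R w $ j) = 0" for i j
  proof -
    have "expectation (\<lambda>w. mwint F F' T t w $ i * R w $ j)
        = expectation (\<lambda>w. wint (\<lambda>s. F s $ i) (\<lambda>s. F' s $ i) T t w * R w $ j)"
      by (rule Bochner_Integration.integral_cong) (simp_all add: mwint_row)
    also have "\<dots> = 0"
    proof (rule wint_orth[OF T row_derivative row_continuous vL_sqi[OF R]])
      show "expectation (\<lambda>w. dB u v k w * R w $ j) = 0" if "T \<le> u" "u \<le> v" "v \<le> t" for u v k
        using arg_cong[OF o[OF that], of "\<lambda>A. A $ k $ j"] by (simp add: cross_def dB_def)
    qed
    finally show ?thesis .
  qed
  then show ?thesis by (simp add: cross_def vec_eq_iff)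
qed

end

lemma mwint_isometry:
  fixes F F' :: "real \<Rightarrow> real^'n^'k" and G G' :: "real \<Rightarrow> real^'n^'l"
  assumes T: "0 \<le> T" "T \<le> t"
    and F: "\<And>s. s \<in> {T..t} \<Longrightarrow> (F has_vector_derivative F' s) (at s within {T..t})" "continuous_on {T..t} F'"
    and G: "\<And>s. s \<in> {T..t} \<Longrightarrow> (G has_vector_derivative G' s) (at s within {T..t})" "continuous_on {T..t} G'"
  shows "cross (mwint F F' T t) (mwint G G' T t) = integral {T..t} (\<lambda>s. F s ** transpose (G s))"
proof -
  have int: "(\<lambda>s. F s ** transpose (G s)) integrable_on {T..t}"
    by (intro integrable_continuous_real continuous_intros
        continuous_on_vector_derivative[OF F(1)] continuous_on_vector_derivative[OF G(1)])
  have "cross (mwint F F' T t) (mwint G G' T t) $ i $ j = integral {T..t} (\<lambda>s. F s ** transpose (G s)) $ i $ j" for i j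
  proof -
    have "cross (mwint F F' T t) (mwint G G' T t) $ i $ j
        = expectation (\<lambda>w. wint (\<lambda>s. F s $ i) (\<lambda>s. F' s $ i) T t w * wint (\<lambda>s. G s $ j) (\<lambda>s. G' s $ j) T t w)"
      unfolding cross_def vec_lambda_beta
      by (rule Bochner_Integration.integral_cong[OF refl])
        (simp only: mwint_row[OF T F(1) F(2)] mwint_row[OF T G(1) G(2)])
    also have "\<dots> = integral {T..t} (\<lambda>s. F s $ i \<bullet> G s $ j)"
      by (rule wint_isometry[OF T row_derivative[OF T F] row_continuous[OF T F] row_derivative[OF T G] row_continuous[OF T G]])
    also have "\<dots> = integral {T..t} (\<lambda>s. (F s ** transpose (G s)) $ i $ j)"
      by (simp add: matrix_matrix_mult_def transpose_def inner_vec_def)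
    also have "\<dots> = integral {T..t} (\<lambda>s. F s ** transpose (G s)) $ i $ j"
    proof -
      have bl: "bounded_linear (\<lambda>A :: real^'l^'k. A $ i $ j)"
        by (rule bounded_linear_compose[OF bounded_linear_vec_nth bounded_linear_vec_nth])
      show ?thesis using integral_linear[OF int bl] by (simp add: o_def)
    qed
    finally show ?thesis .
  qed
  then show ?thesis by (simp add: vec_eq_iff)
qed

lemma cross_increment_past:
  assumes "0 \<le> r" "r \<le> u" "u \<le> v"
  shows "cross (\<lambda>w. B v w - B u w) (B r) = 0"
  using dB_past[OF assms] by (simp add: cross_def dB_def vec_eq_iff)

lemma cross_increments:
  assumes "0 \<le> s" "s \<le> t" "t \<le> u" "u \<le> v"
  shows "cross (\<lambda>w. B v w - B u w) (\<lambda>w. B t w - B s w) = 0"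
  using assms cross_increment_past[of t u v] cross_increment_past[of s u v]
  by (subst cross_diff_right) (simp_all add: B_vL vL_diff)

lemma cross_increment_const:
  assumes "0 \<le> u" "u \<le> v" shows "cross (\<lambda>w. B v w - B u w) (\<lambda>w. c) = 0"
  using dB_moments(1)[OF assms] by (simp add: cross_def vec_eq_iff) (simp add: dB_def[abs_def])

end

section \<open>The filter with a noise that is eventually uncorrelated with the initial state\<close>

text \<open>Independence is reduced to vanishing cross moments, which suffice inside a Gaussian
  space. \<open>N_X0\<close> starts at \<open>T\<close> only: before that time the correlation of
  the observation noise with the initial state is left open.\<close>

locale signal_observation =
  steady_filter a h \<gamma> + gaussian_space M S + W: gaussian_brownian M S W + N: gaussian_brownian M S N
  for a :: "real^'m^'m" and h :: "real^'m^'n" and \<gamma> and M :: "'a measure" and S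
    and W :: "real \<Rightarrow> 'a \<Rightarrow> real^'m" and N :: "real \<Rightarrow> 'a \<Rightarrow> real^'n" +
  fixes X :: "real \<Rightarrow> 'a \<Rightarrow> real^'m" and Z :: "real \<Rightarrow> 'a \<Rightarrow> real^'n" and T :: real
  assumes X0_vL: "vL (X 0)"
    and X_measurable: "\<And>t. 0 \<le> t \<Longrightarrow> X t \<in> borel_measurable M"
    and Z_measurable: "\<And>t. 0 \<le> t \<Longrightarrow> Z t \<in> borel_measurable M"
    and T_nonneg: "0 \<le> T"
    and W_X0: "\<And>s. 0 \<le> s \<Longrightarrow> cross (W s) (X 0) = 0"
    and W_N: "\<And>s t. 0 \<le> s \<Longrightarrow> 0 \<le> t \<Longrightarrow> cross (W s) (N t) = 0"
    and N_X0: "\<And>s t. T \<le> s \<Longrightarrow> s \<le> t \<Longrightarrow> cross (\<lambda>w. N t w - N s w) (X 0) = 0"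
    and signal: "AE w in M. \<forall>t\<ge>0. ((\<lambda>s. a *v X s w) has_integral (X t w - X 0 w - W t w)) {0..t}"
    and observation: "AE w in M. \<forall>t\<ge>0. ((\<lambda>s. h *v X s w) has_integral (Z t w - N t w)) {0..t}"
begin

subsection \<open>Regular paths\<close>

definition good :: "'a \<Rightarrow> bool" where
  "good w \<longleftrightarrow> w \<in> space M \<and> W 0 w = 0 \<and> N 0 w = 0 \<and>
     (\<forall>t\<ge>0. ((\<lambda>s. a *v X s w) has_integral (X t w - X 0 w - W t w)) {0..t}) \<and>
     (\<forall>t\<ge>0. ((\<lambda>s. h *v X s w) has_integral (Z t w - N t w)) {0..t})"

lemma AE_good: "AE w in M. good w"
  using AE_space W.B_0 N.B_0 signal observation by eventually_elim (simp add: good_def)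

text \<open>X is only known to satisfy an integral equation. Indefinite integrals are continuous,
  hence X is; then the integrand is continuous and the equation can be differentiated.\<close>

lemma good_paths:
  assumes "good w"
  shows "continuous_on {0..} (\<lambda>t. X t w)" "continuous_on {0..} (\<lambda>t. Z t w)"
    "continuous_on {0..} (\<lambda>t. W t w)" "continuous_on {0..} (\<lambda>t. N t w)"
    "\<And>t. 0 \<le> t \<Longrightarrow> ((\<lambda>t. X t w - W t w) has_vector_derivative a *v X t w) (at t within {0..})"
    "\<And>t. 0 \<le> t \<Longrightarrow> ((\<lambda>t. Z t w - N t w) has_vector_derivative h *v X t w) (at t within {0..})"
proof -
  have om: "w \<in> space M" and s: "\<And>t. 0 \<le> t \<Longrightarrow> ((\<lambda>s. a *v X s w) has_integral (X t w - X 0 w - W t w)) {0..t}"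
    and o: "\<And>t. 0 \<le> t \<Longrightarrow> ((\<lambda>s. h *v X s w) has_integral (Z t w - N t w)) {0..t}"
    using assms by (auto simp: good_def)
  have IX: "X t w = X 0 w + W t w + integral {0..t} (\<lambda>s. a *v X s w)" if "0 \<le> t" for t
    using integral_unique[OF s[OF that]] by simp
  show cW: "continuous_on {0..} (\<lambda>t. W t w)" and cN: "continuous_on {0..} (\<lambda>t. N t w)"
    by (rule W.B_continuous[OF om], rule N.B_continuous[OF om])
  have ci: "continuous_on {0..} (\<lambda>t. integral {0..t} f)" if f: "\<And>t::real. 0 \<le> t \<Longrightarrow> f integrable_on {0..t}"
    for f :: "real \<Rightarrow> real^'m"
    unfolding continuous_on_eq_continuous_within
  proof
    fix t :: real assume "t \<in> {0..}"
    then have t: "0 \<le> t" by simp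
    have "continuous_on {0..t+1} (\<lambda>t. integral {0..t} f)"
      by (rule indefinite_integral_continuous_1) (use f t in simp)
    then have "continuous (at t within {0..t+1}) (\<lambda>t. integral {0..t} f)"
      using t by (simp add: continuous_on_eq_continuous_within)
    then show "continuous (at t within {0..}) (\<lambda>t. integral {0..t} f)"
      using at_within_Icc_Ici[of 0 t "t + 1"] t by simp
  qed
  have cX: "continuous_on {0..} (\<lambda>t. X 0 w + W t w + integral {0..t} (\<lambda>s. a *v X s w))"
    by (intro continuous_intros cW ci) (use s in \<open>auto simp: integrable_on_def\<close>)
  show cX: "continuous_on {0..} (\<lambda>t. X t w)"
    by (rule continuous_on_eq[OF cX]) (rule IX[symmetric], simp)
  show dX: "((\<lambda>t. X t w - W t w) has_vector_derivative a *v X t w) (at t within {0..})" if t: "0 \<le> t" for t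
  proof -
    have "((\<lambda>t. X 0 w + integral {0..t} (\<lambda>s. a *v X s w)) has_vector_derivative 0 + a *v X t w) (at t within {0..})"
      by (intro has_vector_derivative_add has_vector_derivative_const integral_has_vector_derivative_Ici[OF _ t] continuous_intros cX)
    then show ?thesis
      unfolding add_0
    proof (rule has_vector_derivative_transform[rotated 2])
      show "X u w - W u w = X 0 w + integral {0..u} (\<lambda>s. a *v X s w)" if "u \<in> {0..}" for u
        using IX[of u] that by (simp add: algebra_simps)
    qed (use t in simp)
  qed
  show dZ: "((\<lambda>t. Z t w - N t w) has_vector_derivative h *v X t w) (at t within {0..})" if t: "0 \<le> t" for t
  proof -
    have "((\<lambda>t. integral {0..t} (\<lambda>s. h *v X s w)) has_vector_derivative h *v X t w) (at t within {0..})"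
      by (intro integral_has_vector_derivative_Ici[OF _ t] continuous_intros cX)
    then show ?thesis
      by (rule has_vector_derivative_transform[rotated 2]) (use t o[THEN integral_unique, symmetric] in auto)
  qed
  have "continuous_on {0..} (\<lambda>t. (Z t w - N t w) + N t w)"
    by (intro continuous_intros cN continuous_on_Ici_derivative[OF dZ])
  then show "continuous_on {0..} (\<lambda>t. Z t w)" by simp
qed

section \<open>State and observation in terms of an earlier time\<close>

definition Kt :: "real \<Rightarrow> real^'m^'m" where "Kt u = integral {0..u} (mexp a)"

lemma Kt_0: "Kt 0 = 0" by (simp add: Kt_def)

lemma Kt_derivative:
  assumes "r \<in> {u..s}" shows "((\<lambda>r. Kt (s - r)) has_vector_derivative - mexp a (s - r)) (at r within {u..s})"
  \<comment> \<open>The fact concerns matrices only, so the zero paths may be inserted.\<close>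
  using state_representation(3)[of u s "\<lambda>_. 0" "\<lambda>_. 0" a r] assms
  by (simp add: Kt_def matrix_bilinear)

lemma Kt_mult: assumes "0 \<le> u" shows "Kt u ** a = mexp a u - mat 1"
  using state_representation(6)[of 0 u "\<lambda>_. 0" "\<lambda>_. 0" a u] assms
  by (simp add: Kt_def matrix_bilinear)

lemma mexp_derivative_reverse:
  "((\<lambda>r. mexp a (s - r)) has_vector_derivative - (mexp a (s - r) ** a)) (at r within U)"
proof -
  have "((\<lambda>r. s - r) has_real_derivative -1) (at r within U)" by (auto intro!: derivative_eq_intros)
  from mexp_has_vector_derivative_right_compose[OF this] show ?thesis by simp
qed

abbreviation WE :: "real \<Rightarrow> real \<Rightarrow> 'a \<Rightarrow> real^'m" where
  "WE u s \<equiv> W.mwint (\<lambda>r. mexp a (s - r)) (\<lambda>r. - (mexp a (s - r) ** a)) u s"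

abbreviation WK :: "real \<Rightarrow> real \<Rightarrow> 'a \<Rightarrow> real^'m" where
  "WK u s \<equiv> W.mwint (\<lambda>r. Kt (s - r)) (\<lambda>r. - mexp a (s - r)) u s"

lemma path_representation:
  assumes g: "good w" and us: "0 \<le> u" "u \<le> s"
  shows "X s w = mexp a (s - u) *v X u w + WE u s w"
    and "Z s w = (Z u w + h *v (Kt (s - u) *v X u w + WK u s w)) + (N s w - N u w)"
proof -
  have sub: "{u..s} \<subseteq> {0..}" using us by auto
  note p = good_paths[OF g]
  have c: "continuous_on {u..s} (\<lambda>t. W t w)" "continuous_on {u..s} (\<lambda>t. X t w)"
    using p(3,1) sub by (auto intro: continuous_on_subset)
  have d: "((\<lambda>t. X t w - W t w) has_vector_derivative a *v X t w) (at t within {u..s})" if "t \<in> {u..s}" for t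
    by (rule has_vector_derivative_within_subset[OF p(5) sub]) (use that us in auto)
  show "X s w = mexp a (s - u) *v X u w + WE u s w"
    by (rule state_representation(1)[OF c us(2) d])
  have K: "integral {u..s} (\<lambda>t. X t w) = Kt (s - u) *v X u w + WK u s w"
    unfolding Kt_def by (rule state_representation(2)[OF c us(2) d])
  have "((\<lambda>t. h *v X t w) has_integral ((Z s w - N s w) - (Z u w - N u w))) {u..s}"
    by (rule Ici_FTC[OF p(6)]) (use us in auto)
  then have "(Z s w - N s w) - (Z u w - N u w) = integral {u..s} (\<lambda>t. h *v X t w)"
    by (simp add: integral_unique)
  also have "\<dots> = h *v integral {u..s} (\<lambda>t. X t w)"
    using integral_linear[OF integrable_continuous_real[OF c(2)] matrix_vector_mul_bounded_linear[of h]]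
    by (simp add: o_def)
  finally show "Z s w = (Z u w + h *v (Kt (s - u) *v X u w + WK u s w)) + (N s w - N u w)"
    unfolding K by (simp add: algebra_simps)
qed

lemma continuous_on_mexp_reverse: "continuous_on U (\<lambda>r. - mexp a (s - r))" "continuous_on U (\<lambda>r. - (mexp a (s - r) ** a))"
  by (intro continuous_intros)+

lemma WE_vL: "0 \<le> u \<Longrightarrow> u \<le> s \<Longrightarrow> vL (WE u s)"
  by (rule W.mwint_vL) (auto intro: mexp_derivative_reverse continuous_on_mexp_reverse)

lemma WK_vL: "0 \<le> u \<Longrightarrow> u \<le> s \<Longrightarrow> vL (WK u s)"
  by (rule W.mwint_vL) (auto intro: Kt_derivative continuous_on_mexp_reverse)

lemma X_AE: "0 \<le> u \<Longrightarrow> u \<le> s \<Longrightarrow> AE w in M. mexp a (s - u) *v X u w + WE u s w = X s w"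
  using AE_good by eventually_elim (simp add: path_representation(1)[symmetric])

lemma Z_AE: "0 \<le> u \<Longrightarrow> u \<le> s \<Longrightarrow>
  AE w in M. (Z u w + h *v (Kt (s - u) *v X u w + WK u s w)) + (N s w - N u w) = Z s w"
  using AE_good by eventually_elim (simp add: path_representation(2)[symmetric])

lemma X_vL: "0 \<le> s \<Longrightarrow> vL (X s)"
  by (rule vL_AE[OF _ X_measurable X_AE[of 0 s]]) (auto intro!: vL_add vL_mv X0_vL WE_vL)

lemma Z0_AE: "AE w in M. 0 = Z 0 w"
  using AE_good
proof eventually_elim
  case (elim w)
  then have "((\<lambda>s. h *v X s w) has_integral (Z 0 w - N 0 w)) {0..0}" "N 0 w = 0" by (auto simp: good_def)
  then have "Z 0 w - N 0 w = 0" by (metis has_integral_refl(2) cbox_interval has_integral_unique atLeastAtMost_singleton)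
  then show ?case using \<open>N 0 w = 0\<close> by simp
qed

lemma Z0_vL: "vL (Z 0)"
  by (rule vL_AE[OF vL_const _ Z0_AE]) (simp add: Z_measurable)

lemma Z_vL: "0 \<le> s \<Longrightarrow> vL (Z s)"
  by (rule vL_AE[OF _ Z_measurable Z_AE[of 0 s]])
    (auto intro!: vL_add vL_mv vL_diff X_vL WK_vL Z0_vL N.B_vL)

subsection \<open>Future increments are uncorrelated with the past\<close>

lemma cross_W_N_increment: "0 \<le> u \<Longrightarrow> u \<le> v \<Longrightarrow> 0 \<le> p \<Longrightarrow> p \<le> q \<Longrightarrow> cross (\<lambda>w. W v w - W u w) (\<lambda>w. N q w - N p w) = 0"
  by (simp add: cross_diff_left cross_diff_right W.B_vL N.B_vL vL_diff W_N)

text \<open>X s and Z s are almost surely linear in X 0, in Wiener integrals of W up to s, in an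
  increment of N and in Z 0, and Z 0 vanishes almost surely.\<close>

lemma cross_past:
  fixes D :: "'a \<Rightarrow> real^'k"
  assumes D: "vL D" "cross D (X 0) = 0" "cross (WE 0 s) D = 0" "cross (WK 0 s) D = 0"
      "cross D (\<lambda>w. N s w - N 0 w) = 0" and s: "0 \<le> s"
  shows "cross D (X s) = 0" "cross D (Z s) = 0"
proof -
  have E: "cross D (WE 0 s) = 0" "cross D (WK 0 s) = 0"
    using D(3,4) by (simp_all add: cross_zero_sym[of D])
  have "cross D (X s) = cross D (\<lambda>w. mexp a (s - 0) *v X 0 w + WE 0 s w)"
    by (rule cross_AE[OF D(1) X_vL]) (use s X_AE[of 0 s] in
        \<open>auto intro!: vL_measurable D(1) vL_add vL_mv X0_vL WE_vL elim: eventually_mono\<close>)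
  also have "\<dots> = 0"
    using s by (simp add: cross_add_right cross_mv_right D vL_mv X0_vL WE_vL E matrix_bilinear)
  finally show "cross D (X s) = 0" .
  have "cross D (Z s) = cross D (\<lambda>w. (Z 0 w + h *v (Kt (s - 0) *v X 0 w + WK 0 s w)) + (N s w - N 0 w))"
    by (rule cross_AE[OF D(1) Z_vL]) (use s Z_AE[of 0 s] in
        \<open>auto intro!: vL_measurable D(1) vL_add vL_mv vL_diff X0_vL WK_vL Z0_vL N.B_vL elim: eventually_mono\<close>)
  also have "\<dots> = cross D (Z 0)"
    using s by (simp add: cross_add_right cross_mv_right D vL_mv vL_add vL_diff X0_vL Z0_vL WK_vL N.B_vL E matrix_bilinear)
  also have "\<dots> = cross D (\<lambda>w. 0)"
    by (rule cross_AE[OF D(1) Z0_vL]) (use Z0_AE in \<open>auto intro!: vL_measurable D(1) elim: eventually_mono\<close>)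
  also have "\<dots> = 0" by (simp add: cross_def vec_eq_iff)
  finally show "cross D (Z s) = 0" .
qed

lemma cross_W_increment:
  assumes st: "0 \<le> s" "s \<le> u" "u \<le> v"
  shows "cross (\<lambda>w. W v w - W u w) (X s) = 0" "cross (\<lambda>w. W v w - W u w) (Z s) = 0"
proof -
  let ?D = "\<lambda>w. W v w - W u w"
  have D: "vL ?D" using st by (auto intro!: vL_diff W.B_vL)
  have o: "cross (\<lambda>w. W q w - W p w) ?D = 0" if "0 \<le> p" "p \<le> q" "q \<le> s" for p q
    by (subst cross_zero_sym, rule W.cross_increments) (use that st in auto)
  have c1: "cross (WE 0 s) ?D = 0"
    by (rule W.mwint_orth[OF _ _ mexp_derivative_reverse continuous_on_mexp_reverse(2) D o]) (use st in auto)
  have c2: "cross (WK 0 s) ?D = 0"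
    by (rule W.mwint_orth[OF _ _ Kt_derivative continuous_on_mexp_reverse(1) D o]) (use st in auto)
  have c3: "cross ?D (X 0) = 0" using st by (simp add: cross_diff_left W.B_vL X0_vL W_X0)
  have c4: "cross ?D (\<lambda>w. N s w - N 0 w) = 0" using st by (intro cross_W_N_increment) auto
  show "cross ?D (X s) = 0" "cross ?D (Z s) = 0"
    by (rule cross_past[OF D c3 c1 c2 c4 st(1)])+
qed

text \<open>\<open>T\<close> enters through the correlation with X 0 alone; the time s of the past
  may precede \<open>T\<close>.\<close>

lemma cross_N_increment:
  assumes st: "0 \<le> s" "s \<le> u" "T \<le> u" "u \<le> v"
  shows "cross (\<lambda>w. N v w - N u w) (X s) = 0" "cross (\<lambda>w. N v w - N u w) (Z s) = 0"
proof -
  let ?D = "\<lambda>w. N v w - N u w"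
  have D: "vL ?D" using st by (auto intro!: vL_diff N.B_vL)
  have o: "cross (\<lambda>w. W q w - W p w) ?D = 0" if "0 \<le> p" "p \<le> q" "q \<le> s" for p q
    by (rule cross_W_N_increment) (use that st in auto)
  have c1: "cross (WE 0 s) ?D = 0"
    by (rule W.mwint_orth[OF _ _ mexp_derivative_reverse continuous_on_mexp_reverse(2) D o]) (use st in auto)
  have c2: "cross (WK 0 s) ?D = 0"
    by (rule W.mwint_orth[OF _ _ Kt_derivative continuous_on_mexp_reverse(1) D o]) (use st in auto)
  have c3: "cross ?D (X 0) = 0" using st by (simp add: N_X0)
  have c4: "cross ?D (\<lambda>w. N s w - N 0 w) = 0" using st by (intro N.cross_increments) auto
  show "cross ?D (X s) = 0" "cross ?D (Z s) = 0"
    by (rule cross_past[OF D c3 c1 c2 c4 st(1)])+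
qed

subsection \<open>The conditional law at a fixed time\<close>

definition Ft :: "real \<Rightarrow> 'a measure" where "Ft t = generated_sigma M {0..t} Z"

definition Vt :: "real \<Rightarrow> ('a \<Rightarrow> real) set" where "Vt t = {(\<lambda>w. Z s w $ i) | s i. s \<in> {0..t}}"

text \<open>Orthogonality to the constants is encoded as vanishing cross moments with the
  one-dimensional vector 1.\<close>

definition unobserved :: "real \<Rightarrow> ('a \<Rightarrow> real^'k) \<Rightarrow> bool" where
  "unobserved t Y \<longleftrightarrow> vL Y \<and> cross Y (\<lambda>w. 1 :: real^1) = 0 \<and> (\<forall>s\<in>{0..t}. cross Y (Z s) = 0)"

lemma unobserved_orth: "unobserved t Y \<longleftrightarrow> (\<forall>i. orth (\<lambda>w. Y w $ i) (Vt t))"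
proof -
  have "(\<forall>v\<in>Vt t. Q v) \<longleftrightarrow> (\<forall>s\<in>{0..t}. \<forall>j. Q (\<lambda>w. Z s w $ j))" for Q
    unfolding Vt_def by blast
  then show ?thesis
    by (simp add: unobserved_def orth_def vL_def cross_def vec_eq_iff) blast
qed

lemma Vt_L: "Vt t \<subseteq> L"
  using Z_vL by (auto simp: Vt_def vL_def)

lemmas Ft_cyl = generated_sigma_cyl[of "{0..t}" Z, folded Ft_def Vt_def] for t

lemma Ft_subalgebra: "subalgebra M (Ft t)"
  by (rule Ft_cyl) (simp add: Z_measurable)

lemma Ft_mono:
  assumes tu: "t \<le> u" and f: "f \<in> borel_measurable (Ft t)" shows "f \<in> borel_measurable (Ft u)"
proof -
  let ?G = "\<lambda>t. \<Union>s\<in>{0..t}. {Z s -` A \<inter> space M | A. A \<in> sets borel}"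
  have P: "?G t \<subseteq> Pow (space M)" for t by blast
  have "{0..t} \<subseteq> {0..u}" using tu by auto
  then have "?G t \<subseteq> ?G u" by (rule UN_mono) simp
  then have "sets (Ft t) \<subseteq> sets (Ft u)"
    unfolding Ft_def generated_sigma_def sets_measure_of[OF P] by (rule sigma_sets_mono')
  moreover have "space (Ft t) = space (Ft u)"
    unfolding Ft_def generated_sigma_def space_measure_of[OF P] by simp
  ultimately show ?thesis using f by (auto simp: measurable_def)
qed

text \<open>The projection, coordinate by coordinate. Its last clause will matter at
  \<open>T\<close>: what is orthogonal to the observations is orthogonal to the filter too.\<close>

lemma filter_exists:
  assumes t: "0 \<le> t"
  shows "\<exists>Y. (\<forall>i. (\<lambda>w. Y w $ i) \<in> borel_measurable (Ft t)) \<and> vL Y \<and> unobserved t (\<lambda>w. X t w - Y w)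
    \<and> (\<forall>U j. orth U (Vt t) \<longrightarrow> expectation (\<lambda>w. U w * Y w $ j) = 0)"
proof -
  have "\<exists>Y. Y \<in> borel_measurable (Ft t) \<and> Y \<in> L \<and> orth (\<lambda>w. X t w $ i - Y w) (Vt t)
     \<and> (\<forall>U. orth U (Vt t) \<longrightarrow> expectation (\<lambda>w. U w * Y w) = 0)" for i
  proof (rule gaussian_projection[OF Ft_subalgebra _ Vt_L])
    show "v \<in> borel_measurable (Ft t)" if "v \<in> Vt t" for v by (rule Ft_cyl(3)[OF _ that]) (simp add: Z_measurable)
    show "(\<lambda>w. X t w $ i) \<in> L" using X_vL[OF t] by (simp add: vL_def)
  qed
  then obtain y where y: "\<And>i. y i \<in> borel_measurable (Ft t)" "\<And>i. y i \<in> L"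
    "\<And>i. orth (\<lambda>w. X t w $ i - y i w) (Vt t)" "\<And>i U. orth U (Vt t) \<Longrightarrow> expectation (\<lambda>w. U w * y i w) = 0"
    by metis
  then show ?thesis
    by (intro exI[of _ "\<lambda>w. \<chi> i. y i w"]) (simp add: unobserved_orth vL_def)
qed

text \<open>A measurable Y and a remainder U orthogonal to the observations, however they were
  found, are conditional mean and error. So a filter need only be guessed and verified.\<close>

lemma conditional_moments:
  assumes t: "0 \<le> t" and Y: "\<And>i. (\<lambda>w. Y w $ i) \<in> borel_measurable (Ft t)"
    and U: "unobserved t U" and XY: "AE w in M. X t w - Y w = U w"
  shows "AE w in M. cond_mean M (Ft t) (X t) w = Y w"
    and "AE w in M. cond_cov M (Ft t) (X t) w = cross U U"
proof -
  interpret F: finite_measure_subalgebra M "Ft t" by unfold_locales (rule Ft_subalgebra)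
  have o: "orth (\<lambda>w. U w $ i) (Vt t)" for i using U by (simp add: unobserved_orth)
  have FV: "sets (Ft t) \<subseteq> sigma_sets (space M) (cyl (Vt t))" by (rule Ft_cyl(2)) (simp add: Z_measurable)
  have Ym: "(\<lambda>w. Y w $ i) \<in> borel_measurable M" for i by (rule measurable_from_subalg[OF Ft_subalgebra Y])
  have XL: "(\<lambda>w. X t w $ i) \<in> L" for i using X_vL[OF t] by (simp add: vL_def)
  have UL: "(\<lambda>w. U w $ i) \<in> L" for i using o by (simp add: orth_def)
  have YL: "(\<lambda>w. Y w $ i) \<in> L" for i
  proof (rule L_AE[OF L_diff[OF XL UL] Ym])
    show "AE w in M. X t w $ i - U w $ i = Y w $ i" using XY by eventually_elim (simp add: vec_eq_iff algebra_simps)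
  qed
  have c: "AE w in M. real_cond_exp M (Ft t) (\<lambda>w. X t w $ i) w = Y w $ i" for i
  proof (rule cond_exp_gaussian[OF Ft_subalgebra FV Vt_L o])
    show "AE w in M. X t w $ i - Y w $ i = U w $ i" using XY by eventually_elim (simp add: vec_eq_iff)
  qed (intro integrable_sqi L_sqi XL YL Y)+
  have "AE w in M. \<forall>i\<in>UNIV. real_cond_exp M (Ft t) (\<lambda>w. X t w $ i) w = Y w $ i"
    by (intro AE_finite_allI finite c)
  then show cm: "AE w in M. cond_mean M (Ft t) (X t) w = Y w"
    by eventually_elim (simp add: cond_mean_def vec_eq_iff)
  have e: "AE w in M. X t w - cond_mean M (Ft t) (X t) w = U w" using cm XY by eventually_elim simp
  have em: "(\<lambda>w. (X t w - cond_mean M (Ft t) (X t) w) $ i) \<in> borel_measurable M" for i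
    unfolding cond_mean_def vector_minus_component vec_lambda_beta
    by (intro borel_measurable_diff borel_measurable_cond_exp2 sqi_measurable[OF L_sqi[OF XL]])
  have "AE w in M. cond_cov M (Ft t) (X t) w $ i $ j = cross U U $ i $ j" for i j
  proof -
    have "AE w in M. real_cond_exp M (Ft t) (\<lambda>w. (X t w - cond_mean M (Ft t) (X t) w) $ i * (X t w - cond_mean M (Ft t) (X t) w) $ j) w
      = real_cond_exp M (Ft t) (\<lambda>w. U w $ i * U w $ j) w"
    proof (rule F.real_cond_exp_cong)
      show "AE w in M. (X t w - cond_mean M (Ft t) (X t) w) $ i * (X t w - cond_mean M (Ft t) (X t) w) $ j = U w $ i * U w $ j"
        using e by eventually_elim simp
    qed (intro borel_measurable_times em sqi_measurable[OF L_sqi[OF UL]])+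
    with cond_exp_gaussian_prod[OF Ft_subalgebra FV Vt_L o o, of i j] show ?thesis
      by eventually_elim (simp add: cond_cov_def cross_def)
  qed
  then have "AE w in M. \<forall>i\<in>UNIV. \<forall>j\<in>UNIV. cond_cov M (Ft t) (X t) w $ i $ j = cross U U $ i $ j"
    by (intro AE_finite_allI finite)
  then show "AE w in M. cond_cov M (Ft t) (X t) w = cross U U"
    by eventually_elim (simp add: vec_eq_iff)
qed

end

text \<open>Equality holds simultaneously at the countably many rationals from T on, and every point
  of the half-line is approached by them from the right.\<close>

lemma AE_eq_continuous_paths:
  fixes f g :: "real \<Rightarrow> 'a \<Rightarrow> 'b::real_normed_vector"
  assumes eq: "\<And>t. T \<le> t \<Longrightarrow> AE w in M. f t w = g t w"
    and c: "AE w in M. continuous_on {T..} (\<lambda>t. f t w) \<and> continuous_on {T..} (\<lambda>t. g t w)"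
  shows "AE w in M. \<forall>t\<ge>T. f t w = g t w"
proof -
  have "AE w in M. \<forall>t\<in>\<rat> \<inter> {T..}. f t w = g t w"
    by (subst AE_ball_countable) (use eq in \<open>auto intro: countable_rat countable_Int1\<close>)
  with c show ?thesis
  proof eventually_elim
    case (elim w)
    show ?case
    proof (intro allI impI, rule ccontr)
      fix t assume t: "T \<le> t" and ne: "f t w \<noteq> g t w"
      define e where "e = norm (f t w - g t w)"
      have e: "e > 0" using ne by (simp add: e_def)
      have "continuous_on {T..} (\<lambda>t. f t w - g t w)" using elim by (intro continuous_intros) auto
      then obtain d where d: "d > 0" "\<And>s. s \<in> {T..} \<Longrightarrow> dist s t < d \<Longrightarrow> dist (f s w - g s w) (f t w - g t w) < e"
        using e t unfolding continuous_on_iff by (metis atLeast_iff)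
      obtain q where q: "q \<in> \<rat>" "t < q" "q < t + d" using Rats_dense_in_real[of t "t + d"] d(1) by auto
      have "f q w = g q w" using elim q t by auto
      then show False using d(2)[of q] q t by (simp add: dist_norm e_def norm_minus_commute)
    qed
  qed
qed

context signal_observation
begin

section \<open>The filter error after \<open>T\<close>, started from the projection error at
  \<open>T\<close>\<close>

context
  fixes Y :: "'a \<Rightarrow> real^'m"
  assumes Y_measurable: "\<And>i. (\<lambda>w. Y w $ i) \<in> borel_measurable (Ft T)" and Y_vL: "vL Y"
    and Y_unobserved: "unobserved T (\<lambda>w. X T w - Y w)"
    and Y_orth: "\<And>U j. orth U (Vt T) \<Longrightarrow> expectation (\<lambda>w. U w * Y w $ j) = 0"
begin

definition err :: "'a \<Rightarrow> real^'m" where "err w = X T w - Y w"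
definition \<Delta> :: "real^'m^'m" where "\<Delta> = cross err err - \<gamma>"
definition P :: "real \<Rightarrow> real^'m^'m" where "P t = Pt \<Delta> (t - T)"
definition F :: "real \<Rightarrow> real^'m^'m" where "F t = Th \<Delta> (t - T)"
definition F' :: "real \<Rightarrow> real^'m^'m" where "F' t = - (F t ** (a - P t ** hh))"
definition G :: "real \<Rightarrow> real^'n^'m" where "G t = F t ** (P t ** transpose h)"
definition G' :: "real \<Rightarrow> real^'n^'m" where
  "G' t = F t ** (riccati a h (P t) ** transpose h) + F' t ** (P t ** transpose h)"

text \<open>What \<open>F t *v (X t - Xhat t)\<close> will turn out to be: the error equation integrated from
  the projection error at time \<open>T\<close>.\<close>

definition U :: "real \<Rightarrow> 'a \<Rightarrow> real^'m" where
  "U t w = F T *v err w + W.mwint F F' T t w - N.mwint G G' T t w"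

lemma err_vL: "vL err"
  unfolding err_def by (intro vL_diff X_vL Y_vL T_nonneg)

lemma admissible_\<Delta>: "admissible \<Delta>"
proof -
  have "transpose \<gamma> = \<gamma>" by (rule transpose_gamma)
  then show ?thesis
    unfolding admissible_def \<Delta>_def by (simp add: transpose_bilinear cross_self_nonneg[OF err_vL])
qed

lemma P_T: "P T = cross err err" by (simp add: P_def Pt_0 \<Delta>_def)

lemma transpose_P: "T \<le> t \<Longrightarrow> transpose (P t) = P t"
  unfolding P_def by (rule transpose_Pt[OF admissible_\<Delta>]) simp

lemma P_derivative: "T \<le> t \<Longrightarrow> (P has_vector_derivative riccati a h (P t)) (at t within {T..})"
  unfolding P_def by (rule has_vector_derivative_shift_Ici[OF Pt_derivative[OF admissible_\<Delta>]]) simp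

lemma F_derivative: "T \<le> t \<Longrightarrow> (F has_vector_derivative F' t) (at t within {T..})"
  unfolding F'_def F_def P_def by (rule has_vector_derivative_shift_Ici[OF Th_derivative[OF admissible_\<Delta>]]) simp

lemma G_derivative: "T \<le> t \<Longrightarrow> (G has_vector_derivative G' t) (at t within {T..})"
  unfolding G_def G'_def
  using has_vector_derivative_mult_mm[OF F_derivative has_vector_derivative_mult_mm[OF P_derivative has_vector_derivative_const[of "transpose h"]]]
  by (simp add: matrix_bilinear)

lemma coefficients_continuous:
  "continuous_on {T..} P" "continuous_on {T..} F" "continuous_on {T..} F'" "continuous_on {T..} G" "continuous_on {T..} G'"
proof -
  show P: "continuous_on {T..} P" by (rule continuous_on_Ici_derivative[OF P_derivative])
  show F: "continuous_on {T..} F" by (rule continuous_on_Ici_derivative[OF F_derivative])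
  show F': "continuous_on {T..} F'" unfolding F'_def by (intro continuous_intros F P)
  show "continuous_on {T..} G" by (rule continuous_on_Ici_derivative[OF G_derivative])
  show "continuous_on {T..} G'" unfolding G'_def riccati_eq by (intro continuous_intros F P F')
qed

lemma coefficients_Icc:
  assumes "T \<le> u"
  shows "\<And>s. s \<in> {u..t} \<Longrightarrow> (F has_vector_derivative F' s) (at s within {u..t})" "continuous_on {u..t} F'"
    "\<And>s. s \<in> {u..t} \<Longrightarrow> (G has_vector_derivative G' s) (at s within {u..t})" "continuous_on {u..t} G'"
proof -
  have sub: "{u..t} \<subseteq> {T..}" using assms by auto
  show "(F has_vector_derivative F' s) (at s within {u..t})" "(G has_vector_derivative G' s) (at s within {u..t})"
    if "s \<in> {u..t}" for s
    using that sub by (auto intro!: has_vector_derivative_within_subset[OF F_derivative] has_vector_derivative_within_subset[OF G_derivative])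
  show "continuous_on {u..t} F'" "continuous_on {u..t} G'"
    using coefficients_continuous sub by (auto intro: continuous_on_subset)
qed

lemma mwint_F_vL: "T \<le> u \<Longrightarrow> u \<le> t \<Longrightarrow> vL (W.mwint F F' u t)"
  using T_nonneg by (intro W.mwint_vL coefficients_Icc) auto

lemma mwint_G_vL: "T \<le> u \<Longrightarrow> u \<le> t \<Longrightarrow> vL (N.mwint G G' u t)"
  using T_nonneg by (intro N.mwint_vL coefficients_Icc) auto

lemma mwint_F_orth:
  assumes "T \<le> u" "u \<le> t" "vL R" "\<And>p q. u \<le> p \<Longrightarrow> p \<le> q \<Longrightarrow> q \<le> t \<Longrightarrow> cross (\<lambda>w. W q w - W p w) R = 0"
  shows "cross (W.mwint F F' u t) R = 0"
  by (rule W.mwint_orth[OF _ assms(2) coefficients_Icc(1,2)[OF assms(1)] assms(3,4)]) (use T_nonneg assms(1) in auto)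

lemma mwint_G_orth:
  assumes "T \<le> u" "u \<le> t" "vL R" "\<And>p q. u \<le> p \<Longrightarrow> p \<le> q \<Longrightarrow> q \<le> t \<Longrightarrow> cross (\<lambda>w. N q w - N p w) R = 0"
  shows "cross (N.mwint G G' u t) R = 0"
  by (rule N.mwint_orth[OF _ assms(2) coefficients_Icc(3,4)[OF assms(1)] assms(3,4)]) (use T_nonneg assms(1) in auto)

lemma U_vL: "T \<le> t \<Longrightarrow> vL (U t)"
  unfolding U_def by (intro vL_diff vL_add vL_mv err_vL mwint_F_vL mwint_G_vL) auto

lemma cross_U:
  "T \<le> t \<Longrightarrow> vL R \<Longrightarrow> cross (U t) R = F T ** cross err R + cross (W.mwint F F' T t) R - cross (N.mwint G G' T t) R"
  unfolding U_def by (simp add: cross_diff_left cross_add_left cross_mv_left vL_add vL_mv err_vL mwint_F_vL mwint_G_vL)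

lemma cross_unobserved_Y:
  assumes "unobserved T R" shows "cross R Y = 0"
  using assms Y_orth by (simp add: unobserved_orth cross_def vec_eq_iff)

text \<open>The increment is orthogonal to X T and to the observations up to \<open>T\<close>, hence
  also to the projection Y, and \<open>err\<close> is the difference of X T and Y.\<close>

lemma increments_err:
  assumes "T \<le> p" "p \<le> q"
  shows "cross (\<lambda>w. W q w - W p w) err = 0" "cross (\<lambda>w. N q w - N p w) err = 0"
proof -
  have vw: "vL (\<lambda>w. W q w - W p w)" and vn: "vL (\<lambda>w. N q w - N p w)"
    using assms T_nonneg by (auto intro!: vL_diff W.B_vL N.B_vL)
  have uw: "unobserved T (\<lambda>w. W q w - W p w)" and n: "unobserved T (\<lambda>w. N q w - N p w)"
    using assms T_nonneg
    by (auto simp: unobserved_def vw vn W.cross_increment_const N.cross_increment_const cross_W_increment cross_N_increment)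
  show "cross (\<lambda>w. W q w - W p w) err = 0" "cross (\<lambda>w. N q w - N p w) err = 0"
    using assms T_nonneg cross_unobserved_Y[OF uw] cross_unobserved_Y[OF n]
    unfolding err_def by (simp_all add: cross_diff_right X_vL Y_vL vw vn cross_W_increment cross_N_increment)
qed

lemma cross_err:
  "cross err (X T) = P T" "cross err (\<lambda>w. 1 :: real^1) = 0" "\<And>s. s \<in> {0..T} \<Longrightarrow> cross err (Z s) = 0"
proof -
  have un: "unobserved T err" using Y_unobserved by (simp add: err_def[abs_def])
  then show "cross err (\<lambda>w. 1 :: real^1) = 0" "\<And>s. s \<in> {0..T} \<Longrightarrow> cross err (Z s) = 0"
    by (auto simp: unobserved_def)
  have "cross err err = cross err (X T) - cross err Y"
    using T_nonneg by (subst (2) err_def[abs_def]) (simp add: cross_diff_right err_vL X_vL Y_vL)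
  then show "cross err (X T) = P T" by (simp add: P_T cross_unobserved_Y[OF un])
qed

lemma cross_mwints_N_W:
  assumes "T \<le> u" "u \<le> v" "T \<le> t"
    and F: "\<And>s. s \<in> {u..v} \<Longrightarrow> (f has_vector_derivative f' s) (at s within {u..v})" "continuous_on {u..v} f'"
  shows "cross (W.mwint f f' u v) (N.mwint G G' T t) = 0"
proof (rule W.mwint_orth[OF _ assms(2) F mwint_G_vL])
  fix p q assume pq: "u \<le> p" "p \<le> q" "q \<le> v"
  show "cross (\<lambda>w. W q w - W p w) (N.mwint G G' T t) = 0"
    by (subst cross_zero_sym, rule mwint_G_orth, auto intro!: vL_diff W.B_vL simp: cross_zero_sym[of _ "\<lambda>w. W q w - W p w"])
      (use assms pq T_nonneg in \<open>auto intro!: cross_W_N_increment\<close>)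
qed (use assms T_nonneg in auto)

text \<open>Split the first integral at s: the part after s is orthogonal to the past, and the
  isometry evaluates the common part.\<close>

lemma mwint_F_WK:
  assumes s: "T \<le> s" "s \<le> t"
  shows "cross (W.mwint F F' T t) (WK T s) = integral {T..s} (\<lambda>r. F r ** transpose (Kt (s - r)))"
proof -
  have o: "cross (W.mwint F F' s t) (WK T s) = 0"
  proof (rule mwint_F_orth)
    fix p q assume pq: "s \<le> p" "p \<le> q" "q \<le> t"
    have D: "vL (\<lambda>w. W q w - W p w)" using pq s T_nonneg by (auto intro!: vL_diff W.B_vL)
    have "cross (WK T s) (\<lambda>w. W q w - W p w) = 0"
    proof (rule W.mwint_orth[OF T_nonneg s(1) Kt_derivative continuous_on_mexp_reverse(1) D])
      fix x y assume xy: "T \<le> x" "x \<le> y" "y \<le> s"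
      show "cross (\<lambda>w. W y w - W x w) (\<lambda>w. W q w - W p w) = 0"
        by (subst cross_zero_sym, rule W.cross_increments) (use xy pq T_nonneg in auto)
    qed
    then show "cross (\<lambda>w. W q w - W p w) (WK T s) = 0" by (subst cross_zero_sym)
  qed (use s T_nonneg in \<open>auto intro: WK_vL\<close>)
  have split: "W.mwint F F' T t w = W.mwint F F' T s w + W.mwint F F' s t w" if "w \<in> space M" for w
    by (rule banach_bilinear.jint_split[OF banach_bilinear_mv s coefficients_Icc(2)])
      (use T_nonneg in \<open>auto intro: continuous_on_subset[OF W.B_continuous[OF that]]\<close>)
  have "cross (W.mwint F F' T t) (WK T s) = cross (\<lambda>w. W.mwint F F' T s w + W.mwint F F' s t w) (WK T s)"
    unfolding cross_def
    by (intro arg_cong[where f = vec_lambda] ext Bochner_Integration.integral_cong refl) (simp only: split)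
  also have "\<dots> = cross (W.mwint F F' T s) (WK T s)"
    using s T_nonneg by (simp add: cross_add_left mwint_F_vL WK_vL o)
  also have "\<dots> = integral {T..s} (\<lambda>r. F r ** transpose (Kt (s - r)))"
    by (rule W.mwint_isometry[OF T_nonneg s(1) coefficients_Icc(1,2)[OF order_refl] Kt_derivative continuous_on_mexp_reverse(1)])
  finally show ?thesis .
qed

lemma mwint_G_increment:
  assumes s: "T \<le> s" "s \<le> t"
  shows "cross (N.mwint G G' T t) (\<lambda>w. N s w - N T w) = integral {T..s} G"
proof -
  let ?D = "\<lambda>w. N s w - N T w"
  have D: "vL ?D" using s T_nonneg by (auto intro!: vL_diff N.B_vL)
  have o: "cross (N.mwint G G' s t) ?D = 0"
    by (rule mwint_G_orth) (use s T_nonneg in \<open>auto intro!: D N.cross_increments\<close>)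
  have split: "N.mwint G G' T t w = N.mwint G G' T s w + N.mwint G G' s t w" if "w \<in> space M" for w
    by (rule banach_bilinear.jint_split[OF banach_bilinear_mv s coefficients_Icc(4)])
      (use T_nonneg in \<open>auto intro: continuous_on_subset[OF N.B_continuous[OF that]]\<close>)
  \<comment> \<open>An increment is the Wiener integral of the identity matrix, whose derivative is
    0; this lets the isometry apply.\<close>
  have D_eq: "?D = N.mwint (\<lambda>_. mat 1) (\<lambda>_. 0) T s"
    by (simp add: jint_def matrix_bilinear)
  have "cross (N.mwint G G' T t) ?D = cross (\<lambda>w. N.mwint G G' T s w + N.mwint G G' s t w) ?D"
    unfolding cross_def
    by (intro arg_cong[where f = vec_lambda] ext Bochner_Integration.integral_cong refl) (simp only: split)
  also have "\<dots> = cross (N.mwint G G' T s) ?D"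
    using s T_nonneg by (simp add: cross_add_left mwint_G_vL D o)
  also have "\<dots> = integral {T..s} (\<lambda>r. G r ** transpose (mat 1))"
    unfolding D_eq
    by (rule N.mwint_isometry[OF T_nonneg s(1) coefficients_Icc(3,4)[OF order_refl]]) auto
  finally show ?thesis by (simp add: transpose_mat)
qed

text \<open>The identity behind the orthogonality to later observations. The equations for P and F
  give F P' + F' P = F (P a^T + 1), and exp (u a) = Kt u a + 1; hence F P Kt (s - r)^T has the
  derivative F Kt (s - r)^T - F P in r. Integrate from T to s, where Kt 0 = 0, and multiply by h^T,
  since G = F P h^T.\<close>

lemma FPK_integral:
  assumes s: "T \<le> s"
  shows "F T ** P T ** transpose (Kt (s - T)) ** transpose h
    + integral {T..s} (\<lambda>r. F r ** transpose (Kt (s - r))) ** transpose h = integral {T..s} G"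
proof -
  have cs: "continuous_on {T..s} F" "continuous_on {T..s} P"
    using coefficients_continuous by (auto intro: continuous_on_subset)
  have cK: "continuous_on {T..s} (\<lambda>r. Kt (s - r))" by (rule continuous_on_vector_derivative[OF Kt_derivative])
  have i1: "(\<lambda>r. F r ** transpose (Kt (s - r))) integrable_on {T..s}" and i2: "(\<lambda>r. F r ** P r) integrable_on {T..s}"
    by (intro integrable_continuous_real continuous_intros cs cK)+
  have d: "((\<lambda>r. (F r ** P r) ** transpose (Kt (s - r))) has_vector_derivative
      F r ** transpose (Kt (s - r)) - F r ** P r) (at r within {T..s})" if r: "r \<in> {T..s}" for r
  proof -
    have sub: "{T..s} \<subseteq> {T..}" by auto
    have "((\<lambda>r. (F r ** P r) ** transpose (Kt (s - r))) has_vector_derivative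
        (F r ** P r) ** transpose (- mexp a (s - r)) + (F r ** riccati a h (P r) + F' r ** P r) ** transpose (Kt (s - r))) (at r within {T..s})"
      by (intro has_vector_derivative_mult_mm has_vector_derivative_transpose Kt_derivative r
          has_vector_derivative_within_subset[OF F_derivative sub] has_vector_derivative_within_subset[OF P_derivative sub])
        (use r in auto)
    moreover have "mexp a (s - r) = Kt (s - r) ** a + mat 1" using Kt_mult[of "s - r"] r by simp
    then have "(F r ** P r) ** transpose (- mexp a (s - r)) + (F r ** riccati a h (P r) + F' r ** P r) ** transpose (Kt (s - r))
       = F r ** transpose (Kt (s - r)) - F r ** P r"
      unfolding F'_def riccati_eq
      by (simp add: transpose_bilinear matrix_transpose_mul matrix_bilinear matrix_mul_assoc transpose_mat)
    ultimately show ?thesis by simp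
  qed
  have I: "((\<lambda>r. F r ** transpose (Kt (s - r)) - F r ** P r) has_integral
      ((F s ** P s) ** transpose (Kt (s - s)) - (F T ** P T) ** transpose (Kt (s - T)))) {T..s}"
    by (rule fundamental_theorem_of_calculus[OF s d])
  have "integral {T..s} (\<lambda>r. F r ** transpose (Kt (s - r))) - integral {T..s} (\<lambda>r. F r ** P r)
     = - ((F T ** P T) ** transpose (Kt (s - T)))"
    unfolding integral_diff[OF i1 i2, symmetric] integral_unique[OF I]
    by (simp add: Kt_0 transpose_zero matrix_bilinear)
  then have e: "(F T ** P T) ** transpose (Kt (s - T)) + integral {T..s} (\<lambda>r. F r ** transpose (Kt (s - r)))
      = integral {T..s} (\<lambda>r. F r ** P r)" by (simp add: algebra_simps)
  have "F T ** P T ** transpose (Kt (s - T)) ** transpose h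
    + integral {T..s} (\<lambda>r. F r ** transpose (Kt (s - r))) ** transpose h = integral {T..s} (\<lambda>r. F r ** P r) ** transpose h"
    unfolding e[symmetric] by (simp add: matrix_bilinear)
  also have "\<dots> = integral {T..s} (\<lambda>r. F r ** P r ** transpose h)"
    using integral_linear[OF i2 bounded_bilinear.bounded_linear_left[OF bounded_bilinear_matrix_mult, of "transpose h"]]
    by (simp add: o_def)
  finally show ?thesis by (simp add: G_def[abs_def] matrix_mul_assoc)
qed

text \<open>For s up to \<open>T\<close> each of the three terms of U is orthogonal to Z s. For
  later s, Z s is rewritten through Z T, X T, a Wiener integral of W and an increment of N; the
  contributions of X T and W add up to the integral of G, and that of N is its negative.\<close>

lemma U_unobserved:
  assumes t: "T \<le> t" shows "unobserved t (U t)"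
  unfolding unobserved_def
proof (intro conjI ballI)
  show "vL (U t)" by (rule U_vL[OF t])
  have W0: "cross (W.mwint F F' T t) R = 0" if "vL R" "\<And>p q. T \<le> p \<Longrightarrow> p \<le> q \<Longrightarrow> cross (\<lambda>w. W q w - W p w) R = 0"
    for R :: "'a \<Rightarrow> real^'k" using mwint_F_orth[OF order_refl t] that by blast
  have N0: "cross (N.mwint G G' T t) R = 0" if "vL R" "\<And>p q. T \<le> p \<Longrightarrow> p \<le> q \<Longrightarrow> cross (\<lambda>w. N q w - N p w) R = 0"
    for R :: "'a \<Rightarrow> real^'k" using mwint_G_orth[OF order_refl t] that by blast
  show "cross (U t) (\<lambda>w. 1 :: real^1) = 0"
    using T_nonneg
    by (simp add: cross_U[OF t vL_const] cross_err W0[OF vL_const W.cross_increment_const] N0[OF vL_const N.cross_increment_const] matrix_bilinear)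
  have past: "cross (U t) (Z s) = 0" if s: "s \<in> {0..T}" for s
  proof -
    have v: "vL (Z s)" using s by (intro Z_vL) simp
    have "cross (W.mwint F F' T t) (Z s) = 0"
      by (rule W0[OF v cross_W_increment(2)]) (use s in auto)
    moreover have "cross (N.mwint G G' T t) (Z s) = 0"
      by (rule N0[OF v cross_N_increment(2)]) (use s in auto)
    ultimately show ?thesis using s by (simp add: cross_U[OF t v] cross_err matrix_bilinear)
  qed
  fix s assume st: "s \<in> {0..t}"
  show "cross (U t) (Z s) = 0"
  proof (cases "s \<le> T")
    case True then show ?thesis using past st by simp
  next
    case False
    then have s: "T \<le> s" "s \<le> t" using st by auto
    let ?D = "\<lambda>w. N s w - N T w"
    have D: "vL ?D" using s T_nonneg by (auto intro!: vL_diff N.B_vL)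
    have XT: "vL (X T)" and ZT: "vL (Z T)" and WKv: "vL (WK T s)"
      using s T_nonneg by (auto intro: X_vL Z_vL WK_vL)
    have 1: "cross (U t) (X T) = F T ** P T"
    proof -
      have "cross (W.mwint F F' T t) (X T) = 0"
        by (rule W0[OF XT cross_W_increment(1)]) (use T_nonneg in auto)
      moreover have "cross (N.mwint G G' T t) (X T) = 0"
        by (rule N0[OF XT cross_N_increment(1)]) (use T_nonneg in auto)
      ultimately show ?thesis by (simp add: cross_U[OF t XT] cross_err)
    qed
    have 2: "cross (U t) (WK T s) = integral {T..s} (\<lambda>r. F r ** transpose (Kt (s - r)))"
    proof -
      have "cross (WK T s) err = 0"
        by (rule W.mwint_orth[OF T_nonneg s(1) Kt_derivative continuous_on_mexp_reverse(1) err_vL increments_err(1)])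
      moreover have "cross (WK T s) (N.mwint G G' T t) = 0"
        by (rule cross_mwints_N_W[OF order_refl s(1) t Kt_derivative continuous_on_mexp_reverse(1)])
      ultimately have "cross err (WK T s) = 0" "cross (N.mwint G G' T t) (WK T s) = 0"
        by (simp_all only: cross_zero_sym[of err] cross_zero_sym[of "N.mwint G G' T t"])
      then show ?thesis by (simp add: cross_U[OF t WKv] mwint_F_WK[OF s] matrix_bilinear)
    qed
    have 3: "cross (U t) ?D = - integral {T..s} G"
    proof -
      have "cross err ?D = 0" by (subst cross_zero_sym) (rule increments_err(2)[OF order_refl s(1)])
      moreover have "cross (W.mwint F F' T t) ?D = 0"
        by (rule W0[OF D cross_W_N_increment]) (use s T_nonneg in auto)
      ultimately show ?thesis
        by (simp add: cross_U[OF t D] mwint_G_increment[OF s] matrix_bilinear)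
    qed
    have "cross (U t) (Z s) = cross (U t) (\<lambda>w. (Z T w + h *v (Kt (s - T) *v X T w + WK T s w)) + ?D w)"
      by (rule cross_AE[OF U_vL[OF t] Z_vL]) (use st Z_AE[OF T_nonneg s(1)] in
        \<open>auto intro!: vL_measurable U_vL[OF t] vL_add vL_mv D XT ZT WKv elim: eventually_mono\<close>)
    also have "\<dots> = cross (U t) (Z T) + (cross (U t) (X T) ** transpose (Kt (s - T)) + cross (U t) (WK T s)) ** transpose h + cross (U t) ?D"
      by (simp add: cross_add_right cross_mv_right U_vL[OF t] vL_add vL_mv D XT ZT WKv)
    also have "\<dots> = 0"
      using past[of T] FPK_integral[OF s(1)] T_nonneg unfolding 1 2 3 by (simp add: matrix_bilinear)
    finally show ?thesis .
  qed
qed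

text \<open>The three terms of U are uncorrelated, so their covariances add. By the Riccati equation
  F P F^T has the derivative F F^T + G G^T, which is what the two isometries integrate.\<close>

lemma cross_U_U:
  assumes t: "T \<le> t" shows "cross (U t) (U t) = F t ** P t ** transpose (F t)"
proof -
  let ?wi = "W.mwint F F' T t" and ?n = "N.mwint G G' T t"
  have we: "cross ?wi err = 0" by (rule mwint_F_orth[OF order_refl t err_vL]) (rule increments_err)
  have ne: "cross ?n err = 0" by (rule mwint_G_orth[OF order_refl t err_vL]) (rule increments_err)
  have wn: "cross ?wi ?n = 0" by (rule cross_mwints_N_W[OF order_refl t t coefficients_Icc(1,2)[OF order_refl]])
  have z: "cross err ?wi = 0" "cross err ?n = 0" "cross ?n ?wi = 0"
    using we ne wn by (simp_all only: cross_zero_sym[of err] cross_zero_sym[of ?n ?wi])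
  have v: "vL ?wi" "vL ?n" "vL err" by (auto intro: mwint_F_vL mwint_G_vL t err_vL)
  have R: "cross R (U t) = cross R err ** transpose (F T) + cross R ?wi - cross R ?n" if "vL R" for R :: "'a \<Rightarrow> real^'m"
    unfolding U_def by (simp add: cross_diff_right cross_add_right cross_mv_right vL_add vL_mv v that)
  have "cross (U t) (U t) = F T ** P T ** transpose (F T) + cross ?wi ?wi + cross ?n ?n"
    by (simp add: cross_U[OF t U_vL[OF t]] R v we ne wn z P_T matrix_bilinear matrix_mul_assoc)
  also have "cross ?wi ?wi = integral {T..t} (\<lambda>s. F s ** transpose (F s))"
    by (rule W.mwint_isometry[OF T_nonneg t coefficients_Icc(1,2)[OF order_refl] coefficients_Icc(1,2)[OF order_refl]])
  also have "cross ?n ?n = integral {T..t} (\<lambda>s. G s ** transpose (G s))"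
    by (rule N.mwint_isometry[OF T_nonneg t coefficients_Icc(3,4)[OF order_refl] coefficients_Icc(3,4)[OF order_refl]])
  also have "F T ** P T ** transpose (F T) + integral {T..t} (\<lambda>s. F s ** transpose (F s)) + integral {T..t} (\<lambda>s. G s ** transpose (G s))
     = F t ** P t ** transpose (F t)"
  proof -
    have d: "((\<lambda>t. F t ** P t ** transpose (F t)) has_vector_derivative F s ** transpose (F s) + G s ** transpose (G s)) (at s within {T..})"
      if s: "T \<le> s" for s
    proof -
      have "((\<lambda>t. F t ** P t ** transpose (F t)) has_vector_derivative
          (F s ** P s) ** transpose (F' s) + (F s ** riccati a h (P s) + F' s ** P s) ** transpose (F s)) (at s within {T..})"
        by (intro has_vector_derivative_mult_mm has_vector_derivative_transpose F_derivative P_derivative s)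
      moreover have "(F s ** P s) ** transpose (F' s) + (F s ** riccati a h (P s) + F' s ** P s) ** transpose (F s)
        = F s ** transpose (F s) + G s ** transpose (G s)"
        unfolding F'_def G_def riccati_eq hh_def
        by (simp add: transpose_bilinear matrix_transpose_mul transpose_P[OF s] matrix_bilinear matrix_mul_assoc)
      ultimately show ?thesis by simp
    qed
    have c: "continuous_on {T..t} F" "continuous_on {T..t} G"
      using coefficients_continuous by (auto intro: continuous_on_subset)
    have "((\<lambda>s. F s ** transpose (F s) + G s ** transpose (G s)) has_integral (F t ** P t ** transpose (F t) - F T ** P T ** transpose (F T))) {T..t}"
      by (rule Ici_FTC[OF d]) (use t in auto)
    then have "integral {T..t} (\<lambda>s. F s ** transpose (F s) + G s ** transpose (G s)) = F t ** P t ** transpose (F t) - F T ** P T ** transpose (F T)"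
      by (rule integral_unique)
    moreover have "integral {T..t} (\<lambda>s. F s ** transpose (F s) + G s ** transpose (G s))
       = integral {T..t} (\<lambda>s. F s ** transpose (F s)) + integral {T..t} (\<lambda>s. G s ** transpose (G s))"
      by (intro Henstock_Kurzweil_Integration.integral_add integrable_continuous_real continuous_intros c)
    ultimately show ?thesis by (simp add: algebra_simps)
  qed
  finally show ?thesis .
qed

lemma signal_U:
  assumes g: "good w" and t: "T \<le> t"
  shows "F t *v X t w = U t w + (F T *v Y w + jint (*v) G G' (\<lambda>s. Z s w) T t)"
proof -
  have sub: "{T..} \<subseteq> {0..}" using T_nonneg by auto
  note p = good_paths[OF g]
  have "F t *v X t w = F T *v X T w + W.mwint F F' T t w - N.mwint G G' T t w + jint (*v) G G' (\<lambda>s. Z s w) T t"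
    unfolding F_def P_def F'_def[abs_def] G_def[abs_def] G'_def[abs_def]
    by (rule signal_decomposition[OF admissible_\<Delta> _ _ _ _ _ _ t])
      (use p sub T_nonneg in \<open>auto intro: continuous_on_subset intro!: has_vector_derivative_within_subset[OF p(5) sub] has_vector_derivative_within_subset[OF p(6) sub]\<close>)
  then show ?thesis by (simp add: U_def err_def matrix_bilinear)
qed

lemma F_inverse: "T \<le> t \<Longrightarrow> Thi \<Delta> (t - T) ** F t = mat 1"
  unfolding F_def by (rule Th_inverse[OF admissible_\<Delta>]) simp

text \<open>F X splits into U, orthogonal to the observations, and a functional of the observations;
  after multiplication by the inverse of F these become error and conditional mean.\<close>

lemma filter_moments:
  assumes t: "T \<le> t"
  shows "AE w in M. F t *v (X t w - cond_mean M (Ft t) (X t) w) = U t w"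
    and "AE w in M. cond_cov M (Ft t) (X t) w = P t"
proof -
  let ?H = "Thi \<Delta> (t - T)"
  have t0: "0 \<le> t" using t T_nonneg by simp
  \<comment> \<open>The pathwise integral against Z is known to equal this limit on regular paths;
    written as a limit of sums it is measurable for \<open>Ft t\<close> on the whole space.\<close>
  define R where "R w = F T *v Y w + lim (\<lambda>n. \<Sum>k<n. G (upart T t n k) *v (Z (upart T t n (Suc k)) w - Z (upart T t n k) w))" for w
  have R: "R w = F T *v Y w + jint (*v) G G' (\<lambda>s. Z s w) T t" if "good w" for w
    unfolding R_def
    by (intro arg_cong2[where f = "(+)"] refl limI banach_bilinear.jint_riemann[OF banach_bilinear_mv coefficients_Icc(3,4)[OF order_refl] _ t])
      (use T_nonneg in \<open>auto intro: continuous_on_subset[OF good_paths(2)[OF that]]\<close>)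
  have lin: "(\<lambda>x. A *v x) \<in> borel_measurable borel" for A :: "real^'c^'d"
    by (intro borel_measurable_continuous_onI continuous_intros)
  have Zm: "Z s \<in> borel_measurable (Ft t)" if "s \<in> {0..t}" for s
    by (rule Ft_cyl(4)[OF _ that]) (simp add: Z_measurable)
  have Ym: "Y \<in> borel_measurable (Ft t)"
    by (subst borel_measurable_euclidean_space)
      (auto simp: Basis_real_vec inner_axis intro: Ft_mono[OF t Y_measurable])
  have up: "upart T t n k \<in> {0..t}" if "k \<le> n" for n k
    using upart_in[OF t that] T_nonneg by auto
  have Rm: "R \<in> borel_measurable (Ft t)"
    unfolding R_def
    by (intro borel_measurable_add borel_measurable_lim_metric borel_measurable_sum borel_measurable_diff
        measurable_compose[OF _ lin] Ym Zm up) auto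
  have m: "(\<lambda>w. (?H *v R w) $ i) \<in> borel_measurable (Ft t)" for i
    by (rule measurable_compose[OF measurable_compose[OF Rm lin] borel_measurable_vec_nth])
  have UH: "unobserved t (\<lambda>w. ?H *v U t w)"
    using U_unobserved[OF t] unfolding unobserved_def
    by (simp add: vL_mv cross_mv_left vL_const Z_vL matrix_bilinear)
  have XR: "AE w in M. X t w - ?H *v R w = ?H *v U t w"
    using AE_good
  proof eventually_elim
    case (elim w)
    have "X t w = ?H *v (F t *v X t w)" by (simp add: matrix_vector_mul_assoc F_inverse[OF t])
    then show ?case by (simp add: signal_U[OF elim t] R[OF elim] matrix_bilinear)
  qed
  note c = conditional_moments[OF t0 m UH XR]
  show "AE w in M. F t *v (X t w - cond_mean M (Ft t) (X t) w) = U t w"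
    using c(1) AE_good
  proof eventually_elim
    case (elim w)
    have "F t ** ?H = mat 1" using F_inverse[OF t] by (rule matrix_left_right_inverse[THEN iffD1])
    then have "F t *v (?H *v R w) = R w" by (simp add: matrix_vector_mul_assoc)
    then show ?case using elim by (simp add: matrix_bilinear signal_U[OF elim(2) t] R)
  qed
  have "cross (\<lambda>w. ?H *v U t w) (\<lambda>w. ?H *v U t w) = (?H ** F t) ** P t ** transpose (?H ** F t)"
    using U_vL[OF t] by (simp add: cross_mv_left cross_mv_right vL_mv cross_U_U[OF t] matrix_mul_assoc matrix_transpose_mul)
  then have "cross (\<lambda>w. ?H *v U t w) (\<lambda>w. ?H *v U t w) = P t"
    by (simp add: F_inverse[OF t] transpose_mat)
  then show "AE w in M. cond_cov M (Ft t) (X t) w = P t" using c(2) by simp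
qed

lemma continuous_U:
  assumes "good w" shows "continuous_on {T..} (\<lambda>t. U t w)"
proof -
  have "continuous_on {T..} (\<lambda>t. W t w)" "continuous_on {T..} (\<lambda>t. N t w)"
    using good_paths(3,4)[OF assms] T_nonneg by (auto intro: continuous_on_subset)
  then show ?thesis
    unfolding U_def jint_def by (intro continuous_intros continuous_on_integral_Ici coefficients_continuous)
qed

text \<open>The relation to U holds almost surely at each fixed time. Continuity of Xh makes the
  exceptional null set independent of t, as the pathwise analysis requires.\<close>

lemma filter_paths:
  assumes c: "\<And>w. w \<in> space M \<Longrightarrow> continuous_on {0..} (\<lambda>t. Xh t w)"
    and e: "\<And>t. 0 \<le> t \<Longrightarrow> AE w in M. Xh t w = cond_mean M (Ft t) (X t) w"
  shows "AE w in M. filter_error T P (\<lambda>t. W t w) (\<lambda>t. N t w) (\<lambda>t. X t w - Xh t w)"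
proof -
  have sub: "{T..} \<subseteq> {0..}" using T_nonneg by auto
  have "AE w in M. \<forall>t\<ge>T. F t *v (X t w - Xh t w) = U t w"
  proof (rule AE_eq_continuous_paths)
    fix t assume t: "T \<le> t"
    then have "0 \<le> t" using T_nonneg by simp
    from e[OF this] filter_moments(1)[OF t] show "AE w in M. F t *v (X t w - Xh t w) = U t w"
      by eventually_elim simp
  next
    show "AE w in M. continuous_on {T..} (\<lambda>t. F t *v (X t w - Xh t w)) \<and> continuous_on {T..} (\<lambda>t. U t w)"
      using AE_good
    proof eventually_elim
      case (elim w)
      then have "w \<in> space M" by (simp add: good_def)
      from continuous_on_subset[OF c[OF this] sub] continuous_on_subset[OF good_paths(1)[OF elim] sub]
      show ?case by (intro conjI continuous_intros coefficients_continuous continuous_U elim)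
    qed
  qed
  then show ?thesis using AE_good
  proof eventually_elim
    case (elim w)
    have F_eq: "F t *v (X t w - Xh t w) = U t w" if "T \<le> t" for t using elim(1) that by blast
    have "F T *v (X T w - Xh T w) = F T *v err w" by (subst F_eq) (simp_all add: U_def jint_def)
    then have e: "F t *v (X t w - Xh t w) = F T *v (X T w - Xh T w) + W.mwint F F' T t w - N.mwint G G' T t w"
      if "T \<le> t" for t by (simp add: F_eq[OF that] U_def[of t])
    have cw: "continuous_on {T..} (\<lambda>t. W t w)" "continuous_on {T..} (\<lambda>t. N t w)"
      using good_paths(3,4)[OF elim(2)] sub by (auto intro: continuous_on_subset)
    show ?case
      unfolding P_def[abs_def]
      by (rule filter_error_fundamental[OF admissible_\<Delta> cw])
        (rule e[unfolded F_def P_def F'_def[abs_def] G_def[abs_def] G'_def[abs_def]])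
  qed
qed

end

text \<open>What the asymptotic analysis takes from the preceding context, with the projection Y at
  \<open>T\<close> eliminated.\<close>

lemma filter_after_T:
  obtains \<Delta> where "admissible \<Delta>"
    and "\<And>t. T \<le> t \<Longrightarrow> AE w in M. cond_cov M (Ft t) (X t) w = Pt \<Delta> (t - T)"
    and "\<And>Xh. (\<And>w. w \<in> space M \<Longrightarrow> continuous_on {0..} (\<lambda>t. Xh t w)) \<Longrightarrow>
      (\<And>t. 0 \<le> t \<Longrightarrow> AE w in M. Xh t w = cond_mean M (Ft t) (X t) w) \<Longrightarrow>
      AE w in M. filter_error T (\<lambda>t. Pt \<Delta> (t - T)) (\<lambda>t. W t w) (\<lambda>t. N t w) (\<lambda>t. X t w - Xh t w)"
proof -
  from filter_exists[OF T_nonneg] obtain Y where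
    Y: "\<And>i. (\<lambda>w. Y w $ i) \<in> borel_measurable (Ft T)" "vL Y" "unobserved T (\<lambda>w. X T w - Y w)"
      "\<And>U j. orth U (Vt T) \<Longrightarrow> expectation (\<lambda>w. U w * Y w $ j) = 0" by blast
  have PY: "P Y = (\<lambda>t. Pt (\<Delta> Y) (t - T))"
    by (rule ext, rule P_def) (fact Y)+
  show thesis
  proof (rule that)
    show "admissible (\<Delta> Y)" by (rule admissible_\<Delta>) (fact Y)+
    show "AE w in M. cond_cov M (Ft t) (X t) w = Pt (\<Delta> Y) (t - T)" if "T \<le> t" for t
      using filter_moments(2)[of Y t] Y that by (simp add: PY)
    show "AE w in M. filter_error T (\<lambda>t. Pt (\<Delta> Y) (t - T)) (\<lambda>t. W t w) (\<lambda>t. N t w) (\<lambda>t. X t w - Xh t w)"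
      if "\<And>w. w \<in> space M \<Longrightarrow> continuous_on {0..} (\<lambda>t. Xh t w)"
        "\<And>t. 0 \<le> t \<Longrightarrow> AE w in M. Xh t w = cond_mean M (Ft t) (X t) w" for Xh
      unfolding PY[symmetric] by (rule filter_paths) (fact Y that)+
  qed
qed

text \<open>Before \<open>T\<close> there is no formula, but the conditional covariance is still
  almost surely constant; P11 has to be a deterministic function on the whole half-line.\<close>

lemma conditional_covariance:
  assumes "0 \<le> t" shows "\<exists>C. AE w in M. cond_cov M (Ft t) (X t) w = C"
proof -
  from filter_exists[OF assms] obtain Y where
    Y: "\<And>i. (\<lambda>w. Y w $ i) \<in> borel_measurable (Ft t)" "unobserved t (\<lambda>w. X t w - Y w)" by blast
  from conditional_moments(2)[OF assms Y] show ?thesis by auto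
qed

end

section \<open>The Kalman--Bucy filter\<close>

text \<open>Borel-Cantelli improves convergence in probability to almost sure convergence along a
  sequence of uniform partitions, and there the left-point sums converge pathwise to the expression
  by parts.\<close>

lemma (in prob_space) has_ito_integral_pathwise:
  fixes \<Phi> \<Phi>' :: "real \<Rightarrow> real^'n^'m" and J :: "'a \<Rightarrow> real^'m"
  assumes ito: "has_ito_integral M \<Phi> V t J" and t: "0 \<le> t"
    and \<Phi>: "\<And>s. s \<in> {0..t} \<Longrightarrow> (\<Phi> has_vector_derivative \<Phi>' s) (at s within {0..t})" "continuous_on {0..t} \<Phi>'"
    and V: "AE w in M. continuous_on {0..t} (\<lambda>s. V s w)"
  shows "AE w in M. J w = jint (*v) \<Phi> \<Phi>' (\<lambda>s. V s w) 0 t"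
proof -
  define S where "S n w = (\<Sum>k<n. \<Phi> (upart 0 t n k) *v (V (upart 0 t n (Suc k)) w - V (upart 0 t n k) w))" for n w
  have Jm: "J \<in> borel_measurable M" and Vm: "\<And>s. s \<in> {0..t} \<Longrightarrow> V s \<in> borel_measurable M"
    using ito by (auto simp: has_ito_integral_def)
  have lin: "(\<lambda>x. A *v x) \<in> borel_measurable borel" for A :: "real^'n^'m"
    by (intro borel_measurable_continuous_onI continuous_intros)
  have Sm: "S n \<in> borel_measurable M" for n
    unfolding S_def by (intro borel_measurable_sum measurable_compose[OF _ lin] borel_measurable_diff Vm upart_in[OF t]) auto
  define B where "B j n = {w \<in> space M. norm (S n w - J w) > inverse (real (Suc j))}" for j n
  have "\<exists>n\<ge>Suc j. prob (B j n) < (1/2) ^ j" for j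
  proof -
    have "inverse (real (Suc j)) > 0" "(1/2 :: real) ^ j > 0" by simp_all
    from ito[unfolded has_ito_integral_def, THEN conjunct2, THEN conjunct2, THEN spec, THEN mp, THEN spec, THEN mp, OF this]
    obtain \<eta> where H: "\<eta> > 0 \<and> (\<forall>(\<tau> :: nat \<Rightarrow> real) n. \<tau> 0 = 0 \<and> \<tau> n = t \<and> (\<forall>k<n. \<tau> k \<le> \<tau> (Suc k) \<and> \<tau> (Suc k) - \<tau> k < \<eta>) \<longrightarrow>
        prob {w\<in>space M. norm ((\<Sum>k<n. \<Phi> (\<tau> k) *v (V (\<tau> (Suc k)) w - V (\<tau> k) w)) - J w) > inverse (real (Suc j))} < (1/2) ^ j)"
      by (rule exE)
    note \<eta> = H[THEN conjunct1] and part = H[THEN conjunct2, THEN spec, THEN spec, THEN mp]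
    obtain n0 where n0: "t / \<eta> < real n0" using reals_Archimedean2 by blast
    \<comment> \<open>The summand Suc j makes the number of cells tend to infinity with j; n0 alone
      only ensures the mesh condition.\<close>
    define n where "n = n0 + Suc j"
    have n: "n > 0" "n \<ge> Suc j" by (simp_all add: n_def)
    have "t / \<eta> < real n" using n0 by (simp add: n_def)
    then have step: "t / real n < \<eta>" using \<eta> n(1) by (simp add: field_simps)
    have "prob {w\<in>space M. norm ((\<Sum>k<n. \<Phi> (upart 0 t n k) *v (V (upart 0 t n (Suc k)) w - V (upart 0 t n k) w)) - J w) > inverse (real (Suc j))} < (1/2) ^ j"
      by (rule part) (use step n upart_mono[OF t] in \<open>simp add: upart_step\<close>)
    then show ?thesis using n(2) by (auto simp: B_def S_def)
  qed
  then obtain \<nu> where \<nu>: "\<And>j. Suc j \<le> \<nu> j" "\<And>j. prob (B j (\<nu> j)) < (1/2) ^ j" by metis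
  have "AE w in M. eventually (\<lambda>j. w \<in> space M - B j (\<nu> j)) sequentially"
  proof (rule borel_cantelli_AE1)
    show "B j (\<nu> j) \<in> events" for j
      unfolding B_def using Sm Jm by measurable
    show "emeasure M (B j (\<nu> j)) < \<infinity>" for j by (simp add: emeasure_eq_measure)
    show "summable (\<lambda>j. prob (B j (\<nu> j)))"
      by (rule summable_comparison_test'[of "\<lambda>j. (1/2) ^ j" 0]) (use \<nu>(2) in \<open>auto simp: summable_geometric less_imp_le\<close>)
  qed
  with V AE_space show ?thesis
  proof eventually_elim
    case (elim w)
    have "filterlim \<nu> at_top sequentially"
      by (rule filterlim_at_top_mono[OF filterlim_ident]) (auto intro!: always_eventually Suc_leD[OF \<nu>(1)])
    moreover have "(\<lambda>n. S n w) \<longlonglongrightarrow> jint (*v) \<Phi> \<Phi>' (\<lambda>s. V s w) 0 t"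
      unfolding S_def by (rule banach_bilinear.jint_riemann[OF banach_bilinear_mv \<Phi> elim(1) t])
    ultimately have 1: "(\<lambda>j. S (\<nu> j) w) \<longlonglongrightarrow> jint (*v) \<Phi> \<Phi>' (\<lambda>s. V s w) 0 t"
      by (rule filterlim_compose[rotated])
    have "(\<lambda>j. S (\<nu> j) w - J w) \<longlonglongrightarrow> 0"
    proof (rule tendsto_norm_zero_cancel, rule tendsto_sandwich[OF _ _ tendsto_const LIMSEQ_inverse_real_of_nat])
      show "\<forall>\<^sub>F j in sequentially. norm (S (\<nu> j) w - J w) \<le> inverse (real (Suc j))"
        using elim(3) by eventually_elim (auto simp: B_def)
    qed simp
    then have "(\<lambda>j. S (\<nu> j) w) \<longlonglongrightarrow> J w" by (simp add: LIM_zero_iff)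
    then show ?case using 1 by (rule LIMSEQ_unique)
  qed
qed

context signal_observation
begin

lemma kalman_filter_error:
  assumes kf: "kalman_filter M a h \<mu> C Z Y R"
  shows "AE w in M. filter_error 0 R (\<lambda>t. W t w) (\<lambda>t. N t w) (\<lambda>t. X t w - Y t w)"
proof -
  have R: "(R has_vector_derivative riccati a h (R t)) (at t within {0..})" if "0 \<le> t" for t
    using kf that by (auto simp: kalman_filter_def)
  have cY: "continuous_on {0..} (\<lambda>t. Y t w)" if "w \<in> space M" for w
    using kf that by (auto simp: kalman_filter_def continuous_process_def)
  have ito: "has_ito_integral M (\<lambda>s. R s ** transpose h) (\<lambda>s w. Z s w - integral {0..s} (\<lambda>r. h *v Y r w)) t
        (\<lambda>w. Y t w - \<mu> - integral {0..t} (\<lambda>s. a *v Y s w))" if "0 \<le> t" for t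
    using kf that by (auto simp: kalman_filter_def)
  have cP: "continuous_on {0..} R" by (rule continuous_on_Ici_derivative[OF R])
  have cR: "continuous_on {0..} (\<lambda>s. riccati a h (R s) ** transpose h)"
    unfolding riccati_eq by (intro continuous_intros cP)
  have d: "((\<lambda>s. R s ** transpose h) has_vector_derivative riccati a h (R s) ** transpose h) (at s within {0..})" if "0 \<le> s" for s
    using has_vector_derivative_mult_mm[OF R[OF that] has_vector_derivative_const[of "transpose h"]] by (simp add: matrix_bilinear)
  have cV: "continuous_on {0..} (\<lambda>s. Z s w - integral {0..s} (\<lambda>r. h *v Y r w))" if "good w" for w
    using good_paths(2)[OF that] cY[of w] that unfolding good_def by (intro continuous_intros continuous_on_integral_Ici) auto
  have "AE w in M. \<forall>t\<ge>0. Y t w - \<mu> - integral {0..t} (\<lambda>s. a *v Y s w)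
     = jint (*v) (\<lambda>s. R s ** transpose h) (\<lambda>s. riccati a h (R s) ** transpose h) (\<lambda>s. Z s w - integral {0..s} (\<lambda>r. h *v Y r w)) 0 t"
  proof (rule AE_eq_continuous_paths)
    fix t :: real assume t: "0 \<le> t"
    have sub: "{0..t} \<subseteq> {0..}" by auto
    show "AE w in M. Y t w - \<mu> - integral {0..t} (\<lambda>s. a *v Y s w)
     = jint (*v) (\<lambda>s. R s ** transpose h) (\<lambda>s. riccati a h (R s) ** transpose h) (\<lambda>s. Z s w - integral {0..s} (\<lambda>r. h *v Y r w)) 0 t"
    proof (rule has_ito_integral_pathwise[OF ito[OF t] t])
      show "AE w in M. continuous_on {0..t} (\<lambda>s. Z s w - integral {0..s} (\<lambda>r. h *v Y r w))"
        using AE_good by eventually_elim (rule continuous_on_subset[OF cV sub])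
    qed (auto intro!: has_vector_derivative_within_subset[OF d sub] continuous_on_subset[OF cR sub])
  next
    show "AE w in M. continuous_on {0..} (\<lambda>t. Y t w - \<mu> - integral {0..t} (\<lambda>s. a *v Y s w)) \<and>
      continuous_on {0..} (\<lambda>t. jint (*v) (\<lambda>s. R s ** transpose h) (\<lambda>s. riccati a h (R s) ** transpose h) (\<lambda>s. Z s w - integral {0..s} (\<lambda>r. h *v Y r w)) 0 t)"
      using AE_good
    proof eventually_elim
      case (elim w)
      then have "continuous_on {0..} (\<lambda>t. Y t w)" by (intro cY) (simp add: good_def)
      then show ?case
        unfolding jint_def by (intro conjI continuous_intros continuous_on_integral_Ici cV cP cR elim)
    qed
  qed
  then show ?thesis using AE_good
  proof eventually_elim
    case (elim w)
    note p = good_paths[OF elim(2)]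
    show ?case
      by (rule filter_error_kalman[OF R p(1) cY p(4)]) (use elim in \<open>auto simp: good_def\<close>)
  qed
qed

text \<open>The covariance of X 0 is an admissible initial value, so uniqueness makes P0 one of the
  explicit solutions.\<close>

lemma kalman_covariance:
  assumes kf: "kalman_filter M a h (mean_vec M (X 0)) (cov_mat M (X 0)) Z Y R"
  shows "\<exists>\<Delta>. admissible \<Delta> \<and> (\<forall>t\<ge>0. R t = Pt \<Delta> t)"
proof -
  let ?x = "\<lambda>w. X 0 w - mean_vec M (X 0)" and ?D = "cov_mat M (X 0) - \<gamma>"
  have vR: "vL ?x" by (intro vL_diff X0_vL vL_const)
  have c: "cov_mat M (X 0) = cross ?x ?x" by (simp add: cov_mat_def cross_def)
  have adm: "admissible ?D"
    unfolding admissible_def c by (simp add: transpose_bilinear cross_self_nonneg[OF vR] transpose_gamma)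
  moreover have "R t = Pt ?D t" if "0 \<le> t" for t
    by (rule riccati_unique[OF adm _ _ that]) (use kf in \<open>auto simp: kalman_filter_def\<close>)
  ultimately show ?thesis by blast
qed

lemma filter_convergence:
  assumes Xh: "continuous_process M Xh"
      "\<And>t. 0 \<le> t \<Longrightarrow> AE w in M. Xh t w = cond_mean M (Ft t) (X t) w"
    and kf: "kalman_filter M a h (mean_vec M (X 0)) (cov_mat M (X 0)) Z Y P0"
  shows "\<exists>P11 :: real \<Rightarrow> real^'m^'m.
           (\<forall>t\<ge>0. AE w in M. cond_cov M (Ft t) (X t) w = P11 t) \<and>
           (\<forall>l<decay_rate a h \<gamma>. ((\<lambda>t. exp (l * t) *\<^sub>R (P11 t - \<gamma>)) \<longlongrightarrow> 0) at_top) \<and>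
           (\<forall>l<decay_rate a h \<gamma>. AE w in M. ((\<lambda>t. exp (l * t) *\<^sub>R (Xh t w - Y t w)) \<longlongrightarrow> 0) at_top) \<and>
           (AE w in M. ((\<lambda>t. wasserstein (gaussian_measure (Xh t w) (P11 t))
                                (gaussian_measure (Y t w) (P0 t))) \<longlongrightarrow> 0) at_top)"
proof (rule filter_after_T)
  fix \<Delta>
  assume adm: "admissible \<Delta>"
    and cov: "\<And>t. T \<le> t \<Longrightarrow> AE w in M. cond_cov M (Ft t) (X t) w = Pt \<Delta> (t - T)"
    and fe: "\<And>Xh. (\<And>w. w \<in> space M \<Longrightarrow> continuous_on {0..} (\<lambda>t. Xh t w)) \<Longrightarrow>
      (\<And>t. 0 \<le> t \<Longrightarrow> AE w in M. Xh t w = cond_mean M (Ft t) (X t) w) \<Longrightarrow>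
      AE w in M. filter_error T (\<lambda>t. Pt \<Delta> (t - T)) (\<lambda>t. W t w) (\<lambda>t. N t w) (\<lambda>t. X t w - Xh t w)"
  have cXh: "\<And>w. w \<in> space M \<Longrightarrow> continuous_on {0..} (\<lambda>t. Xh t w)"
    using Xh(1) by (simp add: continuous_process_def)
  from kalman_covariance[OF kf] obtain \<Delta>0 where adm0: "admissible \<Delta>0" and P0: "\<And>t. 0 \<le> t \<Longrightarrow> P0 t = Pt \<Delta>0 t"
    by blast
  \<comment> \<open>The explicit solution from \<open>T\<close> on; before \<open>T\<close>, a
    constant that the conditional covariance equals almost surely.\<close>
  define Q where "Q t = (if T \<le> t then Pt \<Delta> (t - T) else (SOME C. AE w in M. cond_cov M (Ft t) (X t) w = C))" for t
  have QT: "\<forall>\<^sub>F t in at_top. Pt \<Delta> (t - T) = Q t"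
    using eventually_ge_at_top[of T] by eventually_elim (simp add: Q_def)
  have PT: "\<forall>\<^sub>F t in at_top. Pt \<Delta>0 t = P0 t"
    using eventually_ge_at_top[of 0] by eventually_elim (simp add: P0)
  have decay: "ebd T (- (2 * l)) (\<lambda>t. Pt \<Delta> (t - T) - \<gamma>)" "ebd T (- (2 * l)) (\<lambda>t. P0 t - \<gamma>)"
    if E: "\<And>t. 0 \<le> t \<Longrightarrow> norm (E t) \<le> C * exp (- l * t)" for l C
  proof -
    obtain C1 where C1: "\<And>t. 0 \<le> t \<Longrightarrow> norm (Dt \<Delta> t) \<le> C1 * exp (- (2 * l) * t)" using Dt_decay[OF adm E] by blast
    obtain C2 where C2: "\<And>t. 0 \<le> t \<Longrightarrow> norm (Dt \<Delta>0 t) \<le> C2 * exp (- (2 * l) * t)" using Dt_decay[OF adm0 E] by blast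
    \<comment> \<open>Restarting the clock at \<open>T\<close> costs the constant factor exp (2 l
      T).\<close>
    have "norm (Pt \<Delta> (t - T) - \<gamma>) \<le> (C1 * exp (2 * l * T)) * exp (- (2 * l) * t)" if "T \<le> t" for t
      using C1[of "t - T"] that by (simp add: Pt_def algebra_simps exp_add[symmetric] exp_diff)
    then show "ebd T (- (2 * l)) (\<lambda>t. Pt \<Delta> (t - T) - \<gamma>)" unfolding ebd_def by blast
    have "norm (P0 t - \<gamma>) \<le> C2 * exp (- (2 * l) * t)" if "T \<le> t" for t
      using C2[of t] that T_nonneg by (simp add: P0 Pt_def)
    then show "ebd T (- (2 * l)) (\<lambda>t. P0 t - \<gamma>)" unfolding ebd_def by blast
  qed
  have fe': "AE w in M. filter_error T (\<lambda>t. Pt \<Delta> (t - T)) (\<lambda>t. W t w) (\<lambda>t. N t w) (\<lambda>t. X t w - Xh t w)"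
    by (rule fe) (fact cXh Xh(2))+
  \<comment> \<open>One null set serves all rates, as l, k and C are quantified inside. The rate k =
    0 will give the convergence of the means that the Wasserstein distance requires.\<close>
  have b: "AE w in M. \<forall>l k C. 0 < l \<longrightarrow> k < l \<longrightarrow> (\<forall>t\<ge>0. norm (E t) \<le> C * exp (- l * t)) \<longrightarrow>
      ((\<lambda>t. exp (k * t) *\<^sub>R (Xh t w - Y t w)) \<longlongrightarrow> 0) at_top"
    using fe' kalman_filter_error[OF kf] W.B_growth N.B_growth AE_good
  proof eventually_elim
    case (elim w)
    show ?case
    proof (intro allI impI)
      fix l k C :: real
      assume l: "0 < l" "k < l" and E: "\<forall>t\<ge>0. norm (E t) \<le> C * exp (- l * t)"
      have sub: "{T..} \<subseteq> {0..}" using T_nonneg by auto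
      have om: "w \<in> space M" using elim(5) by (simp add: good_def)
      note p = good_paths[OF elim(5)]
      have f0: "filter_error T P0 (\<lambda>t. W t w) (\<lambda>t. N t w) (\<lambda>t. X t w - Y t w)"
        using elim(2) T_nonneg unfolding filter_error_def by (auto intro: has_vector_derivative_within_subset[OF _ sub])
      have P: "(P0 has_vector_derivative riccati a h (P0 t)) (at t within {T..})" if "T \<le> t" for t
        using kf that T_nonneg unfolding kalman_filter_def by (auto intro: has_vector_derivative_within_subset[OF _ sub])
      have Q: "((\<lambda>t. Pt \<Delta> (t - T)) has_vector_derivative riccati a h (Pt \<Delta> (t - T))) (at t within {T..})" if "T \<le> t" for t
        by (rule has_vector_derivative_shift_Ici[OF Pt_derivative[OF adm]]) (use that in simp)
      have E': "\<And>t. 0 \<le> t \<Longrightarrow> norm (E t) \<le> C * exp (- l * t)" using E by blast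
      \<comment> \<open>With the error of the usual filter first and that of the true filter second,
        the difference of the errors is Xh - Y.\<close>
      have "((\<lambda>t. exp (k * t) *\<^sub>R ((X t w - Y t w) - (X t w - Xh t w))) \<longlongrightarrow> 0) at_top"
      proof (rule filter_error_difference)
        show "filter_error T P0 (\<lambda>t. W t w) (\<lambda>t. N t w) (\<lambda>t. X t w - Y t w)" by (rule f0)
        show "filter_error T (\<lambda>t. Pt \<Delta> (t - T)) (\<lambda>t. W t w) (\<lambda>t. N t w) (\<lambda>t. X t w - Xh t w)" by (rule elim(1))
        show "ebd T (- (2 * l)) (\<lambda>t. P0 t - \<gamma>)" "ebd T (- (2 * l)) (\<lambda>t. Pt \<Delta> (t - T) - \<gamma>)"
          by (rule decay[OF E'], assumption)+
        show "continuous_on {T..} (\<lambda>t. W t w)" "continuous_on {T..} (\<lambda>t. N t w)"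
          using p(3,4) sub by (auto intro: continuous_on_subset)
        show "continuous_on {T..} (\<lambda>t. X t w - Xh t w)"
          using p(1) cXh[OF om] sub by (intro continuous_intros) (auto intro: continuous_on_subset)
        show "ebd T d (\<lambda>t. W t w)" "ebd T d (\<lambda>t. N t w)" if "0 < d" for d
          using elim(3,4) that T_nonneg by (auto intro: ebd_mono)
      qed (fact P Q l E')+
      then show "((\<lambda>t. exp (k * t) *\<^sub>R (Xh t w - Y t w)) \<longlongrightarrow> 0) at_top" by simp
    qed
  qed
  show ?thesis
  proof (intro exI[of _ Q] conjI allI impI)
    fix t :: real assume t: "0 \<le> t"
    show "AE w in M. cond_cov M (Ft t) (X t) w = Q t"
      using cov[of t] someI_ex[OF conditional_covariance[OF t]] by (auto simp: Q_def)
  next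
    fix l assume "l < decay_rate a h \<gamma>"
    then obtain l' C where l': "0 < l'" "l < l'" and E: "\<And>t. 0 \<le> t \<Longrightarrow> norm (E t) \<le> C * exp (- l' * t)"
      using E_decay by blast
    have "((\<lambda>t. exp (l * t) *\<^sub>R (Pt \<Delta> (t - T) - \<gamma>)) \<longlongrightarrow> 0) at_top"
      by (rule ebd_tendsto[OF decay(1)[OF E]]) (use l' in auto)
    then show "((\<lambda>t. exp (l * t) *\<^sub>R (Q t - \<gamma>)) \<longlongrightarrow> 0) at_top"
      by (rule Lim_transform_eventually) (use QT in eventually_elim, simp)
    show "AE w in M. ((\<lambda>t. exp (l * t) *\<^sub>R (Xh t w - Y t w)) \<longlongrightarrow> 0) at_top"
      using b by eventually_elim (use l' E in blast)
  next
    obtain l C where l: "0 < l" and E: "\<And>t. 0 \<le> t \<Longrightarrow> norm (E t) \<le> C * exp (- l * t)"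
      using E_decay_some by blast
    have lim: "(f \<longlongrightarrow> \<gamma>) at_top" if "ebd T (- (2 * l)) (\<lambda>t. f t - \<gamma>)" for f :: "real \<Rightarrow> real^'m^'m"
      using ebd_tendsto[OF that, of 0] l by (simp add: LIM_zero_iff)
    show "AE w in M. ((\<lambda>t. wasserstein (gaussian_measure (Xh t w) (Q t)) (gaussian_measure (Y t w) (P0 t))) \<longlongrightarrow> 0) at_top"
      using b
    proof eventually_elim
      case (elim w)
      have "((\<lambda>t. exp (0 * t) *\<^sub>R (Xh t w - Y t w)) \<longlongrightarrow> 0) at_top" using elim l E by blast
      then have d: "((\<lambda>t. Xh t w - Y t w) \<longlongrightarrow> 0) at_top" by simp
      show ?case
      proof (rule wasserstein_gaussian_tendsto[OF transpose_gamma _ _ _ _ _ _ d])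
        \<comment> \<open>The lower bound 1 / norm gi of the form \<gamma> serves as its constant of
          definiteness.\<close>
        show "0 < inverse (norm gi)" using norm_gi_pos by simp
        show "inverse (norm gi) * (norm x)\<^sup>2 \<le> x \<bullet> (\<gamma> *v x)" for x
          using norm_le_gamma[of x] norm_gi_pos by (simp add: field_simps)
        show "(Q \<longlongrightarrow> \<gamma>) at_top"
          by (rule Lim_transform_eventually[OF lim[OF decay(1)[OF E]] QT])
        show "\<forall>\<^sub>F t in at_top. transpose (Q t) = Q t"
          using eventually_ge_at_top[of T] by eventually_elim (simp add: Q_def transpose_Pt[OF adm])
        show "(P0 \<longlongrightarrow> \<gamma>) at_top" by (rule lim[OF decay(2)[OF E]])
        show "\<forall>\<^sub>F t in at_top. transpose (P0 t) = P0 t"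
          using eventually_ge_at_top[of 0] by eventually_elim (simp add: P0 transpose_Pt[OF adm0])
      qed
    qed
  qed
qed

end

section \<open>Independence\<close>

lemma (in prob_space) indep_set_expectation:
  fixes f g :: "'a \<Rightarrow> real"
  assumes ind: "indep_set (sets F) (sets G)" and sp: "space F = space M" "space G = space M"
    and f: "f \<in> borel_measurable F" "sqi f" and g: "g \<in> borel_measurable G" "sqi g"
  shows "expectation (\<lambda>w. f w * g w) = expectation f * expectation g"
proof (rule indep_var_lebesgue_integral)
  have sub: "sigma_sets (space M) {k -` A \<inter> space M |A. A \<in> sets borel} \<subseteq> sets K"
    if "k \<in> borel_measurable K" "space K = space M" for k :: "'a \<Rightarrow> real" and K
  proof -
    have "{k -` A \<inter> space K |A. A \<in> sets borel} \<subseteq> sets K" using that(1) by (auto intro: measurable_sets)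
    then show ?thesis unfolding that(2)[symmetric] by (rule sets.sigma_sets_subset)
  qed
  show "indep_var borel f borel g"
    unfolding indep_var_eq
  proof (intro conjI)
    show "indep_set (sigma_sets (space M) {f -` A \<inter> space M |A. A \<in> sets borel})
       (sigma_sets (space M) {g -` A \<inter> space M |A. A \<in> sets borel})"
      unfolding indep_set_def
      by (rule indep_sets_mono_sets[OF ind[unfolded indep_set_def]])
        (use sub[OF f(1) sp(1)] sub[OF g(1) sp(2)] in \<open>auto split: bool.split\<close>)
  qed (use f g sqi_measurable in auto)
qed (intro integrable_sqi f g)+

lemma measurable_generated_sigma:
  assumes "s \<in> I" shows "Y s \<in> borel_measurable (generated_sigma M I Y)"
proof -
  have P: "(\<Union>s\<in>I. {Y s -` A \<inter> space M | A. A \<in> sets borel}) \<subseteq> Pow (space M)" by blast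
  show ?thesis
    unfolding generated_sigma_def
  proof (rule measurableI)
    fix A :: "'b set" assume "A \<in> sets borel"
    then show "Y s -` A \<inter> space (sigma (space M) (\<Union>s\<in>I. {Y s -` A \<inter> space M | A. A \<in> sets borel}))
        \<in> sets (sigma (space M) (\<Union>s\<in>I. {Y s -` A \<inter> space M | A. A \<in> sets borel}))"
      unfolding space_measure_of[OF P] sets_measure_of[OF P] using assms by (intro sigma_sets.Basic) blast
  qed simp
qed

lemma space_generated_sigma: "space (generated_sigma M I Y) = space M"
  unfolding generated_sigma_def by (rule space_measure_of) blast

text \<open>Independence of W from X 0 and N makes the cross moments factor, and they vanish since W
  has mean 0. A vanishing derivative makes \<rho> constant from T on, which says that later
  increments of N are uncorrelated with X 0.\<close>

lemma signal_observationI: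
  fixes W X :: "real \<Rightarrow> 'w \<Rightarrow> real^'m" and N Z :: "real \<Rightarrow> 'w \<Rightarrow> real^'n"
    and a :: "real^'m^'m" and h :: "real^'m^'n" and \<rho> \<rho>' :: "real \<Rightarrow> real^'m^'n"
  defines "S \<equiv> {(\<lambda>w. X 0 w $ i) | i. True} \<union> {(\<lambda>w. W t w $ i) | t i. t \<ge> 0} \<union> {(\<lambda>w. N t w $ i) | t i. t \<ge> 0}"
  assumes "prob_space M" and W: "brownian_motion M W" and N: "brownian_motion M N" and S: "gaussian_family M S"
    and ind: "prob_space.indep_set M (sets (generated_sigma M {0..} W)) (sets (generated_sigma M {0..} (\<lambda>t w. (X 0 w, N t w))))"
    and \<rho>: "\<And>t. 0 \<le> t \<Longrightarrow> \<rho> t = (\<chi> i j. \<integral>w. N t w $ i * X 0 w $ j \<partial>M)"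
    and \<rho>': "\<And>t. 0 \<le> t \<Longrightarrow> (\<rho> has_vector_derivative \<rho>' t) (at t within {0..})"
    and T: "0 \<le> T" "\<And>t. T \<le> t \<Longrightarrow> \<rho>' t = 0"
    and X: "\<And>t. 0 \<le> t \<Longrightarrow> X t \<in> borel_measurable M" and Z: "\<And>t. 0 \<le> t \<Longrightarrow> Z t \<in> borel_measurable M"
    and signal: "AE w in M. \<forall>t\<ge>0. ((\<lambda>s. a *v X s w) has_integral (X t w - X 0 w - W t w)) {0..t}"
    and observation: "AE w in M. \<forall>t\<ge>0. ((\<lambda>s. h *v X s w) has_integral (Z t w - N t w)) {0..t}"
    and \<gamma>: "sym_nonneg \<gamma>" "riccati a h \<gamma> = 0"
  shows "signal_observation a h \<gamma> M S W N X Z T"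
proof -
  interpret prob_space M by fact
  interpret steady_filter a h \<gamma> by unfold_locales (fact \<gamma>)+
  interpret gaussian_space M S by unfold_locales (rule S)
  interpret W: gaussian_brownian M S W by unfold_locales (auto simp: S_def W)
  interpret N: gaussian_brownian M S N by unfold_locales (auto simp: S_def N)
  have X0: "vL (X 0)" unfolding vL_def by (intro allI L_base) (auto simp: S_def)
  let ?G = "generated_sigma M {0..} W" and ?H = "generated_sigma M {0..} (\<lambda>t w. (X 0 w, N t w))"
  have "continuous_on UNIV (\<lambda>p :: (real^'m) \<times> (real^'n). fst p)" "continuous_on UNIV (\<lambda>p :: (real^'m) \<times> (real^'n). snd p)"
    by (intro continuous_intros)+
  note m = this[THEN borel_measurable_continuous_onI]
  have XN: "(\<lambda>w. (X 0 w, N t w)) \<in> borel_measurable ?H" if "0 \<le> t" for t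
    by (rule measurable_generated_sigma) (use that in simp)
  have H: "X 0 \<in> borel_measurable ?H" "\<And>t. 0 \<le> t \<Longrightarrow> N t \<in> borel_measurable ?H"
    using measurable_compose[OF XN[OF order_refl] m(1)] measurable_compose[OF XN m(2)] by simp_all
  have W_mean: "expectation (\<lambda>w. W s w $ i) = 0" if s: "0 \<le> s" for s i
  proof -
    have "expectation (\<lambda>w. W s w $ i) = expectation (W.dB 0 s i)"
    proof (rule integral_cong_AE)
      show "AE w in M. W s w $ i = W.dB 0 s i w"
        using W.B_0 by eventually_elim (simp add: W.dB_def)
    qed (use s in \<open>auto intro!: sqi_measurable L_sqi W.B_L W.dB_L\<close>)
    then show ?thesis using W.dB_moments(1)[of 0 s i] s by simp
  qed
  have W_indep: "cross (W s) R = 0" if s: "0 \<le> s" and R: "vL R" "R \<in> borel_measurable ?H" for s and R :: "'w \<Rightarrow> real^'k"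
  proof -
    have "expectation (\<lambda>w. W s w $ i * R w $ j) = 0" for i j
    proof -
      have "expectation (\<lambda>w. W s w $ i * R w $ j) = expectation (\<lambda>w. W s w $ i) * expectation (\<lambda>w. R w $ j)"
        using s by (intro indep_set_expectation[OF ind space_generated_sigma space_generated_sigma]
            measurable_compose[OF _ borel_measurable_vec_nth] measurable_generated_sigma R(2) vL_sqi R(1) W.B_vL) auto
      then show ?thesis by (simp add: W_mean s)
    qed
    then show ?thesis by (simp add: cross_def vec_eq_iff)
  qed
  have \<rho>_cross: "\<rho> t = cross (N t) (X 0)" if "0 \<le> t" for t using \<rho>[OF that] by (simp add: cross_def)
  have \<rho>_const: "\<rho> t = \<rho> T" if "T \<le> t" for t
  proof (rule Ici_derivative_zero[OF _ that])
    fix t assume t: "T \<le> t"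
    have "(\<rho> has_vector_derivative \<rho>' t) (at t within {T..})"
      by (rule has_vector_derivative_within_subset[OF \<rho>']) (use t T in auto)
    then show "(\<rho> has_vector_derivative 0) (at t within {T..})" by (simp add: T(2)[OF t])
  qed
  show ?thesis
  proof unfold_locales
    show "cross (\<lambda>w. N t w - N s w) (X 0) = 0" if "T \<le> s" "s \<le> t" for s t
      using that T(1) \<rho>_const[of s] \<rho>_const[of t]
      by (simp add: cross_diff_left N.B_vL X0 \<rho>_cross[symmetric])
    show "cross (W s) (X 0) = 0" if "0 \<le> s" for s by (rule W_indep[OF that X0 H(1)])
    show "cross (W s) (N t) = 0" if "0 \<le> s" "0 \<le> t" for s t
      by (rule W_indep[OF that(1) N.B_vL[OF that(2)] H(2)[OF that(2)]])
  qed (fact X0 X Z T(1) signal observation)+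
qed

theorem theorem4p4:
  fixes M :: "'w measure"
    and W X :: "real \<Rightarrow> 'w \<Rightarrow> real^'m"
    and N Z :: "real \<Rightarrow> 'w \<Rightarrow> real^'n"
    and a :: "real^'m^'m" and h :: "real^'m^'n"
    and \<rho> \<rho>' \<rho>'' :: "real \<Rightarrow> real^'m^'n" and T0 :: real
    and \<gamma> :: "real^'m^'m"
    and Xhat Xhat0 :: "real \<Rightarrow> 'w \<Rightarrow> real^'m" and P0 :: "real \<Rightarrow> real^'m^'m"
  assumes "prob_space M"
    and "brownian_motion M W" and "brownian_motion M N"
    and "gaussian_family M
           ({(\<lambda>\<omega>. X 0 \<omega> $ i) | i. True} \<union>
            {(\<lambda>\<omega>. W t \<omega> $ i) | t i. t \<ge> 0} \<union>
            {(\<lambda>\<omega>. N t \<omega> $ i) | t i. t \<ge> 0})"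
    and "prob_space.indep_set M
           (sets (generated_sigma M {0..} W))
           (sets (generated_sigma M {0..} (\<lambda>t \<omega>. (X 0 \<omega>, N t \<omega>))))"
    and "\<forall>t\<ge>0. \<rho> t = (\<chi> i j. \<integral>\<omega>. N t \<omega> $ i * X 0 \<omega> $ j \<partial>M)"
    and "\<forall>t\<ge>0. (\<rho> has_vector_derivative \<rho>' t) (at t within {0..})"
    and "\<forall>t\<ge>0. (\<rho>' has_vector_derivative \<rho>'' t) (at t within {0..})"
    and "continuous_on {0..} \<rho>''"
    and "\<forall>t\<ge>0. X t \<in> borel_measurable M" and "\<forall>t\<ge>0. Z t \<in> borel_measurable M"
    and "AE \<omega> in M. \<forall>t\<ge>0.
           ((\<lambda>s. a *v X s \<omega>) has_integral (X t \<omega> - X 0 \<omega> - W t \<omega>)) {0..t}"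
    and "AE \<omega> in M. \<forall>t\<ge>0.
           ((\<lambda>s. h *v X s \<omega>) has_integral (Z t \<omega> - N t \<omega>)) {0..t}"
    and "detectable a h" and "stabilizable a (mat 1 :: real^'m^'m)"
    and "T0 > 0" and "\<forall>t>T0. \<rho>' t = 0"
    and "sym_nonneg \<gamma>" and "riccati a h \<gamma> = 0"
    and "continuous_process M Xhat"
    and "\<forall>t\<ge>0. AE \<omega> in M. Xhat t \<omega> = cond_mean M (generated_sigma M {0..t} Z) (X t) \<omega>"
    and "kalman_filter M a h (mean_vec M (X 0)) (cov_mat M (X 0)) Z Xhat0 P0"
  shows "\<exists>P11 :: real \<Rightarrow> real^'m^'m.
           (\<forall>t\<ge>0. AE \<omega> in M. cond_cov M (generated_sigma M {0..t} Z) (X t) \<omega> = P11 t) \<and>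
           (\<forall>l<decay_rate a h \<gamma>. ((\<lambda>t. exp (l * t) *\<^sub>R (P11 t - \<gamma>)) \<longlongrightarrow> 0) at_top) \<and>
           (\<forall>l<decay_rate a h \<gamma>. AE \<omega> in M.
              ((\<lambda>t. exp (l * t) *\<^sub>R (Xhat t \<omega> - Xhat0 t \<omega>)) \<longlongrightarrow> 0) at_top) \<and>
           (AE \<omega> in M.
              ((\<lambda>t. wasserstein (gaussian_measure (Xhat t \<omega>) (P11 t))
                                (gaussian_measure (Xhat0 t \<omega>) (P0 t))) \<longlongrightarrow> 0) at_top)"
proof -
  \<comment> \<open>\<open>\<rho>'\<close> vanishes only strictly after \<open>T0\<close>, whence the shift.\<close>
  interpret signal_observation a h \<gamma> M
    "{(\<lambda>\<omega>. X 0 \<omega> $ i) | i. True} \<union> {(\<lambda>\<omega>. W t \<omega> $ i) | t i. t \<ge> 0} \<union> {(\<lambda>\<omega>. N t \<omega> $ i) | t i. t \<ge> 0}"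
    W N X Z "T0 + 1"
    by (rule signal_observationI[where \<rho> = \<rho> and \<rho>' = \<rho>']) (use assms in auto)
  show ?thesis
    using filter_convergence[unfolded Ft_def] assms(20,21,22) by blast
qed

end
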